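(* Let $(\mathcal X,d,\mu)$ be an RD-space (with either $\mu(\mathcal X)<\infty$ or $\mu(\mathcal X)=\infty$), with constants $0<\kappa\le n$ as in the definition of RD-spaces. Let $s\in(0,1]$ and $p\in(n/(n+s),\infty)$. Then $M^{s,p}(\mathcal X)=\mathcal AF^s_{p,\infty}(\mathcal X)$ with equivalent norms.
   Context: $\mathbb Z_+=\{0,1,2,\dots\}$, $\mathbb N=\{1,2,\dots\}$, $a_+=\max\{a,0\}$. RD-space: $(\mathcal X,d)$ is a metric space with a regular Borel measure $\mu$ such that all balls $B(x,r)=\{y:d(x,y)<r\}$ have finite positive measure, and there exist constants $0<C_1\le1\le C_2$ and $0<\kappa\le n$ such that for all $x\in\mathcal X$, $0<r<2\operatorname{diam}(\mathcal X)$ and $1\le\lambda<2\operatorname{diam}(\mathcal X)/r$, $C_1\lambda^\kappa\mu(B(x,r))\le\mu(B(x,\lambda r))\le C_2\lambda^n\mu(B(x,r))$. Test functions: put $V_r(x)=\mu(B(x,r))$ and $V(x,y)=\mu(B(x,d(x,y)))$. For $x_0\in\mathcal X$, $r>0$, $\beta\in(0,1]$, $\gamma\in(0,\infty)$, $\mathcal G(x_0,r,\beta,\gamma)$ is the set of functions $\varphi$ on $\mathcal X$ for which there is $C\ge0$ with (a) $|\varphi(x)|\le C\frac1{V_r(x_0)+V(x_0,x)}\big(\frac r{r+d(x_0,x)}\big)^\gamma$ for all $x$; (b) $|\varphi(x)-\varphi(y)|\le C\big(\frac{d(x,y)}{r+d(x_0,x)}\big)^\beta\frac1{V_r(x_0)+V(x_0,x)}\big(\frac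 r{r+d(x_0,x)}\big)^\gamma$ whenever $d(x,y)\le(r+d(x_0,x))/2$. The norm $\|\varphi\|_{\mathcal G(x_0,r,\beta,\gamma)}$ is the infimum of such $C$. Fix $x_1\in\mathcal X$; $\mathcal G(\beta,\gamma)=\mathcal G(x_1,1,\beta,\gamma)$, and $\mathring{\mathcal G}(\beta,\gamma)$ is the subspace of those $\varphi\in\mathcal G(\beta,\gamma)$ with $\int_{\mathcal X}\varphi\,d\mu=0$. For $\epsilon\in(0,1)$ and $\beta,\gamma\in(0,\epsilon]$, $\mathcal G^\epsilon_0(\beta,\gamma)$ is the completion (closure) of $\mathcal G(\epsilon,\epsilon)$ in $\mathcal G(\beta,\gamma)$. A prime denotes the dual space. Inhomogeneous grand Triebel–Lizorkin space: let $\mathcal A_0(x)=\{\phi\in\mathcal G(1,2):\|\phi\|_{\mathcal G(x,1,1,2)}\le1\}$ and, for $k\in\mathbb N$, $\mathcal A_k(x)=\{\phi\in\mathring{\mathcal G}(1,2):\|\phi\|_{\mathcal G(x,2^{-k},1,2)}\le1\}$. $\mathcal AF^s_{p,\infty}(\mathcal X)$ is the set of all $f\in(\mathcal G(1,2))'$ with $\|f\|_{\mathcal AF^s_{p,\infty}(\mathcal X)}=\big\|\sup_{k\in\mathbb Z_+}2^{ks}\sup_{\phi\in\mathcal A_k(\cdot)}|\langle f,\phi\rangle|\big\|_{L^p(\mathcal X)}<\infty$. Inhomogeneous Hajłasz–Sobolev space: $\dot M^{s,p}(\mathcal X)$ is the set of all measurable $f\in L^p_{\rm loc}(\mathcal X)$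 for which there exist a nonnegative $g\in L^p(\mathcal X)$ and a null set $E\subset\mathcal X$ such that $|f(x)-f(y)|\le[d(x,y)]^s[g(x)+g(y)]$ for all $x,y\in\mathcal X\setminus E$; $\|f\|_{\dot M^{s,p}(\mathcal X)}$ is the infimum of $\|g\|_{L^p(\mathcal X)}$ over all such $g$. $M^{s,p}(\mathcal X)$ is the set of all measurable $f\in L^p_{\rm loc}(\mathcal X)$ with $f\in h^p(\mathcal X)$ and $f\in\dot M^{s,p}(\mathcal X)$, with $\|f\|_{M^{s,p}(\mathcal X)}=\|f\|_{h^p(\mathcal X)}+\|f\|_{\dot M^{s,p}(\mathcal X)}$, where $h^p(\mathcal X)=F^0_{p,2}(\mathcal X)$ is defined as follows. The space $F^0_{p,2}(\mathcal X)$: choose $\epsilon\in(0,1)$ with $p>n/(n+\epsilon)$ and $\beta,\gamma\in(n(1/p-1)_+,\epsilon)$. Let $\{S_k\}_{k\in\mathbb Z_+}$ be bounded linear integral operators on $L^2(\mathcal X)$ with measurable complex kernels and constants $C_3,C_4>0$ such that for all $k\in\mathbb Z_+$ and $x,x',y,y'\in\mathcal X$: (i) $S_k(x,y)=0$ if $d(x,y)>C_42^{-k}$, and $|S_k(x,y)|\le C_3\frac1{V_{2^{-k}}(x)+V_{2^{-k}}(y)}$; (ii) $|S_k(x,y)-S_k(x',y)|\le C_32^{k\epsilon}[d(x,x')]^{\epsilon}\frac1{V_{2^{-k}}(x)+V_{2^{-k}}(y)}$ if $d(x,x')\le\max\{C_4,1\}2^{1-k}$; (iii) (ii) holds with $x$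 and $y$ interchanged; (iv) $|[S_k(x,y)-S_k(x,y')]-[S_k(x',y)-S_k(x',y')]|\le C_32^{2k\epsilon}\frac{[d(x,x')]^\epsilon[d(y,y')]^\epsilon}{V_{2^{-k}}(x)+V_{2^{-k}}(y)}$ if $d(x,x'),d(y,y')\le\max\{C_4,1\}2^{1-k}$; (v) $\int_{\mathcal X}S_k(x,y)\,d\mu(y)=1=\int_{\mathcal X}S_k(x,y)\,d\mu(x)$. Put $D_k=S_k-S_{k-1}$ for $k\in\mathbb N$, with $S_0(f)(x)=\langle f,S_0(x,\cdot)\rangle$, $D_k(f)(x)=\langle f,D_k(x,\cdot)\rangle$. Let $\{Q^k_\alpha:k\in\mathbb Z,\alpha\in I_k\}$ be Christ's dyadic cubes: open sets such that for each $k$ the $Q^k_\alpha$ are pairwise disjoint and cover $\mathcal X$ up to a null set; for $\ell\ge k$ either $Q^\ell_\beta\subset Q^k_\alpha$ or $Q^\ell_\beta\cap Q^k_\alpha=\emptyset$; for each $(k,\alpha)$ and $\ell<k$ there is a unique $\beta$ with $Q^k_\alpha\subset Q^\ell_\beta$; $\operatorname{diam}(Q^k_\alpha)\le C_52^{-k}$; each $Q^k_\alpha$ contains a ball of radius $C_62^{-k}$ (scale ratio $1/2$ taken for simplicity). Fix a large $j\in\mathbb N$ with $2^{-j}C_5<1/3$, and for $\tau\in I_0$ let $Q^{0,\nu}_\tau$, $\nu=1,\dots,N(0,\tau)$, be the cubes $Q^j_{\tau'}\subset Q^0_\tau$. Then $F^0_{p,2}(\mathcal X)$ is the set of $f\in(\mathcal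 G^\epsilon_0(\beta,\gamma))'$ with $$\|f\|_{F^0_{p,2}(\mathcal X)}=\Big\{\sum_{\tau\in I_0}\sum_{\nu=1}^{N(0,\tau)}\mu(Q^{0,\nu}_\tau)\big[m_{Q^{0,\nu}_\tau}(|S_0(f)|)\big]^p\Big\}^{1/p}+\Big\|\Big\{\sum_{k=1}^\infty|D_k(f)|^2\Big\}^{1/2}\Big\|_{L^p(\mathcal X)}<\infty,$$ where $m_Q(h)=\frac1{\mu(Q)}\int_Qh\,d\mu$; up to equivalence of norms this does not depend on the choices made. Functions are viewed as functionals by integration; equality means that elements of each space can be identified with elements of the other, with (quasi-)norms comparable up to constants independent of $f$. *)

theory Defs
  imports "HOL-Analysis.Analysis"
begin

section \<open>RD-spaces\<close>

text \<open>The metric space is a type of class \<^class>\<open>metric_space\<close>.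
  The library function \<^const>\<open>diameter\<close> is real-valued and gives no information on unbounded sets.\<close>

definition ediam :: "'a::metric_space set \<Rightarrow> ennreal" where
  "ediam A = (SUP x\<in>A. SUP y\<in>A. ennreal (dist x y))"

definition vol :: "'a::metric_space measure \<Rightarrow> 'a \<Rightarrow> real \<Rightarrow> real" where
  "vol \<mu> x r = measure \<mu> (ball x r)"

text \<open>Regularity of the Borel measure is read as outer regularity, the weakest of the usual readings.\<close>

definition rd_space :: "'a::metric_space measure \<Rightarrow> real \<Rightarrow> real \<Rightarrow> bool" where
  "rd_space \<mu> \<kappa> n \<longleftrightarrow>
     sets \<mu> = sets borel \<and>
     (\<forall>A\<in>sets \<mu>. emeasure \<mu> A = (INF U\<in>{U. open U \<and> A \<subseteq> U}. emeasure \<mu> U)) \<and>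
     (\<forall>x r. 0 < r \<longrightarrow> 0 < emeasure \<mu> (ball x r) \<and> emeasure \<mu> (ball x r) < \<infinity>) \<and>
     0 < \<kappa> \<and> \<kappa> \<le> n \<and>
     (\<exists>C1 C2::real. 0 < C1 \<and> C1 \<le> 1 \<and> 1 \<le> C2 \<and>
        (\<forall>x r l. 0 < r \<and> ennreal r < 2 * ediam (UNIV :: 'a set) \<and>
                 1 \<le> l \<and> ennreal l < 2 * ediam (UNIV :: 'a set) / ennreal r \<longrightarrow>
           C1 * l powr \<kappa> * vol \<mu> x r \<le> vol \<mu> x (l * r) \<and>
           vol \<mu> x (l * r) \<le> C2 * l powr n * vol \<mu> x r))"

section \<open>Spaces of test functions and their duals\<close>

definition test_weight :: "'a::metric_space measure \<Rightarrow> 'a \<Rightarrow> real \<Rightarrow> real \<Rightarrow> 'a \<Rightarrow> real" where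
  "test_weight \<mu> x0 r \<gamma> x =
     1 / (vol \<mu> x0 r + vol \<mu> x0 (dist x0 x)) * (r / (r + dist x0 x)) powr \<gamma>"

definition test_bound ::
  "'a::metric_space measure \<Rightarrow> 'a \<Rightarrow> real \<Rightarrow> real \<Rightarrow> real \<Rightarrow> real \<Rightarrow> ('a \<Rightarrow> complex) \<Rightarrow> bool" where
  "test_bound \<mu> x0 r \<beta> \<gamma> C \<phi> \<longleftrightarrow>
     (\<forall>x. cmod (\<phi> x) \<le> C * test_weight \<mu> x0 r \<gamma> x) \<and>
     (\<forall>x y. dist x y \<le> (r + dist x0 x) / 2 \<longrightarrow>
        cmod (\<phi> x - \<phi> y) \<le> C * (dist x y / (r + dist x0 x)) powr \<beta> * test_weight \<mu> x0 r \<gamma> x)"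

definition test_space ::
  "'a::metric_space measure \<Rightarrow> 'a \<Rightarrow> real \<Rightarrow> real \<Rightarrow> real \<Rightarrow> ('a \<Rightarrow> complex) set" where
  "test_space \<mu> x0 r \<beta> \<gamma> = {\<phi>. \<exists>C\<ge>0. test_bound \<mu> x0 r \<beta> \<gamma> C \<phi>}"

definition test_norm ::
  "'a::metric_space measure \<Rightarrow> 'a \<Rightarrow> real \<Rightarrow> real \<Rightarrow> real \<Rightarrow> ('a \<Rightarrow> complex) \<Rightarrow> ennreal" where
  "test_norm \<mu> x0 r \<beta> \<gamma> \<phi> = (INF C\<in>{C::real. 0 \<le> C \<and> test_bound \<mu> x0 r \<beta> \<gamma> C \<phi>}. ennreal C)"

definition test_space_mean_zero ::
  "'a::metric_space measure \<Rightarrow> 'a \<Rightarrow> real \<Rightarrow> real \<Rightarrow> ('a \<Rightarrow> complex) set" where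
  "test_space_mean_zero \<mu> x1 \<beta> \<gamma> = {\<phi> \<in> test_space \<mu> x1 1 \<beta> \<gamma>. (\<integral>x. \<phi> x \<partial>\<mu>) = 0}"

definition test_closure ::
  "'a::metric_space measure \<Rightarrow> 'a \<Rightarrow> real \<Rightarrow> real \<Rightarrow> real \<Rightarrow> ('a \<Rightarrow> complex) set" where
  "test_closure \<mu> x1 \<epsilon> \<beta> \<gamma> =
     {\<phi> \<in> test_space \<mu> x1 1 \<beta> \<gamma>.
        \<forall>\<delta>>0. \<exists>\<psi>\<in>test_space \<mu> x1 1 \<epsilon> \<epsilon>. test_norm \<mu> x1 1 \<beta> \<gamma> (\<lambda>x. \<phi> x - \<psi> x) < ennreal \<delta>}"

text \<open>Bounded linear functionals on a space \<open>E\<close> of functions with norm \<open>N\<close>. Extensionality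
  makes a functional determined by its values on \<open>E\<close>.\<close>

definition dual_space ::
  "('a \<Rightarrow> complex) set \<Rightarrow> (('a \<Rightarrow> complex) \<Rightarrow> ennreal) \<Rightarrow> (('a \<Rightarrow> complex) \<Rightarrow> complex) set" where
  "dual_space E N =
     {u \<in> extensional E.
        (\<forall>\<phi>\<in>E. \<forall>\<psi>\<in>E. u (\<lambda>x. \<phi> x + \<psi> x) = u \<phi> + u \<psi>) \<and>
        (\<forall>c. \<forall>\<phi>\<in>E. u (\<lambda>x. c * \<phi> x) = c * u \<phi>) \<and>
        (\<exists>C::real. 0 \<le> C \<and> (\<forall>\<phi>\<in>E. ennreal (cmod (u \<phi>)) \<le> ennreal C * N \<phi>))}"

definition functional_of ::
  "'a measure \<Rightarrow> ('a \<Rightarrow> complex) set \<Rightarrow> ('a \<Rightarrow> complex) \<Rightarrow> ('a \<Rightarrow> complex) \<Rightarrow> complex" where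
  "functional_of \<mu> E f = restrict (\<lambda>\<phi>. \<integral>x. f x * \<phi> x \<partial>\<mu>) E"

section \<open>The Lebesgue quasi-norm\<close>

definition epowr :: "ennreal \<Rightarrow> real \<Rightarrow> ennreal" where
  "epowr a q = (if a = \<infinity> then \<infinity> else ennreal (enn2real a powr q))"

text \<open>The infimum over measurable majorants makes this an upper integral. For measurable \<open>F\<close> it is
  the usual quasi-norm. The grand maximal function below is a supremum over an uncountable
  family, and \<^const>\<open>nn_integral\<close> of a nonmeasurable function would be a lower integral.\<close>

definition Lp_norm :: "'a measure \<Rightarrow> real \<Rightarrow> ('a \<Rightarrow> ennreal) \<Rightarrow> ennreal" where
  "Lp_norm \<mu> p F =
     epowr (INF h\<in>{h \<in> borel_measurable \<mu>. \<forall>x. F x \<le> h x}. \<integral>\<^sup>+x. epowr (h x) p \<partial>\<mu>) (1 / p)"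

section \<open>Inhomogeneous grand Triebel--Lizorkin spaces\<close>

definition grand_tests ::
  "'a::metric_space measure \<Rightarrow> 'a \<Rightarrow> nat \<Rightarrow> 'a \<Rightarrow> ('a \<Rightarrow> complex) set" where
  "grand_tests \<mu> x1 k x =
     {\<phi> \<in> (if k = 0 then test_space \<mu> x1 1 1 2 else test_space_mean_zero \<mu> x1 1 2).
        test_norm \<mu> x (2 powr (- real k)) 1 2 \<phi> \<le> 1}"

definition AF_norm ::
  "'a::metric_space measure \<Rightarrow> 'a \<Rightarrow> real \<Rightarrow> real \<Rightarrow> (('a \<Rightarrow> complex) \<Rightarrow> complex) \<Rightarrow> ennreal" where
  "AF_norm \<mu> x1 s p u =
     Lp_norm \<mu> p (\<lambda>x. SUP k. ennreal (2 powr (real k * s)) *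
                          (SUP \<phi>\<in>grand_tests \<mu> x1 k x. ennreal (cmod (u \<phi>))))"

definition AF_space ::
  "'a::metric_space measure \<Rightarrow> 'a \<Rightarrow> real \<Rightarrow> real \<Rightarrow> (('a \<Rightarrow> complex) \<Rightarrow> complex) set" where
  "AF_space \<mu> x1 s p =
     {u \<in> dual_space (test_space \<mu> x1 1 1 2) (test_norm \<mu> x1 1 1 2). AF_norm \<mu> x1 s p u < \<infinity>}"

section \<open>The local Hardy space\<close>

definition approx_identity ::
  "'a::metric_space measure \<Rightarrow> real \<Rightarrow> (nat \<Rightarrow> 'a \<Rightarrow> 'a \<Rightarrow> complex) \<Rightarrow> bool" where
  "approx_identity \<mu> \<epsilon> S \<longleftrightarrow>
     (\<forall>k. (\<lambda>(x, y). S k x y) \<in> borel_measurable (\<mu> \<Otimes>\<^sub>M \<mu>)) \<and>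
     (\<forall>k. \<exists>B::real. \<forall>h\<in>borel_measurable \<mu>. (\<integral>\<^sup>+x. ennreal ((cmod (h x))\<^sup>2) \<partial>\<mu>) < \<infinity> \<longrightarrow>
        (\<forall>x. integrable \<mu> (\<lambda>y. S k x y * h y)) \<and>
        (\<lambda>x. \<integral>y. S k x y * h y \<partial>\<mu>) \<in> borel_measurable \<mu> \<and>
        (\<integral>\<^sup>+x. ennreal ((cmod (\<integral>y. S k x y * h y \<partial>\<mu>))\<^sup>2) \<partial>\<mu>)
          \<le> ennreal B * (\<integral>\<^sup>+x. ennreal ((cmod (h x))\<^sup>2) \<partial>\<mu>)) \<and>
     (\<exists>C3 C4::real. 0 < C3 \<and> 0 < C4 \<and>
        (\<forall>k. let r = 2 powr (- real k);
                 w = (\<lambda>x y. 1 / (vol \<mu> x r + vol \<mu> y r));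
                 R = max C4 1 * 2 powr (1 - real k)
             in
             (\<forall>x y. dist x y > C4 * r \<longrightarrow> S k x y = 0) \<and>
             (\<forall>x y. cmod (S k x y) \<le> C3 * w x y) \<and>
             (\<forall>x x' y. dist x x' \<le> R \<longrightarrow>
                cmod (S k x y - S k x' y)
                  \<le> C3 * 2 powr (real k * \<epsilon>) * dist x x' powr \<epsilon> * w x y) \<and>
             (\<forall>x y y'. dist y y' \<le> R \<longrightarrow>
                cmod (S k x y - S k x y')
                  \<le> C3 * 2 powr (real k * \<epsilon>) * dist y y' powr \<epsilon> * w x y) \<and>
             (\<forall>x x' y y'. dist x x' \<le> R \<and> dist y y' \<le> R \<longrightarrow>
                cmod ((S k x y - S k x y') - (S k x' y - S k x' y'))
                  \<le> C3 * 2 powr (2 * real k * \<epsilon>) * (dist x x' powr \<epsilon> * dist y y' powr \<epsilon>) * w x y) \<and>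
             (\<forall>x. integrable \<mu> (\<lambda>y. S k x y) \<and> (\<integral>y. S k x y \<partial>\<mu>) = 1) \<and>
             (\<forall>y. integrable \<mu> (\<lambda>x. S k x y) \<and> (\<integral>x. S k x y \<partial>\<mu>) = 1)))"

text \<open>\<open>C5\<close> is a parameter because the choice of the subdivision level \<open>j\<close> in \<open>F_norm\<close> below
  depends on it.\<close>

definition dyadic_cubes ::
  "'a::metric_space measure \<Rightarrow> real \<Rightarrow> (int \<Rightarrow> 'i set) \<Rightarrow> (int \<Rightarrow> 'i \<Rightarrow> 'a set) \<Rightarrow> bool" where
  "dyadic_cubes \<mu> C5 I Q \<longleftrightarrow>
     (\<forall>k. \<forall>\<alpha>\<in>I k. open (Q k \<alpha>)) \<and>
     (\<forall>k. disjoint_family_on (Q k) (I k)) \<and>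
     (\<forall>k. UNIV - (\<Union>\<alpha>\<in>I k. Q k \<alpha>) \<in> null_sets \<mu>) \<and>
     (\<forall>k l. k \<le> l \<longrightarrow> (\<forall>\<alpha>\<in>I k. \<forall>\<beta>\<in>I l. Q l \<beta> \<subseteq> Q k \<alpha> \<or> Q l \<beta> \<inter> Q k \<alpha> = {})) \<and>
     (\<forall>k l. l < k \<longrightarrow> (\<forall>\<alpha>\<in>I k. \<exists>!\<beta>. \<beta> \<in> I l \<and> Q k \<alpha> \<subseteq> Q l \<beta>)) \<and>
     0 < C5 \<and>
     (\<forall>k. \<forall>\<alpha>\<in>I k. ediam (Q k \<alpha>) \<le> ennreal (C5 * 2 powr (- real_of_int k))) \<and>
     (\<exists>C6>0. \<forall>k. \<forall>\<alpha>\<in>I k. \<exists>z. ball z (C6 * 2 powr (- real_of_int k)) \<subseteq> Q k \<alpha>)"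

definition mean_on :: "'a measure \<Rightarrow> 'a set \<Rightarrow> ('a \<Rightarrow> ennreal) \<Rightarrow> ennreal" where
  "mean_on \<mu> A h = (\<integral>\<^sup>+x\<in>A. h x \<partial>\<mu>) / emeasure \<mu> A"

definition F_norm ::
  "'a::metric_space measure \<Rightarrow> real \<Rightarrow> (nat \<Rightarrow> 'a \<Rightarrow> 'a \<Rightarrow> complex) \<Rightarrow> (int \<Rightarrow> 'i set) \<Rightarrow>
   (int \<Rightarrow> 'i \<Rightarrow> 'a set) \<Rightarrow> nat \<Rightarrow> (('a \<Rightarrow> complex) \<Rightarrow> complex) \<Rightarrow> ennreal" where
  "F_norm \<mu> p S I Q j u =
     epowr (\<Sum>\<^sub>\<infinity>\<tau>\<in>I 0. \<Sum>\<^sub>\<infinity>\<tau>'\<in>{\<tau>'\<in>I (int j). Q (int j) \<tau>' \<subseteq> Q 0 \<tau>}.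
              emeasure \<mu> (Q (int j) \<tau>') *
              epowr (mean_on \<mu> (Q (int j) \<tau>') (\<lambda>x. ennreal (cmod (u (S 0 x))))) p) (1 / p)
     + Lp_norm \<mu> p (\<lambda>x.
         epowr (\<Sum>k. ennreal ((cmod (u (\<lambda>y. S (Suc k) x y - S k x y)))\<^sup>2)) (1 / 2))"

definition F_space ::
  "'a::metric_space measure \<Rightarrow> 'a \<Rightarrow> real \<Rightarrow> real \<Rightarrow> real \<Rightarrow> real \<Rightarrow> (nat \<Rightarrow> 'a \<Rightarrow> 'a \<Rightarrow> complex) \<Rightarrow>
   (int \<Rightarrow> 'i set) \<Rightarrow> (int \<Rightarrow> 'i \<Rightarrow> 'a set) \<Rightarrow> nat \<Rightarrow> (('a \<Rightarrow> complex) \<Rightarrow> complex) set" where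
  "F_space \<mu> x1 p \<epsilon> \<beta> \<gamma> S I Q j =
     {u \<in> dual_space (test_closure \<mu> x1 \<epsilon> \<beta> \<gamma>) (test_norm \<mu> x1 1 \<beta> \<gamma>). F_norm \<mu> p S I Q j u < \<infinity>}"

text \<open>The auxiliary data entering the definition of the local Hardy space.\<close>

definition hardy_data ::
  "'a::metric_space measure \<Rightarrow> real \<Rightarrow> real \<Rightarrow> real \<Rightarrow> real \<Rightarrow> real \<Rightarrow>
   (nat \<Rightarrow> 'a \<Rightarrow> 'a \<Rightarrow> complex) \<Rightarrow> (int \<Rightarrow> 'i set) \<Rightarrow> (int \<Rightarrow> 'i \<Rightarrow> 'a set) \<Rightarrow> nat \<Rightarrow> bool" where
  "hardy_data \<mu> n p \<epsilon> \<beta> \<gamma> S I Q j \<longleftrightarrow>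
     0 < \<epsilon> \<and> \<epsilon> < 1 \<and> n / (n + \<epsilon>) < p \<and>
     n * max (1 / p - 1) 0 < \<beta> \<and> \<beta> < \<epsilon> \<and>
     n * max (1 / p - 1) 0 < \<gamma> \<and> \<gamma> < \<epsilon> \<and>
     approx_identity \<mu> \<epsilon> S \<and>
     1 \<le> j \<and> (\<exists>C5. dyadic_cubes \<mu> C5 I Q \<and> 2 powr (- real j) * C5 < 1 / 3)"

section \<open>Inhomogeneous Hajlasz--Sobolev spaces\<close>

definition Lp_loc :: "'a::metric_space measure \<Rightarrow> real \<Rightarrow> ('a \<Rightarrow> complex) set" where
  "Lp_loc \<mu> p = {f \<in> borel_measurable \<mu>.
     \<forall>x r. (\<integral>\<^sup>+y\<in>ball x r. ennreal (cmod (f y) powr p) \<partial>\<mu>) < \<infinity>}"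

definition hajlasz_gradients ::
  "'a::metric_space measure \<Rightarrow> real \<Rightarrow> real \<Rightarrow> ('a \<Rightarrow> complex) \<Rightarrow> ('a \<Rightarrow> real) set" where
  "hajlasz_gradients \<mu> s p f =
     {g \<in> borel_measurable \<mu>. (\<forall>x. 0 \<le> g x) \<and> Lp_norm \<mu> p (\<lambda>x. ennreal (g x)) < \<infinity> \<and>
        (\<exists>E\<in>null_sets \<mu>. \<forall>x y. x \<notin> E \<and> y \<notin> E \<longrightarrow>
           cmod (f x - f y) \<le> dist x y powr s * (g x + g y))}"

definition hom_sobolev_space ::
  "'a::metric_space measure \<Rightarrow> real \<Rightarrow> real \<Rightarrow> ('a \<Rightarrow> complex) set" where
  "hom_sobolev_space \<mu> s p = {f \<in> Lp_loc \<mu> p. hajlasz_gradients \<mu> s p f \<noteq> {}}"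

definition hom_sobolev_norm ::
  "'a::metric_space measure \<Rightarrow> real \<Rightarrow> real \<Rightarrow> ('a \<Rightarrow> complex) \<Rightarrow> ennreal" where
  "hom_sobolev_norm \<mu> s p f =
     (INF g\<in>hajlasz_gradients \<mu> s p f. Lp_norm \<mu> p (\<lambda>x. ennreal (g x)))"

text \<open>That a function belongs to the local Hardy space means that its product with every test
  function is integrable and the resulting functional belongs to that space.\<close>

definition sobolev_space ::
  "'a::metric_space measure \<Rightarrow> 'a \<Rightarrow> real \<Rightarrow> real \<Rightarrow> real \<Rightarrow> real \<Rightarrow> real \<Rightarrow>
   (nat \<Rightarrow> 'a \<Rightarrow> 'a \<Rightarrow> complex) \<Rightarrow> (int \<Rightarrow> 'i set) \<Rightarrow> (int \<Rightarrow> 'i \<Rightarrow> 'a set) \<Rightarrow> nat \<Rightarrow>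
   ('a \<Rightarrow> complex) set" where
  "sobolev_space \<mu> x1 s p \<epsilon> \<beta> \<gamma> S I Q j =
     {f \<in> hom_sobolev_space \<mu> s p.
        (\<forall>\<phi>\<in>test_closure \<mu> x1 \<epsilon> \<beta> \<gamma>. integrable \<mu> (\<lambda>x. f x * \<phi> x)) \<and>
        functional_of \<mu> (test_closure \<mu> x1 \<epsilon> \<beta> \<gamma>) f \<in> F_space \<mu> x1 p \<epsilon> \<beta> \<gamma> S I Q j}"

definition sobolev_norm ::
  "'a::metric_space measure \<Rightarrow> 'a \<Rightarrow> real \<Rightarrow> real \<Rightarrow> real \<Rightarrow> real \<Rightarrow> real \<Rightarrow>
   (nat \<Rightarrow> 'a \<Rightarrow> 'a \<Rightarrow> complex) \<Rightarrow> (int \<Rightarrow> 'i set) \<Rightarrow> (int \<Rightarrow> 'i \<Rightarrow> 'a set) \<Rightarrow> nat \<Rightarrow>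
   ('a \<Rightarrow> complex) \<Rightarrow> ennreal" where
  "sobolev_norm \<mu> x1 s p \<epsilon> \<beta> \<gamma> S I Q j f =
     F_norm \<mu> p S I Q j (functional_of \<mu> (test_closure \<mu> x1 \<epsilon> \<beta> \<gamma>) f) + hom_sobolev_norm \<mu> s p f"

end

theory Submission
  imports Defs
begin

text \<open>Fix \<open>q \<le> 1\<close>, \<open>q < p\<close>, with \<open>n (1/q - 1) < min s \<gamma>\<close>. Telescoping along points
  where the Hajlasz gradient \<open>g\<close> is at most its \<open>q\<close>-mean gives a Poincare inequality with \<open>g\<close> in
  \<open>L\<^sup>q\<close>, hence with the maximal function of \<open>g powr q\<close>, to which the strong maximal theorem applies
  because \<open>p / q > 1\<close>. Every pairing of \<open>f\<close> with a mean-zero bump of scale \<open>r\<close> is thus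
  \<open>O(r\<^sup>s)\<close>, which bounds the grand maximal function at scales \<open>2 powr (- k)\<close>, \<open>k \<ge> 1\<close>; at
  scale 1 the missing mean value is read off the cell means of \<open>S\<^sub>0 f\<close>.

  Conversely, let \<open>h\<close> majorise the grand maximal function of a functional \<open>u\<close>. The values of
  \<open>u\<close> on normalised bumps of scale \<open>2 powr (- k)\<close> around \<open>x\<close> converge geometrically to some
  \<open>F x\<close> wherever \<open>h x\<close> is finite, and \<open>F\<close> has a multiple of \<open>h\<close> as Hajlasz gradient
  and pointwise bound. A partition of unity of mesh \<open>r\<close> splits a test function into mean-zero pieces plus
  bumps and shows that \<open>u\<close> and integration against \<open>F\<close> differ by
  \<open>O(r powr (s - n (1/q - 1)))\<close>, so they agree. Since all \<open>D\<^sub>k F\<close> are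
  \<open>O(2 powr (- k s))\<close> times a maximal function, the square function needs no
  almost-orthogonality.\<close>

section \<open>Powers of extended reals and \<open>L\<^sup>p\<close> quasi-norms\<close>

text \<open>Since \<open>p\<close> may be at most 1, neither \<open>f\<close> nor its gradient
  \<open>g\<close> need be locally integrable at the outset, and the maximal operator is then not
  bounded on the Lebesgue space of exponent \<open>p\<close>. Means of exponent \<open>q < p\<close>
  cure both, at a price: passing from balls of radius \<open>r\<close> to a ball of radius
  \<open>R\<close> costs \<open>(R / r) powr (n * (1 / q - 1))\<close>. Each series in which this
  loss occurs converges because its exponent is smaller than a gain: \<open>s\<close> when the
  scales shrink, the decay of the test functions when the balls grow. A second obstacle is infinity.
  Cutting off does not improve the decay of a test function, so functions of bounded support need
  not be dense in the test space, and continuity of \<open>u\<close> does not reduce the identity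
  with \<open>F\<close> to bounded supports. Integrability of the majorant \<open>h\<close> has to
  exclude mass at infinity; reverse doubling enters here, through the unbounded volume of balls.
  Finally, the kernels are only Holder of order \<open>\<epsilon> < 1\<close>, while
  \<open>s\<close> may be 1. The differences \<open>S (Suc k) - S k\<close> are therefore estimated
  by size and cancellation, and the decay in \<open>k\<close> is taken from the smoothness of
  \<open>f\<close>.\<close>

lemma epowr_ennreal [simp]: "0 \<le> a \<Longrightarrow> epowr (ennreal a) q = ennreal (a powr q)"
  by (simp add: epowr_def)

lemma epowr_top [simp]: "epowr top q = top"
  by (simp add: epowr_def)

lemma epowr_0 [simp]: "epowr 0 q = 0"
  by (simp add: epowr_def)

lemma epowr_mono: "a \<le> b \<Longrightarrow> 0 \<le> q \<Longrightarrow> epowr a q \<le> epowr b q"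
  by (cases a; cases b) (auto simp: powr_mono2 top_unique)

lemma epowr_mult: "0 < q \<Longrightarrow> epowr (a * b) q = epowr a q * epowr b q"
  by (cases a; cases b)
     (auto simp: ennreal_mult[symmetric] powr_mult ennreal_top_mult ennreal_mult_top)

lemma epowr_epowr: "epowr (epowr a q) r = epowr a (q * r)"
  by (cases a) (auto simp: powr_powr)

text \<open>Valid for all exponents, even zero: the power of \<open>top\<close> is always
  \<open>top\<close> and that of 0 always 0, so both sides agree at the ends.\<close>

lemma epowr_add: "epowr a (q + r) = epowr a q * epowr a r"
  by (cases a) (auto simp: powr_add ennreal_mult)

lemma epowr_one [simp]: "epowr a 1 = a"
  by (cases a) auto

lemma epowr_eq_top_iff [simp]: "epowr a q = top \<longleftrightarrow> a = top"
  by (cases a) auto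

lemma epowr_le_iff: "0 < q \<Longrightarrow> epowr a q \<le> b \<longleftrightarrow> a \<le> epowr b (1 / q)"
proof
  assume q: "0 < q" and "epowr a q \<le> b"
  then have "epowr (epowr a q) (1 / q) \<le> epowr b (1 / q)"
    by (intro epowr_mono) auto
  then show "a \<le> epowr b (1 / q)" using q by (simp add: epowr_epowr)
next
  assume q: "0 < q" and "a \<le> epowr b (1 / q)"
  then have "epowr a q \<le> epowr (epowr b (1 / q)) q"
    by (intro epowr_mono) auto
  then show "epowr a q \<le> b" using q by (simp add: epowr_epowr)
qed

lemma measurable_epowr [measurable]:
  assumes [measurable]: "f \<in> borel_measurable M"
  shows "(\<lambda>x. epowr (f x) q) \<in> borel_measurable M"
  unfolding epowr_def by measurable

text \<open>The fractions of \<open>x\<close> and \<open>y\<close> in \<open>t = x + y\<close> are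
  at most 1, so the exponent \<open>q \<le> 1\<close> can only enlarge them, and together they make
  1.\<close>

lemma powr_subadditive:
  fixes x y q :: real
  assumes "0 \<le> x" "0 \<le> y" "0 < q" "q \<le> 1"
  shows "(x + y) powr q \<le> x powr q + y powr q"
proof (cases "x + y = 0")
  case False
  define t where "t = x + y"
  have t: "t > 0" using False assms by (simp add: t_def)
  have *: "t powr q * (z / t) \<le> z powr q" if "0 \<le> z" "z \<le> t" for z
  proof -
    have "(z / t) powr 1 \<le> (z / t) powr q"
      using that t assms by (intro powr_mono') auto
    then have "t powr q * (z / t) \<le> t powr q * (z / t) powr q"
      using that t by (intro mult_left_mono) auto
    also have "\<dots> = z powr q" using that t by (simp add: powr_divide)
    finally show ?thesis .
  qed
  have "t powr q = t powr q * (x / t) + t powr q * (y / t)"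
    using t by (simp add: t_def flip: distrib_left add_divide_distrib)
  also have "\<dots> \<le> x powr q + y powr q"
    using assms by (intro add_mono *) (auto simp: t_def)
  finally show ?thesis by (simp add: t_def)
qed (use assms in auto)

lemma epowr_subadditive: "0 < q \<Longrightarrow> q \<le> 1 \<Longrightarrow> epowr (a + b) q \<le> epowr a q + epowr b q"
  by (cases a; cases b) (auto simp: powr_subadditive simp flip: ennreal_plus)

lemma epowr_sum_le:
  "0 < q \<Longrightarrow> q \<le> 1 \<Longrightarrow> epowr (\<Sum>i\<in>A. f i) q \<le> (\<Sum>i\<in>A. epowr (f i) q)"
proof (induction A rule: infinite_finite_induct)
  case (insert x F)
  have "epowr (sum f (insert x F)) q \<le> epowr (f x) q + epowr (sum f F) q"
    using insert by (simp add: epowr_subadditive)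
  also have "\<dots> \<le> epowr (f x) q + (\<Sum>i\<in>F. epowr (f i) q)"
    using insert by (intro add_mono) auto
  finally show ?case using insert by simp
qed auto

text \<open>Subadditivity of the power \<open>q\<close>, applied to the terms
  \<open>epowr (f i) (1 / q)\<close>. It allows the \<open>q\<close>-means over the balls of a net
  to be added up.\<close>

lemma sum_epowr_le:
  assumes "0 < q" "q \<le> 1"
  shows "(\<Sum>i\<in>A. epowr (f i) (1 / q)) \<le> epowr (\<Sum>i\<in>A. f i) (1 / q)"
proof -
  have "epowr (\<Sum>i\<in>A. epowr (f i) (1 / q)) q \<le> (\<Sum>i\<in>A. epowr (epowr (f i) (1 / q)) q)"
    using assms by (rule epowr_sum_le)
  then have "epowr (\<Sum>i\<in>A. epowr (f i) (1 / q)) q \<le> (\<Sum>i\<in>A. f i)"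
    using assms by (simp add: epowr_epowr)
  then show ?thesis using assms by (simp add: epowr_le_iff)
qed

text \<open>The sum is at most twice the maximum, which treats exponents below and above 1
  alike.\<close>

lemma epowr_add_le:
  assumes "0 < q"
  shows "epowr (a + b) q \<le> ennreal (2 powr q) * (epowr a q + epowr b q)"
proof -
  have "a + b \<le> 2 * max a b"
    by (metis add_mono max.cobounded1 max.cobounded2 mult_2)
  then have "epowr (a + b) q \<le> epowr (2 * max a b) q"
    using assms by (intro epowr_mono) auto
  also have "\<dots> = ennreal (2 powr q) * epowr (max a b) q"
    using assms epowr_ennreal[of 2 q] by (simp add: epowr_mult)
  also have "epowr (max a b) q \<le> epowr a q + epowr b q"
    by (simp add: max_def add_increasing add_increasing2)
  finally show ?thesis by (simp add: mult_left_mono)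
qed

lemma Lp_norm_le:
  assumes "h \<in> borel_measurable \<mu>" "\<And>x. F x \<le> h x" "0 < p"
  shows "Lp_norm \<mu> p F \<le> epowr (\<integral>\<^sup>+x. epowr (h x) p \<partial>\<mu>) (1 / p)"
  unfolding Lp_norm_def using assms by (intro epowr_mono INF_lower) auto

lemma Lp_norm_measurable:
  assumes "h \<in> borel_measurable \<mu>" "0 < p"
  shows "Lp_norm \<mu> p h = epowr (\<integral>\<^sup>+x. epowr (h x) p \<partial>\<mu>) (1 / p)"
proof -
  have "(INF g\<in>{g \<in> borel_measurable \<mu>. \<forall>x. h x \<le> g x}. \<integral>\<^sup>+x. epowr (g x) p \<partial>\<mu>) = (\<integral>\<^sup>+x. epowr (h x) p \<partial>\<mu>)"
    using assms by (intro antisym INF_lower INF_greatest nn_integral_mono epowr_mono) auto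
  then show ?thesis by (simp add: Lp_norm_def)
qed

lemma le_Lp_norm:
  assumes "0 < p" "0 < C"
    and "\<And>h. h \<in> borel_measurable \<mu> \<Longrightarrow> (\<forall>x. F x \<le> h x) \<Longrightarrow>
           a \<le> ennreal C * epowr (\<integral>\<^sup>+x. epowr (h x) p \<partial>\<mu>) (1 / p)"
  shows "a \<le> ennreal C * Lp_norm \<mu> p F"
proof -
  have "epowr (a / ennreal C) p \<le> (INF h\<in>{h \<in> borel_measurable \<mu>. \<forall>x. F x \<le> h x}. \<integral>\<^sup>+x. epowr (h x) p \<partial>\<mu>)"
  proof (rule INF_greatest)
    fix h assume "h \<in> {h \<in> borel_measurable \<mu>. \<forall>x. F x \<le> h x}"
    then have "a \<le> ennreal C * epowr (\<integral>\<^sup>+x. epowr (h x) p \<partial>\<mu>) (1 / p)"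
      using assms(3) by auto
    then have "a / ennreal C \<le> epowr (\<integral>\<^sup>+x. epowr (h x) p \<partial>\<mu>) (1 / p)"
      using \<open>0 < C\<close> by (intro divide_le_posI_ennreal) (auto simp: mult.commute)
    then show "epowr (a / ennreal C) p \<le> (\<integral>\<^sup>+x. epowr (h x) p \<partial>\<mu>)"
      using assms by (simp add: epowr_le_iff)
  qed
  then have "a / ennreal C \<le> Lp_norm \<mu> p F"
    using assms by (simp add: epowr_le_iff Lp_norm_def)
  then have "ennreal C * (a / ennreal C) \<le> ennreal C * Lp_norm \<mu> p F"
    by (rule mult_left_mono) auto
  then show ?thesis using assms(2)
    by (simp add: ennreal_times_divide ennreal_mult_divide_eq mult.commute)
qed

lemma Lp_integral_cmult:
  assumes "h \<in> borel_measurable \<mu>" "0 < p"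
  shows "epowr (\<integral>\<^sup>+x. epowr (c * h x) p \<partial>\<mu>) (1 / p) = c * epowr (\<integral>\<^sup>+x. epowr (h x) p \<partial>\<mu>) (1 / p)"
  using assms by (simp add: epowr_mult nn_integral_cmult epowr_epowr)

section \<open>Doubling measures\<close>

definition separated :: "real \<Rightarrow> 'a::metric_space set \<Rightarrow> bool" where
  "separated r F \<longleftrightarrow> (\<forall>x\<in>F. \<forall>y\<in>F. x \<noteq> y \<longrightarrow> r \<le> dist x y)"

text \<open>Doubling is required for all radii and all dilations, without the restriction by the
  diameter in the RD condition; \<open>rd_space_doubling\<close> bridges the two.\<close>

locale doubling_measure =
  fixes \<mu> :: "'a::metric_space measure" and n D :: real
  assumes sets_eq [measurable_cong]: "sets \<mu> = sets borel"
    and ball_pos: "0 < r \<Longrightarrow> 0 < emeasure \<mu> (ball x r)"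
    and ball_finite: "0 < r \<Longrightarrow> emeasure \<mu> (ball x r) < \<infinity>"
    and n_pos: "0 < n" and D_ge: "1 \<le> D"
    and doubling: "0 < r \<Longrightarrow> 1 \<le> l \<Longrightarrow> vol \<mu> x (l * r) \<le> D * l powr n * vol \<mu> x r"
begin

abbreviation "V \<equiv> vol \<mu>"

lemma space_eq [simp]: "space \<mu> = UNIV"
  using sets_eq_imp_space_eq[OF sets_eq] by simp

lemma ball_sets [measurable, simp]: "ball x r \<in> sets \<mu>"
  by (simp add: sets_eq)

lemma emeasure_ball: "emeasure \<mu> (ball x r) = ennreal (V x r)"
proof (cases "0 < r")
  case True
  then show ?thesis using ball_finite[OF True, of x]
    by (simp add: vol_def emeasure_eq_ennreal_measure less_top)
qed (auto simp: vol_def not_less ball_empty)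

lemma V_pos [simp]: "0 < r \<Longrightarrow> 0 < V x r"
  using ball_pos[of r x] by (simp add: emeasure_ball)

lemma V_nonneg [simp]: "0 \<le> V x r"
  by (simp add: vol_def)

lemma V_mono: "dist x z + R \<le> R' \<Longrightarrow> V x R \<le> V z R'"
proof -
  assume "dist x z + R \<le> R'"
  then have "ball x R \<subseteq> ball z R'"
    by (auto simp: subset_iff) (smt (verit) dist_triangle3)
  then have "emeasure \<mu> (ball x R) \<le> emeasure \<mu> (ball z R')"
    by (intro emeasure_mono) auto
  then show ?thesis by (simp add: emeasure_ball)
qed

text \<open>The ball around \<open>x\<close> lies in the ball of radius \<open>K * r\<close> around
  \<open>z\<close>, to which doubling applies. Most factors of the form \<open>D * K powr n\<close>
  below arise in this way.\<close>

lemma V_le: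
  assumes "0 < r" "1 \<le> K" "dist x z + R \<le> K * r"
  shows "V x R \<le> D * K powr n * V z r"
  using V_mono[OF assms(3)] doubling[OF assms(1,2), of z] by linarith

text \<open>Packing: the balls of radius \<open>r / 2\<close> around the points are disjoint, lie in
  the ball of radius \<open>R + r\<close>, and each carries a fixed share of its measure.
  \<open>K\<close> is fixed by \<open>K * (r / 2) = 2 * R + r\<close>, the distance \<open>R\<close>
  plus the radius \<open>R + r\<close>. The bound is uniform over finite subsets, which makes
  \<open>F\<close> itself finite.\<close>

lemma separated_card:
  fixes x0 :: 'a
  assumes F: "F \<subseteq> ball x0 R" "separated r F" and r: "0 < r" "0 \<le> R"
  shows "finite F \<and> real (card F) \<le> D * ((4 * R + 2 * r) / r) powr n"
proof -
  define K where "K = (4 * R + 2 * r) / r"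
  have K: "1 \<le> K" "K * (r / 2) = 2 * R + r" using r by (auto simp: K_def field_simps)
  have bd: "real (card G) \<le> D * K powr n" if G: "G \<subseteq> F" "finite G" for G
  proof (cases "G = {}")
    case False
    have R: "0 < R + r" using r by auto
    have disj: "disjoint_family_on (\<lambda>z. ball z (r / 2)) G"
      unfolding disjoint_family_on_def
    proof (intro ballI impI)
      fix a b assume "a \<in> G" "b \<in> G" "a \<noteq> b"
      then have "r \<le> dist a b" using F(2) G by (auto simp: separated_def)
      then show "ball a (r / 2) \<inter> ball b (r / 2) = {}"
        by (auto simp: disjoint_iff) (smt (verit) dist_triangle3 dist_commute field_sum_of_halves)
    qed
    have "real (card G) * V x0 (R + r) = (\<Sum>z\<in>G. V x0 (R + r))" by simp
    also have "\<dots> \<le> (\<Sum>z\<in>G. D * K powr n * V z (r / 2))"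
    proof (rule sum_mono)
      fix z assume "z \<in> G"
      then have "dist x0 z < R" using G F by auto
      then show "V x0 (R + r) \<le> D * K powr n * V z (r / 2)"
        using r K by (intro V_le) auto
    qed
    also have "\<dots> = D * K powr n * measure \<mu> (\<Union>z\<in>G. ball z (r / 2))"
      using disj G(2) ball_finite[of "r / 2"] r
      by (subst measure_finite_Union) (auto simp: vol_def sum_distrib_left less_top)
    also have "measure \<mu> (\<Union>z\<in>G. ball z (r / 2)) \<le> V x0 (R + r)"
      unfolding vol_def
    proof (rule measure_mono_fmeasurable)
      show "(\<Union>z\<in>G. ball z (r / 2)) \<subseteq> ball x0 (R + r)"
      proof
        fix y assume "y \<in> (\<Union>z\<in>G. ball z (r / 2))"
        then obtain z where "z \<in> G" "dist z y < r / 2" by auto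
        moreover then have "dist x0 z < R" using G F by auto
        ultimately show "y \<in> ball x0 (R + r)"
          using dist_triangle[of x0 y z] r by simp
      qed
      show "(\<Union>z\<in>G. ball z (r / 2)) \<in> sets \<mu>"
        using G by (intro sets.finite_UN) auto
      show "ball x0 (R + r) \<in> fmeasurable \<mu>"
        using ball_finite[OF R] by (auto simp: fmeasurable_def)
    qed
    finally have "real (card G) * V x0 (R + r) \<le> (D * K powr n) * V x0 (R + r)"
      using D_ge by (simp add: mult_left_mono)
    then show ?thesis using V_pos[OF R, of x0] by simp
  qed (use D_ge in auto)
  have "finite F \<and> card F \<le> nat \<lfloor>D * K powr n\<rfloor>"
    by (rule finite_if_finite_subsets_card_bdd) (use bd in \<open>auto simp: le_nat_floor\<close>)
  then show ?thesis using bd[of F] by (auto simp: K_def)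
qed

text \<open>Packing bounds the cardinality of separated subsets, so one of largest cardinality
  exists; a point at distance at least \<open>r\<close> from all its members could be added to
  it.\<close>

lemma net_exists:
  fixes x0 :: 'a
  assumes r: "0 < r" "0 \<le> R"
  obtains F where "finite F" "F \<subseteq> ball x0 R" "separated r F" "\<And>y. y \<in> ball x0 R \<Longrightarrow> \<exists>z\<in>F. dist z y < r"
proof -
  define P where "P F \<longleftrightarrow> F \<subseteq> ball x0 R \<and> separated r F" for F
  have "\<forall>F. P F \<longrightarrow> card F \<le> nat \<lfloor>D * ((4 * R + 2 * r) / r) powr n\<rfloor>"
    using separated_card[OF _ _ r] by (auto simp: P_def intro!: le_nat_floor)
  moreover have "P {}" by (simp add: P_def separated_def)
  ultimately obtain F where F: "P F" "\<And>G. P G \<Longrightarrow> card G \<le> card F"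
    using ex_has_greatest_nat[of P "{}" card] by (meson le_imp_less_Suc)
  have fin: "finite F" using separated_card[OF _ _ r] F(1) by (auto simp: P_def)
  have "\<exists>z\<in>F. dist z y < r" if y: "y \<in> ball x0 R" for y
  proof (rule ccontr)
    assume *: "\<not> ?thesis"
    then have "y \<notin> F" using r by auto
    moreover have "P (insert y F)"
      using F(1) y * by (auto simp: P_def separated_def not_less dist_commute)
    ultimately show False using F(2)[of "insert y F"] fin by simp
  qed
  then show ?thesis using that F(1) fin by (auto simp: P_def)
qed

text \<open>Doubling forces separability: the nets of mesh \<open>1 / (m + 1)\<close> in the balls
  of radius \<open>k\<close> are finite, and their union is countable and dense.\<close>

lemma dense_sequence: "\<exists>d :: nat \<Rightarrow> 'a. \<forall>x e. 0 < e \<longrightarrow> (\<exists>i. dist x (d i) < e)"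
proof -
  fix x0 :: 'a
  have "\<exists>F. finite F \<and> (\<forall>y\<in>ball x0 (real k). \<exists>z\<in>F. dist z y < 1 / real (Suc m))" for k m
    by (rule net_exists[of "1 / real (Suc m)" "real k" x0]) auto
  then obtain F where F: "\<And>k m. finite (F k m)"
    "\<And>k m y. y \<in> ball x0 (real k) \<Longrightarrow> \<exists>z\<in>F k m. dist z y < 1 / real (Suc m)"
    by metis
  define A where "A = insert x0 (\<Union>k m. F k m)"
  have cA: "countable A" unfolding A_def
    by (intro countable_insert countable_UN countableI_type) (rule countable_finite, rule F)
  have "\<exists>i. dist x (from_nat_into A i) < e" if "0 < e" for x e
  proof -
    obtain m where m: "1 / real (Suc m) < e" using \<open>0 < e\<close> nat_approx_posE by blast
    obtain k where "dist x0 x < real k" using reals_Archimedean2 by blast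
    then obtain z where z: "z \<in> F k m" "dist z x < 1 / real (Suc m)" using F(2)[of x k m] by auto
    then have "z \<in> A" by (auto simp: A_def)
    then obtain i where "from_nat_into A i = z" using from_nat_into_surj[OF cA] by blast
    then show ?thesis using z m by (auto simp: dist_commute intro!: exI[of _ i])
  qed
  then show ?thesis by blast
qed

definition dn :: "nat \<Rightarrow> 'a" where
  "dn = (SOME d. \<forall>x e. 0 < e \<longrightarrow> (\<exists>i. dist x (d i) < e))"

lemma dn_dense: "0 < e \<Longrightarrow> \<exists>i. dist x (dn i) < e"
  using someI_ex[OF dense_sequence] unfolding dn_def by blast

sublocale sigma_finite_measure \<mu>
proof
  have "\<Union> (range (\<lambda>k. ball (dn 0) (real (Suc k)))) = UNIV"
  proof -
    have "x \<in> \<Union> (range (\<lambda>k. ball (dn 0) (real (Suc k))))" for x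
      using reals_Archimedean2[of "dist (dn 0) x"]
      by (metis UN_I UNIV_I less_add_one less_trans mem_ball of_nat_Suc add.commute)
    then show ?thesis by blast
  qed
  then show "\<exists>A. countable A \<and> A \<subseteq> sets \<mu> \<and> \<Union> A = space \<mu> \<and> (\<forall>a\<in>A. emeasure \<mu> a \<noteq> \<infinity>)"
    using ball_finite by (intro exI[of _ "range (\<lambda>k. ball (dn 0) (real (Suc k)))"]) (auto simp: less_top)
qed

sublocale pair_sigma_finite \<mu> \<mu> ..

lemma measurable_dist_const [measurable]: "(\<lambda>x. dist x c) \<in> borel_measurable \<mu>"
proof -
  have "(\<lambda>x. dist x c) \<in> borel_measurable borel"
    by (intro borel_measurable_continuous_onI continuous_intros)
  then show ?thesis using measurable_cong_sets[OF sets_eq refl] by blast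
qed

text \<open>What is needed is measurability for the product of the sigma-algebras, not only for the
  Borel sets of the product space. Separability gives it: the condition becomes a countable
  disjunction over dense points of conditions on sums of one-variable functions.\<close>

lemma measurable_dist_pair: "(\<lambda>w. dist (fst w) (snd w)) \<in> borel_measurable (\<mu> \<Otimes>\<^sub>M \<mu>)"
proof (subst borel_measurable_iff_less, intro allI)
  fix a :: real
  have *: "dist x y < a \<longleftrightarrow> (\<exists>i. dist x (dn i) + dist y (dn i) < a)" for x y :: 'a
  proof
    assume "dist x y < a"
    then obtain i where "dist x (dn i) < (a - dist x y) / 2" using dn_dense[of "(a - dist x y) / 2" x] by auto
    moreover have "dist y (dn i) \<le> dist x y + dist x (dn i)" by (metis dist_commute dist_triangle2)
    ultimately have "dist x (dn i) + dist y (dn i) < a" by (simp add: field_simps)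
    then show "\<exists>i. dist x (dn i) + dist y (dn i) < a" ..
  next
    assume "\<exists>i. dist x (dn i) + dist y (dn i) < a"
    then show "dist x y < a" by (meson dist_triangle2 le_less_trans)
  qed
  show "{w \<in> space (\<mu> \<Otimes>\<^sub>M \<mu>). dist (fst w) (snd w) < a} \<in> sets (\<mu> \<Otimes>\<^sub>M \<mu>)"
    unfolding * by measurable
qed

lemma measurable_dist [measurable]:
  assumes [measurable]: "f \<in> measurable M \<mu>" "g \<in> measurable M \<mu>"
  shows "(\<lambda>x. dist (f x) (g x)) \<in> borel_measurable M"
  using measurable_compose[OF measurable_Pair[OF assms] measurable_dist_pair] by simp

end

section \<open>The Hardy--Littlewood maximal function\<close>

text \<open>Greedy choice: keep a ball of largest radius, discard all balls that meet it, and
  recurse. A discarded ball is no larger, hence lies in the threefold enlargement.\<close>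

lemma vitali_finite:
  fixes a :: "'i \<Rightarrow> 'b::metric_space"
  assumes "finite K" "\<And>i. i \<in> K \<Longrightarrow> 0 < r i"
  shows "\<exists>C\<subseteq>K. disjoint_family_on (\<lambda>i. ball (a i) (r i)) C \<and>
           (\<forall>i\<in>K. \<exists>j\<in>C. ball (a i) (r i) \<subseteq> ball (a j) (3 * r j))"
  using assms
proof (induction K rule: finite_psubset_induct)
  case (psubset K)
  show ?case
  proof (cases "K = {}")
    case False
    then have "Max (r ` K) \<in> r ` K" using psubset.hyps by (intro Max_in) auto
    then obtain j where j: "j \<in> K" "r j = Max (r ` K)" by (metis imageE)
    have jmax: "r i \<le> r j" if "i \<in> K" for i using j that psubset.hyps by simp
    define K' where "K' = {i \<in> K. ball (a i) (r i) \<inter> ball (a j) (r j) = {}}"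
    have "a j \<in> ball (a j) (r j)" using j(1) psubset.prems by simp
    then have "j \<notin> K'" by (auto simp: K'_def)
    then have "K' \<subset> K" using j(1) unfolding K'_def by blast
    then obtain C where C: "C \<subseteq> K'" "disjoint_family_on (\<lambda>i. ball (a i) (r i)) C"
      "\<forall>i\<in>K'. \<exists>j\<in>C. ball (a i) (r i) \<subseteq> ball (a j) (3 * r j)"
      using psubset.IH[of K'] psubset.prems by (auto simp: K'_def)
    have "disjoint_family_on (\<lambda>i. ball (a i) (r i)) (insert j C)"
      using C(1,2) unfolding disjoint_family_on_def K'_def by blast
    moreover have "\<exists>l\<in>insert j C. ball (a i) (r i) \<subseteq> ball (a l) (3 * r l)" if i: "i \<in> K" for i
    proof (cases "i \<in> K'")
      case True then show ?thesis using C by auto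
    next
      case False
      then obtain z where z: "dist (a i) z < r i" "dist (a j) z < r j" using i by (auto simp: K'_def)
      have "ball (a i) (r i) \<subseteq> ball (a j) (3 * r j)"
      proof
        fix y assume "y \<in> ball (a i) (r i)"
        then have "dist (a j) y < r j + r i + r i"
          using z dist_triangle[of "a j" y z] dist_triangle3[of z y "a i"] by simp
        then show "y \<in> ball (a j) (3 * r j)" using jmax[OF i] by simp
      qed
      then show ?thesis by auto
    qed
    ultimately show ?thesis using C(1) j K'_def by (intro exI[of _ "insert j C"]) auto
  qed (simp add: disjoint_family_on_def)
qed

text \<open>Layer cake formula with the weight \<open>b * t powr (b - 1)\<close>, which is
  integrable at 0 also for \<open>b < 1\<close>. The value \<open>top\<close> is compared with the
  intervals from 0 to \<open>k powr (1 / b)\<close>, whose integrals are \<open>k\<close>.\<close>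

lemma nn_integral_powr_layer:
  assumes "0 < b"
  shows "(\<integral>\<^sup>+t. ennreal (b * t powr (b - 1)) * indicator {t. 0 < t \<and> ennreal t < y} t \<partial>lborel) = epowr y b"
proof -
  have *: "(\<integral>\<^sup>+t. ennreal (b * t powr (b - 1)) * indicator {0..c} t \<partial>lborel) = ennreal (c powr b)" if "0 \<le> c" for c
  proof -
    have "((\<lambda>t. b * t powr (b - 1)) has_integral (b * (c powr (b - 1 + 1) / (b - 1 + 1)))) {0..c}"
      using assms that by (intro has_integral_mult_right has_integral_powr_from_0) auto
    then show ?thesis
      using nn_integral_has_integral_lebesgue[of "{0..c}" "\<lambda>t. b * t powr (b - 1)"] assms
      by (auto simp: indicator_mult_ennreal mult.commute intro!: nn_integral_cong)
  qed
  show ?thesis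
  proof (cases y)
    case (real c)
    have "(\<integral>\<^sup>+t. ennreal (b * t powr (b - 1)) * indicator {t. 0 < t \<and> ennreal t < y} t \<partial>lborel)
      = (\<integral>\<^sup>+t. ennreal (b * t powr (b - 1)) * indicator {0..c} t \<partial>lborel)"
      using AE_lborel_singleton[of c] AE_lborel_singleton[of 0] real
      by (intro nn_integral_cong_AE) (auto simp: ennreal_less_iff indicator_def elim!: eventually_elim2)
    then show ?thesis using * real by simp
  next
    case top
    have "ennreal (real k) \<le> (\<integral>\<^sup>+t. ennreal (b * t powr (b - 1)) * indicator {t. 0 < t \<and> ennreal t < y} t \<partial>lborel)" for k :: nat
    proof -
      have "ennreal (real k) = (\<integral>\<^sup>+t. ennreal (b * t powr (b - 1)) * indicator {0..real k powr (1 / b)} t \<partial>lborel)"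
        using assms by (subst *) (auto simp: powr_powr)
      also have "\<dots> \<le> (\<integral>\<^sup>+t. ennreal (b * t powr (b - 1)) * indicator {t. 0 < t \<and> ennreal t < y} t \<partial>lborel)"
        using AE_lborel_singleton[of 0] top
        by (intro nn_integral_mono_AE) (auto simp: indicator_def elim!: eventually_mono)
      finally show ?thesis .
    qed
    then have *: "of_nat k \<le> (\<integral>\<^sup>+t. ennreal (b * t powr (b - 1)) * indicator {t. 0 < t \<and> ennreal t < y} t \<partial>lborel)" for k :: nat
      by (simp add: ennreal_of_nat_eq_real_of_nat)
    have "(\<integral>\<^sup>+t. ennreal (b * t powr (b - 1)) * indicator {t. 0 < t \<and> ennreal t < y} t \<partial>lborel) = top"
      (is "?I = _")
    proof (rule ccontr)
      assume "?I \<noteq> top"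
      then obtain k where "?I < of_nat k" using ennreal_Ex_less_of_nat[of ?I] unfolding less_top by blast
      then show False using *[of k] by (meson leD)
    qed
    then show ?thesis using top by (metis epowr_top)
  qed
qed

context doubling_measure
begin

lemma ball_borel: "A \<in> sets borel \<Longrightarrow> A \<in> sets \<mu>"
  by (simp add: sets_eq)

lemma measurable_emeasure_ball: "(\<lambda>x. emeasure \<mu> (ball x r)) \<in> borel_measurable \<mu>"
proof -
  have "emeasure \<mu> (ball x r) = (\<integral>\<^sup>+y. indicator {w. dist (fst w) (snd w) < r} (x, y) \<partial>\<mu>)" for x
  proof -
    have "emeasure \<mu> (ball x r) = (\<integral>\<^sup>+y. indicator (ball x r) y \<partial>\<mu>)" by simp
    also have "\<dots> = (\<integral>\<^sup>+y. indicator {w. dist (fst w) (snd w) < r} (x, y) \<partial>\<mu>)"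
      by (intro nn_integral_cong) (auto simp: indicator_def)
    finally show ?thesis .
  qed
  then show ?thesis by simp
qed

lemma measurable_V [measurable]: "(\<lambda>x. V x r) \<in> borel_measurable \<mu>"
  unfolding vol_def measure_def using measurable_emeasure_ball by measurable

lemma mean_on_ball:
  "0 < r \<Longrightarrow> mean_on \<mu> (ball x r) w = (\<integral>\<^sup>+y\<in>ball x r. w y \<partial>\<mu>) / ennreal (V x r)"
  by (simp add: mean_on_def emeasure_ball)

lemma V_times_mean:
  assumes "0 < r"
  shows "ennreal (V x r) * mean_on \<mu> (ball x r) w = (\<integral>\<^sup>+y\<in>ball x r. w y \<partial>\<mu>)"
  using V_pos[OF assms, of x] unfolding mean_on_ball[OF assms] ennreal_times_divide
  by (subst mult.commute) (simp add: ennreal_mult_divide_eq)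

lemma mean_le_iff:
  "0 < r \<Longrightarrow> mean_on \<mu> (ball x r) w \<le> c \<longleftrightarrow> (\<integral>\<^sup>+y\<in>ball x r. w y \<partial>\<mu>) \<le> ennreal (V x r) * c"
  by (simp add: mean_on_ball divide_le_posI_ennreal mult.commute) (metis V_pos V_times_mean mean_on_ball divide_le_posI_ennreal ennreal_less_zero_iff mult.commute mult_left_mono zero_le)

lemma mean_on_mono: "(\<And>y. w y \<le> w' y) \<Longrightarrow> mean_on \<mu> A w \<le> mean_on \<mu> A w'"
  unfolding mean_on_def by (intro divide_right_mono_ennreal nn_integral_mono mult_right_mono) auto

lemma set_nn_integral_ball_mono:
  "dist x z + R \<le> R' \<Longrightarrow> (\<integral>\<^sup>+y\<in>ball x R. w y \<partial>\<mu>) \<le> (\<integral>\<^sup>+y\<in>ball z R'. w y \<partial>\<mu>)"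
  by (intro nn_integral_mono mult_left_mono) (auto simp: indicator_def, smt (verit) dist_triangle3)

lemma mean_on_ball_le:
  assumes "0 < R" "1 \<le> K" "dist x z + R \<le> R'" "dist x z + R' \<le> K * R"
  shows "mean_on \<mu> (ball x R) w \<le> ennreal (D * K powr n) * mean_on \<mu> (ball z R') w"
proof -
  have R': "0 < R'" using assms zero_le_dist[of x z] by linarith
  have "(\<integral>\<^sup>+y\<in>ball x R. w y \<partial>\<mu>) \<le> (\<integral>\<^sup>+y\<in>ball z R'. w y \<partial>\<mu>)"
    using assms by (intro set_nn_integral_ball_mono)
  also have "\<dots> = ennreal (V z R') * mean_on \<mu> (ball z R') w" using R' by (simp add: V_times_mean)
  also have "\<dots> \<le> ennreal (D * K powr n * V x R) * mean_on \<mu> (ball z R') w"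
    using assms by (intro mult_right_mono ennreal_leI V_le) (auto simp: dist_commute)
  also have "\<dots> = ennreal (V x R) * (ennreal (D * K powr n) * mean_on \<mu> (ball z R') w)"
    using D_ge by (simp add: ennreal_mult mult_ac)
  finally show ?thesis using assms by (simp add: mean_le_iff)
qed

text \<open>Centres in a dense sequence and dyadic radii keep the supremum countable, hence measurable.\<close>
definition hl_ball :: "nat \<times> int \<Rightarrow> 'a set" where
  "hl_ball p = ball (dn (fst p)) (2 powr real_of_int (snd p))"

definition hl :: "('a \<Rightarrow> ennreal) \<Rightarrow> 'a \<Rightarrow> ennreal" where
  "hl w x = (SUP p. mean_on \<mu> (hl_ball p) w * indicator (hl_ball p) x)"

lemma measurable_hl [measurable]: "hl w \<in> borel_measurable \<mu>"
  unfolding hl_def hl_ball_def by measurable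

text \<open>The ball is replaced by one of the countable family, with centre \<open>dn i\<close>
  closer than \<open>r\<close> to \<open>z\<close> and dyadic radius \<open>2 powr (k + 1)\<close>
  between \<open>2 * r\<close> and \<open>4 * r\<close>. It contains the given ball, and
  \<open>r + 4 * r\<close> is the origin of the 5.\<close>

lemma mean_le_hl:
  assumes "dist z x < r"
  shows "mean_on \<mu> (ball z r) w \<le> ennreal (D * 5 powr n) * hl w x"
proof -
  have r: "0 < r" using assms zero_le_dist[of z x] by linarith
  define k where "k = \<lceil>log 2 r\<rceil>"
  have "r = 2 powr (log 2 r)" using r by simp
  also have "\<dots> \<le> 2 powr real_of_int k" by (simp add: k_def)
  finally have k1: "r \<le> 2 powr real_of_int k" .
  have "2 powr real_of_int k < 2 powr (log 2 r + 1)" unfolding k_def by (simp, linarith)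
  also have "\<dots> = 2 * r" using r by (simp add: powr_add)
  finally have k2: "2 powr real_of_int k < 2 * r" .
  obtain i where i: "dist z (dn i) < r" using dn_dense[OF r] by blast
  have p1: "2 powr real_of_int (k + 1) = 2 * 2 powr real_of_int k" by (simp add: powr_add)
  have "mean_on \<mu> (ball z r) w \<le> ennreal (D * 5 powr n) * mean_on \<mu> (hl_ball (i, k + 1)) w"
    unfolding hl_ball_def fst_conv snd_conv p1 using r k1 k2 i by (intro mean_on_ball_le) auto
  also have "mean_on \<mu> (hl_ball (i, k + 1)) w = mean_on \<mu> (hl_ball (i, k + 1)) w * indicator (hl_ball (i, k + 1)) x"
    using assms i k1 dist_triangle3[of "dn i" x z] unfolding hl_ball_def fst_conv snd_conv p1
    by (auto simp: indicator_def dist_commute)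
  also have "\<dots> \<le> hl w x" unfolding hl_def by (rule SUP_upper) auto
  finally show ?thesis by (simp add: mult_left_mono)
qed

text \<open>The superlevel set is exactly the union of the countably many balls whose mean exceeds
  \<open>t\<close>. Finite subfamilies exhaust it, so the finite Vitali lemma suffices; the 3 is its
  enlargement factor.\<close>

lemma hl_weak_type:
  assumes [measurable]: "w \<in> borel_measurable \<mu>" and t: "0 < t"
  shows "ennreal t * emeasure \<mu> {x. ennreal t < hl w x} \<le> ennreal (D * 3 powr n) * (\<integral>\<^sup>+x. w x \<partial>\<mu>)"
proof -
  define P where "P = {p. ennreal t < mean_on \<mu> (hl_ball p) w}"
  define U where "U m = (\<Union>p\<in>{p \<in> P. to_nat p \<le> m}. hl_ball p)" for m :: nat
  have fin: "finite {p \<in> P. to_nat p \<le> m}" for m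
  proof (rule finite_subset)
    show "{p \<in> P. to_nat p \<le> m} \<subseteq> from_nat ` {..m}"
      by (metis (mono_tags, lifting) atMost_iff from_nat_to_nat image_eqI mem_Collect_eq subsetI)
  qed simp
  have Um [measurable]: "U m \<in> sets \<mu>" for m
    unfolding U_def using fin by (intro sets.finite_UN) (auto simp: hl_ball_def)
  have "{x. ennreal t < hl w x} = (\<Union>m. U m)"
    unfolding hl_def less_SUP_iff U_def P_def by (auto split: split_indicator_asm split_indicator)
  moreover have "incseq U" by (auto simp: incseq_def U_def)
  ultimately have "emeasure \<mu> {x. ennreal t < hl w x} = (SUP m. emeasure \<mu> (U m))"
    using SUP_emeasure_incseq[of U \<mu>] by (simp add: image_subset_iff)
  moreover have "ennreal t * emeasure \<mu> (U m) \<le> ennreal (D * 3 powr n) * (\<integral>\<^sup>+x. w x \<partial>\<mu>)" for m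
  proof -
    let ?r = "\<lambda>p::nat \<times> int. 2 powr real_of_int (snd p)"
    let ?K = "{p \<in> P. to_nat p \<le> m}"
    obtain C where C: "C \<subseteq> ?K" "disjoint_family_on hl_ball C"
      "\<forall>i\<in>?K. \<exists>j\<in>C. hl_ball i \<subseteq> ball (dn (fst j)) (3 * ?r j)"
      using vitali_finite[OF fin[of m], of ?r "\<lambda>p. dn (fst p)"] unfolding hl_ball_def by auto
    have fC: "finite C" using C(1) fin finite_subset by blast
    have "emeasure \<mu> (U m) \<le> emeasure \<mu> (\<Union>j\<in>C. ball (dn (fst j)) (3 * ?r j))"
    proof (rule emeasure_mono)
      show "U m \<subseteq> (\<Union>j\<in>C. ball (dn (fst j)) (3 * ?r j))"
        using C(3) unfolding U_def by blast
      show "(\<Union>j\<in>C. ball (dn (fst j)) (3 * ?r j)) \<in> sets \<mu>"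
        using fC by (intro sets.finite_UN) simp_all
    qed
    also have "\<dots> \<le> (\<Sum>j\<in>C. emeasure \<mu> (ball (dn (fst j)) (3 * ?r j)))"
      using fC by (intro emeasure_subadditive_finite) auto
    also have "\<dots> \<le> (\<Sum>j\<in>C. ennreal (D * 3 powr n) * emeasure \<mu> (hl_ball j))"
    proof (rule sum_mono)
      fix j assume "j \<in> C"
      have "V (dn (fst j)) (3 * ?r j) \<le> D * 3 powr n * V (dn (fst j)) (?r j)"
        by (rule doubling) auto
      then show "emeasure \<mu> (ball (dn (fst j)) (3 * ?r j)) \<le> ennreal (D * 3 powr n) * emeasure \<mu> (hl_ball j)"
        using D_ge unfolding hl_ball_def emeasure_ball
        by (subst ennreal_mult[symmetric]) (auto intro!: ennreal_leI)
    qed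
    also have "\<dots> = ennreal (D * 3 powr n) * (\<Sum>j\<in>C. emeasure \<mu> (hl_ball j))"
      by (simp add: sum_distrib_left)
    finally have "ennreal t * emeasure \<mu> (U m) \<le> ennreal t * (ennreal (D * 3 powr n) * (\<Sum>j\<in>C. emeasure \<mu> (hl_ball j)))"
      by (rule mult_left_mono) auto
    also have "\<dots> = ennreal (D * 3 powr n) * (\<Sum>j\<in>C. ennreal t * emeasure \<mu> (hl_ball j))"
      unfolding sum_distrib_left[symmetric] by (simp only: mult.left_commute)
    also have "(\<Sum>j\<in>C. ennreal t * emeasure \<mu> (hl_ball j)) \<le> (\<Sum>j\<in>C. (\<integral>\<^sup>+x\<in>hl_ball j. w x \<partial>\<mu>))"
    proof (rule sum_mono)
      fix j assume "j \<in> C"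
      then have "ennreal t \<le> mean_on \<mu> (hl_ball j) w" using C(1) by (auto simp: P_def)
      then have "ennreal t * emeasure \<mu> (hl_ball j) \<le> emeasure \<mu> (hl_ball j) * mean_on \<mu> (hl_ball j) w"
        by (subst mult.commute) (rule mult_left_mono, auto)
      also have "\<dots> = (\<integral>\<^sup>+x\<in>hl_ball j. w x \<partial>\<mu>)"
        unfolding hl_ball_def emeasure_ball by (rule V_times_mean) simp
      finally show "ennreal t * emeasure \<mu> (hl_ball j) \<le> (\<integral>\<^sup>+x\<in>hl_ball j. w x \<partial>\<mu>)" .
    qed
    also have "\<dots> = (\<integral>\<^sup>+x. (\<Sum>j\<in>C. w x * indicator (hl_ball j) x) \<partial>\<mu>)"
      by (subst nn_integral_sum) (auto simp: hl_ball_def)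
    also have "\<dots> \<le> (\<integral>\<^sup>+x. w x \<partial>\<mu>)"
    proof (rule nn_integral_mono)
      fix x
      have "(\<Sum>j\<in>C. w x * indicator (hl_ball j) x) = w x * indicator (\<Union>j\<in>C. hl_ball j) x"
        using fC C(2) by (simp add: sum_distrib_left[symmetric] indicator_UN_disjoint)
      then show "(\<Sum>j\<in>C. w x * indicator (hl_ball j) x) \<le> w x"
        by (simp add: indicator_def)
    qed
    finally show ?thesis by (simp add: mult_left_mono)
  qed
  ultimately show ?thesis
    by (simp add: SUP_mult_left_ennreal SUP_le_iff)
qed

text \<open>The part of \<open>w\<close> below \<open>t / 2\<close> contributes at most
  \<open>t / 2\<close> to any mean. This is the truncation in Marcinkiewicz interpolation between
  the weak type bound and the trivial bound for bounded functions.\<close>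

lemma hl_truncate:
  "{x. ennreal t < hl w x} \<subseteq> {x. ennreal (t / 2) < hl (\<lambda>y. w y * indicator {y. ennreal (t / 2) < w y} y) x}"
  if [measurable]: "w \<in> borel_measurable \<mu>" and t: "0 < t"
proof
  fix x assume "x \<in> {x. ennreal t < hl w x}"
  then obtain p where p: "x \<in> hl_ball p" "ennreal t < mean_on \<mu> (hl_ball p) w"
    by (auto simp: hl_def less_SUP_iff split: split_indicator_asm)
  let ?w = "\<lambda>y. w y * indicator {y. ennreal (t / 2) < w y} y"
  let ?v = "V (dn (fst p)) (2 powr real_of_int (snd p))"
  have [measurable]: "hl_ball p \<in> sets \<mu>" by (simp add: hl_ball_def)
  have *: "w y \<le> ennreal (t / 2) + ?w y" for y
  proof (cases "ennreal (t / 2) < w y")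
    case True
    then have "?w y = w y" by simp
    then show ?thesis by (metis add_increasing order_refl zero_le)
  next
    case False
    then have "?w y = 0" "w y \<le> ennreal (t / 2)" by (simp_all add: not_less)
    then show ?thesis by (metis add.right_neutral)
  qed
  have "(\<integral>\<^sup>+y\<in>hl_ball p. w y \<partial>\<mu>) \<le> (\<integral>\<^sup>+y\<in>hl_ball p. (ennreal (t / 2) + ?w y) \<partial>\<mu>)"
    by (rule nn_integral_mono, rule mult_right_mono[OF * zero_le])
  also have "\<dots> = (\<integral>\<^sup>+y. (ennreal (t / 2) * indicator (hl_ball p) y + ?w y * indicator (hl_ball p) y) \<partial>\<mu>)"
    by (simp add: distrib_right)
  also have "\<dots> = ennreal (t / 2) * emeasure \<mu> (hl_ball p) + (\<integral>\<^sup>+y\<in>hl_ball p. ?w y \<partial>\<mu>)"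
    by (subst nn_integral_add) (auto simp: nn_integral_cmult)
  also have "\<dots> = ennreal ?v * (ennreal (t / 2) + mean_on \<mu> (hl_ball p) ?w)"
    unfolding hl_ball_def emeasure_ball
    by (subst V_times_mean[symmetric]) (simp_all add: distrib_left mult.commute)
  finally have "mean_on \<mu> (hl_ball p) w \<le> ennreal (t / 2) + mean_on \<mu> (hl_ball p) ?w"
    unfolding hl_ball_def by (subst mean_le_iff) auto
  with p(2) have "ennreal t < ennreal (t / 2) + mean_on \<mu> (hl_ball p) ?w" by simp
  moreover have "ennreal t = ennreal (t / 2) + ennreal (t / 2)"
    by (subst ennreal_plus[symmetric]) (use t in auto)
  ultimately have "ennreal (t / 2) < mean_on \<mu> (hl_ball p) ?w"
    using add_left_mono[of "mean_on \<mu> (hl_ball p) ?w" "ennreal (t / 2)" "ennreal (t / 2)"]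
    by (auto simp: not_le[symmetric])
  also have "\<dots> \<le> hl ?w x"
    unfolding hl_def by (rule SUP_upper2[of p]) (use p in auto)
  finally show "x \<in> {x. ennreal (t / 2) < hl ?w x}" by simp
qed

text \<open>Marcinkiewicz interpolation: write the power by layer cake, apply the weak type bound to
  \<open>w\<close> truncated at half the level, exchange the integrals, and integrate the level out
  again.\<close>

lemma hl_strong_type:
  assumes [measurable]: "w \<in> borel_measurable \<mu>" and a: "1 < a"
  shows "(\<integral>\<^sup>+x. epowr (hl w x) a \<partial>\<mu>) \<le>
           ennreal (2 powr a * a / (a - 1) * (D * 3 powr n)) * (\<integral>\<^sup>+x. epowr (w x) a \<partial>\<mu>)"
proof -
  interpret L: pair_sigma_finite \<mu> lborel ..
  let ?c = "D * 3 powr n"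
  have "(\<integral>\<^sup>+x. epowr (hl w x) a \<partial>\<mu>) =
      (\<integral>\<^sup>+x. (\<integral>\<^sup>+t. ennreal (a * t powr (a - 1)) * indicator {t. 0 < t \<and> ennreal t < hl w x} t \<partial>lborel) \<partial>\<mu>)"
    using a by (subst nn_integral_powr_layer) auto
  also have "\<dots> = (\<integral>\<^sup>+t. (\<integral>\<^sup>+x. ennreal (a * t powr (a - 1)) * indicator {t. 0 < t \<and> ennreal t < hl w x} t \<partial>\<mu>) \<partial>lborel)"
    by (rule L.Fubini'[symmetric]) measurable
  also have "\<dots> \<le> (\<integral>\<^sup>+t. (\<integral>\<^sup>+x. ennreal (2 * a * ?c * t powr (a - 2)) * w x * indicator {t. 0 < t \<and> ennreal t < 2 * w x} t \<partial>\<mu>) \<partial>lborel)"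
  proof (rule nn_integral_mono)
    fix t :: real
    show "(\<integral>\<^sup>+x. ennreal (a * t powr (a - 1)) * indicator {t. 0 < t \<and> ennreal t < hl w x} t \<partial>\<mu>) \<le>
       (\<integral>\<^sup>+x. ennreal (2 * a * ?c * t powr (a - 2)) * w x * indicator {t. 0 < t \<and> ennreal t < 2 * w x} t \<partial>\<mu>)"
    proof (cases "0 < t")
      case t: True
      let ?w = "\<lambda>y. w y * indicator {y. ennreal (t / 2) < w y} y"
      have "(\<integral>\<^sup>+x. ennreal (a * t powr (a - 1)) * indicator {t. 0 < t \<and> ennreal t < hl w x} t \<partial>\<mu>)
         = (\<integral>\<^sup>+x. ennreal (a * t powr (a - 1)) * indicator {x. ennreal t < hl w x} x \<partial>\<mu>)"
        using t by (intro nn_integral_cong) (auto simp: indicator_def)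
      also have "\<dots> = ennreal (a * t powr (a - 1)) * emeasure \<mu> {x. ennreal t < hl w x}"
        by (subst nn_integral_cmult_indicator) auto
      \<comment> \<open>A factor \<open>t / 2\<close> is split off because the weak type bound is
        used at level \<open>t / 2\<close>.\<close>
      also have "\<dots> = ennreal (2 * a * t powr (a - 2) * (t / 2)) * emeasure \<mu> {x. ennreal t < hl w x}"
        using t powr_add[of t "a - 2" 1] by simp
      also have "\<dots> = ennreal (2 * a * t powr (a - 2)) * (ennreal (t / 2) * emeasure \<mu> {x. ennreal t < hl w x})"
        by (subst ennreal_mult) (use t a in \<open>simp_all add: mult.assoc\<close>)
      also have "\<dots> \<le> ennreal (2 * a * t powr (a - 2)) * (ennreal (t / 2) * emeasure \<mu> {x. ennreal (t / 2) < hl ?w x})"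
        using hl_truncate[OF assms(1) t] by (intro mult_left_mono emeasure_mono) auto
      also have "\<dots> \<le> ennreal (2 * a * t powr (a - 2)) * (ennreal ?c * (\<integral>\<^sup>+x. ?w x \<partial>\<mu>))"
        using t by (intro mult_left_mono hl_weak_type) auto
      also have "\<dots> = ennreal (2 * a * ?c * t powr (a - 2)) * (\<integral>\<^sup>+x. ?w x \<partial>\<mu>)"
        using t a D_ge by (simp add: ennreal_mult mult_ac)
      also have "\<dots> = (\<integral>\<^sup>+x. ennreal (2 * a * ?c * t powr (a - 2)) * ?w x \<partial>\<mu>)"
        by (subst nn_integral_cmult) auto
      also have "\<dots> = (\<integral>\<^sup>+x. ennreal (2 * a * ?c * t powr (a - 2)) * w x * indicator {t. 0 < t \<and> ennreal t < 2 * w x} t \<partial>\<mu>)"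
      proof (rule nn_integral_cong)
        fix x
        have "ennreal (t / 2) < w x \<longleftrightarrow> ennreal t < 2 * w x"
        proof (cases "w x")
          case (real c)
          then have "2 * w x = ennreal (2 * c)" by (simp add: ennreal_mult)
          with real t show ?thesis by (auto simp: ennreal_less_iff)
        qed (simp add: ennreal_mult_top)
        then show "ennreal (2 * a * ?c * t powr (a - 2)) * ?w x =
           ennreal (2 * a * ?c * t powr (a - 2)) * w x * indicator {t. 0 < t \<and> ennreal t < 2 * w x} t"
          using t by (simp add: indicator_def)
      qed
      finally show ?thesis .
    qed simp
  qed
  also have "\<dots> = (\<integral>\<^sup>+x. (\<integral>\<^sup>+t. ennreal (2 * a * ?c * t powr (a - 2)) * w x * indicator {t. 0 < t \<and> ennreal t < 2 * w x} t \<partial>lborel) \<partial>\<mu>)"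
    by (rule L.Fubini') measurable
  also have "\<dots> = (\<integral>\<^sup>+x. ennreal (2 powr a * a / (a - 1) * ?c) * epowr (w x) a \<partial>\<mu>)"
  proof (rule nn_integral_cong)
    fix x
    have "(\<integral>\<^sup>+t. ennreal (2 * a * ?c * t powr (a - 2)) * w x * indicator {t. 0 < t \<and> ennreal t < 2 * w x} t \<partial>lborel)
      = (\<integral>\<^sup>+t. (ennreal (2 * a * ?c / (a - 1)) * w x) * (ennreal ((a - 1) * t powr (a - 1 - 1)) * indicator {t. 0 < t \<and> ennreal t < 2 * w x} t) \<partial>lborel)"
    proof (rule nn_integral_cong)
      fix t :: real
      have "2 * a * ?c * t powr (a - 2) = (2 * a * ?c / (a - 1)) * ((a - 1) * t powr (a - 1 - 1))"
        using a by simp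
      then have "ennreal (2 * a * ?c * t powr (a - 2)) = ennreal (2 * a * ?c / (a - 1)) * ennreal ((a - 1) * t powr (a - 1 - 1))"
        using a by (subst ennreal_mult''[symmetric]) (simp_all add: mult_ac)
      then show "ennreal (2 * a * ?c * t powr (a - 2)) * w x * indicator {t. 0 < t \<and> ennreal t < 2 * w x} t =
        (ennreal (2 * a * ?c / (a - 1)) * w x) * (ennreal ((a - 1) * t powr (a - 1 - 1)) * indicator {t. 0 < t \<and> ennreal t < 2 * w x} t)"
        by (simp add: mult_ac)
    qed
    \<comment> \<open>Layer cake once more, with exponent \<open>a - 1\<close> and value
      \<open>2 * w x\<close>. It needs \<open>1 < a\<close> and produces the factor
      \<open>1 / (a - 1)\<close>.\<close>
    also have "\<dots> = ennreal (2 * a * ?c / (a - 1)) * w x * epowr (2 * w x) (a - 1)"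
      using a nn_integral_powr_layer[of "a - 1" "2 * w x"] by (subst nn_integral_cmult) auto
    also have "\<dots> = ennreal (2 * a * ?c / (a - 1)) * ennreal (2 powr (a - 1)) * (epowr (w x) 1 * epowr (w x) (a - 1))"
      using a epowr_ennreal[of 2 "a - 1"] by (simp add: epowr_mult mult_ac)
    also have "\<dots> = ennreal (2 * a * ?c / (a - 1) * 2 powr (a - 1)) * epowr (w x) a"
      using a D_ge epowr_add[of "w x" 1 "a - 1"] by (subst ennreal_mult) simp_all
    also have "2 * a * ?c / (a - 1) * 2 powr (a - 1) = 2 powr a * a / (a - 1) * ?c"
      using a by (simp add: powr_diff field_simps)
    finally show "(\<integral>\<^sup>+t. ennreal (2 * a * ?c * t powr (a - 2)) * w x * indicator {t. 0 < t \<and> ennreal t < 2 * w x} t \<partial>lborel)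
      = ennreal (2 powr a * a / (a - 1) * ?c) * epowr (w x) a" .
  qed
  also have "\<dots> = ennreal (2 powr a * a / (a - 1) * ?c) * (\<integral>\<^sup>+x. epowr (w x) a \<partial>\<mu>)"
    by (rule nn_integral_cmult) measurable
  finally show ?thesis .
qed

end

section \<open>Means with exponent at most one\<close>

context doubling_measure
begin

abbreviation avg :: "'a \<Rightarrow> real \<Rightarrow> ('a \<Rightarrow> ennreal) \<Rightarrow> ennreal" where
  "avg x r w \<equiv> mean_on \<mu> (ball x r) w"

text \<open>The \<open>q\<close>-quasi-norm for the normalised measure on the ball. Below it is
  taken with \<open>q \<le> 1\<close>, for functions that need not be locally integrable.\<close>

definition pavg :: "real \<Rightarrow> 'a \<Rightarrow> real \<Rightarrow> ('a \<Rightarrow> ennreal) \<Rightarrow> ennreal" where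
  "pavg q x r g = epowr (avg x r (\<lambda>y. epowr (g y) q)) (1 / q)"

lemma measurable_avg [measurable]:
  assumes [measurable]: "w \<in> borel_measurable \<mu>"
  shows "(\<lambda>x. avg x r w) \<in> borel_measurable \<mu>"
proof -
  have "(\<integral>\<^sup>+y\<in>ball x r. w y \<partial>\<mu>) = (\<integral>\<^sup>+y. w y * indicator {w. dist (fst w) (snd w) < r} (x, y) \<partial>\<mu>)" for x
    by (rule nn_integral_cong) (simp add: indicator_def)
  then show ?thesis unfolding mean_on_def using measurable_emeasure_ball by simp
qed

lemma measurable_pavg [measurable]:
  assumes [measurable]: "w \<in> borel_measurable \<mu>"
  shows "(\<lambda>x. pavg q x r w) \<in> borel_measurable \<mu>"
  unfolding pavg_def by measurable

lemma pavg_mono: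
  assumes "0 < q" "\<And>y. g y \<le> g' y"
  shows "pavg q x r g \<le> pavg q x r g'"
  unfolding pavg_def using assms by (intro epowr_mono mean_on_mono) auto

lemma pavg_le:
  assumes "0 < q" "0 \<le> c" "avg x R (\<lambda>y. epowr (g y) q) \<le> ennreal c * a"
  shows "pavg q x R g \<le> ennreal (c powr (1 / q)) * epowr a (1 / q)"
proof -
  have "pavg q x R g \<le> epowr (ennreal c * a) (1 / q)"
    unfolding pavg_def using assms by (intro epowr_mono) auto
  then show ?thesis using assms by (simp add: epowr_mult)
qed

lemma pavg_ball_le:
  assumes "0 < q" "0 < R" "1 \<le> K" "dist x z + R \<le> R'" "dist x z + R' \<le> K * R"
  shows "pavg q x R g \<le> ennreal ((D * K powr n) powr (1 / q)) * pavg q z R' g"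
  unfolding pavg_def[of q z R' g] using assms D_ge
  by (intro pavg_le mean_on_ball_le) auto

lemma pavg_le_hl:
  assumes "0 < q" "dist z x < r"
  shows "pavg q z r g \<le> ennreal ((D * 5 powr n) powr (1 / q)) * epowr (hl (\<lambda>y. epowr (g y) q) x) (1 / q)"
  using assms D_ge by (intro pavg_le mean_le_hl) auto

text \<open>If \<open>w\<close> exceeded its mean at all points of the ball outside
  \<open>E\<close>, a difference that is positive almost everywhere on the ball would have integral
  zero.\<close>

lemma exists_le_avg:
  assumes [measurable]: "w \<in> borel_measurable \<mu>" and r: "0 < r" and E: "E \<in> null_sets \<mu>"
  shows "\<exists>z. dist x z < r \<and> z \<notin> E \<and> w z \<le> avg x r w"
proof (rule ccontr)
  assume *: "\<not> ?thesis"
  have nonnull: "\<not> ball x r \<subseteq> E'" if "E' \<in> null_sets \<mu>" for E'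
    using that ball_pos[OF r, of x] by (metis emeasure_mono leD null_setsD1 null_setsD2)
  then obtain z where z: "z \<in> ball x r" "z \<notin> E" using E by blast
  let ?A = "avg x r w"
  \<comment> \<open>By the contrary assumption \<open>w z\<close> exceeds the mean at
    \<open>z\<close>, so the mean is finite and may be subtracted.\<close>
  have A: "?A < top" using z * by (auto simp: not_le) (metis not_le top_greatest less_top)
  have le: "AE y in \<mu>. ?A * indicator (ball x r) y \<le> w y * indicator (ball x r) y"
    using AE_not_in[OF E]
  proof eventually_elim
    case (elim y)
    then show ?case using * by (cases "y \<in> ball x r") (auto simp: not_le intro: less_imp_le)
  qed
  have I: "(\<integral>\<^sup>+y. ?A * indicator (ball x r) y \<partial>\<mu>) = (\<integral>\<^sup>+y\<in>ball x r. w y \<partial>\<mu>)"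
    using V_times_mean[OF r, of x w] by (subst nn_integral_cmult_indicator) (auto simp: emeasure_ball mult.commute)
  have fin: "(\<integral>\<^sup>+y. ?A * indicator (ball x r) y \<partial>\<mu>) < top"
    using A by (subst nn_integral_cmult_indicator) (auto simp: emeasure_ball ennreal_mult_less_top)
  have "(\<integral>\<^sup>+y. (w y * indicator (ball x r) y - ?A * indicator (ball x r) y) \<partial>\<mu>)
     = (\<integral>\<^sup>+y. w y * indicator (ball x r) y \<partial>\<mu>) - (\<integral>\<^sup>+y. ?A * indicator (ball x r) y \<partial>\<mu>)"
    using fin le by (intro nn_integral_diff) auto
  also have "\<dots> = 0" using I fin by simp
  finally have "AE y in \<mu>. w y * indicator (ball x r) y - ?A * indicator (ball x r) y = 0"
    by (subst (asm) nn_integral_0_iff_AE) auto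
  then have "AE y in \<mu>. y \<notin> ball x r"
    using AE_not_in[OF E]
  proof eventually_elim
    case (elim y)
    show ?case
    proof
      assume y: "y \<in> ball x r"
      then have "w y - ?A = 0" using elim by simp
      moreover have "?A < w y" using * y elim by (auto simp: not_le)
      ultimately show False
        by (metis A diff_gr0_ennreal less_irrefl)
    qed
  qed
  then have "{y \<in> space \<mu>. \<not> y \<notin> ball x r} \<in> null_sets \<mu>"
    by (subst (asm) AE_iff_null) auto
  then show False using nonnull[of "ball x r"] by (simp add: ball_def)
qed

text \<open>Such points are the reference points of all later estimates: the value
  \<open>f z\<close> stands in for a mean value of \<open>f\<close>, and avoiding \<open>E\<close>
  makes the pointwise Hajlasz inequality available there.\<close>

lemma exists_le_pavg:
  assumes [measurable]: "g \<in> borel_measurable \<mu>" and "0 < r" "E \<in> null_sets \<mu>" "0 < q"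
  shows "\<exists>z. dist x z < r \<and> z \<notin> E \<and> g z \<le> pavg q x r g"
  using exists_le_avg[of "\<lambda>y. epowr (g y) q" r E x] assms by (auto simp: pavg_def epowr_le_iff)

text \<open>The normalisation of the inner mean is moved from \<open>V x \<rho>\<close> to the
  comparable \<open>V y \<rho>\<close>; after the exchange of integrals the inner one cancels it
  exactly.\<close>

lemma fubini_avg:
  assumes [measurable]: "w \<in> borel_measurable \<mu>" and \<rho>: "0 < \<rho>"
  shows "(\<integral>\<^sup>+x\<in>ball x0 r. avg x \<rho> w \<partial>\<mu>) \<le> ennreal (D * 2 powr n) * (\<integral>\<^sup>+y\<in>ball x0 (r + \<rho>). w y \<partial>\<mu>)"
proof -
  let ?c = "D * 2 powr n"
  let ?k = "\<lambda>x y. ennreal (?c / V y \<rho>) * w y * indicator {w. dist (fst w) (snd w) < \<rho>} (x, y) * indicator (ball x0 (r + \<rho>)) y"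
  have "(\<integral>\<^sup>+x\<in>ball x0 r. avg x \<rho> w \<partial>\<mu>) \<le> (\<integral>\<^sup>+x. (\<integral>\<^sup>+y. ?k x y \<partial>\<mu>) \<partial>\<mu>)"
  proof (rule nn_integral_mono)
    fix x
    show "avg x \<rho> w * indicator (ball x0 r) x \<le> (\<integral>\<^sup>+y. ?k x y \<partial>\<mu>)"
    proof (cases "x \<in> ball x0 r")
      case True
      have "avg x \<rho> w = (\<integral>\<^sup>+y. w y * indicator (ball x \<rho>) y / ennreal (V x \<rho>) \<partial>\<mu>)"
        using \<rho> by (simp add: mean_on_ball nn_integral_divide)
      also have "\<dots> \<le> (\<integral>\<^sup>+y. ?k x y \<partial>\<mu>)"
      proof (rule nn_integral_mono)
        fix y
        show "w y * indicator (ball x \<rho>) y / ennreal (V x \<rho>) \<le> ?k x y"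
        proof (cases "dist x y < \<rho>")
          case d: True
          have "V y \<rho> \<le> ?c * V x \<rho>" using d \<rho> by (intro V_le) (auto simp: dist_commute)
          then have "1 / V x \<rho> \<le> ?c / V y \<rho>" using \<rho> by (simp add: field_simps)
          then have "w y * ennreal (1 / V x \<rho>) \<le> w y * ennreal (?c / V y \<rho>)"
            by (intro mult_left_mono ennreal_leI) auto
          moreover have "w y / ennreal (V x \<rho>) = w y * ennreal (1 / V x \<rho>)"
            using V_pos[OF \<rho>, of x] by (simp add: divide_ennreal_def inverse_ennreal divide_inverse)
          moreover have "y \<in> ball x0 (r + \<rho>)" using d True dist_triangle[of x0 y x] by simp
          ultimately show ?thesis using d by (simp add: mult.commute)
        qed simp
      qed
      finally show ?thesis using True by simp
    qed simp
  qed
  also have "\<dots> = (\<integral>\<^sup>+y. (\<integral>\<^sup>+x. ?k x y \<partial>\<mu>) \<partial>\<mu>)"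
    by (rule Fubini'[symmetric]) measurable
  also have "\<dots> = (\<integral>\<^sup>+y. ennreal ?c * (w y * indicator (ball x0 (r + \<rho>)) y) \<partial>\<mu>)"
  proof (rule nn_integral_cong)
    fix y
    have "(\<integral>\<^sup>+x. ?k x y \<partial>\<mu>) = (\<integral>\<^sup>+x. ennreal (?c / V y \<rho>) * w y * indicator (ball x0 (r + \<rho>)) y * indicator (ball y \<rho>) x \<partial>\<mu>)"
      by (rule nn_integral_cong) (simp add: indicator_def dist_commute)
    also have "\<dots> = ennreal (?c / V y \<rho>) * w y * indicator (ball x0 (r + \<rho>)) y * ennreal (V y \<rho>)"
      by (subst nn_integral_cmult_indicator) (auto simp: emeasure_ball)
    also have "\<dots> = (ennreal (?c / V y \<rho>) * ennreal (V y \<rho>)) * (w y * indicator (ball x0 (r + \<rho>)) y)"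
      by (simp only: mult_ac)
    also have "ennreal (?c / V y \<rho>) * ennreal (V y \<rho>) = ennreal ?c"
      using V_pos[OF \<rho>, of y] by (subst ennreal_mult''[symmetric]) auto
    finally show "(\<integral>\<^sup>+x. ?k x y \<partial>\<mu>) = ennreal ?c * (w y * indicator (ball x0 (r + \<rho>)) y)" .
  qed
  also have "\<dots> = ennreal ?c * (\<integral>\<^sup>+y\<in>ball x0 (r + \<rho>). w y \<partial>\<mu>)"
    by (subst nn_integral_cmult) auto
  finally show ?thesis .
qed

lemma set_nn_integral_cover:
  assumes "finite F" "\<And>y. y \<in> A \<Longrightarrow> \<exists>z\<in>F. dist z y < r" and [measurable]: "w \<in> borel_measurable \<mu>"
  shows "(\<integral>\<^sup>+y\<in>A. w y \<partial>\<mu>) \<le> (\<Sum>z\<in>F. \<integral>\<^sup>+y\<in>ball z r. w y \<partial>\<mu>)"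
proof -
  have "(\<integral>\<^sup>+y\<in>A. w y \<partial>\<mu>) \<le> (\<integral>\<^sup>+y. (\<Sum>z\<in>F. w y * indicator (ball z r) y) \<partial>\<mu>)"
  proof (rule nn_integral_mono)
    fix y
    show "w y * indicator A y \<le> (\<Sum>z\<in>F. w y * indicator (ball z r) y)"
    proof (cases "y \<in> A")
      case True
      then obtain z where "z \<in> F" "dist z y < r" using assms by blast
      then show ?thesis using True assms(1) member_le_sum[of z F "\<lambda>z. w y * indicator (ball z r) y"] by simp
    qed simp
  qed
  then show ?thesis by (subst (asm) nn_integral_sum) auto
qed

text \<open>Bounded overlap: packing around \<open>y\<close> with radius \<open>K * r\<close> bounds
  the number of dilated balls that contain \<open>y\<close>, and
  \<open>(4 * (K * r) + 2 * r) / r = 4 * K + 2\<close>.\<close>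

lemma set_nn_integral_overlap:
  fixes x0 :: 'a
  assumes F: "finite F" "F \<subseteq> ball x0 R" "separated r F" and r: "0 < r" "0 < K"
    and [measurable]: "w \<in> borel_measurable \<mu>"
  shows "(\<Sum>z\<in>F. \<integral>\<^sup>+y\<in>ball z (K * r). w y \<partial>\<mu>) \<le>
           ennreal (D * (4 * K + 2) powr n) * (\<integral>\<^sup>+y\<in>ball x0 (R + K * r). w y \<partial>\<mu>)"
proof -
  let ?N = "D * (4 * K + 2) powr n"
  have "(\<Sum>z\<in>F. \<integral>\<^sup>+y\<in>ball z (K * r). w y \<partial>\<mu>) = (\<integral>\<^sup>+y. (\<Sum>z\<in>F. w y * indicator (ball z (K * r)) y) \<partial>\<mu>)"
    by (subst nn_integral_sum) auto
  also have "\<dots> \<le> (\<integral>\<^sup>+y. ennreal ?N * (w y * indicator (ball x0 (R + K * r)) y) \<partial>\<mu>)"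
  proof (rule nn_integral_mono)
    fix y
    let ?G = "{z \<in> F. dist y z < K * r}"
    have G: "finite ?G \<and> real (card ?G) \<le> D * ((4 * (K * r) + 2 * r) / r) powr n"
      using F r by (intro separated_card[of _ y]) (auto simp: separated_def)
    have "(4 * (K * r) + 2 * r) / r = 4 * K + 2" using r by (simp add: field_simps)
    then have G': "real (card ?G) \<le> ?N" using G by simp
    have "(\<Sum>z\<in>F. w y * indicator (ball z (K * r)) y) = (\<Sum>z\<in>?G. w y)"
      using F(1) by (intro sum.mono_neutral_cong_right) (auto simp: dist_commute)
    also have "\<dots> = ennreal (real (card ?G)) * w y" by (simp add: ennreal_of_nat_eq_real_of_nat)
    also have "\<dots> \<le> ennreal ?N * (w y * indicator (ball x0 (R + K * r)) y)"
    proof (cases "?G = {}")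
      case False
      then obtain z where "z \<in> F" "dist y z < K * r" by auto
      then have "y \<in> ball x0 (R + K * r)" using F(2) dist_triangle2[of x0 y z] by (auto simp: subset_iff)
      then show ?thesis using G' by (simp add: ennreal_leI mult_right_mono)
    next
      case True
      then show ?thesis by (metis card.empty ennreal_0 mult_zero_left of_nat_0 zero_le)
    qed
    finally show "(\<Sum>z\<in>F. w y * indicator (ball z (K * r)) y) \<le> ennreal ?N * (w y * indicator (ball x0 (R + K * r)) y)" .
  qed
  also have "\<dots> = ennreal ?N * (\<integral>\<^sup>+y\<in>ball x0 (R + K * r). w y \<partial>\<mu>)"
    by (subst nn_integral_cmult) auto
  finally show ?thesis .
qed

text \<open>The factors come from comparing \<open>V x0 R\<close> with \<open>V z r\<close>, from
  the overlap of the balls of radius \<open>K * r\<close>, and from enlarging the ball of radius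
  \<open>R\<close> by the factor \<open>K + 1\<close>.\<close>

definition net_const :: "real \<Rightarrow> real \<Rightarrow> real" where
  "net_const q K = (D * 2 powr n) powr (1 / q - 1) * (D * (4 * K + 2) powr n) powr (1 / q) *
     (D * (K + 1) powr n) powr (1 / q)"

lemma net_const_pos: "1 \<le> K \<Longrightarrow> 0 < net_const q K"
  using D_ge by (simp add: net_const_def)

text \<open>Up to constants each summand is \<open>V z r powr (1 - 1 / q)\<close> times the power
  \<open>1 / q\<close> of an integral. The volume has a nonpositive exponent, so doubling, in the
  form of a lower bound for \<open>V z r\<close>, yields the loss
  \<open>(R / r) powr (n * (1 / q - 1))\<close>. The integrals are added inside the power by
  \<open>sum_epowr_le\<close> and merged by bounded overlap. For \<open>q = 1\<close> nothing is
  lost.\<close>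

lemma sum_pavg_le:
  fixes x0 :: 'a and r R :: real and w :: "'a \<Rightarrow> ennreal"
  assumes q: "0 < q" "q \<le> 1" and K: "1 \<le> K"
    and F: "finite F" "F \<subseteq> ball x0 R" "separated r F" and r: "0 < r" "r \<le> R"
    and [measurable]: "w \<in> borel_measurable \<mu>"
  shows "(\<Sum>z\<in>F. ennreal (V z r) * pavg q z (K * r) w)
        \<le> ennreal (net_const q K * (R / r) powr (n * (1 / q - 1)) * V x0 R) * pavg q x0 ((K + 1) * R) w"
proof -
  let ?N = "D * (4 * K + 2) powr n" and ?M = "D * (K + 1) powr n"
  let ?C = "(D * 2 powr n) powr (1 / q - 1) * ?N powr (1 / q) * ?M powr (1 / q)"
  have R: "0 < R" using r by simp
  let ?w = "\<lambda>y. epowr (w y) q"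
  let ?I = "\<lambda>z. \<integral>\<^sup>+y\<in>ball z (K * r). ?w y \<partial>\<mu>"
  let ?A = "avg x0 ((K + 1) * R) ?w"
  let ?v = "V x0 R"
  let ?m = "(?v powr (1 - 1 / q)) * ((D * 2 powr n) powr (1 / q - 1) * (R / r) powr (n * (1 / q - 1)))"
  have one: "ennreal (V z r) * pavg q z (K * r) w \<le> ennreal ?m * epowr (?I z) (1 / q)" if z: "z \<in> F" for z
  proof -
    have Kr: "r \<le> K * r" using K r by simp
    have vz: "0 < V z r" using r by simp
    have "?v \<le> D * (2 * R / r) powr n * V z r"
      using z F(2) r R by (intro V_le) auto
    also have "(2 * R / r) powr n = 2 powr n * (R / r) powr n"
      using r R by (simp add: powr_mult[symmetric])
    finally have 1: "?v \<le> (D * 2 powr n) * (R / r) powr n * V z r" by (simp add: mult_ac)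
    define t where "t = 1 / q - 1"
    have t: "0 \<le> t" using q by (simp add: t_def)
    have "?v powr t \<le> ((D * 2 powr n) * (R / r) powr n * V z r) powr t"
      using 1 t by (intro powr_mono2) auto
    also have "\<dots> = (D * 2 powr n) powr t * (R / r) powr (n * t) * V z r powr t"
      using D_ge by (simp add: powr_mult powr_powr)
    finally have 2: "?v powr t \<le> (D * 2 powr n) powr t * (R / r) powr (n * t) * V z r powr t" .
    have "V z r powr (- t) \<le> ?v powr (- t) * ((D * 2 powr n) powr t * (R / r) powr (n * t))"
    proof -
      have "0 < ?v powr t" "0 < V z r powr t" using R vz V_pos[OF R, of x0] by (auto simp del: V_pos)
      then show ?thesis using 2 by (simp add: powr_minus_divide divide_simps mult_ac)
    qed
    then have 3: "V z r powr (1 - 1 / q) \<le> ?m" by (simp add: t_def)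
    have "pavg q z (K * r) w \<le> epowr (ennreal (1 / V z r) * ?I z) (1 / q)"
      unfolding pavg_def
    proof (rule epowr_mono)
      have "V z r \<le> V z (K * r)" using Kr by (intro V_mono) simp
      then have "ennreal (1 / V z (K * r)) * ?I z \<le> ennreal (1 / V z r) * ?I z"
        using vz by (intro mult_right_mono ennreal_leI divide_left_mono) auto
      moreover have "?I z / ennreal (V z (K * r)) = ennreal (1 / V z (K * r)) * ?I z"
        using Kr r by (simp add: divide_ennreal_def inverse_ennreal divide_inverse mult.commute)
      ultimately have "?I z / ennreal (V z (K * r)) \<le> ennreal (1 / V z r) * ?I z" by simp
      then show "avg z (K * r) ?w \<le> ennreal (1 / V z r) * ?I z"
        using Kr r by (subst mean_on_ball) auto
    qed (use q in auto)
    also have "\<dots> = ennreal ((1 / V z r) powr (1 / q)) * epowr (?I z) (1 / q)"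
      using q vz by (simp add: epowr_mult)
    finally have "ennreal (V z r) * pavg q z (K * r) w \<le> ennreal (V z r) * (ennreal ((1 / V z r) powr (1 / q)) * epowr (?I z) (1 / q))"
      by (rule mult_left_mono) simp
    also have "\<dots> = ennreal (V z r * (1 / V z r) powr (1 / q)) * epowr (?I z) (1 / q)"
      by (simp add: ennreal_mult mult.assoc)
    also have "V z r * (1 / V z r) powr (1 / q) = V z r powr (1 - 1 / q)"
      using vz by (simp add: powr_diff powr_divide)
    also have "ennreal (V z r powr (1 - 1 / q)) * epowr (?I z) (1 / q) \<le> ennreal ?m * epowr (?I z) (1 / q)"
      using 3 by (intro mult_right_mono ennreal_leI) auto
    finally show ?thesis .
  qed
  have "(\<Sum>z\<in>F. ennreal (V z r) * pavg q z (K * r) w) \<le> (\<Sum>z\<in>F. ennreal ?m * epowr (?I z) (1 / q))"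
    by (intro sum_mono one)
  also have "\<dots> = ennreal ?m * (\<Sum>z\<in>F. epowr (?I z) (1 / q))" by (simp add: sum_distrib_left)
  also have "\<dots> \<le> ennreal ?m * epowr (\<Sum>z\<in>F. ?I z) (1 / q)"
    using q by (intro mult_left_mono sum_epowr_le) auto
  also have "\<dots> \<le> ennreal ?m * epowr (ennreal ?N * (ennreal ?M * (ennreal ?v * ?A))) (1 / q)"
  proof (intro mult_left_mono epowr_mono)
    have KR: "R + K * r \<le> (K + 1) * R" using mult_left_mono[OF r(2), of K] K by (simp add: algebra_simps)
    have "(\<Sum>z\<in>F. ?I z) \<le> ennreal ?N * (\<integral>\<^sup>+y\<in>ball x0 (R + K * r). ?w y \<partial>\<mu>)"
      using F r K by (intro set_nn_integral_overlap) auto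
    also have "\<dots> \<le> ennreal ?N * (\<integral>\<^sup>+y\<in>ball x0 ((K + 1) * R). ?w y \<partial>\<mu>)"
      using KR by (intro mult_left_mono set_nn_integral_ball_mono) auto
    also have "\<dots> = ennreal ?N * (ennreal (V x0 ((K + 1) * R)) * ?A)"
      using R K by (subst V_times_mean) auto
    also have "\<dots> \<le> ennreal ?N * (ennreal (?M * ?v) * ?A)"
      using R K by (intro mult_left_mono mult_right_mono ennreal_leI V_le) auto
    also have "\<dots> = ennreal ?N * (ennreal ?M * (ennreal ?v * ?A))"
      using D_ge by (simp add: ennreal_mult mult.assoc)
    finally show "(\<Sum>z\<in>F. ?I z) \<le> ennreal ?N * (ennreal ?M * (ennreal ?v * ?A))" .
  qed (use q in auto)
  also have "\<dots> = ennreal ?m * (ennreal (?N powr (1 / q)) * (ennreal (?M powr (1 / q)) * (ennreal (?v powr (1 / q)) * pavg q x0 ((K + 1) * R) w)))"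
    unfolding pavg_def using q D_ge by (simp add: epowr_mult)
  also have "\<dots> = ennreal (?m * ?N powr (1 / q) * ?M powr (1 / q) * ?v powr (1 / q)) * pavg q x0 ((K + 1) * R) w"
    using D_ge by (simp add: ennreal_mult mult.assoc)
  also have "?m * ?N powr (1 / q) * ?M powr (1 / q) * ?v powr (1 / q)
      = ?C * (R / r) powr (n * (1 / q - 1)) * (?v powr (1 - 1 / q) * ?v powr (1 / q))"
    by (simp only: mult_ac)
  also have "?v powr (1 - 1 / q) * ?v powr (1 / q) = ?v"
    using R by (simp add: powr_add[symmetric])
  finally show ?thesis unfolding net_const_def .
qed

text \<open>The ball is covered by unit balls centred at a net of mesh 1, and the local bounds are
  summed by \<open>sum_pavg_le\<close>. Control of integrals by \<open>q\<close>-means at scale 1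
  thus passes to all larger scales with polynomial loss in \<open>R\<close>.\<close>

lemma tail_integral:
  assumes q: "0 < q" "q \<le> 1" and K: "1 \<le> K"
  and [measurable]: "F \<in> borel_measurable \<mu>" "H \<in> borel_measurable \<mu>" and c: "0 \<le> c" and R: "1 \<le> R"
  and *: "\<And>y. (\<integral>\<^sup>+z\<in>ball y 1. F z \<partial>\<mu>) \<le> ennreal (c * V y 1) * pavg q y K H"
  shows "avg x R F \<le> ennreal (net_const q K * c * R powr (n * (1 / q - 1))) * pavg q x ((K + 1) * R) H"
proof -
  let ?C = "net_const q K"
  have C: "0 < ?C" using K by (rule net_const_pos)
  obtain N where N: "finite N" "N \<subseteq> ball x R" "separated 1 N" "\<And>y. y \<in> ball x R \<Longrightarrow> \<exists>z\<in>N. dist z y < 1"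
    by (rule net_exists[of 1 R x]) (use R in auto)
  have "(\<integral>\<^sup>+y\<in>ball x R. F y \<partial>\<mu>) \<le> (\<Sum>z\<in>N. \<integral>\<^sup>+y\<in>ball z 1. F y \<partial>\<mu>)"
    using N by (intro set_nn_integral_cover) auto
  also have "\<dots> \<le> (\<Sum>z\<in>N. ennreal c * (ennreal (V z 1) * pavg q z (K * 1) H))"
    using * c by (intro sum_mono) (simp add: ennreal_mult mult.assoc)
  also have "\<dots> = ennreal c * (\<Sum>z\<in>N. ennreal (V z 1) * pavg q z (K * 1) H)"
    by (simp add: sum_distrib_left)
  also have "\<dots> \<le> ennreal c * (ennreal (?C * (R / 1) powr (n * (1 / q - 1)) * V x R) * pavg q x ((K + 1) * R) H)"
    using N R by (intro mult_left_mono sum_pavg_le q K) auto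
  also have "\<dots> = ennreal (V x R) * (ennreal (?C * c * R powr (n * (1 / q - 1))) * pavg q x ((K + 1) * R) H)"
    using C c by (simp add: ennreal_mult mult_ac)
  finally show ?thesis
    using R by (subst mean_le_iff) auto
qed

text \<open>Dyadic decomposition: for the least \<open>l\<close> with
  \<open>dist x y < 2 ^ l * r\<close>, the \<open>l\<close>-th term alone dominates. Minimality
  gives \<open>dist x y\<close> at least half of \<open>2 ^ l * r\<close> when \<open>l > 0\<close>,
  which accounts for the factors \<open>2 powr n\<close> and \<open>2 powr \<gamma>\<close>.\<close>

lemma test_weight_le:
  assumes r: "0 < r" and \<gamma>: "0 < \<gamma>"
  shows "ennreal (test_weight \<mu> x r \<gamma> y) \<le>
    ennreal (D * 2 powr n * 2 powr \<gamma>) * (\<Sum>l. ennreal (2 powr (- real l * \<gamma>)) * (indicator (ball x (2 ^ l * r)) y / ennreal (V x (2 ^ l * r))))"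
proof -
  let ?t = "\<lambda>l. ennreal (2 powr (- real l * \<gamma>)) * (indicator (ball x (2 ^ l * r)) y / ennreal (V x (2 ^ l * r)))"
  obtain l where l: "dist x y < 2 ^ l * r" "\<And>m. m < l \<Longrightarrow> 2 ^ m * r \<le> dist x y"
  proof -
    obtain N where "dist x y / r < 2 ^ N" using real_arch_pow[of 2 "dist x y / r"] by auto
    then have "dist x y < 2 ^ N * r" using r by (simp add: field_simps)
    then show ?thesis
      using that[of "LEAST l. dist x y < 2 ^ l * r"] LeastI[of "\<lambda>l. dist x y < 2 ^ l * r" N]
        not_less_Least[of _ "\<lambda>l. dist x y < 2 ^ l * r"] by (metis not_le)
  qed
  have v: "0 < V x (2 ^ l * r)" using r by simp
  have "test_weight \<mu> x r \<gamma> y \<le> D * 2 powr n * 2 powr \<gamma> * (2 powr (- real l * \<gamma>) * (1 / V x (2 ^ l * r)))"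
  proof (cases l)
    case 0
    have "test_weight \<mu> x r \<gamma> y \<le> 1 / V x r * 1"
      unfolding test_weight_def
    proof (intro mult_mono)
      show "1 / (V x r + V x (dist x y)) \<le> 1 / V x r" using r by (intro divide_left_mono) (auto intro!: mult_pos_pos add_pos_nonneg)
      show "(r / (r + dist x y)) powr \<gamma> \<le> 1" using r \<gamma> powr_mono2[of \<gamma> "r / (r + dist x y)" 1] add_pos_nonneg[OF r zero_le_dist[of x y]]
        by (simp add: divide_le_eq)
    qed (use r in auto)
    also have "1 / V x r * 1 \<le> (D * 2 powr n * 2 powr \<gamma>) * (1 / V x r)"
    proof -
      have "1 * 1 * 1 \<le> D * 2 powr n * 2 powr \<gamma>"
        using D_ge n_pos \<gamma> by (intro mult_mono) (auto simp: ge_one_powr_ge_zero)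
      then show ?thesis using mult_right_mono[of 1 "D * 2 powr n * 2 powr \<gamma>" "1 / V x r"] by simp
    qed
    finally show ?thesis using 0 by simp
  next
    case (Suc m)
    have d: "2 ^ m * r \<le> dist x y" using l(2)[of m] Suc by simp
    have d0: "0 < dist x y" using d r by (smt (verit) mult_pos_pos zero_less_power)
    have "V x (2 ^ l * r) \<le> D * 2 powr n * V x (dist x y)"
      using d d0 Suc by (intro V_le) auto
    then have "1 / V x (dist x y) \<le> D * 2 powr n * (1 / V x (2 ^ l * r))"
      using v d0 by (simp add: field_simps)
    moreover have "1 / (V x r + V x (dist x y)) \<le> 1 / V x (dist x y)"
      using d0 r by (intro divide_left_mono) (auto intro!: mult_pos_pos add_pos_pos)
    ultimately have 1: "1 / (V x r + V x (dist x y)) \<le> D * 2 powr n * (1 / V x (2 ^ l * r))" by linarith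
    have "r / (r + dist x y) \<le> r / (2 ^ m * r)"
      using d d0 r by (intro divide_left_mono mult_pos_pos add_pos_pos) auto
    also have "\<dots> = 2 powr (1 - real l)" using r Suc by (simp add: powr_minus powr_realpow powr_diff divide_inverse)
    finally have "(r / (r + dist x y)) powr \<gamma> \<le> (2 powr (1 - real l)) powr \<gamma>"
      using r \<gamma> by (intro powr_mono2) auto
    also have "\<dots> = 2 powr \<gamma> * 2 powr (- real l * \<gamma>)" by (simp add: powr_powr powr_add[symmetric] algebra_simps)
    finally have 2: "(r / (r + dist x y)) powr \<gamma> \<le> 2 powr \<gamma> * 2 powr (- real l * \<gamma>)" .
    have "test_weight \<mu> x r \<gamma> y \<le> (D * 2 powr n * (1 / V x (2 ^ l * r))) * (2 powr \<gamma> * 2 powr (- real l * \<gamma>))"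
      unfolding test_weight_def using 1 2 D_ge by (intro mult_mono) auto
    then show ?thesis by (simp only: mult_ac)
  qed
  then have "ennreal (test_weight \<mu> x r \<gamma> y) \<le> ennreal (D * 2 powr n * 2 powr \<gamma> * (2 powr (- real l * \<gamma>) * (1 / V x (2 ^ l * r))))"
    by (rule ennreal_leI)
  also have "\<dots> = ennreal (D * 2 powr n * 2 powr \<gamma>) * ?t l"
  proof -
    have "indicator (ball x (2 ^ l * r)) y / ennreal (V x (2 ^ l * r)) = ennreal (1 / V x (2 ^ l * r))"
      using l(1) v by (simp add: divide_ennreal[symmetric])
    then show ?thesis
      using ennreal_mult[of "D * 2 powr n * 2 powr \<gamma>" "2 powr (- real l * \<gamma>) * (1 / V x (2 ^ l * r))"] D_ge
        ennreal_mult[of "2 powr (- real l * \<gamma>)" "1 / V x (2 ^ l * r)"] by (simp only:) simp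
  qed
  also have "?t l \<le> (\<Sum>l. ?t l)"
    using sum_le_suminf[OF summableI, of "{l}" ?t] by simp
  finally show ?thesis by (simp add: mult_left_mono)
qed

text \<open>Every pairing with a test function is reduced in this way to means over the dyadic
  dilates of one ball, with geometric weights.\<close>

lemma weighted_integral_le:
  assumes r: "0 < r" and \<gamma>: "0 < \<gamma>" and [measurable]: "F \<in> borel_measurable \<mu>"
  shows "(\<integral>\<^sup>+y. F y * ennreal (test_weight \<mu> x r \<gamma> y) \<partial>\<mu>) \<le>
    ennreal (D * 2 powr n * 2 powr \<gamma>) * (\<Sum>l. ennreal (2 powr (- real l * \<gamma>)) * avg x (2 ^ l * r) F)"
proof -
  let ?c = "ennreal (D * 2 powr n * 2 powr \<gamma>)"
  have "(\<integral>\<^sup>+y. F y * ennreal (test_weight \<mu> x r \<gamma> y) \<partial>\<mu>) \<le>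
    (\<integral>\<^sup>+y. ?c * (\<Sum>l. ennreal (2 powr (- real l * \<gamma>)) / ennreal (V x (2 ^ l * r)) * (F y * indicator (ball x (2 ^ l * r)) y)) \<partial>\<mu>)"
  proof (rule nn_integral_mono)
    fix y
    have "F y * ennreal (test_weight \<mu> x r \<gamma> y) \<le> F y * (?c * (\<Sum>l. ennreal (2 powr (- real l * \<gamma>)) * (indicator (ball x (2 ^ l * r)) y / ennreal (V x (2 ^ l * r)))))"
      by (intro mult_left_mono test_weight_le r \<gamma>) simp
    also have "\<dots> = ?c * (\<Sum>l. F y * (ennreal (2 powr (- real l * \<gamma>)) * (indicator (ball x (2 ^ l * r)) y / ennreal (V x (2 ^ l * r)))))"
      by (simp add: ennreal_suminf_cmult mult.left_commute)
    also have "\<dots> = ?c * (\<Sum>l. ennreal (2 powr (- real l * \<gamma>)) / ennreal (V x (2 ^ l * r)) * (F y * indicator (ball x (2 ^ l * r)) y))"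
      by (simp add: divide_ennreal_def mult_ac)
    finally show "F y * ennreal (test_weight \<mu> x r \<gamma> y) \<le> \<dots>" .
  qed
  also have "\<dots> = ?c * (\<Sum>l. ennreal (2 powr (- real l * \<gamma>)) / ennreal (V x (2 ^ l * r)) * (\<integral>\<^sup>+y\<in>ball x (2 ^ l * r). F y \<partial>\<mu>))"
    by (simp add: nn_integral_cmult nn_integral_suminf)
  also have "\<dots> = ?c * (\<Sum>l. ennreal (2 powr (- real l * \<gamma>)) * avg x (2 ^ l * r) F)"
    using r by (simp add: mean_on_ball divide_ennreal_def mult_ac)
  finally show ?thesis .
qed

end

section \<open>Poincare inequality\<close>

lemma suminf_ennreal_geometric:
  assumes "0 \<le> c" "c < 1"
  shows "(\<Sum>i. ennreal (c ^ i)) = ennreal (1 / (1 - c))"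
proof -
  have "(\<lambda>i. c ^ i) sums (1 / (1 - c))" using assms by (intro geometric_sums) auto
  then show ?thesis using assms by (intro suminf_ennreal_eq) auto
qed

definition hajlasz_on :: "real \<Rightarrow> ('a::metric_space \<Rightarrow> complex) \<Rightarrow> ('a \<Rightarrow> real) \<Rightarrow> 'a set \<Rightarrow> bool" where
  "hajlasz_on s f g E \<longleftrightarrow> (\<forall>x. 0 \<le> g x) \<and>
     (\<forall>x y. x \<notin> E \<longrightarrow> y \<notin> E \<longrightarrow> cmod (f x - f y) \<le> dist x y powr s * (g x + g y))"

lemma hajlasz_onD: "hajlasz_on s f g E \<Longrightarrow> x \<notin> E \<Longrightarrow> y \<notin> E \<Longrightarrow> cmod (f x - f y) \<le> dist x y powr s * (g x + g y)"
  by (simp add: hajlasz_on_def)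

lemma hajlasz_on_nonneg: "hajlasz_on s f g E \<Longrightarrow> 0 \<le> g x"
  by (simp add: hajlasz_on_def)

lemma hajlasz_on_le:
  assumes "hajlasz_on s f g E" "x \<notin> E" "y \<notin> E" "dist x y \<le> d" "g x \<le> a" "g y \<le> b" "0 \<le> s"
  shows "cmod (f x - f y) \<le> d powr s * (a + b)"
proof -
  have "cmod (f x - f y) \<le> dist x y powr s * (g x + g y)" using assms hajlasz_onD by blast
  also have "\<dots> \<le> d powr s * (a + b)"
    using assms hajlasz_on_nonneg[OF assms(1)] by (intro mult_mono powr_mono2 add_mono) auto
  finally show ?thesis .
qed

context doubling_measure
begin

text \<open>Telescopes along points \<open>y\<^sub>i\<close> of the balls of radius \<open>2 powr (- i) r\<close> around \<open>x\<close> at which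
  \<open>g\<close> is at most its \<open>q\<close>-mean.\<close>
lemma hajlasz_telescope:
  assumes hj: "hajlasz_on s f g E" and s: "0 < s" "s \<le> 1" and q: "0 < q"
    and [measurable]: "g \<in> borel_measurable \<mu>" and E: "E \<in> null_sets \<mu>"
    and r: "0 < r" and x: "x \<notin> E" and z: "z \<notin> E" "dist x z \<le> 2 * r"
  shows "ennreal (cmod (f x - f z)) \<le>
    ennreal (9 * r powr s) * (ennreal (g z) + (\<Sum>i. ennreal (2 powr (- real i * s)) * pavg q x (2 powr (- real i) * r) (\<lambda>y. ennreal (g y))))"
proof -
  define a where "a i = pavg q x (2 powr (- real i) * r) (\<lambda>y. ennreal (g y))" for i
  define T where "T = (\<Sum>i. ennreal (2 powr (- real i * s)) * a i)"
  have g0: "0 \<le> g y" for y using hj by (rule hajlasz_on_nonneg)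
  show ?thesis
  proof (cases "T = top")
    case True
    then show ?thesis using r unfolding T_def[symmetric] a_def[symmetric] by (simp add: ennreal_mult_top)
  next
    case False
    define \<alpha> where "\<alpha> i = enn2real (a i)" for i
    define u where "u i = 2 powr (- real i * s) * \<alpha> i" for i
    have term_le: "(\<Sum>i<m. ennreal (2 powr (- real i * s)) * a i) \<le> T" for m
      unfolding T_def by (intro sum_le_suminf) auto
    have "ennreal (2 powr (- real i * s)) * a i \<le> T" for i
      using sum_le_suminf[OF summableI, of "{i}" "\<lambda>i. ennreal (2 powr (- real i * s)) * a i"] by (simp add: T_def)
    then have "a i \<noteq> top" for i using False
      by (metis ennreal_mult_top ennreal_eq_0_iff not_le powr_gt_zero zero_neq_numeral top.extremum_uniqueI)
    then have \<alpha>: "a i = ennreal (\<alpha> i)" "0 \<le> \<alpha> i" for i by (auto simp: \<alpha>_def less_top)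
    have u0: "0 \<le> u i" for i using \<alpha> by (simp add: u_def)
    have u: "ennreal (2 powr (- real i * s)) * a i = ennreal (u i)" for i
      by (simp add: u_def \<alpha>(1) ennreal_mult \<alpha>(2))
    define \<tau> where "\<tau> = enn2real T"
    have \<tau>: "T = ennreal \<tau>" "0 \<le> \<tau>" using False by (auto simp: \<tau>_def less_top)
    have usum: "(\<Sum>i<m. u i) \<le> \<tau>" for m
    proof -
      have "(\<Sum>i<m. ennreal (u i)) \<le> ennreal \<tau>" using term_le[of m] unfolding u \<tau>(1) .
      then have "ennreal (\<Sum>i<m. u i) \<le> ennreal \<tau>" using u0 by (subst sum_ennreal[symmetric]) auto
      then show ?thesis using \<tau>(2) by simp
    qed
    have "summable u" using u0 usum by (rule summableI_nonneg_bounded)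
    then have uto0: "u \<longlonglongrightarrow> 0" by (rule summable_LIMSEQ_zero)
    have "\<exists>y. dist x y < 2 powr (- real i) * r \<and> y \<notin> E \<and> ennreal (g y) \<le> a i" for i
      unfolding a_def using q r E by (intro exists_le_pavg) auto
    then obtain y where y: "\<And>i. dist x (y i) < 2 powr (- real i) * r" "\<And>i. y i \<notin> E" "\<And>i. ennreal (g (y i)) \<le> a i"
      by metis
    have gy: "g (y i) \<le> \<alpha> i" for i using y(3)[of i] \<alpha> by simp
    have p2: "(2 powr (- real i) * r) powr s = 2 powr (- real i * s) * r powr s" for i
      using r by (simp add: powr_mult powr_powr)
    have two: "2 powr s \<le> 2" using s powr_mono[of s 1 2] by simp
    have three: "3 powr s \<le> 3" using s powr_mono[of s 1 3] by simp
    \<comment> \<open>The step from \<open>y N\<close> to \<open>y (Suc N)\<close> costs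
      \<open>4 * u (Suc N) + 2 * u N\<close>. The credit \<open>- 2 * u N\<close> in the invariant
      pays for the second term and leaves the same credit one index later.\<close>
    have A: "cmod (f (y N) - f z) \<le> r powr s * (3 * g z + 6 * (\<Sum>i<Suc N. u i) - 2 * u N)" for N
    proof (induction N)
      case 0
      have "dist (y 0) z \<le> 3 * r" using y(1)[of 0] z(2) dist_triangle3[of "y 0" z x] by simp
      then have "cmod (f (y 0) - f z) \<le> (3 * r) powr s * (\<alpha> 0 + g z)"
        using s by (intro hajlasz_on_le[OF hj y(2) z(1)] gy) auto
      also have "\<dots> = 3 powr s * (r powr s * (\<alpha> 0 + g z))" using r by (simp add: powr_mult)
      also have "\<dots> \<le> 3 * (r powr s * (\<alpha> 0 + g z))" using three \<alpha>(2) g0 by (intro mult_right_mono) auto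
      also have "\<dots> \<le> r powr s * (3 * g z + 6 * (\<Sum>i<Suc 0. u i) - 2 * u 0)"
        using \<alpha>(2)[of 0] mult_nonneg_nonneg[of "r powr s" "\<alpha> 0"] by (simp add: u_def algebra_simps)
      finally show ?case .
    next
      case (Suc N)
      let ?\<rho> = "2 powr (- real N) * r"
      have \<rho>: "2 powr (- real (Suc N)) * r = ?\<rho> / 2" by (simp add: powr_diff powr_minus field_simps powr_add)
      have "dist (y (Suc N)) (y N) \<le> 2 * ?\<rho>"
      proof -
        have "0 < ?\<rho>" using r by simp
        then show ?thesis
          using y(1)[of N] y(1)[of "Suc N"] dist_triangle3[of "y (Suc N)" "y N" x] unfolding \<rho> by linarith
      qed
      then have "cmod (f (y (Suc N)) - f (y N)) \<le> (2 * ?\<rho>) powr s * (\<alpha> (Suc N) + \<alpha> N)"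
        using s by (intro hajlasz_on_le[OF hj y(2) y(2)] gy) auto
      also have "\<dots> = 2 powr s * (r powr s * (2 powr (- real N * s) * \<alpha> (Suc N) + u N))"
        using r p2[of N] by (simp add: powr_mult u_def algebra_simps)
      also have "2 powr (- real N * s) = 2 powr s * 2 powr (- real (Suc N) * s)"
        by (simp add: powr_add[symmetric] algebra_simps)
      also have "2 powr s * (r powr s * (2 powr s * 2 powr (- real (Suc N) * s) * \<alpha> (Suc N) + u N))
         = 2 powr s * (r powr s * (2 powr s * u (Suc N) + u N))" by (simp add: u_def)
      also have "\<dots> \<le> 2 * (r powr s * (2 * u (Suc N) + u N))"
        using two u0 by (intro mult_mono add_mono mult_right_mono mult_nonneg_nonneg add_nonneg_nonneg) auto
      finally have "cmod (f (y (Suc N)) - f (y N)) \<le> r powr s * (4 * u (Suc N) + 2 * u N)" by (simp add: algebra_simps)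
      then have "cmod (f (y (Suc N)) - f z) \<le> r powr s * (4 * u (Suc N) + 2 * u N) + r powr s * (3 * g z + 6 * (\<Sum>i<Suc N. u i) - 2 * u N)"
        using Suc.IH norm_triangle_ineq[of "f (y (Suc N)) - f (y N)" "f (y N) - f z"] by simp
      also have "\<dots> = r powr s * (3 * g z + 6 * (\<Sum>i<Suc (Suc N). u i) - 2 * u (Suc N))"
        by (simp add: algebra_simps)
      finally show ?case .
    qed
    \<comment> \<open>The last step, from \<open>y N\<close> to \<open>x\<close>, involves
      \<open>g x\<close> only with the factor \<open>2 powr (- N * s)\<close>. As \<open>g x\<close>
      is a real number and \<open>u\<close> is summable, it vanishes in the limit, so
      \<open>g x\<close> does not appear in the result.\<close>
    have B: "cmod (f x - f z) \<le> 9 * r powr s * (g z + \<tau>) + r powr s * ((2 powr (- s)) ^ N * g x + u N)" for N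
    proof -
      have "cmod (f x - f (y N)) \<le> (2 powr (- real N) * r) powr s * (g x + \<alpha> N)"
        using s y(1)[of N] by (intro hajlasz_on_le[OF hj x y(2)] gy) auto
      also have "\<dots> = r powr s * ((2 powr (- s)) ^ N * g x + u N)"
        unfolding p2 u_def by (simp add: powr_realpow[symmetric] powr_powr algebra_simps)
      finally have 1: "cmod (f x - f (y N)) \<le> r powr s * ((2 powr (- s)) ^ N * g x + u N)" .
      have *: "3 * b + 6 * S - 2 * c \<le> 9 * (b + t)" if "S \<le> t" "0 \<le> b" "0 \<le> c" "0 \<le> t" for b c S t :: real
        using that by argo
      have "3 * g z + 6 * (\<Sum>i<Suc N. u i) - 2 * u N \<le> 9 * (g z + \<tau>)"
        by (rule *[OF usum g0 u0 \<tau>(2)])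
      then have "r powr s * (3 * g z + 6 * (\<Sum>i<Suc N. u i) - 2 * u N) \<le> r powr s * (9 * (g z + \<tau>))"
        by (intro mult_left_mono) auto
      then have "cmod (f (y N) - f z) \<le> 9 * r powr s * (g z + \<tau>)" using A[of N] by linarith
      then show ?thesis using 1 norm_triangle_ineq[of "f x - f (y N)" "f (y N) - f z"] by simp
    qed
    have "(\<lambda>N. 9 * r powr s * (g z + \<tau>) + r powr s * ((2 powr (- s)) ^ N * g x + u N)) \<longlonglongrightarrow>
       9 * r powr s * (g z + \<tau>) + r powr s * (0 * g x + 0)"
      using s by (intro tendsto_intros LIMSEQ_power_zero uto0) (auto simp: powr_less_one)
    then have "cmod (f x - f z) \<le> 9 * r powr s * (g z + \<tau>)"
      using B by (intro LIMSEQ_le_const[of _ "9 * r powr s * (g z + \<tau>)"]) auto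
    then have "ennreal (cmod (f x - f z)) \<le> ennreal (9 * r powr s * (g z + \<tau>))" by (rule ennreal_leI)
    also have "\<dots> = ennreal (9 * r powr s) * (ennreal (g z) + T)"
      using g0[of z] \<tau> by (simp add: ennreal_mult)
    finally show ?thesis by (simp add: T_def a_def)
  qed
qed

text \<open>The exponent \<open>1 / q\<close> is split as \<open>1 + (1 / q - 1)\<close>. The first
  factor is a plain mean, integrated by \<open>fubini_avg\<close>. The second is bounded pointwise:
  the small ball sits in the ball of radius \<open>2 * r\<close>, and the dilation
  \<open>3 * 2 powr i\<close> between them, raised to \<open>n * (1 / q - 1)\<close>, is the
  loss.\<close>

lemma integral_pavg_le:
  assumes q: "0 < q" "q \<le> 1" and [measurable]: "G \<in> borel_measurable \<mu>" and r: "0 < r"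
  shows "(\<integral>\<^sup>+x\<in>ball x0 r. pavg q x (2 powr (- real i) * r) G \<partial>\<mu>) \<le>
    ennreal ((D * 3 powr n) powr (1 / q - 1) * (D * 2 powr n)\<^sup>2 * V x0 r * 2 powr (real i * (n * (1 / q - 1)))) * pavg q x0 (2 * r) G"
proof -
  let ?\<rho> = "2 powr (- real i) * r" and ?w = "\<lambda>y. epowr (G y) q" and ?t = "1 / q - 1"
  let ?A0 = "avg x0 (2 * r) ?w" and ?b = "D * (3 * 2 powr real i) powr n"
  have t: "0 \<le> ?t" using q by simp
  have \<rho>: "0 < ?\<rho>" "?\<rho> \<le> r" using r powr_mono[of "- real i" 0 2] by auto
  have split: "epowr a (1 / q) = a * epowr a ?t" for a
    using epowr_add[of a 1 ?t] by simp
  have "(\<integral>\<^sup>+x\<in>ball x0 r. pavg q x ?\<rho> G \<partial>\<mu>) \<le> (\<integral>\<^sup>+x. ennreal (?b powr ?t) * epowr ?A0 ?t * (avg x ?\<rho> ?w * indicator (ball x0 r) x) \<partial>\<mu>)"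
  proof (rule nn_integral_mono)
    fix x
    show "pavg q x ?\<rho> G * indicator (ball x0 r) x \<le> ennreal (?b powr ?t) * epowr ?A0 ?t * (avg x ?\<rho> ?w * indicator (ball x0 r) x)"
    proof (cases "x \<in> ball x0 r")
      case True
      have K: "3 * 2 powr real i * ?\<rho> = 3 * r" by (simp add: powr_minus)
      have "avg x ?\<rho> ?w \<le> ennreal ?b * ?A0"
        using True \<rho> ge_one_powr_ge_zero[of 2 "real i"]
        by (intro mean_on_ball_le) (auto simp: K dist_commute)
      then have "epowr (avg x ?\<rho> ?w) ?t \<le> epowr (ennreal ?b * ?A0) ?t"
        using t by (rule epowr_mono)
      also have "\<dots> \<le> ennreal (?b powr ?t) * epowr ?A0 ?t"
      \<comment> \<open>For \<open>q = 1\<close> the exponent is zero, outside the range of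
        \<open>epowr_mult\<close>.\<close>
      proof (cases "?t = 0")
        case True
        then show ?thesis using D_ge by (cases ?A0) (auto simp: epowr_def ennreal_mult_eq_top_iff ennreal_mult[symmetric] enn2real_mult)
      next
        case False
        then have "0 < ?t" using t by linarith
        then show ?thesis using D_ge by (subst epowr_mult) auto
      qed
      finally have "avg x ?\<rho> ?w * epowr (avg x ?\<rho> ?w) ?t \<le> avg x ?\<rho> ?w * (ennreal (?b powr ?t) * epowr ?A0 ?t)"
        by (rule mult_left_mono) simp
      then show ?thesis using True by (simp add: pavg_def split mult_ac)
    qed simp
  qed
  also have "\<dots> = ennreal (?b powr ?t) * epowr ?A0 ?t * (\<integral>\<^sup>+x\<in>ball x0 r. avg x ?\<rho> ?w \<partial>\<mu>)"
    by (rule nn_integral_cmult) measurable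
  also have "\<dots> \<le> ennreal (?b powr ?t) * epowr ?A0 ?t * (ennreal (D * 2 powr n) * (\<integral>\<^sup>+y\<in>ball x0 (r + ?\<rho>). ?w y \<partial>\<mu>))"
    using \<rho> by (intro mult_left_mono fubini_avg) auto
  also have "\<dots> \<le> ennreal (?b powr ?t) * epowr ?A0 ?t * (ennreal (D * 2 powr n) * (\<integral>\<^sup>+y\<in>ball x0 (2 * r). ?w y \<partial>\<mu>))"
    using \<rho> by (intro mult_left_mono set_nn_integral_ball_mono) auto
  also have "\<dots> = ennreal (?b powr ?t) * epowr ?A0 ?t * (ennreal (D * 2 powr n) * (ennreal (V x0 (2 * r)) * ?A0))"
    using r by (subst V_times_mean) auto
  also have "\<dots> \<le> ennreal (?b powr ?t) * epowr ?A0 ?t * (ennreal (D * 2 powr n) * (ennreal (D * 2 powr n * V x0 r) * ?A0))"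
    using r by (intro mult_left_mono mult_right_mono ennreal_leI V_le) auto
  also have "\<dots> = (ennreal (?b powr ?t) * (ennreal (D * 2 powr n) * ennreal (D * 2 powr n * V x0 r))) * pavg q x0 (2 * r) G"
    by (simp add: pavg_def split mult_ac)
  also have "ennreal (?b powr ?t) * (ennreal (D * 2 powr n) * ennreal (D * 2 powr n * V x0 r)) =
     ennreal (?b powr ?t * ((D * 2 powr n) * (D * 2 powr n * V x0 r)))"
    using D_ge by (simp add: ennreal_mult)
  also have "?b powr ?t = (D * 3 powr n) powr ?t * 2 powr (real i * (n * ?t))"
    using D_ge by (simp add: powr_mult powr_powr mult_ac)
  finally show ?thesis by (simp only: power2_eq_square mult_ac)
qed

text \<open>The 9 is the constant of the telescope; the quotient is the loss of
  \<open>integral_pavg_le\<close> summed over the geometric series of ratio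
  \<open>2 powr (n * (1 / q - 1) - s)\<close>.\<close>

definition poincare_const :: "real \<Rightarrow> real \<Rightarrow> real" where
  "poincare_const s q = 9 + 9 * ((D * 3 powr n) powr (1 / q - 1) * (D * 2 powr n)\<^sup>2) / (1 - 2 powr (n * (1 / q - 1) - s))"

lemma poincare_const_pos: "n * (1 / q - 1) < s \<Longrightarrow> 0 < poincare_const s q"
  using D_ge powr_less_one[of 2 "n * (1 / q - 1) - s"] unfolding poincare_const_def
  by (intro add_pos_nonneg divide_nonneg_nonneg) auto

text \<open>In the integrated telescope the gain \<open>2 powr (- i * s)\<close> beats the loss
  \<open>2 powr (i * n * (1 / q - 1))\<close>. The inequality improves integrability: an integral of
  first powers on the left is controlled by a \<open>q\<close>-mean on the right.\<close>

lemma poincare: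
  assumes hj: "hajlasz_on s f g E" and s: "0 < s" "s \<le> 1" and q: "0 < q" "q \<le> 1" "n * (1 / q - 1) < s"
    and [measurable]: "g \<in> borel_measurable \<mu>" and E: "E \<in> null_sets \<mu>"
    and r: "0 < r" and z: "z \<notin> E" "dist x0 z < r"
  shows "(\<integral>\<^sup>+x\<in>ball x0 r. ennreal (cmod (f x - f z)) \<partial>\<mu>) \<le>
    ennreal (poincare_const s q * r powr s * V x0 r) * (ennreal (g z) + pavg q x0 (2 * r) (\<lambda>y. ennreal (g y)))"
proof -
  let ?G = "\<lambda>y. ennreal (g y)" and ?\<theta> = "n * (1 / q - 1)"
  let ?P = "pavg q x0 (2 * r) ?G"
  let ?M = "(D * 3 powr n) powr (1 / q - 1) * (D * 2 powr n)\<^sup>2"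
  let ?a = "\<lambda>i x. pavg q x (2 powr (- real i) * r) ?G"
  have "(\<integral>\<^sup>+x\<in>ball x0 r. ennreal (cmod (f x - f z)) \<partial>\<mu>) \<le>
    (\<integral>\<^sup>+x. ennreal (9 * r powr s) * (ennreal (g z) * indicator (ball x0 r) x + (\<Sum>i. ennreal (2 powr (- real i * s)) * (?a i x * indicator (ball x0 r) x))) \<partial>\<mu>)"
  proof (rule nn_integral_mono_AE)
    show "AE x in \<mu>. ennreal (cmod (f x - f z)) * indicator (ball x0 r) x \<le>
      ennreal (9 * r powr s) * (ennreal (g z) * indicator (ball x0 r) x + (\<Sum>i. ennreal (2 powr (- real i * s)) * (?a i x * indicator (ball x0 r) x)))"
      using AE_not_in[OF E]
    proof eventually_elim
      case (elim x)
      show ?case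
      proof (cases "x \<in> ball x0 r")
        case True
        then have "dist x z \<le> 2 * r" using z dist_triangle3[of x z x0] by simp
        then show ?thesis using hajlasz_telescope[OF hj s q(1) assms(7) E r elim z(1)] True by simp
      qed simp
    qed
  qed
  also have "\<dots> = ennreal (9 * r powr s) * (ennreal (g z) * ennreal (V x0 r) + (\<Sum>i. ennreal (2 powr (- real i * s)) * (\<integral>\<^sup>+x\<in>ball x0 r. ?a i x \<partial>\<mu>)))"
    by (simp add: nn_integral_cmult nn_integral_add nn_integral_suminf nn_integral_cmult_indicator emeasure_ball)
  also have "\<dots> \<le> ennreal (9 * r powr s) * (ennreal (g z) * ennreal (V x0 r) + (\<Sum>i. ennreal (?M * V x0 r) * ?P * ennreal ((2 powr (?\<theta> - s)) ^ i)))"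
  proof (intro mult_left_mono add_left_mono suminf_le)
    fix i
    have "ennreal (2 powr (- real i * s)) * (\<integral>\<^sup>+x\<in>ball x0 r. ?a i x \<partial>\<mu>) \<le>
      ennreal (2 powr (- real i * s)) * (ennreal (?M * V x0 r * 2 powr (real i * ?\<theta>)) * ?P)"
      using q r by (intro mult_left_mono integral_pavg_le) auto
    also have "\<dots> = ennreal (2 powr (- real i * s) * (?M * V x0 r * 2 powr (real i * ?\<theta>))) * ?P"
      using D_ge by (subst ennreal_mult) (auto simp: mult.assoc)
    also have "2 powr (- real i * s) * (?M * V x0 r * 2 powr (real i * ?\<theta>)) = ?M * V x0 r * ((2 powr (?\<theta> - s)) ^ i)"
      by (simp add: powr_realpow[symmetric] powr_powr powr_add[symmetric] algebra_simps)
    also have "ennreal (?M * V x0 r * ((2 powr (?\<theta> - s)) ^ i)) * ?P = ennreal (?M * V x0 r) * ?P * ennreal ((2 powr (?\<theta> - s)) ^ i)"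
      using D_ge by (subst ennreal_mult) (auto simp: mult_ac)
    finally show "ennreal (2 powr (- real i * s)) * (\<integral>\<^sup>+x\<in>ball x0 r. ?a i x \<partial>\<mu>) \<le> ennreal (?M * V x0 r) * ?P * ennreal ((2 powr (?\<theta> - s)) ^ i)" .
  qed auto
  also have "\<dots> = ennreal (9 * r powr s) * (ennreal (g z) * ennreal (V x0 r) + ennreal (?M * V x0 r) * ?P * ennreal (1 / (1 - 2 powr (?\<theta> - s))))"
    using q by (subst ennreal_suminf_cmult, subst suminf_ennreal_geometric) (auto intro: powr_less_one)
  also have "\<dots> = ennreal (9 * r powr s * V x0 r) * ennreal (g z) + ennreal (9 * r powr s * V x0 r * (?M / (1 - 2 powr (?\<theta> - s)))) * ?P"
  proof -
    have pos: "0 < 1 - 2 powr (?\<theta> - s)" using q powr_less_one[of 2 "?\<theta> - s"] by simp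
    have 1: "ennreal (9 * r powr s * V x0 r) = ennreal (9 * r powr s) * ennreal (V x0 r)"
      by (rule ennreal_mult) auto
    have "9 * r powr s * V x0 r * (?M / (1 - 2 powr (?\<theta> - s))) = (9 * r powr s) * ((?M * V x0 r) * (1 / (1 - 2 powr (?\<theta> - s))))"
      by simp
    then have 2: "ennreal (9 * r powr s * V x0 r * (?M / (1 - 2 powr (?\<theta> - s)))) =
        ennreal (9 * r powr s) * (ennreal (?M * V x0 r) * ennreal (1 / (1 - 2 powr (?\<theta> - s))))"
      using pos D_ge by (simp only: ennreal_mult[symmetric] mult_nonneg_nonneg powr_ge_zero V_nonneg) (subst ennreal_mult[symmetric], auto)+
    show ?thesis unfolding 1 2 by (simp only: distrib_left mult_ac)
  qed
  also have "\<dots> \<le> ennreal (poincare_const s q * r powr s * V x0 r) * ennreal (g z) + ennreal (poincare_const s q * r powr s * V x0 r) * ?P"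
  proof -
    have pos: "0 < 1 - 2 powr (?\<theta> - s)" using q powr_less_one[of 2 "?\<theta> - s"] by simp
    have M: "0 \<le> ?M / (1 - 2 powr (?\<theta> - s))" using pos D_ge by (intro divide_nonneg_pos) auto
    have pc: "poincare_const s q = 9 + 9 * (?M / (1 - 2 powr (?\<theta> - s)))" by (simp add: poincare_const_def)
    have vr: "0 \<le> r powr s * V x0 r" by simp
    have 1: "9 * r powr s * V x0 r \<le> poincare_const s q * r powr s * V x0 r"
      using mult_right_mono[of 9 "poincare_const s q" "r powr s * V x0 r"] M vr unfolding pc by (simp add: mult.assoc)
    have 2: "9 * r powr s * V x0 r * (?M / (1 - 2 powr (?\<theta> - s))) \<le> poincare_const s q * r powr s * V x0 r"
      using mult_right_mono[of "9 * (?M / (1 - 2 powr (?\<theta> - s)))" "poincare_const s q" "r powr s * V x0 r"] vr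
      unfolding pc by (simp add: mult_ac)
    show ?thesis
      by (rule add_mono[OF mult_right_mono[OF ennreal_leI[OF 1]] mult_right_mono[OF ennreal_leI[OF 2]]]) simp_all
  qed
  finally show ?thesis by (simp add: distrib_left)
qed

end

section \<open>Test functions\<close>

lemma ennreal_mult_mono_const:
  assumes "a \<le> ennreal c * b" "c \<le> c'" shows "a \<le> ennreal c' * b"
  using assms(1) mult_right_mono[OF ennreal_leI[OF assms(2)], of b] by simp

lemma epowr_le_add_one:
  assumes "0 < q" "q \<le> p" shows "epowr a q \<le> 1 + epowr a p"
proof (cases a)
  case (real r)
  have "r powr q \<le> 1 + r powr p"
  proof (cases "r \<le> 1")
    case True
    then have "r powr q \<le> 1" using real assms powr_mono2[of q r 1] by simp
    then show ?thesis by (smt (verit) powr_ge_zero)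
  next
    case False
    then have "r powr q \<le> r powr p" using assms by (intro powr_mono) auto
    then show ?thesis by simp
  qed
  then have "ennreal (r powr q) \<le> ennreal (1 + r powr p)" by (rule ennreal_leI)
  then show ?thesis using real by (simp add: ennreal_plus flip: ennreal_1)
qed simp

lemma test_bound_norm: "test_bound \<mu> x r \<beta> \<gamma> C \<phi> \<Longrightarrow> 0 \<le> C \<Longrightarrow> test_norm \<mu> x r \<beta> \<gamma> \<phi> \<le> ennreal C"
  unfolding test_norm_def by (rule INF_lower) simp

lemma test_norm_less:
  assumes "test_norm \<mu> x r \<beta> \<gamma> \<phi> < ennreal b"
  obtains C where "0 \<le> C" "C < b" "test_bound \<mu> x r \<beta> \<gamma> C \<phi>"
proof -
  obtain C where "0 \<le> C" "test_bound \<mu> x r \<beta> \<gamma> C \<phi>" "ennreal C < ennreal b"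
    using assms unfolding test_norm_def INF_less_iff by auto
  then show ?thesis using that by (simp add: ennreal_less_iff)
qed

lemma test_weight_nonneg: "0 \<le> test_weight \<mu> x r \<gamma> y"
  by (simp add: test_weight_def vol_def)

lemma test_bound_add:
  assumes "test_bound \<mu> x r \<beta> \<gamma> C \<phi>" "test_bound \<mu> x r \<beta> \<gamma> C' \<psi>"
  shows "test_bound \<mu> x r \<beta> \<gamma> (C + C') (\<lambda>y. \<phi> y + \<psi> y)"
  unfolding test_bound_def
proof (intro conjI allI impI)
  fix y
  show "cmod (\<phi> y + \<psi> y) \<le> (C + C') * test_weight \<mu> x r \<gamma> y"
    using assms norm_triangle_ineq[of "\<phi> y" "\<psi> y"] unfolding test_bound_def distrib_right by (smt (verit))
next
  fix y y' assume "dist y y' \<le> (r + dist x y) / 2"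
  then have "cmod (\<phi> y - \<phi> y') \<le> C * (dist y y' / (r + dist x y)) powr \<beta> * test_weight \<mu> x r \<gamma> y"
    "cmod (\<psi> y - \<psi> y') \<le> C' * (dist y y' / (r + dist x y)) powr \<beta> * test_weight \<mu> x r \<gamma> y"
    using assms unfolding test_bound_def by blast+
  moreover have "\<phi> y + \<psi> y - (\<phi> y' + \<psi> y') = (\<phi> y - \<phi> y') + (\<psi> y - \<psi> y')" by simp
  ultimately show "cmod (\<phi> y + \<psi> y - (\<phi> y' + \<psi> y')) \<le> (C + C') * (dist y y' / (r + dist x y)) powr \<beta> * test_weight \<mu> x r \<gamma> y"
    using norm_triangle_ineq[of "\<phi> y - \<phi> y'" "\<psi> y - \<psi> y'"] unfolding distrib_right by (smt (verit))
qed

lemma test_bound_scale: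
  assumes "test_bound \<mu> x r \<beta> \<gamma> C \<phi>"
  shows "test_bound \<mu> x r \<beta> \<gamma> (cmod c * C) (\<lambda>y. c * \<phi> y)"
  using assms unfolding test_bound_def
  by (auto simp: norm_mult mult.assoc right_diff_distrib[symmetric] intro!: mult_left_mono)

lemma test_bound_mono:
  assumes "test_bound \<mu> x r \<beta> \<gamma> C \<phi>" "\<beta>' \<le> \<beta>" "\<gamma>' \<le> \<gamma>" "0 < r" "0 \<le> C"
  shows "test_bound \<mu> x r \<beta>' \<gamma>' C \<phi>"
proof -
  have w: "test_weight \<mu> x r \<gamma> y \<le> test_weight \<mu> x r \<gamma>' y" for y
    unfolding test_weight_def using assms add_pos_nonneg[of r "dist x y"]
    by (intro mult_left_mono powr_mono') (auto simp: vol_def)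
  show ?thesis unfolding test_bound_def
  proof (intro conjI allI impI)
    fix y
    show "cmod (\<phi> y) \<le> C * test_weight \<mu> x r \<gamma>' y"
      using assms(1,5) mult_left_mono[OF w[of y], of C] unfolding test_bound_def by (meson order_trans)
  next
    fix y y' assume d: "dist y y' \<le> (r + dist x y) / 2"
    have pos: "0 < r + dist x y" using assms(4) by (intro add_pos_nonneg) auto
    have "cmod (\<phi> y - \<phi> y') \<le> C * (dist y y' / (r + dist x y)) powr \<beta> * test_weight \<mu> x r \<gamma> y"
      using assms(1) d unfolding test_bound_def by blast
    also have "\<dots> \<le> C * (dist y y' / (r + dist x y)) powr \<beta>' * test_weight \<mu> x r \<gamma>' y"
    proof (intro mult_mono w mult_left_mono powr_mono' assms)
      have "dist y y' \<le> r + dist x y" using d pos by argo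
      then show "dist y y' / (r + dist x y) \<le> 1" using pos by (simp add: divide_le_eq)
    qed (use pos assms in \<open>auto simp: test_weight_nonneg\<close>)
    finally show "cmod (\<phi> y - \<phi> y') \<le> C * (dist y y' / (r + dist x y)) powr \<beta>' * test_weight \<mu> x r \<gamma>' y" .
  qed
qed

lemma test_spaceI: "test_bound \<mu> x 1 \<beta> \<gamma> C \<phi> \<Longrightarrow> 0 \<le> C \<Longrightarrow> \<phi> \<in> test_space \<mu> x 1 \<beta> \<gamma>"
  by (auto simp: test_space_def)

lemma test_space_add: "\<phi> \<in> test_space \<mu> x r \<beta> \<gamma> \<Longrightarrow> \<psi> \<in> test_space \<mu> x r \<beta> \<gamma> \<Longrightarrow> (\<lambda>y. \<phi> y + \<psi> y) \<in> test_space \<mu> x r \<beta> \<gamma>"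
  unfolding test_space_def using test_bound_add add_nonneg_nonneg by blast

lemma test_space_scale: "\<phi> \<in> test_space \<mu> x r \<beta> \<gamma> \<Longrightarrow> (\<lambda>y. c * \<phi> y) \<in> test_space \<mu> x r \<beta> \<gamma>"
proof -
  assume "\<phi> \<in> test_space \<mu> x r \<beta> \<gamma>"
  then obtain C where "0 \<le> C" "test_bound \<mu> x r \<beta> \<gamma> C \<phi>" by (auto simp: test_space_def)
  then show ?thesis
    using test_bound_scale[of \<mu> x r \<beta> \<gamma> C \<phi> c] unfolding test_space_def
    by (auto intro!: exI[of _ "cmod c * C"])
qed

lemma test_space_diff: "\<phi> \<in> test_space \<mu> x r \<beta> \<gamma> \<Longrightarrow> \<psi> \<in> test_space \<mu> x r \<beta> \<gamma> \<Longrightarrow> (\<lambda>y. \<phi> y - \<psi> y) \<in> test_space \<mu> x r \<beta> \<gamma>"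
  using test_space_add[of \<phi> \<mu> x r \<beta> \<gamma> "\<lambda>y. - 1 * \<psi> y"] test_space_scale[of \<psi> \<mu> x r \<beta> \<gamma> "- 1"] by simp

lemma test_bound_zero: "test_bound \<mu> x r \<beta> \<gamma> 0 (\<lambda>_. 0)"
  by (simp add: test_bound_def)

lemma test_space_sum: "finite A \<Longrightarrow> (\<And>i. i \<in> A \<Longrightarrow> \<phi> i \<in> test_space \<mu> x r \<beta> \<gamma>) \<Longrightarrow> (\<lambda>y. \<Sum>i\<in>A. \<phi> i y) \<in> test_space \<mu> x r \<beta> \<gamma>"
proof (induction A rule: finite_induct)
  case empty
  then show ?case using test_bound_zero[of \<mu> x r \<beta> \<gamma>] by (auto simp: test_space_def)
next
  case (insert i A)
  then show ?case using test_space_add[of "\<phi> i" \<mu> x r \<beta> \<gamma> "\<lambda>y. \<Sum>i\<in>A. \<phi> i y"] by simp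
qed

lemma dual_add: "u \<in> dual_space E N \<Longrightarrow> \<phi> \<in> E \<Longrightarrow> \<psi> \<in> E \<Longrightarrow> u (\<lambda>x. \<phi> x + \<psi> x) = u \<phi> + u \<psi>"
  by (auto simp: dual_space_def)

lemma dual_scale: "u \<in> dual_space E N \<Longrightarrow> \<phi> \<in> E \<Longrightarrow> u (\<lambda>x. c * \<phi> x) = c * u \<phi>"
  by (auto simp: dual_space_def)

lemma dual_diff:
  assumes "u \<in> dual_space (test_space \<mu> x r \<beta> \<gamma>) N" "\<phi> \<in> test_space \<mu> x r \<beta> \<gamma>" "\<psi> \<in> test_space \<mu> x r \<beta> \<gamma>"
  shows "u (\<lambda>x. \<phi> x - \<psi> x) = u \<phi> - u \<psi>"
  using dual_add[OF assms(1,2), of "\<lambda>y. - 1 * \<psi> y"] test_space_scale[OF assms(3), of "- 1"] dual_scale[OF assms(1,3), of "- 1"]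
  by simp

lemma dual_sum:
  assumes u: "u \<in> dual_space (test_space \<mu> x r \<beta> \<gamma>) N"
  shows "finite A \<Longrightarrow> (\<And>i. i \<in> A \<Longrightarrow> \<phi> i \<in> test_space \<mu> x r \<beta> \<gamma>) \<Longrightarrow> u (\<lambda>y. \<Sum>i\<in>A. \<phi> i y) = (\<Sum>i\<in>A. u (\<phi> i))"
proof (induction A rule: finite_induct)
  case empty
  have "(\<lambda>_. 0) \<in> test_space \<mu> x r \<beta> \<gamma>" using test_bound_zero[of \<mu> x r \<beta> \<gamma>] by (auto simp: test_space_def)
  then show ?case using dual_scale[OF u, of "\<lambda>_. 0" 0] by simp
next
  case (insert i A)
  then show ?case using dual_add[OF u, of "\<phi> i" "\<lambda>y. \<Sum>i\<in>A. \<phi> i y"] test_space_sum[of A \<phi> \<mu> x r \<beta> \<gamma>] by simp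
qed

text \<open>By homogeneity: \<open>\<phi>\<close> divided by \<open>C\<close> is an admissible test
  function at \<open>x\<close>.\<close>

lemma grand_tests_le:
  assumes u: "u \<in> dual_space (test_space \<mu> x1 1 1 2) N"
    and \<phi>: "\<phi> \<in> test_space \<mu> x1 1 1 2" "k \<noteq> 0 \<Longrightarrow> (\<integral>y. \<phi> y \<partial>\<mu>) = 0"
    and b: "test_bound \<mu> x (2 powr (- real k)) 1 2 C \<phi>" and C: "0 < C"
  shows "ennreal (cmod (u \<phi>)) \<le> ennreal C * (SUP \<psi>\<in>grand_tests \<mu> x1 k x. ennreal (cmod (u \<psi>)))"
proof -
  let ?\<psi> = "\<lambda>y. complex_of_real (1 / C) * \<phi> y"
  have "test_bound \<mu> x (2 powr (- real k)) 1 2 1 ?\<psi>"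
    using test_bound_scale[OF b, of "complex_of_real (1 / C)"] C by (simp add: norm_divide)
  then have "test_norm \<mu> x (2 powr (- real k)) 1 2 ?\<psi> \<le> 1"
    using test_bound_norm[of \<mu> x _ 1 2 1 ?\<psi>] by simp
  moreover have \<psi>: "?\<psi> \<in> test_space \<mu> x1 1 1 2" using \<phi>(1) by (rule test_space_scale)
  moreover have "k \<noteq> 0 \<Longrightarrow> (\<integral>y. ?\<psi> y \<partial>\<mu>) = 0" using \<phi>(2) by simp
  ultimately have "?\<psi> \<in> grand_tests \<mu> x1 k x"
    by (simp add: grand_tests_def test_space_mean_zero_def)
  then have "ennreal (cmod (u ?\<psi>)) \<le> (SUP \<psi>\<in>grand_tests \<mu> x1 k x. ennreal (cmod (u \<psi>)))"
    by (rule SUP_upper)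
  moreover have "cmod (u \<phi>) = C * cmod (u ?\<psi>)"
    using dual_scale[OF u \<phi>(1), of "complex_of_real (1 / C)"] C by (simp add: norm_mult norm_divide)
  ultimately show ?thesis using C by (simp add: ennreal_mult mult_left_mono)
qed

context doubling_measure
begin

text \<open>Measurability is not part of being a test function. It follows from continuity, since
  all \<open>y\<close> close to \<open>x\<close> fall within the range of the Holder
  condition.\<close>

lemma test_bound_measurable:
  assumes b: "test_bound \<mu> x0 r \<beta> \<gamma> C \<phi>" and r: "0 < r" and \<beta>: "0 < \<beta>"
  shows "\<phi> \<in> borel_measurable \<mu>"
proof -
  have "isCont \<phi> x" for x
  proof -
    have pos: "0 < r + dist x0 x" using r by (intro add_pos_nonneg) auto
    let ?g = "\<lambda>y. C * (dist x y / (r + dist x0 x)) powr \<beta> * test_weight \<mu> x0 r \<gamma> x"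
    have dt: "((\<lambda>y. dist x y / (r + dist x0 x)) \<longlongrightarrow> 0) (at x)"
      by (rule tendsto_eq_intros refl | use pos in simp)+
    have "(?g \<longlongrightarrow> C * 0 * test_weight \<mu> x0 r \<gamma> x) (at x)"
      using pos \<beta> by (intro tendsto_intros tendsto_zero_powrI[OF dt tendsto_const]) auto
    then have g0: "(?g \<longlongrightarrow> 0) (at x)" by simp
    have "eventually (\<lambda>y. dist y x < (r + dist x0 x) / 2) (at x)"
      using pos unfolding eventually_at by (intro exI[of _ "(r + dist x0 x) / 2"]) auto
    then have "eventually (\<lambda>y. cmod (\<phi> y - \<phi> x) \<le> ?g y) (at x)"
    proof eventually_elim
      case (elim y)
      then have "dist x y \<le> (r + dist x0 x) / 2" by (simp add: dist_commute)
      then show ?case using b unfolding test_bound_def by (metis norm_minus_commute)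
    qed
    then have "((\<lambda>y. \<phi> y - \<phi> x) \<longlongrightarrow> 0) (at x)" using g0 by (rule Lim_null_comparison)
    then show ?thesis by (simp add: isCont_def LIM_zero_iff)
  qed
  then have "\<phi> \<in> borel_measurable borel"
    by (intro borel_measurable_continuous_onI) (simp add: continuous_at_imp_continuous_on)
  then show ?thesis using measurable_cong_sets[OF sets_eq refl] by blast
qed

lemma test_weight_measurable [measurable]: "(\<lambda>y. test_weight \<mu> x r \<gamma> y) \<in> borel_measurable \<mu>"
proof -
  have "mono (V x)" by (intro monoI V_mono) simp
  then have V: "V x \<in> borel_measurable borel" by (rule borel_measurable_mono)
  have d: "(\<lambda>y. dist x y) \<in> borel_measurable \<mu>" by (subst dist_commute) measurable
  have [measurable]: "(\<lambda>y. V x (dist x y)) \<in> borel_measurable \<mu>"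
    by (rule measurable_compose[OF d V])
  show ?thesis unfolding test_weight_def using d by measurable
qed

lemma hl_Lp:
  assumes q: "0 < q" "q < p" and [measurable]: "G \<in> borel_measurable \<mu>"
  shows "epowr (\<integral>\<^sup>+x. epowr (epowr (hl (\<lambda>y. epowr (G y) q) x) (1 / q)) p \<partial>\<mu>) (1 / p) \<le>
    ennreal ((2 powr (p / q) * (p / q) / (p / q - 1) * (D * 3 powr n)) powr (1 / p)) * epowr (\<integral>\<^sup>+x. epowr (G x) p \<partial>\<mu>) (1 / p)"
proof -
  let ?c = "2 powr (p / q) * (p / q) / (p / q - 1) * (D * 3 powr n)"
  have a: "1 < p / q" using q by simp
  have c: "0 \<le> ?c" using a q D_ge by (intro mult_nonneg_nonneg divide_nonneg_pos) auto
  have "(\<integral>\<^sup>+x. epowr (epowr (hl (\<lambda>y. epowr (G y) q) x) (1 / q)) p \<partial>\<mu>) = (\<integral>\<^sup>+x. epowr (hl (\<lambda>y. epowr (G y) q) x) (p / q) \<partial>\<mu>)"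
    by (simp add: epowr_epowr)
  also have "\<dots> \<le> ennreal ?c * (\<integral>\<^sup>+x. epowr (epowr (G x) q) (p / q) \<partial>\<mu>)"
    by (rule hl_strong_type[OF _ a]) measurable
  also have "(\<integral>\<^sup>+x. epowr (epowr (G x) q) (p / q) \<partial>\<mu>) = (\<integral>\<^sup>+x. epowr (G x) p \<partial>\<mu>)"
    using q by (simp add: epowr_epowr)
  finally have "epowr (\<integral>\<^sup>+x. epowr (epowr (hl (\<lambda>y. epowr (G y) q) x) (1 / q)) p \<partial>\<mu>) (1 / p) \<le> epowr (ennreal ?c * (\<integral>\<^sup>+x. epowr (G x) p \<partial>\<mu>)) (1 / p)"
    using q by (intro epowr_mono) auto
  then show ?thesis using q c by (simp add: epowr_mult)
qed

text \<open>From \<open>epowr a q \<le> 1 + epowr a p\<close> and \<open>V x 1 \<le> V x R\<close>.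
  The bound depends on \<open>x\<close>; it serves to show that pairings are finite, not to estimate
  norms.\<close>

lemma pavg_bounded:
  assumes q: "0 < q" "q \<le> p" and [measurable]: "H \<in> borel_measurable \<mu>" and fin: "(\<integral>\<^sup>+x. epowr (H x) p \<partial>\<mu>) < top"
  shows "\<exists>B\<ge>0. \<forall>R\<ge>1. pavg q x R H \<le> ennreal B"
proof -
  let ?B = "ennreal (1 / V x 1) * (\<integral>\<^sup>+x. epowr (H x) p \<partial>\<mu>)"
  have B: "epowr (1 + ?B) (1 / q) < top"
    using fin by (simp add: less_top[symmetric] ennreal_mult_eq_top_iff)
  have "pavg q x R H \<le> epowr (1 + ?B) (1 / q)" if R: "1 \<le> R" for R
    unfolding pavg_def
  proof (rule epowr_mono)
    have "(\<integral>\<^sup>+y\<in>ball x R. epowr (H y) q \<partial>\<mu>) \<le> (\<integral>\<^sup>+y. (indicator (ball x R) y + epowr (H y) p) \<partial>\<mu>)"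
    proof (rule nn_integral_mono)
      fix y show "epowr (H y) q * indicator (ball x R) y \<le> indicator (ball x R) y + epowr (H y) p"
        using epowr_le_add_one[OF q, of "H y"] by (cases "y \<in> ball x R") auto
    qed
    also have "\<dots> = ennreal (V x R) + (\<integral>\<^sup>+y. epowr (H y) p \<partial>\<mu>)"
      by (subst nn_integral_add) (auto simp: emeasure_ball)
    also have "\<dots> \<le> ennreal (V x R) * (1 + ?B)"
    proof -
      have "V x 1 \<le> V x R" using R by (intro V_mono) simp
      then have "1 \<le> V x R * (1 / V x 1)" by simp
      then have "ennreal 1 * (\<integral>\<^sup>+y. epowr (H y) p \<partial>\<mu>) \<le> ennreal (V x R * (1 / V x 1)) * (\<integral>\<^sup>+y. epowr (H y) p \<partial>\<mu>)"
        by (intro mult_right_mono ennreal_leI) auto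
      also have "\<dots> = ennreal (V x R) * ?B" by (subst ennreal_mult) (auto simp: mult.assoc)
      finally show ?thesis by (simp add: distrib_left)
    qed
    finally show "avg x R (\<lambda>y. epowr (H y) q) \<le> 1 + ?B" using R by (subst mean_le_iff) auto
  qed (use q in auto)
  moreover obtain b where "epowr (1 + ?B) (1 / q) = ennreal b" "0 \<le> b"
    using B by (cases "epowr (1 + ?B) (1 / q)") auto
  ultimately show ?thesis by (intro exI[of _ b]) auto
qed

text \<open>The product of the constant of the dyadic decomposition, the Poincare constant, twice
  the constant from \<open>q\<close>-means to the maximal function, and a geometric series of ratio
  \<open>2 powr (s - \<gamma>)\<close>.\<close>

definition osc_const :: "real \<Rightarrow> real \<Rightarrow> real \<Rightarrow> real" where
  "osc_const s q \<gamma> = D * 2 powr n * 2 powr \<gamma> * (poincare_const s q * (2 * (D * 5 powr n) powr (1 / q)) * (1 / (1 - 2 powr (s - \<gamma>))))"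

lemma osc_const_pos: "n * (1 / q - 1) < s \<Longrightarrow> s < \<gamma> \<Longrightarrow> 0 < osc_const s q \<gamma>"
  using D_ge poincare_const_pos[of q s] powr_less_one[of 2 "s - \<gamma>"] unfolding osc_const_def
  by (intro mult_pos_pos divide_pos_pos) auto

text \<open>One reference point \<open>z\<close>, chosen at the smallest scale, serves all dilates.
  On the \<open>l\<close>-th one the Poincare inequality gives \<open>(2 ^ l * r) powr s\<close>,
  against the weight \<open>2 powr (- l * \<gamma>)\<close>, and \<open>s < \<gamma>\<close> makes
  the series converge. The \<open>q\<close>-means over all dilates are bounded by the same maximal
  function at \<open>x\<close>.\<close>

lemma weighted_oscillation:
  assumes hj: "hajlasz_on s f g E" and s: "0 < s" "s \<le> 1" and q: "0 < q" "q \<le> 1" "n * (1 / q - 1) < s"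
    and [measurable]: "g \<in> borel_measurable \<mu>" "f \<in> borel_measurable \<mu>" and E: "E \<in> null_sets \<mu>"
    and r: "0 < r" and \<gamma>: "s < \<gamma>"
  shows "\<exists>z. z \<notin> E \<and> dist x z < r \<and> ennreal (g z) \<le> pavg q x r (\<lambda>y. ennreal (g y)) \<and>
    (\<integral>\<^sup>+y. ennreal (cmod (f y - f z)) * ennreal (test_weight \<mu> x r \<gamma> y) \<partial>\<mu>) \<le>
      ennreal (osc_const s q \<gamma> * r powr s) * epowr (hl (\<lambda>y. epowr (ennreal (g y)) q) x) (1 / q)"
proof -
  let ?G = "\<lambda>y. ennreal (g y)" and ?h = "epowr (hl (\<lambda>y. epowr (ennreal (g y)) q) x) (1 / q)"
  let ?c = "(D * 5 powr n) powr (1 / q)"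
  have pav: "pavg q x R ?G \<le> ennreal ?c * ?h" if "0 < R" for R
    using q that by (intro pavg_le_hl) auto
  obtain z where z: "dist x z < r" "z \<notin> E" "?G z \<le> pavg q x r ?G"
    using exists_le_pavg[of ?G r E q x] r E q by auto
  have pc: "0 < poincare_const s q" using q by (intro poincare_const_pos) auto
  have gr: "0 < 1 - 2 powr (s - \<gamma>)" using \<gamma> powr_less_one[of 2 "s - \<gamma>"] by simp
  let ?F = "\<lambda>y. ennreal (cmod (f y - f z))"
  have "avg x (2 ^ l * r) ?F \<le> ennreal (poincare_const s q * (2 ^ l * r) powr s * (2 * ?c)) * ?h" for l
  proof -
    have lr: "0 < 2 ^ l * r" using r by simp
    have "(1::real) \<le> 2 ^ l" by simp
    then have "r \<le> 2 ^ l * r" using r by simp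
    then have zl: "dist x z < 2 ^ l * r" using z(1) by linarith
    have "(\<integral>\<^sup>+y\<in>ball x (2 ^ l * r). ?F y \<partial>\<mu>) \<le>
       ennreal (poincare_const s q * (2 ^ l * r) powr s * V x (2 ^ l * r)) * (?G z + pavg q x (2 * (2 ^ l * r)) ?G)"
      by (rule poincare[OF hj s q assms(7) E lr z(2) zl])
    also have "\<dots> \<le> ennreal (poincare_const s q * (2 ^ l * r) powr s * V x (2 ^ l * r)) * (ennreal ?c * ?h + ennreal ?c * ?h)"
      using lr by (intro mult_left_mono[OF add_mono[OF order_trans[OF z(3) pav[OF r]] pav]]) auto
    also have "ennreal ?c * ?h + ennreal ?c * ?h = ennreal (2 * ?c) * ?h"
      unfolding distrib_right[symmetric] by (subst ennreal_plus[symmetric]) simp_all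
    also have "ennreal (poincare_const s q * (2 ^ l * r) powr s * V x (2 ^ l * r)) * (ennreal (2 * ?c) * ?h) =
       ennreal ((poincare_const s q * (2 ^ l * r) powr s * V x (2 ^ l * r)) * (2 * ?c)) * ?h"
      using pc by (subst ennreal_mult[of _ "2 * ?c"]) (auto simp: mult.assoc)
    also have "(poincare_const s q * (2 ^ l * r) powr s * V x (2 ^ l * r)) * (2 * ?c) = V x (2 ^ l * r) * (poincare_const s q * (2 ^ l * r) powr s * (2 * ?c))"
      by (simp only: mult_ac)
    also have "ennreal (V x (2 ^ l * r) * (poincare_const s q * (2 ^ l * r) powr s * (2 * ?c))) * ?h =
       ennreal (V x (2 ^ l * r)) * (ennreal (poincare_const s q * (2 ^ l * r) powr s * (2 * ?c)) * ?h)"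
      using pc by (subst ennreal_mult) (auto simp: mult.assoc)
    finally show ?thesis using lr by (subst mean_le_iff) auto
  qed
  note av = this
  have "(\<integral>\<^sup>+y. ?F y * ennreal (test_weight \<mu> x r \<gamma> y) \<partial>\<mu>) \<le>
    ennreal (D * 2 powr n * 2 powr \<gamma>) * (\<Sum>l. ennreal (2 powr (- real l * \<gamma>)) * avg x (2 ^ l * r) ?F)"
    using r \<gamma> s by (intro weighted_integral_le) auto
  also have "\<dots> \<le> ennreal (D * 2 powr n * 2 powr \<gamma>) * (\<Sum>l. (ennreal (poincare_const s q * (2 * ?c) * r powr s) * ?h) * ennreal ((2 powr (s - \<gamma>)) ^ l))"
  proof (intro mult_left_mono suminf_le)
    fix l
    have "ennreal (2 powr (- real l * \<gamma>)) * avg x (2 ^ l * r) ?F \<le>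
      ennreal (2 powr (- real l * \<gamma>)) * (ennreal (poincare_const s q * (2 ^ l * r) powr s * (2 * ?c)) * ?h)"
      by (intro mult_left_mono av) auto
    also have "\<dots> = ennreal (2 powr (- real l * \<gamma>) * (poincare_const s q * (2 ^ l * r) powr s * (2 * ?c))) * ?h"
      using pc by (subst ennreal_mult) (auto simp: mult.assoc)
    also have "2 powr (- real l * \<gamma>) * (poincare_const s q * (2 ^ l * r) powr s * (2 * ?c)) =
       (poincare_const s q * (2 * ?c) * r powr s) * (2 powr (s - \<gamma>)) ^ l"
    proof -
      have "(2 powr (s - \<gamma>)) ^ l = 2 powr (- real l * \<gamma>) * (2 ^ l) powr s"
        by (simp add: powr_realpow[symmetric] powr_powr powr_add[symmetric] algebra_simps)
      then show ?thesis using r by (simp add: powr_mult)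
    qed
    also have "ennreal ((poincare_const s q * (2 * ?c) * r powr s) * (2 powr (s - \<gamma>)) ^ l) * ?h =
       (ennreal (poincare_const s q * (2 * ?c) * r powr s) * ?h) * ennreal ((2 powr (s - \<gamma>)) ^ l)"
      using pc by (subst ennreal_mult) (auto simp: mult_ac)
    finally show "ennreal (2 powr (- real l * \<gamma>)) * avg x (2 ^ l * r) ?F \<le>
      (ennreal (poincare_const s q * (2 * ?c) * r powr s) * ?h) * ennreal ((2 powr (s - \<gamma>)) ^ l)" .
  qed auto
  also have "\<dots> = ennreal (D * 2 powr n * 2 powr \<gamma>) * ((ennreal (poincare_const s q * (2 * ?c) * r powr s) * ?h) * ennreal (1 / (1 - 2 powr (s - \<gamma>))))"
    using gr by (subst ennreal_suminf_cmult, subst suminf_ennreal_geometric) auto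
  also have "\<dots> = (ennreal (D * 2 powr n * 2 powr \<gamma>) * (ennreal (poincare_const s q * (2 * ?c) * r powr s) * ennreal (1 / (1 - 2 powr (s - \<gamma>))))) * ?h"
    by (simp only: mult_ac)
  also have "ennreal (D * 2 powr n * 2 powr \<gamma>) * (ennreal (poincare_const s q * (2 * ?c) * r powr s) * ennreal (1 / (1 - 2 powr (s - \<gamma>))))
     = ennreal (D * 2 powr n * 2 powr \<gamma> * ((poincare_const s q * (2 * ?c) * r powr s) * (1 / (1 - 2 powr (s - \<gamma>)))))"
    using pc gr D_ge by (subst ennreal_mult[symmetric], simp, simp, subst ennreal_mult[symmetric]) auto
  also have "D * 2 powr n * 2 powr \<gamma> * ((poincare_const s q * (2 * ?c) * r powr s) * (1 / (1 - 2 powr (s - \<gamma>)))) = osc_const s q \<gamma> * r powr s"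
    unfolding osc_const_def by (simp only: mult_ac)
  finally show ?thesis using z by blast
qed

definition size_const :: "real \<Rightarrow> real \<Rightarrow> real \<Rightarrow> real" where
  "size_const q K \<gamma> = D * 2 powr n * 2 powr \<gamma> * (net_const q K * (1 / (1 - 2 powr (n * (1 / q - 1) - \<gamma>))))"

lemma size_const_pos: "1 \<le> K \<Longrightarrow> n * (1 / q - 1) < \<gamma> \<Longrightarrow> 0 < size_const q K \<gamma>"
  using D_ge net_const_pos[of K q] powr_less_one[of 2 "n * (1 / q - 1) - \<gamma>"] unfolding size_const_def
  by (intro mult_pos_pos divide_pos_pos) auto

text \<open>Without cancellation no power of the scale is gained, so the argument starts at scale 1.
  The growth \<open>2 powr (l * n * (1 / q - 1))\<close> of \<open>tail_integral\<close> is absorbed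
  by the decay \<open>2 powr (- l * \<gamma>)\<close>.\<close>

lemma weighted_size:
  assumes q: "0 < q" "q \<le> 1" "n * (1 / q - 1) < \<gamma>" and \<gamma>: "0 < \<gamma>" and K: "1 \<le> K"
    and [measurable]: "F \<in> borel_measurable \<mu>" "H \<in> borel_measurable \<mu>" and c: "0 \<le> c"
    and loc: "\<And>y. (\<integral>\<^sup>+z\<in>ball y 1. F z \<partial>\<mu>) \<le> ennreal (c * V y 1) * pavg q y K H"
    and B: "\<And>R. 1 \<le> R \<Longrightarrow> pavg q x R H \<le> B"
  shows "(\<integral>\<^sup>+y. F y * ennreal (test_weight \<mu> x 1 \<gamma> y) \<partial>\<mu>) \<le> ennreal (size_const q K \<gamma> * c) * B"
proof -
  let ?\<theta> = "n * (1 / q - 1)"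
  have gr: "0 < 1 - 2 powr (?\<theta> - \<gamma>)" using q powr_less_one[of 2 "?\<theta> - \<gamma>"] by simp
  have nc: "0 < net_const q K" using K by (rule net_const_pos)
  have "(\<integral>\<^sup>+y. F y * ennreal (test_weight \<mu> x 1 \<gamma> y) \<partial>\<mu>) \<le>
    ennreal (D * 2 powr n * 2 powr \<gamma>) * (\<Sum>l. ennreal (2 powr (- real l * \<gamma>)) * avg x (2 ^ l * 1) F)"
    using \<gamma> by (intro weighted_integral_le) auto
  also have "\<dots> \<le> ennreal (D * 2 powr n * 2 powr \<gamma>) * (\<Sum>l. (ennreal (net_const q K * c) * B) * ennreal ((2 powr (?\<theta> - \<gamma>)) ^ l))"
  proof (intro mult_left_mono suminf_le)
    fix l
    have "1 \<le> (K + 1) * 2 ^ l" using K mult_mono[of 1 "K + 1" 1 "2 ^ l"] by simp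
    then have "avg x (2 ^ l * 1) F \<le> ennreal (net_const q K * c * (2 ^ l * 1) powr ?\<theta>) * B"
      by (intro order_trans[OF tail_integral[OF q(1,2) K assms(6,7) c _ loc]] mult_left_mono B) auto
    then have "ennreal (2 powr (- real l * \<gamma>)) * avg x (2 ^ l * 1) F \<le> ennreal (2 powr (- real l * \<gamma>)) * (ennreal (net_const q K * c * (2 ^ l * 1) powr ?\<theta>) * B)"
      by (intro mult_left_mono) auto
    also have "\<dots> = ennreal (2 powr (- real l * \<gamma>) * (net_const q K * c * (2 ^ l * 1) powr ?\<theta>)) * B"
      using nc c by (subst ennreal_mult) (auto simp: mult.assoc)
    also have "2 powr (- real l * \<gamma>) * (net_const q K * c * (2 ^ l * 1) powr ?\<theta>) = net_const q K * c * (2 powr (?\<theta> - \<gamma>)) ^ l"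
      by (simp add: powr_realpow[symmetric] powr_powr powr_add[symmetric] algebra_simps)
    also have "ennreal (net_const q K * c * (2 powr (?\<theta> - \<gamma>)) ^ l) * B = (ennreal (net_const q K * c) * B) * ennreal ((2 powr (?\<theta> - \<gamma>)) ^ l)"
      using nc c by (subst ennreal_mult) (auto simp: mult_ac)
    finally show "ennreal (2 powr (- real l * \<gamma>)) * avg x (2 ^ l * 1) F \<le> (ennreal (net_const q K * c) * B) * ennreal ((2 powr (?\<theta> - \<gamma>)) ^ l)" .
  qed auto
  also have "\<dots> = ennreal (D * 2 powr n * 2 powr \<gamma>) * ((ennreal (net_const q K * c) * B) * ennreal (1 / (1 - 2 powr (?\<theta> - \<gamma>))))"
    using gr by (subst ennreal_suminf_cmult, subst suminf_ennreal_geometric) auto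
  also have "\<dots> = (ennreal (D * 2 powr n * 2 powr \<gamma>) * (ennreal (net_const q K * c) * ennreal (1 / (1 - 2 powr (?\<theta> - \<gamma>))))) * B"
    by (simp only: mult_ac)
  also have "ennreal (D * 2 powr n * 2 powr \<gamma>) * (ennreal (net_const q K * c) * ennreal (1 / (1 - 2 powr (?\<theta> - \<gamma>))))
     = ennreal (D * 2 powr n * 2 powr \<gamma> * ((net_const q K * c) * (1 / (1 - 2 powr (?\<theta> - \<gamma>)))))"
    using nc c gr D_ge by (subst ennreal_mult[symmetric], simp, simp, subst ennreal_mult[symmetric]) auto
  also have "D * 2 powr n * 2 powr \<gamma> * ((net_const q K * c) * (1 / (1 - 2 powr (?\<theta> - \<gamma>)))) = size_const q K \<gamma> * c"
    unfolding size_const_def by (simp only: mult_ac)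
  finally show ?thesis .
qed

text \<open>The means of the constant 1 are all 1, which leaves a geometric series of ratio
  \<open>2 powr (- \<gamma>)\<close>.\<close>

lemma test_weight_integral:
  assumes r: "0 < r" and \<gamma>: "0 < \<gamma>"
  shows "(\<integral>\<^sup>+y. ennreal (test_weight \<mu> x r \<gamma> y) \<partial>\<mu>) < top"
proof -
  have one: "avg x (2 ^ l * r) (\<lambda>_. 1) = 1" for l
  proof -
    have "0 < V x (2 ^ l * r)" using r by simp
    then show ?thesis by (simp add: mean_on_def emeasure_ball divide_ennreal del: V_pos)
  qed
  have "(\<integral>\<^sup>+y. ennreal (test_weight \<mu> x r \<gamma> y) \<partial>\<mu>) \<le> ennreal (D * 2 powr n * 2 powr \<gamma>) * (\<Sum>l. ennreal (2 powr (- real l * \<gamma>)) * avg x (2 ^ l * r) (\<lambda>_. 1))"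
    using weighted_integral_le[OF r \<gamma>, of "\<lambda>_. 1" x] by simp
  also have "\<dots> = ennreal (D * 2 powr n * 2 powr \<gamma>) * (\<Sum>l. ennreal ((2 powr (- \<gamma>)) ^ l))"
    unfolding one by (simp add: powr_realpow[symmetric] powr_powr mult.commute[of \<gamma>])
  also have "\<dots> < top"
    using \<gamma> powr_less_one[of 2 "- \<gamma>"] by (subst suminf_ennreal_geometric) (auto simp: ennreal_mult_less_top)
  finally show ?thesis .
qed

lemma test_bound_integrable:
  assumes b: "test_bound \<mu> x r \<beta> \<gamma> C \<phi>" and "0 < r" "0 < \<beta>" "0 < \<gamma>"
  shows "integrable \<mu> \<phi>"
proof (rule integrableI_bounded)
  show "\<phi> \<in> borel_measurable \<mu>" using test_bound_measurable[OF b] assms by auto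
  have "(\<integral>\<^sup>+y. ennreal (cmod (\<phi> y)) \<partial>\<mu>) \<le> (\<integral>\<^sup>+y. ennreal \<bar>C\<bar> * ennreal (test_weight \<mu> x r \<gamma> y) \<partial>\<mu>)"
  proof (rule nn_integral_mono)
    fix y
    have "cmod (\<phi> y) \<le> C * test_weight \<mu> x r \<gamma> y" using b by (simp add: test_bound_def)
    also have "\<dots> \<le> \<bar>C\<bar> * test_weight \<mu> x r \<gamma> y" by (intro mult_right_mono test_weight_nonneg) auto
    finally show "ennreal (cmod (\<phi> y)) \<le> ennreal \<bar>C\<bar> * ennreal (test_weight \<mu> x r \<gamma> y)"
      by (subst ennreal_mult[symmetric]) (auto simp: test_weight_nonneg intro: ennreal_leI)
  qed
  also have "\<dots> < \<infinity>" using test_weight_integral[of r \<gamma> x] assms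
    by (subst nn_integral_cmult) (auto simp: ennreal_mult_less_top)
  finally show "(\<integral>\<^sup>+y. ennreal (cmod (\<phi> y)) \<partial>\<mu>) < \<infinity>" .
qed

text \<open>The first factor is the reciprocal of the least size of the weight near the support, up
  to \<open>V z r\<close>. The last one converts distances measured in units of \<open>r\<close>
  into units of \<open>r + dist x y\<close>.\<close>

definition bump_const :: "real \<Rightarrow> real \<Rightarrow> real \<Rightarrow> real" where
  "bump_const K \<beta> \<gamma> = (2 * D * (5 * K + 2) powr n * (4 * K + 2) powr \<gamma>) * (4 * K + 2) powr \<beta>"

lemma bump_const_pos: "1 \<le> K \<Longrightarrow> 0 < bump_const K \<beta> \<gamma>"
  using D_ge by (simp add: bump_const_def)

text \<open>Wherever one of the two conditions is not trivial, \<open>y\<close> lies within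
  \<open>(4 * K + 1) * r\<close> of \<open>x\<close>. There \<open>r + dist x y\<close> is
  comparable with \<open>r\<close>, and the weight with \<open>1 / V z r\<close>.\<close>

lemma bump_test_bound:
  assumes r: "0 < r" and \<beta>: "0 < \<beta>" and \<gamma>: "0 < \<gamma>" and K: "1 \<le> K" and xz: "dist x z \<le> K * r"
    and supp: "\<And>y. \<phi> y \<noteq> 0 \<Longrightarrow> dist z y \<le> K * r" and A: "0 \<le> A" "\<And>y. cmod (\<phi> y) \<le> A"
    and hol: "\<And>y y'. cmod (\<phi> y - \<phi> y') \<le> A * (dist y y' / r) powr \<beta>"
  shows "test_bound \<mu> x r \<beta> \<gamma> (bump_const K \<beta> \<gamma> * A * V z r) \<phi>"
proof -
  let ?b = "2 * D * (5 * K + 2) powr n * (4 * K + 2) powr \<gamma>"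
  have b: "0 < ?b" using D_ge K by simp
  have vz: "0 < V z r" using r by simp
  have one: "1 \<le> (4 * K + 2) powr \<beta>" using K \<beta> by (intro ge_one_powr_ge_zero) auto
  have w: "1 / (?b * V z r) \<le> test_weight \<mu> x r \<gamma> y" if y: "dist x y \<le> (4 * K + 1) * r" for y
  proof -
    have y': "dist x y \<le> (4 * K + 2) * r" using y r by (simp add: algebra_simps)
    have 1: "r \<le> (4 * K + 2) * r" using K r by simp
    have "V x r + V x (dist x y) \<le> V x ((4 * K + 2) * r) + V x ((4 * K + 2) * r)"
      using 1 y' by (intro add_mono V_mono) auto
    moreover have "V x ((4 * K + 2) * r) \<le> D * (5 * K + 2) powr n * V z r"
      using xz r K by (intro V_le) (auto simp: algebra_simps)
    ultimately have v: "V x r + V x (dist x y) \<le> 2 * D * (5 * K + 2) powr n * V z r" by simp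
    have v0: "0 < V x r + V x (dist x y)" using r by (intro add_pos_nonneg) auto
    have pos: "0 < r + dist x y" using r by (intro add_pos_nonneg) auto
    have "r + dist x y \<le> (4 * K + 2) * r" using y by (simp add: algebra_simps)
    then have "1 / (4 * K + 2) \<le> r / (r + dist x y)" using pos K by (simp add: divide_simps mult.commute)
    then have "(1 / (4 * K + 2)) powr \<gamma> \<le> (r / (r + dist x y)) powr \<gamma>" using K \<gamma> by (intro powr_mono2) auto
    moreover have "1 / (2 * D * (5 * K + 2) powr n * V z r) \<le> 1 / (V x r + V x (dist x y))"
      using v v0 D_ge vz K by (intro divide_left_mono mult_pos_pos) auto
    ultimately have "1 / (2 * D * (5 * K + 2) powr n * V z r) * (1 / (4 * K + 2)) powr \<gamma> \<le> test_weight \<mu> x r \<gamma> y"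
      unfolding test_weight_def using v0 by (intro mult_mono) auto
    moreover have "1 / (2 * D * (5 * K + 2) powr n * V z r) * (1 / (4 * K + 2)) powr \<gamma> = 1 / (?b * V z r)"
      using K by (simp add: powr_divide)
    ultimately show ?thesis by simp
  qed
  \<comment> \<open>Both conditions follow from this: the size with \<open>c = c' = 1\<close>, the
    Holder condition with the two normalised distances raised to \<open>\<beta>\<close>.\<close>
  have *: "A * c \<le> bump_const K \<beta> \<gamma> * A * V z r * c' * test_weight \<mu> x r \<gamma> y"
    if "dist x y \<le> (4 * K + 1) * r" "0 \<le> c" "c \<le> (4 * K + 2) powr \<beta> * c'" for y c c'
  proof -
    have "1 \<le> test_weight \<mu> x r \<gamma> y * (?b * V z r)"
      using w[OF that(1)] by (simp only: pos_divide_le_eq[OF mult_pos_pos[OF b vz]])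
    then have 1: "1 \<le> ?b * V z r * test_weight \<mu> x r \<gamma> y" by (simp only: mult.commute)
    have "A * c * 1 \<le> A * c * (?b * V z r * test_weight \<mu> x r \<gamma> y)"
      by (rule mult_left_mono[OF 1 mult_nonneg_nonneg[OF A(1) that(2)]])
    also have "\<dots> \<le> A * ((4 * K + 2) powr \<beta> * c') * (?b * V z r * test_weight \<mu> x r \<gamma> y)"
      by (rule mult_right_mono[OF mult_left_mono[OF that(3) A(1)] order_trans[OF zero_le_one 1]])
    also have "\<dots> = bump_const K \<beta> \<gamma> * A * V z r * c' * test_weight \<mu> x r \<gamma> y"
      unfolding bump_const_def by (simp only: mult_ac)
    finally show ?thesis by simp
  qed
  have bc: "0 \<le> bump_const K \<beta> \<gamma>" using bump_const_pos[OF K, of \<beta> \<gamma>] by simp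
  show ?thesis unfolding test_bound_def
  proof (intro conjI allI impI)
    fix y
    show "cmod (\<phi> y) \<le> bump_const K \<beta> \<gamma> * A * V z r * test_weight \<mu> x r \<gamma> y"
    proof (cases "\<phi> y = 0")
      case False
      have "dist x y \<le> K * r + K * r" using supp[OF False] xz dist_triangle[of x y z] by linarith
      also have "\<dots> \<le> (4 * K + 1) * r" using K r by (simp add: algebra_simps)
      finally show ?thesis using *[of y 1 1] one A(2)[of y] by simp
    qed (use bc A test_weight_nonneg[of \<mu> x r \<gamma> y] in simp)
  next
    fix y y' assume d: "dist y y' \<le> (r + dist x y) / 2"
    show "cmod (\<phi> y - \<phi> y') \<le> bump_const K \<beta> \<gamma> * A * V z r * (dist y y' / (r + dist x y)) powr \<beta> * test_weight \<mu> x r \<gamma> y"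
    proof (cases "\<phi> y = \<phi> y'")
      case False
      \<comment> \<open>If only \<open>y'\<close> lies in the support, \<open>dist x y\<close> is at
        most \<open>2 * K * r\<close> plus half of \<open>r + dist x y\<close>. Solving for
        \<open>dist x y\<close> gives the constant.\<close>
      have "dist x y \<le> (4 * K + 1) * r"
      proof (cases "\<phi> y = 0")
        case True
        then have "\<phi> y' \<noteq> 0" using False by auto
        then have "dist x y' \<le> K * r + K * r" using supp[of y'] xz dist_triangle[of x y' z] by linarith
        then show ?thesis using d dist_triangle2[of x y y'] by (simp add: algebra_simps)
      next
        case False
        have "dist x y \<le> K * r + K * r" using supp[OF False] xz dist_triangle[of x y z] by linarith
        also have "\<dots> \<le> (4 * K + 1) * r" using K r by (simp add: algebra_simps)
        finally show ?thesis .
      qed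
      moreover have "(dist y y' / r) powr \<beta> \<le> (4 * K + 2) powr \<beta> * (dist y y' / (r + dist x y)) powr \<beta>"
      proof -
        have pos: "0 < r + dist x y" using r by (intro add_pos_nonneg) auto
        have "r + dist x y \<le> (4 * K + 2) * r" using calculation by (simp add: algebra_simps)
        then have "dist y y' * (r + dist x y) \<le> dist y y' * ((4 * K + 2) * r)" by (intro mult_left_mono) auto
        then have "dist y y' / r \<le> (4 * K + 2) * (dist y y' / (r + dist x y))"
          using pos r by (simp add: divide_simps mult_ac)
        then have "(dist y y' / r) powr \<beta> \<le> ((4 * K + 2) * (dist y y' / (r + dist x y))) powr \<beta>"
          using r \<beta> by (intro powr_mono2) auto
        also have "\<dots> = (4 * K + 2) powr \<beta> * (dist y y' / (r + dist x y)) powr \<beta>"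
          by (rule powr_mult)
        finally show ?thesis .
      qed
      ultimately show ?thesis using *[of y "(dist y y' / r) powr \<beta>" "(dist y y' / (r + dist x y)) powr \<beta>"] hol[of y y'] by simp
    qed (use bc A test_weight_nonneg[of \<mu> x r \<gamma> y] in simp)
  qed
qed

text \<open>The bump is regarded as one of scale 1 around \<open>x1\<close>, with \<open>K\<close>
  large enough to reach its support. The resulting constant is poor, but only membership is at
  stake.\<close>

lemma bump_in_test_space:
  assumes \<beta>: "0 < \<beta>" and \<gamma>: "0 < \<gamma>" and supp: "\<And>y. \<phi> y \<noteq> 0 \<Longrightarrow> dist z y \<le> R" and A: "\<And>y. cmod (\<phi> y) \<le> A"
    and hol: "\<And>y y'. cmod (\<phi> y - \<phi> y') \<le> L * dist y y' powr \<beta>"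
  shows "\<phi> \<in> test_space \<mu> x1 1 \<beta> \<gamma>"
proof -
  define K where "K = Max {1, R, dist x1 z}"
  have K: "1 \<le> K" "R \<le> K" "dist x1 z \<le> K" by (auto simp: K_def)
  have A0: "0 \<le> A" using A[of z] norm_ge_zero order_trans by blast
  have "test_bound \<mu> x1 1 \<beta> \<gamma> (bump_const K \<beta> \<gamma> * max A L * V z 1) \<phi>"
  proof (rule bump_test_bound)
    fix y y'
    have "cmod (\<phi> y - \<phi> y') \<le> L * dist y y' powr \<beta>" by (rule hol)
    also have "\<dots> \<le> max A L * dist y y' powr \<beta>" by (intro mult_right_mono) auto
    finally show "cmod (\<phi> y - \<phi> y') \<le> max A L * (dist y y' / 1) powr \<beta>" by simp
    show "\<phi> y \<noteq> 0 \<Longrightarrow> dist z y \<le> K * 1" using supp[of y] K by simp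
    show "cmod (\<phi> y) \<le> max A L" using A[of y] by simp
  qed (use \<beta> \<gamma> K A0 in auto)
  moreover have "0 \<le> bump_const K \<beta> \<gamma> * max A L * V z 1"
    using bump_const_pos[OF K(1), of \<beta> \<gamma>] A0 by (intro mult_nonneg_nonneg) auto
  ultimately show ?thesis by (rule test_spaceI)
qed

lemma bump_integrable:
  assumes "0 < \<beta>" "\<And>y. \<phi> y \<noteq> 0 \<Longrightarrow> dist z y \<le> R" "\<And>y. cmod (\<phi> y) \<le> A"
    "\<And>y y'. cmod (\<phi> y - \<phi> y') \<le> L * dist y y' powr \<beta>"
  shows "integrable \<mu> \<phi>"
proof -
  have "\<phi> \<in> test_space \<mu> z 1 \<beta> 1" using assms by (intro bump_in_test_space[of \<beta> 1 \<phi> z R A L]) auto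
  then obtain C where "test_bound \<mu> z 1 \<beta> 1 C \<phi>" by (auto simp: test_space_def)
  then show ?thesis by (rule test_bound_integrable) (use assms in auto)
qed

end

section \<open>The function represented by a functional\<close>

definition tent :: "real \<Rightarrow> 'a::metric_space \<Rightarrow> 'a \<Rightarrow> real" where
  "tent r z y = max 0 (1 - dist z y / r)"

lemma tent_nonneg [simp]: "0 \<le> tent r z y"
  by (simp add: tent_def)

lemma tent_le_1 [simp]: "0 < r \<Longrightarrow> tent r z y \<le> 1"
  by (simp add: tent_def)

lemma tent_nonzero: "0 < r \<Longrightarrow> tent r z y \<noteq> 0 \<Longrightarrow> dist z y < r"
  by (simp add: tent_def max_def divide_simps split: if_splits)

lemma tent_lipschitz:
  assumes "0 < r" shows "\<bar>tent r z y - tent r z y'\<bar> \<le> dist y y' / r"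
proof -
  have "\<bar>dist z y / r - dist z y' / r\<bar> \<le> dist y y' / r"
    using assms abs_dist_diff_le[of y z y'] by (simp add: diff_divide_distrib[symmetric] divide_right_mono dist_commute)
  then show ?thesis unfolding tent_def by linarith
qed

lemma tent_ge_half: "0 < r \<Longrightarrow> dist z y \<le> r / 2 \<Longrightarrow> 1 / 2 \<le> tent r z y"
  by (simp add: tent_def le_max_iff_disj divide_simps)

context doubling_measure
begin

lemma tent_measurable [measurable]: "tent r z \<in> borel_measurable \<mu>"
  unfolding tent_def by (subst dist_commute) measurable

lemma tent_integrable: "0 < r \<Longrightarrow> integrable \<mu> (tent r z)"
proof (rule integrableI_bounded)
  assume r: "0 < r"
  have "(\<integral>\<^sup>+y. ennreal (norm (tent r z y)) \<partial>\<mu>) \<le> (\<integral>\<^sup>+y. indicator (ball z r) y \<partial>\<mu>)"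
  proof (rule nn_integral_mono)
    fix y show "ennreal (norm (tent r z y)) \<le> indicator (ball z r) y"
      using tent_nonzero[OF r, of z y] r by (cases "tent r z y = 0") auto
  qed
  also have "\<dots> < \<infinity>" using r by (simp add: emeasure_ball)
  finally show "(\<integral>\<^sup>+y. ennreal (norm (tent r z y)) \<partial>\<mu>) < \<infinity>" .
qed measurable

lemma tent_integral_ge:
  assumes r: "0 < r"
  shows "V z r \<le> (2 * (D * 2 powr n)) * (\<integral>y. tent r z y \<partial>\<mu>)"
proof -
  have "V z r \<le> D * 2 powr n * V z (r / 2)" using r by (intro V_le) auto
  also have "V z (r / 2) = (\<integral>y. indicator (ball z (r / 2)) y \<partial>\<mu>)" by (simp add: vol_def)
  also have "\<dots> \<le> (\<integral>y. 2 * tent r z y \<partial>\<mu>)"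
  proof (rule integral_mono)
    show "integrable \<mu> (indicator (ball z (r / 2)) :: 'a \<Rightarrow> real)"
      using ball_finite[of "r / 2" z] r by (simp add: integrable_indicator_iff)
    fix y show "indicator (ball z (r / 2)) y \<le> 2 * tent r z y"
      using tent_ge_half[OF r, of z y] by (cases "y \<in> ball z (r / 2)") auto
  qed (use tent_integrable[OF r] in auto)
  finally show ?thesis using D_ge by (simp add: mult_left_mono mult_ac)
qed

text \<open>With integral 1, differences of two such bumps have mean zero and become grand test
  functions at positive levels \<open>k\<close>.\<close>

definition rho :: "real \<Rightarrow> 'a \<Rightarrow> 'a \<Rightarrow> complex" where
  "rho r z y = complex_of_real (tent r z y / (\<integral>y. tent r z y \<partial>\<mu>))"

lemma tent_integral_pos: "0 < r \<Longrightarrow> 0 < (\<integral>y. tent r z y \<partial>\<mu>)"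
  using tent_integral_ge[of r z] V_pos[of r z] D_ge
  by (smt (verit) mult_nonneg_nonpos powr_ge_zero mult_nonneg_nonneg)

lemma rho_integral: "0 < r \<Longrightarrow> (\<integral>y. rho r z y \<partial>\<mu>) = 1"
  using tent_integral_pos[of r z] unfolding rho_def by (simp add: integral_complex_of_real)

lemma rho_bounds:
  assumes r: "0 < r"
  shows "rho r z y \<noteq> 0 \<Longrightarrow> dist z y < r"
    and "cmod (rho r z y) \<le> 2 * (D * 2 powr n) / V z r"
    and "cmod (rho r z y - rho r z y') \<le> 2 * (D * 2 powr n) / V z r * (dist y y' / r)"
proof -
  let ?I = "\<integral>y. tent r z y \<partial>\<mu>"
  have I: "0 < ?I" and v: "0 < V z r" using r tent_integral_pos by auto
  have inv: "1 / ?I \<le> 2 * (D * 2 powr n) / V z r"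
    using tent_integral_ge[OF r, of z] I v by (simp add: divide_simps mult_ac)
  show "rho r z y \<noteq> 0 \<Longrightarrow> dist z y < r" using tent_nonzero[OF r] by (auto simp: rho_def)
  have "cmod (rho r z y) = tent r z y * (1 / ?I)" using I less_imp_le[OF I] by (simp add: rho_def norm_divide)
  also have "\<dots> \<le> 1 * (2 * (D * 2 powr n) / V z r)" using r I inv by (intro mult_mono) auto
  finally show "cmod (rho r z y) \<le> 2 * (D * 2 powr n) / V z r" by simp
  have "rho r z y - rho r z y' = complex_of_real ((tent r z y - tent r z y') * (1 / ?I))"
    by (simp add: rho_def diff_divide_distrib)
  then have "cmod (rho r z y - rho r z y') = \<bar>tent r z y - tent r z y'\<bar> * (1 / ?I)"
    using I by (simp only: norm_of_real abs_mult) simp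
  also have "\<dots> \<le> (dist y y' / r) * (2 * (D * 2 powr n) / V z r)"
    using r I inv by (intro mult_mono tent_lipschitz) auto
  finally show "cmod (rho r z y - rho r z y') \<le> 2 * (D * 2 powr n) / V z r * (dist y y' / r)" by (simp only: mult.commute)
qed

definition rho_const :: "real \<Rightarrow> real" where
  "rho_const K = bump_const K 1 2 * (4 * (D * 2 powr n)\<^sup>2)"

lemma rho_const_pos: "1 \<le> K \<Longrightarrow> 0 < rho_const K"
  using D_ge bump_const_pos[of K 1 2] by (simp add: rho_const_def)

text \<open>The freedom of \<open>r'\<close> between \<open>r / 2\<close> and \<open>r\<close> lets
  bumps of two consecutive dyadic scales be measured at the same scale.\<close>

lemma rho_test_bound:
  assumes r: "0 < r'" "r' \<le> r" "r \<le> 2 * r'" and K: "1 \<le> K" and xz: "dist x z \<le> K * r"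
  shows "test_bound \<mu> x r 1 2 (rho_const K) (rho r' z)"
proof -
  let ?A = "2 * (2 * (D * 2 powr n) / V z r')"
  have r0: "0 < r" and v: "0 < V z r'" using r by auto
  have b: "test_bound \<mu> x r 1 2 (bump_const K 1 2 * ?A * V z r) (rho r' z)"
  proof (rule bump_test_bound)
    fix y assume "rho r' z y \<noteq> 0"
    then have "dist z y < r'" by (rule rho_bounds(1)[OF r(1)])
    also have "r' \<le> K * r" using r r0 K mult_mono[of 1 K r' r] by simp
    finally show "dist z y \<le> K * r" by simp
  next
    fix y
    have "0 \<le> 2 * (D * 2 powr n) / V z r'" using D_ge v by simp
    then show "cmod (rho r' z y) \<le> ?A" using rho_bounds(2)[OF r(1), of z y] by linarith
  next
    fix y y'
    have "cmod (rho r' z y - rho r' z y') \<le> 2 * (D * 2 powr n) / V z r' * (dist y y' / r')"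
      by (rule rho_bounds(3)[OF r(1)])
    also have "\<dots> \<le> 2 * (D * 2 powr n) / V z r' * (2 * (dist y y' / r))"
    proof (rule mult_left_mono)
      have "dist y y' * r \<le> dist y y' * (2 * r')" using r by (intro mult_left_mono) auto
      then show "dist y y' / r' \<le> 2 * (dist y y' / r)" using r r0 by (simp add: divide_simps mult_ac)
    qed (use D_ge v in auto)
    finally show "cmod (rho r' z y - rho r' z y') \<le> ?A * (dist y y' / r) powr 1" using r0 by (simp add: mult_ac)
  qed (use r r0 K xz D_ge v in auto)
  have "V z r \<le> D * 2 powr n * V z r'" using r by (intro V_le) auto
  then have "V z r / V z r' \<le> D * 2 powr n" using v by (simp add: divide_le_eq)
  then have "bump_const K 1 2 * (4 * (D * 2 powr n)) * (V z r / V z r') \<le> bump_const K 1 2 * (4 * (D * 2 powr n)) * (D * 2 powr n)"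
    using bump_const_pos[OF K, of 1 2] D_ge by (intro mult_left_mono) auto
  then have le: "bump_const K 1 2 * ?A * V z r \<le> rho_const K"
    unfolding rho_const_def power2_eq_square by (simp add: mult_ac)
  show ?thesis
    unfolding test_bound_def
  proof (intro conjI allI impI)
    fix y
    have "cmod (rho r' z y) \<le> bump_const K 1 2 * ?A * V z r * test_weight \<mu> x r 2 y"
      using b unfolding test_bound_def by blast
    also have "\<dots> \<le> rho_const K * test_weight \<mu> x r 2 y"
      by (intro mult_right_mono le test_weight_nonneg)
    finally show "cmod (rho r' z y) \<le> rho_const K * test_weight \<mu> x r 2 y" .
  next
    fix y y' assume "dist y y' \<le> (r + dist x y) / 2"
    then have "cmod (rho r' z y - rho r' z y') \<le> bump_const K 1 2 * ?A * V z r * (dist y y' / (r + dist x y)) powr 1 * test_weight \<mu> x r 2 y"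
      using b unfolding test_bound_def by blast
    also have "\<dots> \<le> rho_const K * (dist y y' / (r + dist x y)) powr 1 * test_weight \<mu> x r 2 y"
      by (intro mult_right_mono le test_weight_nonneg powr_ge_zero)
    finally show "cmod (rho r' z y - rho r' z y') \<le> rho_const K * (dist y y' / (r + dist x y)) powr 1 * test_weight \<mu> x r 2 y" .
  qed
qed

lemma rho_test_space:
  assumes r: "0 < r" shows "rho r z \<in> test_space \<mu> x1 1 1 2"
proof (rule bump_in_test_space)
  fix y y'
  show "cmod (rho r z y - rho r z y') \<le> 2 * (D * 2 powr n) / V z r / r * dist y y' powr 1"
    using rho_bounds(3)[OF r, of z y y'] by simp
  show "rho r z y \<noteq> 0 \<Longrightarrow> dist z y \<le> r" using rho_bounds(1)[OF r, of z y] by auto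
  show "cmod (rho r z y) \<le> 2 * (D * 2 powr n) / V z r" by (rule rho_bounds(2)[OF r])
qed auto

lemma rho_integrable: "0 < r \<Longrightarrow> integrable \<mu> (rho r z)"
  using tent_integrable[of r z] unfolding rho_def by auto

text \<open>Twice the constant by which \<open>hr x\<close> controls the distance from
  \<open>F x\<close> to the value of \<open>u\<close> on a bump, plus 1 so that \<open>g\<close>
  dominates \<open>hr\<close>.\<close>

definition maj_const :: "real \<Rightarrow> real" where
  "maj_const s = 4 * rho_const 1 + 4 * rho_const 1 / (1 - 2 powr (- s)) + 1"

end

text \<open>The grand maximal function need not be measurable. The construction works with one fixed
  measurable majorant, and the infimum over majorants is taken only at the end.\<close>

locale grand_majorant = doubling_measure +
  fixes x1 :: 'a and s p :: real and u :: "('a \<Rightarrow> complex) \<Rightarrow> complex" and h :: "'a \<Rightarrow> ennreal"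
  assumes s: "0 < s" "s \<le> 1" and p: "0 < p"
    and u: "u \<in> dual_space (test_space \<mu> x1 1 1 2) (test_norm \<mu> x1 1 1 2)"
    and h_measurable [measurable]: "h \<in> borel_measurable \<mu>"
    and maj: "(SUP k. ennreal (2 powr (real k * s)) * (SUP \<phi>\<in>grand_tests \<mu> x1 k x. ennreal (cmod (u \<phi>)))) \<le> h x"
    and h_Lp: "(\<integral>\<^sup>+x. epowr (h x) p \<partial>\<mu>) < top"
begin

definition E :: "'a set" where "E = {x. h x = top}"

text \<open>On \<open>E\<close> this is 0, since \<open>enn2real\<close> maps \<open>top\<close> to
  0; every pointwise estimate excludes \<open>E\<close>, a null set.\<close>

definition hr :: "'a \<Rightarrow> real" where "hr x = enn2real (h x)"

lemma hr: "x \<notin> E \<Longrightarrow> h x = ennreal (hr x)" "0 \<le> hr x"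
  by (auto simp: E_def hr_def less_top)

lemma hr_measurable [measurable]: "hr \<in> borel_measurable \<mu>"
  unfolding hr_def by measurable

lemma E_null: "E \<in> null_sets \<mu>"
proof -
  have [measurable]: "E \<in> sets \<mu>"
    unfolding E_def using measurable_sets[OF h_measurable, of "{top}"] by (simp add: vimage_def)
  have "AE x in \<mu>. epowr (h x) p \<noteq> \<infinity>"
    using h_Lp by (intro nn_integral_PInf_AE) auto
  then have "AE x in \<mu>. x \<notin> E" by (simp add: E_def)
  then show ?thesis by (subst (asm) AE_iff_null_sets[symmetric]) auto
qed

lemma u_le:
  assumes \<phi>: "\<phi> \<in> test_space \<mu> x1 1 1 2" "k \<noteq> 0 \<Longrightarrow> (\<integral>y. \<phi> y \<partial>\<mu>) = 0"
    and b: "test_bound \<mu> x (2 powr (- real k)) 1 2 C \<phi>" and C: "0 < C"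
  shows "ennreal (cmod (u \<phi>)) \<le> ennreal (C * 2 powr (- real k * s)) * h x"
proof -
  let ?S = "SUP \<phi>\<in>grand_tests \<mu> x1 k x. ennreal (cmod (u \<phi>))"
  have "ennreal (2 powr (real k * s)) * ?S \<le> h x"
    by (rule order_trans[OF _ maj]) (rule SUP_upper, simp)
  then have "ennreal (2 powr (- real k * s)) * (ennreal (2 powr (real k * s)) * ?S) \<le> ennreal (2 powr (- real k * s)) * h x"
    by (rule mult_left_mono) simp
  also have "ennreal (2 powr (- real k * s)) * (ennreal (2 powr (real k * s)) * ?S) = ?S"
    by (simp add: mult.assoc[symmetric] ennreal_mult[symmetric] powr_add[symmetric])
  finally have "ennreal C * ?S \<le> ennreal C * (ennreal (2 powr (- real k * s)) * h x)"
    by (rule mult_left_mono) simp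
  then show ?thesis using grand_tests_le[OF u \<phi> b C] C by (simp add: ennreal_mult mult.assoc)
qed

lemma u_le_real:
  assumes "\<phi> \<in> test_space \<mu> x1 1 1 2" "k \<noteq> 0 \<Longrightarrow> (\<integral>y. \<phi> y \<partial>\<mu>) = 0"
    "test_bound \<mu> x (2 powr (- real k)) 1 2 C \<phi>" "0 < C" "x \<notin> E"
  shows "cmod (u \<phi>) \<le> C * 2 powr (- real k * s) * hr x"
proof -
  have "ennreal (cmod (u \<phi>)) \<le> ennreal (C * 2 powr (- real k * s)) * ennreal (hr x)"
    using u_le[OF assms(1-4)] hr(1)[OF assms(5)] by simp
  also have "\<dots> = ennreal (C * 2 powr (- real k * s) * hr x)"
    using assms(4) hr(2) by (simp add: ennreal_mult)
  finally show ?thesis using assms(4) hr(2)[of x] by (simp add: ennreal_le_iff)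
qed

text \<open>The difference of two normalised bumps has mean zero, so it may be tested at level
  \<open>k\<close> at any \<open>x\<close> that is close to both centres. This compares the values
  of \<open>u\<close> at one scale with different centres as well as at two consecutive
  scales.\<close>

lemma u_rho_diff:
  assumes K: "1 \<le> K" and x: "x \<notin> E" "dist x z \<le> K * 2 powr (- real k)" "dist x z' \<le> K * 2 powr (- real k)"
    and r: "r = 2 powr (- real k)" "r' = r \<or> r' = r / 2"
  shows "cmod (u (rho r' z') - u (rho r z)) \<le> 2 * rho_const K * 2 powr (- real k * s) * hr x"
proof -
  have "0 < r" using r(1) by simp
  then have r0: "0 < r" "0 < r'" "r' \<le> r" "r \<le> 2 * r'" using r(2) by auto
  have t: "rho r' z' \<in> test_space \<mu> x1 1 1 2" "rho r z \<in> test_space \<mu> x1 1 1 2"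
    using r0 by (auto intro: rho_test_space)
  have "test_bound \<mu> x r 1 2 (rho_const K + cmod (- 1) * rho_const K) (\<lambda>y. rho r' z' y + - 1 * rho r z y)"
    using K x r0 r(1) by (intro test_bound_add test_bound_scale rho_test_bound) auto
  then have b: "test_bound \<mu> x (2 powr (- real k)) 1 2 (2 * rho_const K) (\<lambda>y. rho r' z' y - rho r z y)"
    by (simp add: r(1))
  have "cmod (u (\<lambda>y. rho r' z' y - rho r z y)) \<le> 2 * rho_const K * 2 powr (- real k * s) * hr x"
  proof (rule u_le_real[OF _ _ b])
    show "(\<lambda>y. rho r' z' y - rho r z y) \<in> test_space \<mu> x1 1 1 2" using t by (rule test_space_diff)
    show "(\<integral>y. rho r' z' y - rho r z y \<partial>\<mu>) = 0"
      using rho_integrable r0 by (simp add: rho_integral)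
    show "0 < 2 * rho_const K" using rho_const_pos[OF K] by simp
  qed (use x in auto)
  then show ?thesis using dual_diff[OF u t] by simp
qed

lemma u_rho_0:
  assumes "x \<notin> E" "dist x z \<le> 1"
  shows "cmod (u (rho 1 z)) \<le> rho_const 1 * hr x"
  using u_le_real[of "rho 1 z" 0 x "rho_const 1"] rho_test_bound[of 1 1 1 x z] rho_test_space[of 1 z x1]
    rho_const_pos[of 1] assms by simp

text \<open>Rounding \<open>x\<close> to a countable dense set makes the approximants measurable.\<close>
definition idx :: "nat \<Rightarrow> 'a \<Rightarrow> nat" where
  "idx k x = (LEAST i. dist x (dn i) < 2 powr (- real k))"

lemma idx: "dist x (dn (idx k x)) < 2 powr (- real k)"
proof -
  obtain i where "dist x (dn i) < 2 powr (- real k)" using dn_dense[of "2 powr (- real k)" x] by auto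
  then show ?thesis unfolding idx_def by (rule LeastI)
qed

lemma idx_measurable [measurable]: "idx k \<in> measurable \<mu> (count_space UNIV)"
  unfolding idx_def by measurable

definition fk :: "nat \<Rightarrow> 'a \<Rightarrow> complex" where
  "fk k x = u (rho (2 powr (- real k)) (dn (idx k x)))"

lemma fk_measurable [measurable]: "fk k \<in> borel_measurable \<mu>"
  unfolding fk_def by (rule measurable_compose[OF idx_measurable]) simp

lemma fk_step: "x \<notin> E \<Longrightarrow> cmod (fk (Suc k) x - fk k x) \<le> 2 * rho_const 1 * hr x * (2 powr (- s)) ^ k"
proof -
  assume x: "x \<notin> E"
  have half: "2 powr (- real (Suc k)) = 2 powr (- real k) / 2" by (simp add: powr_diff powr_minus_divide powr_add)
  have "dist x (dn (idx (Suc k) x)) \<le> 2 powr (- real k)"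
    using idx[of x "Suc k"] unfolding half by (smt (verit) field_sum_of_halves powr_ge_zero)
  then have "cmod (fk (Suc k) x - fk k x) \<le> 2 * rho_const 1 * 2 powr (- real k * s) * hr x"
    unfolding fk_def using x idx[of x k] half by (intro u_rho_diff) auto
  also have "2 powr (- real k * s) = (2 powr (- s)) ^ k"
    by (simp add: powr_realpow[symmetric] powr_powr mult.commute)
  finally show ?thesis by (simp only: mult_ac)
qed

lemma fk_diff:
  assumes x: "x \<notin> E" and km: "k \<le> m"
  shows "cmod (fk m x - fk k x) \<le> 2 * rho_const 1 * hr x / (1 - 2 powr (- s)) * ((2 powr (- s)) ^ k - (2 powr (- s)) ^ m)"
  using km
proof (induction m rule: dec_induct)
  case (step m)
  let ?a = "2 powr (- s)" and ?d = "2 * rho_const 1 * hr x"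
  have a: "0 < 1 - ?a" using s powr_less_one[of 2 "- s"] by simp
  have "cmod (fk (Suc m) x - fk k x) \<le> ?d * ?a ^ m + ?d / (1 - ?a) * (?a ^ k - ?a ^ m)"
    using fk_step[OF x, of m] step.IH norm_triangle_ineq[of "fk (Suc m) x - fk m x" "fk m x - fk k x"] by simp
  also have "\<dots> = ?d / (1 - ?a) * (?a ^ k - ?a ^ Suc m)"
  proof -
    have "d * Q + d / (1 - a) * (P - Q) = d / (1 - a) * (P - a * Q)" if "a < 1" for d a P Q :: real
      using that by (simp add: field_simps)
    then show ?thesis using a by simp
  qed
  finally show ?case .
qed simp

definition F :: "'a \<Rightarrow> complex" where
  "F x = (if h x = top then 0 else lim (\<lambda>k. fk k x))"

lemma F_measurable [measurable]: "F \<in> borel_measurable \<mu>"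
  unfolding F_def by (intro measurable_If borel_measurable_lim_metric fk_measurable) measurable

lemma fk_F:
  assumes x: "x \<notin> E"
  shows "cmod (F x - fk k x) \<le> 2 * rho_const 1 / (1 - 2 powr (- s)) * 2 powr (- real k * s) * hr x"
proof -
  let ?a = "2 powr (- s)" and ?b = "2 * rho_const 1 * hr x / (1 - 2 powr (- s))"
  have a: "0 < 1 - ?a" "0 \<le> ?a" using s powr_less_one[of 2 "- s"] by simp_all
  have b: "0 \<le> ?b" using a rho_const_pos[of 1] hr(2)[of x] by (intro divide_nonneg_pos mult_nonneg_nonneg) auto
  have le: "cmod (fk m x - fk k x) \<le> ?b * ?a ^ k" if "k \<le> m" for k m
  proof -
    have "?a ^ k - ?a ^ m \<le> ?a ^ k" using a by simp
    then have "?b * (?a ^ k - ?a ^ m) \<le> ?b * ?a ^ k" using b by (rule mult_left_mono)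
    then show ?thesis using fk_diff[OF x that] by linarith
  qed
  have to0: "(\<lambda>k. ?b * ?a ^ k) \<longlonglongrightarrow> 0"
    using a by (intro tendsto_mult_right_zero LIMSEQ_power_zero) auto
  have "Cauchy (\<lambda>k. fk k x)"
  proof (rule metric_CauchyI)
    fix e :: real assume "0 < e"
    then have "eventually (\<lambda>k. ?b * ?a ^ k < e / 2) sequentially" using to0 by (intro order_tendstoD) auto
    then obtain M where M: "?b * ?a ^ M < e / 2" by (auto simp: eventually_sequentially)
    have "dist (fk m x) (fk l x) < e" if "M \<le> m" "M \<le> l" for m l
    proof -
      have "dist (fk m x) (fk M x) < e / 2" "dist (fk l x) (fk M x) < e / 2"
        using le[OF that(1)] le[OF that(2)] M by (auto simp: dist_norm)
      then show ?thesis using dist_triangle2[of "fk m x" "fk l x" "fk M x"] by simp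
    qed
    then show "\<exists>M. \<forall>m\<ge>M. \<forall>l\<ge>M. dist (fk m x) (fk l x) < e" by blast
  qed
  then have "(\<lambda>m. fk m x) \<longlonglongrightarrow> lim (\<lambda>k. fk k x)"
    using convergent_LIMSEQ_iff Cauchy_convergent by blast
  moreover have "F x = lim (\<lambda>k. fk k x)" using x by (simp add: F_def E_def)
  ultimately have "(\<lambda>m. fk m x) \<longlonglongrightarrow> F x" by simp
  then have "(\<lambda>m. cmod (fk m x - fk k x)) \<longlonglongrightarrow> cmod (F x - fk k x)" by (intro tendsto_intros)
  then have "cmod (F x - fk k x) \<le> ?b * ?a ^ k"
    by (rule LIMSEQ_le_const2) (use le in blast)
  also have "?a ^ k = 2 powr (- real k * s)"
    by (simp add: powr_realpow[symmetric] powr_powr mult.commute)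
  finally show ?thesis by (simp add: mult_ac)
qed

definition g :: "'a \<Rightarrow> real" where "g x = maj_const s * hr x"

lemma g_nonneg: "0 \<le> g x"
proof -
  have "0 < 1 - 2 powr (- s)" using s powr_less_one[of 2 "- s"] by simp
  then show ?thesis using rho_const_pos[of 1] hr(2)[of x] unfolding g_def maj_const_def
    by (intro mult_nonneg_nonneg add_nonneg_nonneg divide_nonneg_pos) auto
qed

lemma g_measurable [measurable]: "g \<in> borel_measurable \<mu>"
  unfolding g_def by measurable

lemma hr_le_g: "hr x \<le> g x"
proof -
  have "0 < 1 - 2 powr (- s)" using s powr_less_one[of 2 "- s"] by simp
  then have "1 \<le> maj_const s" using rho_const_pos[of 1] unfolding maj_const_def
    by (smt (verit) divide_nonneg_pos)
  then show ?thesis using hr(2)[of x] mult_right_mono[of 1 "maj_const s" "hr x"] by (simp add: g_def)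
qed

text \<open>The limit is compared with the \<open>k\<close>-th approximant by the geometric series,
  and the approximant with the bump at \<open>z\<close> by \<open>u_rho_diff\<close>. The factor 1/2
  is reserved for \<open>F_hajlasz\<close>, where it pays for
  \<open>2 powr s \<le> 2\<close>.\<close>

lemma F_rho:
  assumes x: "x \<notin> E" "dist x z \<le> 2 powr (- real k)"
  shows "cmod (F x - u (rho (2 powr (- real k)) z)) \<le> 2 powr (- real k * s) * (g x / 2)"
proof -
  let ?c = "2 * rho_const 1 / (1 - 2 powr (- s))" and ?t = "2 powr (- real k * s)"
  have "cmod (fk k x - u (rho (2 powr (- real k)) z)) \<le> 2 * rho_const 1 * ?t * hr x"
    unfolding fk_def using x idx[of x k] by (intro u_rho_diff) auto
  moreover have "cmod (F x - fk k x) \<le> ?c * ?t * hr x" by (rule fk_F[OF x(1)])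
  ultimately have "cmod (F x - u (rho (2 powr (- real k)) z)) \<le> ?c * ?t * hr x + 2 * rho_const 1 * ?t * hr x"
    using norm_triangle_ineq[of "F x - fk k x" "fk k x - u (rho (2 powr (- real k)) z)"] by simp
  also have "\<dots> = ?t * ((maj_const s - 1) * hr x / 2)" by (simp add: maj_const_def field_simps)
  also have "\<dots> \<le> ?t * (g x / 2)"
    using hr(2)[of x] by (intro mult_left_mono) (auto simp: g_def algebra_simps)
  finally show ?thesis .
qed

lemma F_le_g:
  assumes x: "x \<notin> E" shows "cmod (F x) \<le> g x"
proof -
  have "cmod (F x - u (rho 1 x)) \<le> g x / 2" using F_rho[OF x, of x 0] by simp
  moreover have "cmod (u (rho 1 x)) \<le> rho_const 1 * hr x" using x by (intro u_rho_0) auto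
  moreover have "rho_const 1 * hr x \<le> g x / 2"
  proof -
    have "0 < 1 - 2 powr (- s)" using s powr_less_one[of 2 "- s"] by simp
    then have "0 \<le> 4 * rho_const 1 / (1 - 2 powr (- s))" using rho_const_pos[of 1] by (intro divide_nonneg_pos) auto
    then have "rho_const 1 \<le> maj_const s / 2" using rho_const_pos[of 1] by (simp add: maj_const_def)
    then show ?thesis using hr(2)[of x] mult_right_mono[of "rho_const 1" "maj_const s / 2" "hr x"] by (simp add: g_def)
  qed
  ultimately show ?thesis using norm_triangle_ineq[of "F x - u (rho 1 x)" "u (rho 1 x)"] by simp
qed

text \<open>For points at distance at most 1 both values are compared with \<open>u\<close> on one
  and the same bump, centred at \<open>x\<close>, whose scale is between \<open>dist x y\<close> and
  twice that. For larger distances the pointwise bound by \<open>g\<close> suffices.\<close>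

lemma F_hajlasz: "hajlasz_on s F g E"
  unfolding hajlasz_on_def
proof (intro conjI allI impI)
  fix x show "0 \<le> g x" by (rule g_nonneg)
next
  fix x y assume x: "x \<notin> E" and y: "y \<notin> E"
  show "cmod (F x - F y) \<le> dist x y powr s * (g x + g y)"
  proof (cases "dist x y \<le> 1")
    case True
    show ?thesis
    proof (cases "x = y")
      case False
      then have d: "0 < dist x y" by simp
      obtain k where k: "dist x y \<le> 2 powr (- real k)" "2 powr (- real k) < 2 * dist x y"
      proof -
        define k where "k = nat \<lfloor>- log 2 (dist x y)\<rfloor>"
        have l: "0 \<le> - log 2 (dist x y)" using d True by simp
        then have "real k \<le> - log 2 (dist x y)" "- log 2 (dist x y) < real k + 1"
          unfolding k_def by (auto simp: le_nat_floor intro: of_nat_floor)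
        then have "log 2 (dist x y) \<le> - real k" "- real k < 1 + log 2 (dist x y)" by auto
        then have "2 powr (log 2 (dist x y)) \<le> 2 powr (- real k)" "2 powr (- real k) < 2 powr (1 + log 2 (dist x y))"
          by auto
        moreover have "2 powr (log 2 (dist x y)) = dist x y" using d by simp
        ultimately have "dist x y \<le> 2 powr (- real k)" "2 powr (- real k) < 2 * dist x y"
          unfolding powr_add by simp_all
        then show ?thesis by (rule that)
      qed
      let ?c = "u (rho (2 powr (- real k)) x)"
      have "cmod (F x - ?c) \<le> 2 powr (- real k * s) * (g x / 2)" using x by (intro F_rho) auto
      moreover have "cmod (F y - ?c) \<le> 2 powr (- real k * s) * (g y / 2)"
        using y k(1) by (intro F_rho) (auto simp: dist_commute)
      ultimately have "cmod (F x - F y) \<le> 2 powr (- real k * s) * ((g x + g y) / 2)"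
        using norm_triangle_ineq4[of "F x - ?c" "F y - ?c"] by (simp add: algebra_simps add_divide_distrib)
      also have "2 powr (- real k * s) = (2 powr (- real k)) powr s" by (simp add: powr_powr)
      also have "(2 powr (- real k)) powr s * ((g x + g y) / 2) \<le> (2 * dist x y) powr s * ((g x + g y) / 2)"
        using k(2) s g_nonneg[of x] g_nonneg[of y] by (intro mult_right_mono powr_mono2) auto
      also have "\<dots> = 2 powr s * (dist x y powr s * ((g x + g y) / 2))" by (simp add: powr_mult)
      also have "\<dots> \<le> 2 * (dist x y powr s * ((g x + g y) / 2))"
        using s powr_mono[of s 1 2] g_nonneg[of x] g_nonneg[of y] by (intro mult_right_mono) auto
      finally show ?thesis by simp
    qed simp
  next
    case False
    have "cmod (F x - F y) \<le> g x + g y"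
      using F_le_g[OF x] F_le_g[OF y] norm_triangle_ineq4[of "F x" "F y"] by linarith
    also have "\<dots> \<le> dist x y powr s * (g x + g y)"
      using False s g_nonneg[of x] g_nonneg[of y] mult_right_mono[of 1 "dist x y powr s" "g x + g y"]
      by (simp add: ge_one_powr_ge_zero)
    finally show ?thesis .
  qed
qed

lemma u_le_g:
  assumes "\<phi> \<in> test_space \<mu> x1 1 1 2" "k \<noteq> 0 \<Longrightarrow> (\<integral>y. \<phi> y \<partial>\<mu>) = 0"
    "test_bound \<mu> x (2 powr (- real k)) 1 2 C \<phi>" "0 < C" "x \<notin> E"
  shows "cmod (u \<phi>) \<le> C * 2 powr (- real k * s) * g x"
proof -
  have "C * 2 powr (- real k * s) * hr x \<le> C * 2 powr (- real k * s) * g x"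
    using assms(4) hr_le_g by (intro mult_left_mono) auto
  then show ?thesis using u_le_real[OF assms] by linarith
qed

lemma g_Lp: "(\<integral>\<^sup>+x. epowr (ennreal (g x)) p \<partial>\<mu>) \<le> ennreal (maj_const s powr p) * (\<integral>\<^sup>+x. epowr (h x) p \<partial>\<mu>)"
proof -
  have mc: "0 \<le> maj_const s"
  proof -
    have "0 < 1 - 2 powr (- s)" using s powr_less_one[of 2 "- s"] by simp
    then show ?thesis using rho_const_pos[of 1] unfolding maj_const_def by (intro add_nonneg_nonneg divide_nonneg_pos) auto
  qed
  have "(\<integral>\<^sup>+x. epowr (ennreal (g x)) p \<partial>\<mu>) \<le> (\<integral>\<^sup>+x. ennreal (maj_const s powr p) * epowr (h x) p \<partial>\<mu>)"
  proof (rule nn_integral_mono)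
    fix x
    have "ennreal (hr x) \<le> h x" by (simp add: hr_def ennreal_enn2real_if)
    then have "ennreal (g x) \<le> ennreal (maj_const s) * h x"
      using mc hr(2)[of x] by (simp add: g_def ennreal_mult mult_left_mono)
    then have "epowr (ennreal (g x)) p \<le> epowr (ennreal (maj_const s) * h x) p" using p by (intro epowr_mono) auto
    then show "epowr (ennreal (g x)) p \<le> ennreal (maj_const s powr p) * epowr (h x) p"
      using p mc by (simp add: epowr_mult)
  qed
  then show ?thesis by (simp add: nn_integral_cmult)
qed

end

section \<open>Functionals on test functions with bounded support\<close>

context doubling_measure
begin

definition loc_const :: "real \<Rightarrow> real \<Rightarrow> real" where
  "loc_const s q = (poincare_const s q + 1) * (D * 2 powr n) powr (1 / q) + poincare_const s q"

lemma loc_const_pos: "n * (1 / q - 1) < s \<Longrightarrow> 0 < loc_const s q"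
  using poincare_const_pos[of q s] unfolding loc_const_def by (intro add_nonneg_pos mult_nonneg_nonneg) auto

text \<open>The Poincare inequality at scale 1 controls \<open>f - f z\<close>, and the pointwise
  bound by \<open>g\<close> controls \<open>f z\<close> itself; \<open>g z\<close> is at most a
  \<open>q\<close>-mean by the choice of \<open>z\<close>.\<close>

lemma local_integral:
  assumes hj: "hajlasz_on s f g E" and fg: "\<And>x. x \<notin> E \<Longrightarrow> cmod (f x) \<le> g x"
    and s: "0 < s" "s \<le> 1" and q: "0 < q" "q \<le> 1" "n * (1 / q - 1) < s"
    and [measurable]: "g \<in> borel_measurable \<mu>" "f \<in> borel_measurable \<mu>" and E: "E \<in> null_sets \<mu>"
  shows "(\<integral>\<^sup>+x\<in>ball y 1. ennreal (cmod (f x)) \<partial>\<mu>) \<le> ennreal (loc_const s q * V y 1) * pavg q y 2 (\<lambda>x. ennreal (g x))"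
proof -
  let ?P = "pavg q y 2 (\<lambda>x. ennreal (g x))" and ?c = "(D * 2 powr n) powr (1 / q)" and ?k = "poincare_const s q"
  have k: "0 < ?k" using q by (intro poincare_const_pos)
  obtain z where z: "dist y z < 1" "z \<notin> E" "ennreal (g z) \<le> pavg q y 1 (\<lambda>x. ennreal (g x))"
    using exists_le_pavg[of "\<lambda>x. ennreal (g x)" 1 E q y] E q by auto
  have "pavg q y 1 (\<lambda>x. ennreal (g x)) \<le> ennreal ?c * ?P"
    using q by (intro pavg_ball_le) auto
  then have gz: "ennreal (g z) \<le> ennreal ?c * ?P" using z(3) by simp
  have "(\<integral>\<^sup>+x\<in>ball y 1. ennreal (cmod (f x)) \<partial>\<mu>) \<le> (\<integral>\<^sup>+x. (ennreal (cmod (f x - f z)) * indicator (ball y 1) x + ennreal (cmod (f z)) * indicator (ball y 1) x) \<partial>\<mu>)"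
  proof (rule nn_integral_mono)
    fix x
    have "cmod (f x) \<le> cmod (f x - f z) + cmod (f z)" using norm_triangle_ineq[of "f x - f z" "f z"] by simp
    then have "ennreal (cmod (f x)) \<le> ennreal (cmod (f x - f z)) + ennreal (cmod (f z))"
      using ennreal_leI[of "cmod (f x)" "cmod (f x - f z) + cmod (f z)"] by simp
    then show "ennreal (cmod (f x)) * indicator (ball y 1) x \<le> ennreal (cmod (f x - f z)) * indicator (ball y 1) x + ennreal (cmod (f z)) * indicator (ball y 1) x"
      unfolding distrib_right[symmetric] by (rule mult_right_mono) simp
  qed
  also have "\<dots> = (\<integral>\<^sup>+x\<in>ball y 1. ennreal (cmod (f x - f z)) \<partial>\<mu>) + ennreal (cmod (f z)) * ennreal (V y 1)"
    by (subst nn_integral_add) (auto simp: nn_integral_cmult_indicator emeasure_ball)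
  also have "\<dots> \<le> ennreal (?k * V y 1) * (ennreal ?c * ?P + ?P) + (ennreal ?c * ?P) * ennreal (V y 1)"
  proof (intro add_mono mult_right_mono)
    have "(\<integral>\<^sup>+x\<in>ball y 1. ennreal (cmod (f x - f z)) \<partial>\<mu>) \<le> ennreal (?k * 1 powr s * V y 1) * (ennreal (g z) + pavg q y (2 * 1) (\<lambda>x. ennreal (g x)))"
      by (rule poincare[OF hj s q assms(8) E]) (use z in auto)
    also have "\<dots> \<le> ennreal (?k * V y 1) * (ennreal ?c * ?P + ?P)"
      using gz by (simp add: mult_left_mono)
    finally show "(\<integral>\<^sup>+x\<in>ball y 1. ennreal (cmod (f x - f z)) \<partial>\<mu>) \<le> ennreal (?k * V y 1) * (ennreal ?c * ?P + ?P)" .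
    show "ennreal (cmod (f z)) \<le> ennreal ?c * ?P"
      using gz ennreal_leI[OF fg[OF z(2)]] by (rule order_trans[rotated])
  qed auto
  also have "\<dots> = ennreal (loc_const s q * V y 1) * ?P"
  proof -
    have "ennreal (?k * V y 1) * (ennreal ?c * ?P + ?P) + (ennreal ?c * ?P) * ennreal (V y 1)
       = (ennreal (?k * V y 1 * ?c) + ennreal (?k * V y 1) + ennreal (?c * V y 1)) * ?P"
      using k by (simp add: distrib_left distrib_right ennreal_mult mult_ac)
    also have "ennreal (?k * V y 1 * ?c) + ennreal (?k * V y 1) + ennreal (?c * V y 1) = ennreal (?k * V y 1 * ?c + ?k * V y 1 + ?c * V y 1)"
      using k by simp
    also have "?k * V y 1 * ?c + ?k * V y 1 + ?c * V y 1 = loc_const s q * V y 1"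
      by (simp add: loc_const_def algebra_simps)
    finally show ?thesis .
  qed
  finally show ?thesis .
qed

lemma weighted_size_hajlasz:
  assumes hj: "hajlasz_on s f g E" and fg: "\<And>x. x \<notin> E \<Longrightarrow> cmod (f x) \<le> g x"
    and s: "0 < s" "s \<le> 1" and q: "0 < q" "q \<le> 1" "n * (1 / q - 1) < s" "n * (1 / q - 1) < \<gamma>" and \<gamma>: "0 < \<gamma>"
    and [measurable]: "g \<in> borel_measurable \<mu>" "f \<in> borel_measurable \<mu>" and E: "E \<in> null_sets \<mu>"
    and B: "\<And>R. 1 \<le> R \<Longrightarrow> pavg q x R (\<lambda>x. ennreal (g x)) \<le> B"
  shows "(\<integral>\<^sup>+y. ennreal (cmod (f y)) * ennreal (test_weight \<mu> x 1 \<gamma> y) \<partial>\<mu>) \<le> ennreal (size_const q 2 \<gamma> * loc_const s q) * B"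
proof (rule weighted_size)
  show "(\<integral>\<^sup>+z\<in>ball y 1. ennreal (cmod (f z)) \<partial>\<mu>) \<le> ennreal (loc_const s q * V y 1) * pavg q y 2 (\<lambda>x. ennreal (g x))" for y
    by (rule local_integral[OF hj fg s q(1-3) assms(10,11) E])
  show "0 \<le> loc_const s q" using loc_const_pos[OF q(3)] by simp
qed (use q \<gamma> B in auto)

lemma test_product:
  assumes b: "test_bound \<mu> x 1 \<beta> \<gamma> C \<phi>" and C: "0 \<le> C" and \<beta>: "0 < \<beta>"
    and [measurable]: "f \<in> borel_measurable \<mu>"
    and W: "(\<integral>\<^sup>+y. ennreal (cmod (f y)) * ennreal (test_weight \<mu> x 1 \<gamma> y) \<partial>\<mu>) \<le> ennreal W" and W0: "0 \<le> W"
  shows "integrable \<mu> (\<lambda>y. f y * \<phi> y)" and "cmod (\<integral>y. f y * \<phi> y \<partial>\<mu>) \<le> C * W"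
proof -
  have [measurable]: "\<phi> \<in> borel_measurable \<mu>" using test_bound_measurable[OF b _ \<beta>] by simp
  have "(\<integral>\<^sup>+y. ennreal (cmod (f y * \<phi> y)) \<partial>\<mu>) \<le> (\<integral>\<^sup>+y. ennreal C * (ennreal (cmod (f y)) * ennreal (test_weight \<mu> x 1 \<gamma> y)) \<partial>\<mu>)"
  proof (rule nn_integral_mono)
    fix y
    have "cmod (f y * \<phi> y) \<le> cmod (f y) * (C * test_weight \<mu> x 1 \<gamma> y)"
      unfolding norm_mult using b by (intro mult_left_mono) (auto simp: test_bound_def)
    then have "ennreal (cmod (f y * \<phi> y)) \<le> ennreal (cmod (f y) * (C * test_weight \<mu> x 1 \<gamma> y))" by (rule ennreal_leI)
    also have "\<dots> = ennreal C * (ennreal (cmod (f y)) * ennreal (test_weight \<mu> x 1 \<gamma> y))"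
      using C by (simp add: ennreal_mult test_weight_nonneg mult_ac)
    finally show "ennreal (cmod (f y * \<phi> y)) \<le> ennreal C * (ennreal (cmod (f y)) * ennreal (test_weight \<mu> x 1 \<gamma> y))" .
  qed
  also have "\<dots> = ennreal C * (\<integral>\<^sup>+y. ennreal (cmod (f y)) * ennreal (test_weight \<mu> x 1 \<gamma> y) \<partial>\<mu>)"
    by (rule nn_integral_cmult) measurable
  also have "\<dots> \<le> ennreal C * ennreal W" by (intro mult_left_mono W) simp
  also have "\<dots> = ennreal (C * W)" using C W0 by (simp add: ennreal_mult)
  finally have *: "(\<integral>\<^sup>+y. ennreal (cmod (f y * \<phi> y)) \<partial>\<mu>) \<le> ennreal (C * W)" .
  show i: "integrable \<mu> (\<lambda>y. f y * \<phi> y)"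
    by (rule integrableI_bounded) (use * in \<open>auto intro: le_less_trans\<close>)
  have "ennreal (cmod (\<integral>y. f y * \<phi> y \<partial>\<mu>)) \<le> (\<integral>\<^sup>+y. ennreal (cmod (f y * \<phi> y)) \<partial>\<mu>)"
    by (rule integral_norm_bound_ennreal[OF i])
  then have "ennreal (cmod (\<integral>y. f y * \<phi> y \<partial>\<mu>)) \<le> ennreal (C * W)" using * by (rule order_trans)
  then show "cmod (\<integral>y. f y * \<phi> y \<partial>\<mu>) \<le> C * W" using C W0 by (simp add: ennreal_le_iff)
qed

lemma test_product_integrable:
  assumes \<phi>: "\<phi> \<in> test_space \<mu> x 1 \<beta> \<gamma>" and "0 < \<beta>"
    and "f \<in> borel_measurable \<mu>"
    and "(\<integral>\<^sup>+y. ennreal (cmod (f y)) * ennreal (test_weight \<mu> x 1 \<gamma> y) \<partial>\<mu>) \<le> ennreal W" "0 \<le> W"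
  shows "integrable \<mu> (\<lambda>y. f y * \<phi> y)"
proof -
  obtain C where "0 \<le> C" "test_bound \<mu> x 1 \<beta> \<gamma> C \<phi>" using \<phi> by (auto simp: test_space_def)
  then show ?thesis using test_product(1)[of x \<beta> \<gamma> C \<phi> f W] assms by auto
qed

text \<open>At each point at most \<open>D * 10 powr n\<close> tents are nonzero, by packing with
  radius \<open>2 * r\<close>. Truncating the sum from below at 1/2 keeps the quotient Lipschitz on
  the whole space, also away from the net.\<close>

lemma partition_lipschitz:
  fixes N :: "'a set"
  assumes N: "finite N" "separated r N" and r: "0 < r"
  defines "\<sigma> \<equiv> \<lambda>y. max (1 / 2) (\<Sum>\<alpha>\<in>N. tent (2 * r) \<alpha> y)"
  assumes \<alpha>: "\<alpha> \<in> N"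
  shows "\<bar>tent (2 * r) \<alpha> y / \<sigma> y - tent (2 * r) \<alpha> y' / \<sigma> y'\<bar> \<le> (1 + 4 * (D * 10 powr n)) * (dist y y' / r)"
proof -
  let ?t = "tent (2 * r) \<alpha>"
  let ?G = "\<lambda>y. {z \<in> N. dist y z < 2 * r}"
  have G: "finite (?G y) \<and> real (card (?G y)) \<le> D * 10 powr n" for y
  proof -
    have "finite (?G y) \<and> real (card (?G y)) \<le> D * ((4 * (2 * r) + 2 * r) / r) powr n"
      using N r by (intro separated_card[of _ y]) (auto simp: separated_def)
    moreover have "(4 * (2 * r) + 2 * r) / r = 10" using r by (simp add: field_simps)
    ultimately show ?thesis by simp
  qed
  have "\<bar>(\<Sum>\<alpha>\<in>N. tent (2 * r) \<alpha> y) - (\<Sum>\<alpha>\<in>N. tent (2 * r) \<alpha> y')\<bar> \<le> (\<Sum>\<alpha>\<in>N. \<bar>tent (2 * r) \<alpha> y - tent (2 * r) \<alpha> y'\<bar>)"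
    by (simp add: sum_subtractf[symmetric])
  also have "\<dots> = (\<Sum>\<alpha>\<in>?G y \<union> ?G y'. \<bar>tent (2 * r) \<alpha> y - tent (2 * r) \<alpha> y'\<bar>)"
  proof (rule sum.mono_neutral_right[OF N(1)])
    show "\<forall>i\<in>N - (?G y \<union> ?G y'). \<bar>tent (2 * r) i y - tent (2 * r) i y'\<bar> = 0"
    proof
      fix i assume i: "i \<in> N - (?G y \<union> ?G y')"
      then have "tent (2 * r) i y = 0" "tent (2 * r) i y' = 0"
        using tent_nonzero[of "2 * r" i y] tent_nonzero[of "2 * r" i y'] r by (auto simp: dist_commute)
      then show "\<bar>tent (2 * r) i y - tent (2 * r) i y'\<bar> = 0" by simp
    qed
  qed auto
  also have "\<dots> \<le> (\<Sum>\<alpha>\<in>?G y \<union> ?G y'. dist y y' / (2 * r))"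
    using r by (intro sum_mono tent_lipschitz) auto
  also have "\<dots> = real (card (?G y \<union> ?G y')) * (dist y y' / (2 * r))" by simp
  also have "\<dots> \<le> (2 * (D * 10 powr n)) * (dist y y' / (2 * r))"
  proof (rule mult_right_mono)
    have "real (card (?G y \<union> ?G y')) \<le> real (card (?G y)) + real (card (?G y'))"
      using card_Un_le[of "?G y" "?G y'"] by linarith
    then show "real (card (?G y \<union> ?G y')) \<le> 2 * (D * 10 powr n)" using G[of y] G[of y'] by linarith
  qed (use r in auto)
  also have "\<dots> = D * 10 powr n * (dist y y' / r)" by simp
  finally have S: "\<bar>(\<Sum>\<alpha>\<in>N. tent (2 * r) \<alpha> y) - (\<Sum>\<alpha>\<in>N. tent (2 * r) \<alpha> y')\<bar> \<le> D * 10 powr n * (dist y y' / r)" .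
  then have \<sigma>d: "\<bar>\<sigma> y' - \<sigma> y\<bar> \<le> D * 10 powr n * (dist y y' / r)" unfolding \<sigma>_def by linarith
  have \<sigma>: "1 / 2 \<le> \<sigma> y" for y by (simp add: \<sigma>_def)
  have \<sigma>0: "0 < \<sigma> y" for y using \<sigma>[of y] by linarith
  have inv: "1 / \<sigma> y \<le> 2" for y using \<sigma>[of y] \<sigma>0[of y] by (simp add: divide_simps)
  have "?t y / \<sigma> y - ?t y' / \<sigma> y' = (?t y - ?t y') * (1 / \<sigma> y) + ?t y' * ((1 / \<sigma> y) * (1 / \<sigma> y') * (\<sigma> y' - \<sigma> y))"
    using \<sigma>0[of y] \<sigma>0[of y'] by (simp add: field_simps)
  also have "\<bar>\<dots>\<bar> \<le> \<bar>?t y - ?t y'\<bar> * (1 / \<sigma> y) + ?t y' * ((1 / \<sigma> y) * (1 / \<sigma> y') * \<bar>\<sigma> y' - \<sigma> y\<bar>)"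
    using \<sigma>0[of y] \<sigma>0[of y'] by (intro order_trans[OF abs_triangle_ineq] add_mono) (simp_all add: abs_mult)
  also have "\<dots> \<le> (dist y y' / (2 * r)) * 2 + 1 * ((2 * 2) * (D * 10 powr n * (dist y y' / r)))"
    using r \<sigma>0[of y] \<sigma>0[of y'] D_ge by (intro add_mono mult_mono tent_lipschitz inv \<sigma>d tent_le_1 mult_nonneg_nonneg) auto
  also have "\<dots> = (1 + 4 * (D * 10 powr n)) * (dist y y' / r)"
    using r by (simp add: field_simps)
  finally show ?thesis .
qed

end

context grand_majorant
begin

lemma g_Lp_finite: "(\<integral>\<^sup>+x. epowr (ennreal (g x)) p \<partial>\<mu>) < top"
  using g_Lp h_Lp by (meson ennreal_mult_less_top ennreal_less_top le_less_trans)

context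
  fixes q :: real
  assumes q: "0 < q" "q \<le> 1" "q \<le> p" "n * (1 / q - 1) < s"
begin

lemma g_avg_bounded: "\<exists>B\<ge>0. \<forall>R\<ge>1. pavg q x R (\<lambda>x. ennreal (g x)) \<le> ennreal B"
  using q g_Lp_finite by (intro pavg_bounded) auto

lemma F_weight_bounded:
  assumes "0 < \<gamma>" "n * (1 / q - 1) < \<gamma>"
  shows "\<exists>W\<ge>0. (\<integral>\<^sup>+y. ennreal (cmod (F y)) * ennreal (test_weight \<mu> x 1 \<gamma> y) \<partial>\<mu>) \<le> ennreal W"
proof -
  obtain B where B: "0 \<le> B" "\<And>R. 1 \<le> R \<Longrightarrow> pavg q x R (\<lambda>x. ennreal (g x)) \<le> ennreal B"
    using g_avg_bounded by blast
  have c: "0 \<le> size_const q 2 \<gamma> * loc_const s q"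
    using size_const_pos[of 2 q \<gamma>] loc_const_pos[of q s] assms q by simp
  have "(\<integral>\<^sup>+y. ennreal (cmod (F y)) * ennreal (test_weight \<mu> x 1 \<gamma> y) \<partial>\<mu>) \<le> ennreal (size_const q 2 \<gamma> * loc_const s q) * ennreal B"
    using q assms s by (intro weighted_size_hajlasz[OF F_hajlasz F_le_g] B E_null) auto
  also have "\<dots> = ennreal (size_const q 2 \<gamma> * loc_const s q * B)" using c B by (intro ennreal_mult[symmetric]) auto
  finally show ?thesis using c B by (intro exI[of _ "size_const q 2 \<gamma> * loc_const s q * B"]) auto
qed

lemma F_test_integrable:
  assumes "\<phi> \<in> test_space \<mu> x 1 \<beta> \<gamma>" "0 < \<beta>" "0 < \<gamma>" "n * (1 / q - 1) < \<gamma>"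
  shows "integrable \<mu> (\<lambda>y. F y * \<phi> y)"
  using F_weight_bounded[OF assms(3,4), of x] test_product_integrable[OF assms(1,2), of F] by auto

text \<open>The first summand bounds \<open>u\<close> on the mean-zero part of a piece; the second
  bounds the integral of \<open>F\<close> minus the bump value against the piece.\<close>

definition piece_const :: real where
  "piece_const = (let M = D * 2 powr n; c = (D * 4 powr n) powr (1 / q) in
     (bump_const 2 1 2 + M * rho_const 2) * c + (2 * poincare_const s q * M * (c + 1) + M * c))"

text \<open>After subtracting a bump with the same integral, \<open>\<omega>\<close> is a multiple of a grand test function of scale \<open>r\<close>.\<close>
lemma u_piece:
  assumes r: "r = 2 powr (- real k)" and k: "k \<noteq> 0" and A: "0 < A"
    and supp: "\<And>y. \<omega> y \<noteq> 0 \<Longrightarrow> dist \<alpha> y < 2 * r" and bd: "\<And>y. cmod (\<omega> y) \<le> A"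
    and lip: "\<And>y y'. cmod (\<omega> y - \<omega> y') \<le> A * (dist y y' / r)"
  shows "ennreal (cmod (u \<omega> - (\<integral>y. F y * \<omega> y \<partial>\<mu>))) \<le> ennreal (piece_const * A * r powr s * V \<alpha> r) * pavg q \<alpha> (4 * r) (\<lambda>x. ennreal (g x))"
proof (cases "pavg q \<alpha> (4 * r) (\<lambda>x. ennreal (g x))")
  case top
  have r0: "0 < r" using r by simp
  have "0 < piece_const"
    using D_ge bump_const_pos[of 2 1 2] rho_const_pos[of 2] poincare_const_pos[OF q(4)]
    unfolding piece_const_def Let_def by (intro add_pos_nonneg mult_pos_pos) auto
  then have "0 < piece_const * A * r powr s * V \<alpha> r" using A r0 by (intro mult_pos_pos) auto
  then have "ennreal (piece_const * A * r powr s * V \<alpha> r) * top = top"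
    by (auto simp: ennreal_mult_top)
  then show ?thesis using top by (metis top_greatest)
next
  case (real P)
  have r0: "0 < r" using r by simp
  define M where "M = D * 2 powr n"
  define c1 where "c1 = (D * 4 powr n) powr (1 / q)"
  define k0 where "k0 = poincare_const s q"
  let ?v = "V \<alpha> r"
  have M: "0 < M" and k0: "0 < k0" and c1: "0 < c1" and v: "0 < ?v"
    using D_ge poincare_const_pos[OF q(4)] r0 by (auto simp: M_def k0_def c1_def)
  have v2: "V \<alpha> (2 * r) \<le> M * ?v" unfolding M_def using r0 by (intro V_le) auto
  have rs: "2 powr (- real k * s) = r powr s" by (simp add: r powr_powr)
  have \<omega>_int: "integrable \<mu> \<omega>"
    using supp bd lip r0 by (intro bump_integrable[of 1 \<omega> \<alpha> "2 * r" A "A / r"]) (auto intro: less_imp_le)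
  have \<omega>_test: "\<omega> \<in> test_space \<mu> x1 1 1 2"
    using supp bd lip r0 by (intro bump_in_test_space[of 1 2 \<omega> \<alpha> "2 * r" A "A / r"]) (auto intro: less_imp_le)
  define c where "c = (\<integral>y. \<omega> y \<partial>\<mu>)"
  have c: "cmod c \<le> A * (M * ?v)"
  proof -
    have "ennreal (cmod c) \<le> (\<integral>\<^sup>+y. ennreal (cmod (\<omega> y)) \<partial>\<mu>)"
      unfolding c_def by (rule integral_norm_bound_ennreal[OF \<omega>_int])
    also have "\<dots> \<le> (\<integral>\<^sup>+y. ennreal A * indicator (ball \<alpha> (2 * r)) y \<partial>\<mu>)"
    proof (rule nn_integral_mono)
      fix y show "ennreal (cmod (\<omega> y)) \<le> ennreal A * indicator (ball \<alpha> (2 * r)) y"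
        using supp[of y] bd[of y] by (cases "\<omega> y = 0") (auto intro: ennreal_leI)
    qed
    also have "\<dots> = ennreal (A * V \<alpha> (2 * r))"
      using A by (subst nn_integral_cmult_indicator) (auto simp: emeasure_ball ennreal_mult)
    finally have "cmod c \<le> A * V \<alpha> (2 * r)" using A by (simp add: ennreal_le_iff)
    also have "\<dots> \<le> A * (M * ?v)" using v2 A by (intro mult_left_mono) auto
    finally show ?thesis .
  qed
  \<comment> \<open>The same \<open>z\<close> is the point at which the mean-zero part is tested and
    the reference point for \<open>F\<close>, so both errors are governed by \<open>g z\<close> and
    one \<open>q\<close>-mean.\<close>
  obtain z where z: "dist \<alpha> z < r" "z \<notin> E" "ennreal (g z) \<le> pavg q \<alpha> r (\<lambda>x. ennreal (g x))"
    using exists_le_pavg[of "\<lambda>x. ennreal (g x)" r E q \<alpha>] E_null q r0 by auto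
  have "pavg q \<alpha> r (\<lambda>x. ennreal (g x)) \<le> ennreal c1 * pavg q \<alpha> (4 * r) (\<lambda>x. ennreal (g x))"
    unfolding c1_def using q r0 by (intro pavg_ball_le) auto
  then have "ennreal (g z) \<le> ennreal (c1 * P)" using z(3) real c1 by (simp add: ennreal_mult)
  then have gz: "g z \<le> c1 * P" using c1 real by (simp add: ennreal_le_iff)
  define \<phi> where "\<phi> = (\<lambda>y. \<omega> y - c * rho r \<alpha> y)"
  have rt: "(\<lambda>y. c * rho r \<alpha> y) \<in> test_space \<mu> x1 1 1 2" by (intro test_space_scale rho_test_space r0)
  have \<phi>1: "cmod (u \<phi>) \<le> (bump_const 2 1 2 + M * rho_const 2) * (A * ?v) * r powr s * (c1 * P)"
  proof -
    let ?C = "bump_const 2 1 2 * A * ?v + cmod (- c) * rho_const 2"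
    have "test_bound \<mu> z r 1 2 ?C (\<lambda>y. \<omega> y + (- c) * rho r \<alpha> y)"
    proof (intro test_bound_add test_bound_scale rho_test_bound bump_test_bound)
      show "dist z \<alpha> \<le> 2 * r" using z(1) r0 by (simp add: dist_commute)
      then show "dist z \<alpha> \<le> 2 * r" .
      show "cmod (\<omega> y - \<omega> y') \<le> A * (dist y y' / r) powr 1" for y y' using lip[of y y'] r0 by simp
      show "\<omega> y \<noteq> 0 \<Longrightarrow> dist \<alpha> y \<le> 2 * r" for y using supp[of y] by auto
    qed (use r0 A bd in auto)
    then have b: "test_bound \<mu> z (2 powr (- real k)) 1 2 ?C \<phi>" by (simp add: \<phi>_def r)
    have Cpos: "0 < ?C" using bump_const_pos[of 2 1 2] rho_const_pos[of 2] A v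
      by (intro add_pos_nonneg mult_pos_pos mult_nonneg_nonneg) auto
    have "cmod (u \<phi>) \<le> ?C * 2 powr (- real k * s) * g z"
    proof (rule u_le_g[OF _ _ b Cpos z(2)])
      show "\<phi> \<in> test_space \<mu> x1 1 1 2" unfolding \<phi>_def by (rule test_space_diff[OF \<omega>_test rt])
      show "(\<integral>y. \<phi> y \<partial>\<mu>) = 0"
        unfolding \<phi>_def using \<omega>_int rho_integrable[OF r0, of \<alpha>] by (simp add: rho_integral[OF r0] c_def)
    qed
    also have "\<dots> \<le> ((bump_const 2 1 2 + M * rho_const 2) * (A * ?v)) * r powr s * (c1 * P)"
      unfolding rs
    proof (intro mult_mono gz mult_right_mono)
      have "cmod (- c) * rho_const 2 \<le> A * (M * ?v) * rho_const 2"
        using c rho_const_pos[of 2] by (intro mult_right_mono) auto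
      then show "?C \<le> (bump_const 2 1 2 + M * rho_const 2) * (A * ?v)" by (simp add: algebra_simps)
    qed (use Cpos g_nonneg[of z] bump_const_pos[of 2 1 2] rho_const_pos[of 2] A v M in auto)
    finally show ?thesis .
  qed
  define b where "b = u (rho r \<alpha>)"
  have Fb: "cmod (F z - b) \<le> r powr s * (c1 * P)"
  proof -
    have "cmod (F z - b) \<le> 2 powr (- real k * s) * (g z / 2)"
      unfolding b_def r using z r by (intro F_rho) (auto simp: dist_commute)
    also have "\<dots> \<le> r powr s * (c1 * P)" unfolding rs using gz g_nonneg[of z] by (intro mult_left_mono) auto
    finally show ?thesis .
  qed
  have F\<omega>: "integrable \<mu> (\<lambda>y. F y * \<omega> y)"
    using q by (intro F_test_integrable[OF \<omega>_test]) (use s in auto)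
  have i2: "integrable \<mu> (\<lambda>y. (F y - b) * \<omega> y)"
    using F\<omega> \<omega>_int by (simp add: left_diff_distrib)
  have i3: "(\<integral>y. (F y - b) * \<omega> y \<partial>\<mu>) = (\<integral>y. F y * \<omega> y \<partial>\<mu>) - b * c"
    using F\<omega> \<omega>_int by (simp add: left_diff_distrib c_def)
  have I: "cmod (\<integral>y. (F y - b) * \<omega> y \<partial>\<mu>) \<le> A * (k0 * (2 * r powr s) * (M * ?v) * (c1 * P + P) + M * ?v * (r powr s * (c1 * P)))"
  proof -
    have "ennreal (cmod (\<integral>y. (F y - b) * \<omega> y \<partial>\<mu>)) \<le> (\<integral>\<^sup>+y. ennreal (cmod ((F y - b) * \<omega> y)) \<partial>\<mu>)"
      by (rule integral_norm_bound_ennreal[OF i2])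
    also have "\<dots> \<le> (\<integral>\<^sup>+y. ennreal A * (ennreal (cmod (F y - F z)) * indicator (ball \<alpha> (2 * r)) y + ennreal (cmod (F z - b)) * indicator (ball \<alpha> (2 * r)) y) \<partial>\<mu>)"
    proof (rule nn_integral_mono)
      fix y
      show "ennreal (cmod ((F y - b) * \<omega> y)) \<le> ennreal A * (ennreal (cmod (F y - F z)) * indicator (ball \<alpha> (2 * r)) y + ennreal (cmod (F z - b)) * indicator (ball \<alpha> (2 * r)) y)"
      proof (cases "\<omega> y = 0")
        case False
        have "cmod ((F y - b) * \<omega> y) \<le> (cmod (F y - F z) + cmod (F z - b)) * A"
          unfolding norm_mult using norm_triangle_ineq[of "F y - F z" "F z - b"] bd[of y] by (intro mult_mono) auto
        then have "ennreal (cmod ((F y - b) * \<omega> y)) \<le> ennreal (A * (cmod (F y - F z) + cmod (F z - b)))"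
          by (intro ennreal_leI) (simp add: mult.commute)
        also have "\<dots> = ennreal A * (ennreal (cmod (F y - F z)) + ennreal (cmod (F z - b)))"
          using A by (simp add: ennreal_mult)
        finally show ?thesis using supp[OF False] by simp
      qed simp
    qed
    also have "\<dots> = ennreal A * ((\<integral>\<^sup>+y\<in>ball \<alpha> (2 * r). ennreal (cmod (F y - F z)) \<partial>\<mu>) + ennreal (cmod (F z - b)) * ennreal (V \<alpha> (2 * r)))"
      by (simp add: nn_integral_cmult nn_integral_add nn_integral_cmult_indicator emeasure_ball)
    also have "\<dots> \<le> ennreal A * (ennreal (k0 * (2 * r powr s) * (M * ?v) * (c1 * P + P)) + ennreal (M * ?v * (r powr s * (c1 * P))))"
    proof (intro mult_left_mono add_mono)
      have "(\<integral>\<^sup>+y\<in>ball \<alpha> (2 * r). ennreal (cmod (F y - F z)) \<partial>\<mu>) \<le>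
        ennreal (k0 * (2 * r) powr s * V \<alpha> (2 * r)) * (ennreal (g z) + pavg q \<alpha> (2 * (2 * r)) (\<lambda>x. ennreal (g x)))"
        unfolding k0_def using r0 z by (intro poincare[OF F_hajlasz s q(1,2,4) g_measurable E_null]) auto
      also have "\<dots> \<le> ennreal (k0 * (2 * r powr s) * (M * ?v)) * ennreal (c1 * P + P)"
      proof -
        have "(2 * r) powr s = 2 powr s * r powr s" using r0 by (simp add: powr_mult)
        also have "\<dots> \<le> 2 * r powr s" using s powr_mono[of s 1 2] by (intro mult_right_mono) auto
        finally have a1: "k0 * (2 * r) powr s * V \<alpha> (2 * r) \<le> k0 * (2 * r powr s) * (M * ?v)"
          using k0 v2 M v by (intro mult_mono mult_left_mono) auto
        have "ennreal (g z) + pavg q \<alpha> (2 * (2 * r)) (\<lambda>x. ennreal (g x)) = ennreal (g z + P)"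
          using real g_nonneg[of z] by simp
        also have "\<dots> \<le> ennreal (c1 * P + P)" using gz by (intro ennreal_leI) auto
        finally have a2: "ennreal (g z) + pavg q \<alpha> (2 * (2 * r)) (\<lambda>x. ennreal (g x)) \<le> ennreal (c1 * P + P)" .
        show ?thesis by (rule mult_mono[OF ennreal_leI[OF a1] a2]) auto
      qed
      also have "\<dots> = ennreal (k0 * (2 * r powr s) * (M * ?v) * (c1 * P + P))"
        using k0 M v c1 real by (intro ennreal_mult[symmetric]) auto
      finally show "(\<integral>\<^sup>+y\<in>ball \<alpha> (2 * r). ennreal (cmod (F y - F z)) \<partial>\<mu>) \<le> ennreal (k0 * (2 * r powr s) * (M * ?v) * (c1 * P + P))" .
      have "ennreal (cmod (F z - b)) * ennreal (V \<alpha> (2 * r)) = ennreal (V \<alpha> (2 * r) * cmod (F z - b))"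
        by (simp add: ennreal_mult mult.commute)
      also have "\<dots> \<le> ennreal (M * ?v * (r powr s * (c1 * P)))"
        using v2 Fb M v by (intro ennreal_leI mult_mono) auto
      finally show "ennreal (cmod (F z - b)) * ennreal (V \<alpha> (2 * r)) \<le> ennreal (M * ?v * (r powr s * (c1 * P)))" .
    qed auto
    also have "\<dots> = ennreal (A * (k0 * (2 * r powr s) * (M * ?v) * (c1 * P + P) + M * ?v * (r powr s * (c1 * P))))"
      using A k0 M v c1 real by (simp add: ennreal_mult[symmetric] ennreal_plus[symmetric] del: ennreal_plus)
    finally show ?thesis
      using A k0 M v c1 real by (subst (asm) ennreal_le_iff) (auto intro!: mult_nonneg_nonneg add_nonneg_nonneg)
  qed
  \<comment> \<open>The product \<open>b * c\<close> occurs in \<open>u \<phi>\<close> and in the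
    integral of \<open>(F - b) * \<omega>\<close>, and cancels in the difference.\<close>
  have "u \<phi> = u \<omega> - c * b"
    unfolding \<phi>_def b_def using dual_diff[OF u \<omega>_test rt] dual_scale[OF u rho_test_space[OF r0, of \<alpha> x1], of c] by simp
  then have "u \<omega> - (\<integral>y. F y * \<omega> y \<partial>\<mu>) = u \<phi> - (\<integral>y. (F y - b) * \<omega> y \<partial>\<mu>)" using i3 by simp
  then have "cmod (u \<omega> - (\<integral>y. F y * \<omega> y \<partial>\<mu>)) \<le> cmod (u \<phi>) + cmod (\<integral>y. (F y - b) * \<omega> y \<partial>\<mu>)"
    by (simp add: norm_triangle_ineq4)
  also have "\<dots> \<le> (bump_const 2 1 2 + M * rho_const 2) * (A * ?v) * r powr s * (c1 * P) +
      A * (k0 * (2 * r powr s) * (M * ?v) * (c1 * P + P) + M * ?v * (r powr s * (c1 * P)))"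
    by (rule add_mono[OF \<phi>1 I])
  also have "\<dots> = (piece_const * A * r powr s * ?v) * P"
    unfolding piece_const_def Let_def M_def[symmetric] c1_def[symmetric] k0_def[symmetric] by (simp add: algebra_simps)
  finally have "cmod (u \<omega> - (\<integral>y. F y * \<omega> y \<partial>\<mu>)) \<le> (piece_const * A * r powr s * ?v) * P" .
  then have "ennreal (cmod (u \<omega> - (\<integral>y. F y * \<omega> y \<partial>\<mu>))) \<le> ennreal ((piece_const * A * r powr s * ?v) * P)" by (rule ennreal_leI)
  also have "\<dots> = ennreal (piece_const * A * r powr s * ?v) * ennreal P"
    using real by (intro ennreal_mult'') auto
  finally show ?thesis using real by simp
qed

text \<open>By \<open>sum_pavg_le\<close> the errors \<open>r powr s * V \<alpha> r\<close> times a
  \<open>q\<close>-mean add up to a multiple of \<open>r powr (s - n * (1 / q - 1))\<close>. The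
  quantity estimated does not depend on \<open>r\<close>, hence it is zero.\<close>

lemma u_eq_bounded_support:
  assumes R: "1 \<le> R" and A: "0 < A" and supp: "\<And>y. \<psi> y \<noteq> 0 \<Longrightarrow> dist x1 y \<le> R"
    and bd: "\<And>y. cmod (\<psi> y) \<le> A" and lip: "\<And>y y'. cmod (\<psi> y - \<psi> y') \<le> A * dist y y'"
  shows "u \<psi> = (\<integral>y. F y * \<psi> y \<partial>\<mu>)"
proof -
  \<comment> \<open>A Lipschitz constant for products of \<open>\<psi>\<close> with the partition: 2
    bounds the partition functions, the rest is the constant of
    \<open>partition_lipschitz\<close>.\<close>
  define L0 where "L0 = 3 + 4 * (D * 10 powr n)"
  let ?\<theta> = "n * (1 / q - 1)"
  have L0: "2 \<le> L0" using D_ge by (simp add: L0_def)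
  obtain B where B: "0 \<le> B" "\<And>R. 1 \<le> R \<Longrightarrow> pavg q x1 R (\<lambda>x. ennreal (g x)) \<le> ennreal B"
    using g_avg_bounded by blast
  define Z where "Z = piece_const * (A * L0) * (net_const q 4 * (R + 1) powr ?\<theta> * V x1 (R + 1)) * B"
  have pcp: "0 < piece_const"
    using D_ge bump_const_pos[of 2 1 2] rho_const_pos[of 2] poincare_const_pos[OF q(4)]
    unfolding piece_const_def Let_def by (intro add_pos_nonneg mult_pos_pos) auto
  have nc: "0 < net_const q 4" by (rule net_const_pos) simp
  have main: "cmod (u \<psi> - (\<integral>y. F y * \<psi> y \<partial>\<mu>)) \<le> Z * (2 powr (?\<theta> - s)) ^ k" if k: "k \<noteq> 0" for k
  proof -
    define r where "r = 2 powr (- real k)"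
    have r: "0 < r" "r \<le> 1" using powr_mono[of "- real k" 0 2] by (auto simp: r_def)
    obtain N where N: "finite N" "N \<subseteq> ball x1 (R + 1)" "separated r N" "\<And>y. y \<in> ball x1 (R + 1) \<Longrightarrow> \<exists>z\<in>N. dist z y < r"
      by (rule net_exists[of r "R + 1" x1]) (use r R in auto)
    \<comment> \<open>Tents of radius \<open>2 * r\<close> are at least 1/2 within \<open>r\<close>
      of their centre, so where \<open>\<psi>\<close> does not vanish the truncation is inactive and
      the quotients sum to 1.\<close>
    define \<sigma> where "\<sigma> y = max (1 / 2) (\<Sum>\<alpha>\<in>N. tent (2 * r) \<alpha> y)" for y
    define \<omega> where "\<omega> \<alpha> y = \<psi> y * complex_of_real (tent (2 * r) \<alpha> y / \<sigma> y)" for \<alpha> y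
    have \<sigma>: "1 / 2 \<le> \<sigma> y" for y by (simp add: \<sigma>_def)
    have \<sigma>0: "0 < \<sigma> y" for y using \<sigma>[of y] by linarith
    have inv: "tent (2 * r) \<alpha> y / \<sigma> y \<le> 2" for \<alpha> y
    proof -
      have "tent (2 * r) \<alpha> y \<le> 1" using r by simp
      then show ?thesis using \<sigma>[of y] \<sigma>0[of y] by (simp add: divide_le_eq)
    qed
    have t0: "0 \<le> tent (2 * r) \<alpha> y / \<sigma> y" for \<alpha> y using \<sigma>0[of y] by simp
    have sum1: "\<psi> y = (\<Sum>\<alpha>\<in>N. \<omega> \<alpha> y)" for y
    proof (cases "\<psi> y = 0")
      case False
      then have "y \<in> ball x1 (R + 1)" using supp[of y] by simp
      then obtain z where z: "z \<in> N" "dist z y < r" using N(4) by blast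
      have "1 / 2 \<le> tent (2 * r) z y" using z r by (intro tent_ge_half) auto
      also have "\<dots> \<le> (\<Sum>\<alpha>\<in>N. tent (2 * r) \<alpha> y)" using z N(1) by (intro member_le_sum) auto
      finally have "\<sigma> y = (\<Sum>\<alpha>\<in>N. tent (2 * r) \<alpha> y)" by (simp add: \<sigma>_def)
      then have "(\<Sum>\<alpha>\<in>N. tent (2 * r) \<alpha> y / \<sigma> y) = 1"
        using \<sigma>0[of y] by (simp add: sum_divide_distrib[symmetric])
      then have "(\<Sum>\<alpha>\<in>N. complex_of_real (tent (2 * r) \<alpha> y / \<sigma> y)) = 1"
        unfolding of_real_sum[symmetric] by simp
      then show ?thesis unfolding \<omega>_def sum_distrib_left[symmetric] by simp
    qed (simp add: \<omega>_def)
    have AL: "0 < A * L0" "2 * A \<le> A * L0" using A L0 by auto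
    have \<omega>s: "dist \<alpha> y < 2 * r" if "\<omega> \<alpha> y \<noteq> 0" for \<alpha> y
      using that tent_nonzero[of "2 * r" \<alpha> y] r by (auto simp: \<omega>_def)
    have \<omega>b: "cmod (\<omega> \<alpha> y) \<le> A * L0" for \<alpha> y
    proof -
      have "cmod (\<omega> \<alpha> y) = cmod (\<psi> y) * (tent (2 * r) \<alpha> y / \<sigma> y)"
        using less_imp_le[OF \<sigma>0[of y]] by (simp add: \<omega>_def norm_mult norm_divide)
      also have "\<dots> \<le> A * 2" using bd[of y] inv[of \<alpha> y] t0[of \<alpha> y] A by (intro mult_mono) auto
      finally show ?thesis using AL by simp
    qed
    have \<omega>l: "cmod (\<omega> \<alpha> y - \<omega> \<alpha> y') \<le> A * L0 * (dist y y' / r)" if "\<alpha> \<in> N" for \<alpha> y y'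
    proof -
      let ?t = "\<lambda>y. tent (2 * r) \<alpha> y / \<sigma> y"
      have td: "\<bar>?t y - ?t y'\<bar> \<le> (1 + 4 * (D * 10 powr n)) * (dist y y' / r)"
        unfolding \<sigma>_def by (rule partition_lipschitz[OF N(1,3) r(1) that])
      have "\<omega> \<alpha> y - \<omega> \<alpha> y' = (\<psi> y - \<psi> y') * complex_of_real (?t y) + \<psi> y' * complex_of_real (?t y - ?t y')"
      proof -
        have "a * c - b * d = (a - b) * c + b * (c - d)" for a b c d :: complex by (simp add: algebra_simps)
        then show ?thesis unfolding \<omega>_def of_real_diff .
      qed
      then have "cmod (\<omega> \<alpha> y - \<omega> \<alpha> y') \<le> cmod ((\<psi> y - \<psi> y') * complex_of_real (?t y)) + cmod (\<psi> y' * complex_of_real (?t y - ?t y'))"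
        by (metis norm_triangle_ineq)
      also have "\<dots> = cmod (\<psi> y - \<psi> y') * ?t y + cmod (\<psi> y') * \<bar>?t y - ?t y'\<bar>"
        using t0[of \<alpha> y] by (simp only: norm_mult norm_of_real abs_of_nonneg)
      also have "\<dots> \<le> (A * dist y y') * 2 + A * ((1 + 4 * (D * 10 powr n)) * (dist y y' / r))"
        using lip[of y y'] inv[of \<alpha> y] t0[of \<alpha> y] bd[of y'] td A by (intro add_mono mult_mono) auto
      also have "\<dots> \<le> (A * (dist y y' / r)) * 2 + A * ((1 + 4 * (D * 10 powr n)) * (dist y y' / r))"
      proof -
        have "dist y y' * r \<le> dist y y' * 1" using r by (intro mult_left_mono) auto
        then have dr: "dist y y' \<le> dist y y' / r" using r by (simp add: pos_le_divide_eq)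
        show ?thesis
          by (intro add_right_mono mult_right_mono mult_left_mono dr) (use A in auto)
      qed
      also have "\<dots> = A * L0 * (dist y y' / r)" by (simp add: L0_def algebra_simps)
      finally show ?thesis .
    qed
    have \<omega>_test: "\<omega> \<alpha> \<in> test_space \<mu> x1 1 1 2" if "\<alpha> \<in> N" for \<alpha>
      using \<omega>s[of \<alpha>] \<omega>b \<omega>l[OF that] r by (intro bump_in_test_space[of 1 2 "\<omega> \<alpha>" \<alpha> "2 * r" "A * L0" "A * L0 / r"]) (auto intro: less_imp_le)
    have "u \<psi> = u (\<lambda>y. \<Sum>\<alpha>\<in>N. \<omega> \<alpha> y)" using sum1 by presburger
    also have "\<dots> = (\<Sum>\<alpha>\<in>N. u (\<omega> \<alpha>))" by (rule dual_sum[OF u N(1) \<omega>_test])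
    finally have 1: "u \<psi> = (\<Sum>\<alpha>\<in>N. u (\<omega> \<alpha>))" .
    have "(\<integral>y. F y * \<psi> y \<partial>\<mu>) = (\<integral>y. (\<Sum>\<alpha>\<in>N. F y * \<omega> \<alpha> y) \<partial>\<mu>)"
      by (subst sum1) (simp add: sum_distrib_left)
    also have "\<dots> = (\<Sum>\<alpha>\<in>N. \<integral>y. F y * \<omega> \<alpha> y \<partial>\<mu>)"
      using q s by (intro Bochner_Integration.integral_sum F_test_integrable[OF \<omega>_test]) auto
    finally have 2: "(\<integral>y. F y * \<psi> y \<partial>\<mu>) = (\<Sum>\<alpha>\<in>N. \<integral>y. F y * \<omega> \<alpha> y \<partial>\<mu>)" .
    have "ennreal (cmod (u \<psi> - (\<integral>y. F y * \<psi> y \<partial>\<mu>))) \<le> (\<Sum>\<alpha>\<in>N. ennreal (cmod (u (\<omega> \<alpha>) - (\<integral>y. F y * \<omega> \<alpha> y \<partial>\<mu>))))"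
      unfolding 1 2 sum_subtractf[symmetric] by (subst sum_ennreal) (auto intro!: ennreal_leI norm_sum)
    also have "\<dots> \<le> (\<Sum>\<alpha>\<in>N. ennreal (piece_const * (A * L0) * r powr s * V \<alpha> r) * pavg q \<alpha> (4 * r) (\<lambda>x. ennreal (g x)))"
      using k \<omega>s \<omega>b \<omega>l AL by (intro sum_mono u_piece) (auto simp: r_def)
    also have "\<dots> = ennreal (piece_const * (A * L0) * r powr s) * (\<Sum>\<alpha>\<in>N. ennreal (V \<alpha> r) * pavg q \<alpha> (4 * r) (\<lambda>x. ennreal (g x)))"
      unfolding sum_distrib_left
      by (rule sum.cong[OF refl], subst ennreal_mult[of "piece_const * (A * L0) * r powr s"])
         (use pcp A L0 in \<open>auto simp: mult.assoc intro!: mult_nonneg_nonneg\<close>)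
    also have "\<dots> \<le> ennreal (piece_const * (A * L0) * r powr s) *
        (ennreal (net_const q 4 * ((R + 1) / r) powr ?\<theta> * V x1 (R + 1)) * pavg q x1 ((4 + 1) * (R + 1)) (\<lambda>x. ennreal (g x)))"
      using q N r R by (intro mult_left_mono sum_pavg_le) auto
    also have "\<dots> \<le> ennreal (piece_const * (A * L0) * r powr s) *
        (ennreal (net_const q 4 * ((R + 1) / r) powr ?\<theta> * V x1 (R + 1)) * ennreal B)"
      using R by (intro mult_left_mono B) auto
    also have "\<dots> = ennreal (piece_const * (A * L0) * r powr s * (net_const q 4 * ((R + 1) / r) powr ?\<theta> * V x1 (R + 1) * B))"
      using pcp AL nc B by (simp add: ennreal_mult)
    finally have "cmod (u \<psi> - (\<integral>y. F y * \<psi> y \<partial>\<mu>)) \<le> piece_const * (A * L0) * r powr s * (net_const q 4 * ((R + 1) / r) powr ?\<theta> * V x1 (R + 1) * B)"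
      using pcp AL nc B by (subst (asm) ennreal_le_iff) auto
    also have "\<dots> = Z * (2 powr (?\<theta> - s)) ^ k"
    proof -
      have "((R + 1) / r) powr ?\<theta> = (R + 1) powr ?\<theta> / r powr ?\<theta>" using R r by (simp add: powr_divide)
      moreover have "r powr s / r powr ?\<theta> = (2 powr (?\<theta> - s)) ^ k"
        unfolding r_def by (simp add: powr_realpow[symmetric] powr_powr powr_diff[symmetric] algebra_simps)
      ultimately show ?thesis unfolding Z_def by (simp add: divide_inverse mult_ac)
    qed
    finally show ?thesis .
  qed
  have "(\<lambda>k. Z * (2 powr (?\<theta> - s)) ^ k) \<longlonglongrightarrow> 0"
    using q powr_less_one[of 2 "?\<theta> - s"] by (intro tendsto_mult_right_zero LIMSEQ_power_zero) auto
  then have "cmod (u \<psi> - (\<integral>y. F y * \<psi> y \<partial>\<mu>)) \<le> 0"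
    by (rule LIMSEQ_le_const) (use main in \<open>auto intro!: exI[of _ 1]\<close>)
  then show ?thesis by simp
qed

end

end

section \<open>Removing the support condition\<close>

lemma test_bound_le_const:
  assumes "test_bound \<mu> x r \<beta> \<gamma> C \<phi>" "C \<le> C'"
  shows "test_bound \<mu> x r \<beta> \<gamma> C' \<phi>"
  unfolding test_bound_def
proof (intro conjI allI impI)
  fix y
  show "cmod (\<phi> y) \<le> C' * test_weight \<mu> x r \<gamma> y"
    using assms mult_right_mono[OF assms(2) test_weight_nonneg] unfolding test_bound_def by (meson order_trans)
next
  fix y y' assume "dist y y' \<le> (r + dist x y) / 2"
  then have "cmod (\<phi> y - \<phi> y') \<le> C * ((dist y y' / (r + dist x y)) powr \<beta> * test_weight \<mu> x r \<gamma> y)"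
    using assms(1) unfolding test_bound_def by (simp add: mult.assoc)
  also have "\<dots> \<le> C' * ((dist y y' / (r + dist x y)) powr \<beta> * test_weight \<mu> x r \<gamma> y)"
    by (intro mult_right_mono assms(2) mult_nonneg_nonneg powr_ge_zero test_weight_nonneg)
  finally show "cmod (\<phi> y - \<phi> y') \<le> C' * (dist y y' / (r + dist x y)) powr \<beta> * test_weight \<mu> x r \<gamma> y"
    by (simp add: mult.assoc)
qed

text \<open>Zero near the centre and one far away: multiplication by it retains the tail of a
  function.\<close>

definition cutoff :: "'a::metric_space \<Rightarrow> real \<Rightarrow> 'a \<Rightarrow> real" where
  "cutoff x1 R y = min 1 (max 0 (dist x1 y / R - 1))"

lemma cutoff_bounds: "0 \<le> cutoff x1 R y" "cutoff x1 R y \<le> 1"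
  by (auto simp: cutoff_def)

lemma cutoff_zero: "0 < R \<Longrightarrow> dist x1 y \<le> R \<Longrightarrow> cutoff x1 R y = 0"
  by (simp add: cutoff_def divide_le_eq)

lemma cutoff_one: "0 < R \<Longrightarrow> 2 * R \<le> dist x1 y \<Longrightarrow> cutoff x1 R y = 1"
  by (simp add: cutoff_def le_divide_eq)

lemma cutoff_lipschitz:
  assumes "0 < R" shows "\<bar>cutoff x1 R y - cutoff x1 R y'\<bar> \<le> dist y y' / R"
proof -
  have "\<bar>dist x1 y / R - dist x1 y' / R\<bar> \<le> dist y y' / R"
    using assms abs_dist_diff_le[of y x1 y'] by (simp add: diff_divide_distrib[symmetric] divide_right_mono dist_commute)
  then show ?thesis unfolding cutoff_def by linarith
qed

context doubling_measure
begin

text \<open>The centres are much closer to each other than either is to \<open>y\<close>: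
  \<open>dist x1 x\<close> is at most a quarter of \<open>dist x1 y\<close>, so distances and
  volumes seen from \<open>x\<close> and from \<open>x1\<close> are comparable.\<close>

lemma test_weight_recentre:
  assumes x: "dist x1 x \<le> R / 8" and R: "2 \<le> R" and y: "R / 2 \<le> dist x1 y"
  shows "test_weight \<mu> x1 1 2 y \<le> 8 * (D * 2 powr n) * test_weight \<mu> x 1 2 y"
proof -
  let ?D1 = "dist x1 y" and ?Dx = "dist x y" and ?M = "D * 2 powr n"
  have xd: "dist x1 x \<le> ?D1 / 4" using x y by linarith
  have up: "?Dx \<le> 5 / 4 * ?D1" using xd dist_triangle[of x y x1] by (simp add: dist_commute)
  have D1: "0 < ?D1" "1 \<le> ?D1" using y R by linarith+
  have v0: "0 < V x 1 + V x ?Dx" "0 < V x1 1 + V x1 ?D1" by (auto intro!: add_pos_nonneg)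
  have "V x 1 \<le> ?M * V x1 ?D1" "V x ?Dx \<le> ?M * V x1 ?D1"
    using D1 xd up by (auto intro!: V_le simp: dist_commute)
  then have "V x 1 + V x ?Dx \<le> 2 * ?M * V x1 ?D1" by linarith
  also have "\<dots> \<le> 2 * ?M * (V x1 1 + V x1 ?D1)" using D_ge by (intro mult_left_mono) auto
  finally have "V x 1 + V x ?Dx \<le> 2 * ?M * (V x1 1 + V x1 ?D1)" .
  then have 1: "1 / (V x1 1 + V x1 ?D1) \<le> 2 * ?M * (1 / (V x 1 + V x ?Dx))"
    using v0 by (simp add: divide_simps mult_ac)
  have pos: "0 < 1 + ?D1" "0 < 1 + ?Dx" by (auto intro: add_pos_nonneg)
  have "1 + ?Dx \<le> 2 * (1 + ?D1)" using up D1 by argo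
  then have "1 / (1 + ?D1) \<le> 2 * (1 / (1 + ?Dx))" using pos by (simp add: divide_simps mult_ac)
  then have "(1 / (1 + ?D1)) powr 2 \<le> (2 * (1 / (1 + ?Dx))) powr 2" using pos by (intro powr_mono2) auto
  also have "\<dots> = 4 * (1 / (1 + ?Dx)) powr 2" by (subst powr_mult) simp
  finally have 2: "(1 / (1 + ?D1)) powr 2 \<le> 4 * (1 / (1 + ?Dx)) powr 2" .
  have "test_weight \<mu> x1 1 2 y \<le> (2 * ?M * (1 / (V x 1 + V x ?Dx))) * (4 * (1 / (1 + ?Dx)) powr 2)"
    unfolding test_weight_def using 1 2 v0 D_ge by (intro mult_mono) auto
  then show ?thesis unfolding test_weight_def by (simp add: mult_ac)
qed

text \<open>In the range of the Holder condition \<open>1 + dist x y\<close> is at most twice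
  \<open>1 + dist x y'\<close>, and doubling carries this over to volumes.\<close>

lemma test_weight_shift:
  assumes d: "dist y y' \<le> (1 + dist x y) / 2"
  shows "test_weight \<mu> x 1 2 y' \<le> 4 * (1 + D * 4 powr n) * test_weight \<mu> x 1 2 y"
proof -
  let ?d = "dist x y" and ?d' = "dist x y'" and ?M = "D * 4 powr n"
  have half: "1 + ?d \<le> 2 * (1 + ?d')" using d dist_triangle2[of x y y'] by argo
  have pos: "0 < 1 + ?d" "0 < 1 + ?d'" by (auto intro: add_pos_nonneg)
  have v0: "0 < V x 1 + V x ?d" "0 < V x 1 + V x ?d'" by (auto intro!: add_pos_nonneg)
  have "V x ?d \<le> ?M * V x (max 1 ?d')"
    using half by (intro V_le) (auto simp: max_def)
  moreover have "V x (max 1 ?d') \<le> V x 1 + V x ?d'" by (simp add: max_def)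
  then have "?M * V x (max 1 ?d') \<le> ?M * (V x 1 + V x ?d')"
    using D_ge by (intro mult_left_mono) auto
  ultimately have "V x ?d \<le> ?M * (V x 1 + V x ?d')" by (rule order_trans)
  then have "V x 1 + V x ?d \<le> (1 + ?M) * (V x 1 + V x ?d')"
    using V_nonneg[of x ?d'] by (simp add: distrib_right add_increasing2 del: V_nonneg)
  then have 1: "1 / (V x 1 + V x ?d') \<le> (1 + ?M) * (1 / (V x 1 + V x ?d))"
    using v0 by (simp add: divide_simps mult_ac)
  have "1 / (1 + ?d') \<le> 2 * (1 / (1 + ?d))" using half pos by (simp add: divide_simps mult_ac)
  then have "(1 / (1 + ?d')) powr 2 \<le> (2 * (1 / (1 + ?d))) powr 2" using pos by (intro powr_mono2) auto
  also have "\<dots> = 4 * (1 / (1 + ?d)) powr 2" by (subst powr_mult) simp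
  finally have 2: "(1 / (1 + ?d')) powr 2 \<le> 4 * (1 / (1 + ?d)) powr 2" .
  have "test_weight \<mu> x 1 2 y' \<le> ((1 + ?M) * (1 / (V x 1 + V x ?d))) * (4 * (1 / (1 + ?d)) powr 2)"
    unfolding test_weight_def using 1 2 v0 D_ge by (intro mult_mono) auto
  also have "\<dots> = 4 * (1 + ?M) * test_weight \<mu> x 1 2 y" unfolding test_weight_def by (simp only: mult_ac)
  finally show ?thesis .
qed

text \<open>The leading factor moves the centre of the weight. In the bracket, 13 is 2 for the
  smoothness of \<open>\<psi>\<close> plus 11 for that of the cutoff, and the remaining term covers
  distances too large for smoothness.\<close>

definition cutoff_const :: real where
  "cutoff_const = 8 * (D * 2 powr n) * (13 + 4 * (1 + 4 * (1 + D * 4 powr n)))"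

lemma cutoff_const_pos: "0 < cutoff_const"
  using D_ge unfolding cutoff_const_def by (intro mult_pos_pos add_pos_pos) auto

text \<open>The point is a constant independent of \<open>R\<close> and \<open>x\<close>. Near
  \<open>x1\<close> the tail vanishes; farther out the weights at \<open>x1\<close> and
  \<open>x\<close> are comparable, and the slope \<open>1 / R\<close> of the cutoff is harmless
  because it lives at distances comparable with \<open>R\<close>.\<close>

lemma cutoff_test_bound:
  assumes b: "test_bound \<mu> x1 1 1 2 C \<psi>" and C: "0 \<le> C" and R: "4 \<le> R" and x: "dist x1 x \<le> R / 8"
  shows "test_bound \<mu> x 1 1 2 (cutoff_const * C) (\<lambda>y. \<psi> y * complex_of_real (cutoff x1 R y))"
proof -
  let ?\<eta> = "cutoff x1 R" and ?w = "test_weight \<mu> x 1 2" and ?w1 = "test_weight \<mu> x1 1 2"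
  define c1 where "c1 = 8 * (D * 2 powr n)"
  define c2 where "c2 = 4 * (1 + D * 4 powr n)"
  have c: "0 < c1" "0 < c2" using D_ge by (auto simp: c1_def c2_def intro!: add_pos_pos)
  have cc: "cutoff_const = c1 * (13 + 4 * (1 + c2))" by (simp add: cutoff_const_def c1_def c2_def)
  have R0: "0 < R" using R by simp
  define \<phi> where "\<phi> = (\<lambda>y. \<psi> y * complex_of_real (?\<eta> y))"
  have w0: "0 \<le> ?w y" for y by (rule test_weight_nonneg)
  have w10: "0 \<le> ?w1 y" for y by (rule test_weight_nonneg)
  have \<psi>: "cmod (\<psi> y) \<le> C * ?w1 y" for y using b by (simp add: test_bound_def)
  have n\<phi>: "cmod (\<phi> y) = cmod (\<psi> y) * ?\<eta> y" for y
    using cutoff_bounds[of x1 R y] by (simp add: \<phi>_def norm_mult)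
  have rec: "?w1 y \<le> c1 * ?w y" if "R / 2 \<le> dist x1 y" for y
    unfolding c1_def using x R that by (intro test_weight_recentre) auto
  have size: "cmod (\<phi> y) \<le> C * c1 * ?w y" for y
  proof (cases "dist x1 y \<le> R")
    case True
    then show ?thesis using cutoff_zero[OF R0 True] C c w0[of y] by (simp add: n\<phi>)
  next
    case False
    have "cmod (\<phi> y) \<le> cmod (\<psi> y) * 1" unfolding n\<phi> using cutoff_bounds[of x1 R y] by (intro mult_left_mono) auto
    also have "\<dots> \<le> C * ?w1 y" using \<psi> by simp
    also have "\<dots> \<le> C * (c1 * ?w y)" using False R0 C by (intro mult_left_mono rec) auto
    finally show ?thesis by (simp add: mult.assoc)
  qed
  have "test_bound \<mu> x 1 1 2 (cutoff_const * C) \<phi>"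
    unfolding test_bound_def
  proof (intro conjI allI impI)
    fix y
    have "C * c1 * ?w y \<le> cutoff_const * C * ?w y"
      unfolding cc using C c w0[of y] by (intro mult_right_mono) (auto simp: algebra_simps intro!: mult_nonneg_nonneg add_nonneg_nonneg)
    then show "cmod (\<phi> y) \<le> cutoff_const * C * ?w y" using size[of y] by linarith
  next
    fix y y' assume d: "dist y y' \<le> (1 + dist x y) / 2"
    let ?d = "dist y y'" and ?D1 = "dist x1 y" and ?Dx = "dist x y"
    have pos: "0 < 1 + ?D1" "0 < 1 + ?Dx" by (auto intro: add_pos_nonneg)
    have q0: "0 \<le> ?d / (1 + ?Dx)" using pos by simp
    have goal: "cmod (\<phi> y - \<phi> y') \<le> cutoff_const * C * (?d / (1 + ?Dx)) * ?w y"
    proof (cases "?D1 < R / 2")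
      case True
      have "?Dx \<le> R / 8 + R / 2" using True x dist_triangle[of x y x1] by (simp add: dist_commute)
      then have "?d \<le> (1 + (R / 8 + R / 2)) / 2" using d by argo
      then have "dist x1 y' \<le> R" using True dist_triangle[of x1 y' y] R by argo
      then have "\<phi> y = 0" "\<phi> y' = 0" using True R0 cutoff_zero[OF R0, of x1 y] cutoff_zero[OF R0, of x1 y']
        by (auto simp: \<phi>_def)
      then show ?thesis using cutoff_const_pos C q0 w0[of y] by simp
    next
      case far: False
      have xd: "dist x1 x \<le> ?D1 / 4" using x far by linarith
      have up: "?Dx \<le> 5 / 4 * ?D1" using xd dist_triangle[of x y x1] by (simp add: dist_commute)
      have wy: "?w1 y \<le> c1 * ?w y" using far by (intro rec) auto
      show ?thesis
      proof (cases "?d \<le> (1 + ?D1) / 2")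
        case True
        have e1: "cmod (\<psi> y - \<psi> y') \<le> C * (2 * (?d / (1 + ?Dx))) * ?w1 y"
        proof -
          have "cmod (\<psi> y - \<psi> y') \<le> C * (?d / (1 + ?D1)) powr 1 * ?w1 y"
            using b True unfolding test_bound_def by blast
          also have "(?d / (1 + ?D1)) powr 1 = ?d / (1 + ?D1)" using pos by simp
          also have "C * (?d / (1 + ?D1)) * ?w1 y \<le> C * (2 * (?d / (1 + ?Dx))) * ?w1 y"
          proof (intro mult_right_mono mult_left_mono C w10)
            have "1 + ?Dx \<le> 2 * (1 + ?D1)" using up zero_le_dist[of x1 y] by argo
            then have "?d * (1 + ?Dx) \<le> ?d * (2 * (1 + ?D1))" by (rule mult_left_mono) simp
            then have "?d * (1 + ?Dx) \<le> 2 * (?d * (1 + ?D1))" by (simp only: mult.left_commute[of "?d" 2])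
            then show "?d / (1 + ?D1) \<le> 2 * (?d / (1 + ?Dx))" using pos by (simp add: divide_simps mult_ac)
          qed
          finally show ?thesis .
        qed
        \<comment> \<open>For \<open>dist x1 y \<le> 8 * R\<close> the slope \<open>1 / R\<close> is
          at most \<open>11 / (1 + dist x y)\<close>. Beyond that the cutoff is 1 at both
          points.\<close>
        have e2: "\<bar>?\<eta> y - ?\<eta> y'\<bar> \<le> 11 * (?d / (1 + ?Dx))"
        proof (cases "?D1 \<le> 8 * R")
          case True
          have "1 + ?Dx \<le> 11 * R" using True up R by linarith
          then have "?d * (1 + ?Dx) \<le> ?d * (11 * R)" by (intro mult_left_mono) auto
          then have "?d / R \<le> 11 * (?d / (1 + ?Dx))" using pos R0 by (simp add: divide_simps mult_ac)
          then show ?thesis using cutoff_lipschitz[OF R0, of x1 y y'] by linarith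
        next
          case False
          have "2 * R \<le> dist x1 y'" using False True R dist_triangle2[of x1 y y'] by argo
          then have "?\<eta> y = 1" "?\<eta> y' = 1" using False R0 by (auto intro!: cutoff_one)
          then show ?thesis using q0 by simp
        qed
        have "\<phi> y - \<phi> y' = (\<psi> y - \<psi> y') * complex_of_real (?\<eta> y') + \<psi> y * complex_of_real (?\<eta> y - ?\<eta> y')"
          by (simp add: \<phi>_def algebra_simps)
        then have "cmod (\<phi> y - \<phi> y') \<le> cmod ((\<psi> y - \<psi> y') * complex_of_real (?\<eta> y')) + cmod (\<psi> y * complex_of_real (?\<eta> y - ?\<eta> y'))"
          by (metis norm_triangle_ineq)
        also have "\<dots> = cmod (\<psi> y - \<psi> y') * ?\<eta> y' + cmod (\<psi> y) * \<bar>?\<eta> y - ?\<eta> y'\<bar>"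
          using cutoff_bounds(1)[of x1 R y'] by (simp only: norm_mult norm_of_real abs_of_nonneg)
        also have "\<dots> \<le> (C * (2 * (?d / (1 + ?Dx))) * ?w1 y) * 1 + (C * ?w1 y) * (11 * (?d / (1 + ?Dx)))"
          using e1 e2 \<psi>[of y] cutoff_bounds[of x1 R y'] C w10[of y] q0
          by (intro add_mono mult_mono mult_nonneg_nonneg) auto
        also have "\<dots> = (13 * C * (?d / (1 + ?Dx))) * ?w1 y" by (simp add: algebra_simps)
        also have "\<dots> \<le> (13 * C * (?d / (1 + ?Dx))) * (c1 * ?w y)"
          using wy C q0 by (intro mult_left_mono mult_nonneg_nonneg) auto
        also have "\<dots> = (c1 * 13) * (C * (?d / (1 + ?Dx)) * ?w y)" by (simp only: mult_ac)
        also have "\<dots> \<le> cutoff_const * (C * (?d / (1 + ?Dx)) * ?w y)"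
          unfolding cc using C q0 w0[of y] c by (intro mult_right_mono mult_left_mono mult_nonneg_nonneg) auto
        finally show ?thesis by (simp only: mult_ac)
      next
        case False
        \<comment> \<open>The distance of the points is now comparable with
          \<open>1 + dist x y\<close>, so the normalised distance is bounded below and size alone
          gives the bound.\<close>
        have one: "1 \<le> 4 * (?d / (1 + ?Dx))"
        proof -
          have "1 + ?Dx \<le> 4 * ?d" using False up zero_le_dist[of x1 y] by argo
          then show ?thesis using pos by (simp add: divide_simps)
        qed
        have "cmod (\<phi> y - \<phi> y') \<le> cmod (\<phi> y) + cmod (\<phi> y')" by (rule norm_triangle_ineq4)
        also have "\<dots> \<le> C * c1 * ?w y + C * c1 * (c2 * ?w y)"
        proof (intro add_mono size order_trans[OF size] mult_left_mono)
          show "?w y' \<le> c2 * ?w y" unfolding c2_def using d by (rule test_weight_shift)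
        qed (use C c in auto)
        also have "\<dots> = (C * c1 * (1 + c2) * ?w y) * 1" by (simp add: algebra_simps)
        also have "\<dots> \<le> (C * c1 * (1 + c2) * ?w y) * (4 * (?d / (1 + ?Dx)))"
          using one C c w0[of y] by (intro mult_left_mono mult_nonneg_nonneg) auto
        also have "\<dots> = (c1 * (4 * (1 + c2))) * (C * (?d / (1 + ?Dx)) * ?w y)" by (simp only: mult_ac)
        also have "\<dots> \<le> cutoff_const * (C * (?d / (1 + ?Dx)) * ?w y)"
          unfolding cc using C q0 w0[of y] c by (intro mult_right_mono mult_left_mono mult_nonneg_nonneg) auto
        finally show ?thesis by (simp only: mult_ac)
      qed
    qed
    then show "cmod (\<phi> y - \<phi> y') \<le> cutoff_const * C * (?d / (1 + ?Dx)) powr 1 * ?w y"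
      using q0 by simp
  qed
  then show ?thesis by (simp add: \<phi>_def)
qed

text \<open>The Holder exponent is 1, and the weight is at most \<open>1 / V x1 1\<close>. Outside
  the range of the Holder condition the distance exceeds 1/2 and the size bound takes over.\<close>

lemma test_bound_lipschitz:
  assumes b: "test_bound \<mu> x1 1 1 2 C \<psi>" and C: "0 \<le> C"
  shows "cmod (\<psi> y) \<le> C / V x1 1" and "cmod (\<psi> y - \<psi> y') \<le> 4 * (C / V x1 1) * dist y y'"
proof -
  have w: "test_weight \<mu> x1 1 2 y \<le> 1 / V x1 1" for y
  proof -
    have pos: "0 < 1 + dist x1 y" by (auto intro: add_pos_nonneg)
    have "test_weight \<mu> x1 1 2 y \<le> 1 / V x1 1 * 1"
      unfolding test_weight_def
    proof (intro mult_mono)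
      show "1 / (V x1 1 + V x1 (dist x1 y)) \<le> 1 / V x1 1" by (intro divide_left_mono) (auto intro!: mult_pos_pos add_pos_nonneg)
      show "(1 / (1 + dist x1 y)) powr 2 \<le> 1" using pos powr_mono2[of 2 "1 / (1 + dist x1 y)" 1] by (simp add: divide_le_eq)
    qed auto
    then show ?thesis by simp
  qed
  have sz: "cmod (\<psi> y) \<le> C / V x1 1" for y
  proof -
    have "cmod (\<psi> y) \<le> C * test_weight \<mu> x1 1 2 y" using b by (simp add: test_bound_def)
    also have "\<dots> \<le> C * (1 / V x1 1)" by (intro mult_left_mono w C)
    finally show ?thesis by simp
  qed
  show "cmod (\<psi> y) \<le> C / V x1 1" by (rule sz)
  have a: "0 \<le> C / V x1 1" using C by simp
  show "cmod (\<psi> y - \<psi> y') \<le> 4 * (C / V x1 1) * dist y y'"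
  proof (cases "dist y y' \<le> (1 + dist x1 y) / 2")
    case True
    have pos: "0 < 1 + dist x1 y" by (auto intro: add_pos_nonneg)
    have "cmod (\<psi> y - \<psi> y') \<le> C * (dist y y' / (1 + dist x1 y)) powr 1 * test_weight \<mu> x1 1 2 y"
      using b True unfolding test_bound_def by blast
    also have "(dist y y' / (1 + dist x1 y)) powr 1 = dist y y' / (1 + dist x1 y)" using pos by simp
    also have "C * (dist y y' / (1 + dist x1 y)) * test_weight \<mu> x1 1 2 y \<le> C * dist y y' * (1 / V x1 1)"
    proof (intro mult_mono w mult_left_mono C)
      have "dist y y' * 1 \<le> dist y y' * (1 + dist x1 y)" by (intro mult_left_mono) auto
      then show "dist y y' / (1 + dist x1 y) \<le> dist y y'" using pos by (simp add: divide_le_eq)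
    qed (use C in \<open>auto simp: test_weight_nonneg\<close>)
    also have "\<dots> = 1 * (C / V x1 1 * dist y y')" by simp
    also have "\<dots> \<le> 4 * (C / V x1 1 * dist y y')" using a by (intro mult_right_mono mult_nonneg_nonneg) auto
    finally show ?thesis by (simp only: mult.assoc)
  next
    case False
    then have d: "1 \<le> 2 * dist y y'" using zero_le_dist[of x1 y] by argo
    have "cmod (\<psi> y - \<psi> y') \<le> 2 * (C / V x1 1) * 1" using norm_triangle_ineq4[of "\<psi> y" "\<psi> y'"] sz[of y] sz[of y'] by linarith
    also have "\<dots> \<le> 2 * (C / V x1 1) * (2 * dist y y')" using d a by (intro mult_left_mono) auto
    finally show ?thesis by simp
  qed
qed

end

context grand_majorant
begin

lemma u_cutoff_le:
  assumes b: "test_bound \<mu> x1 1 1 2 C \<psi>" and C: "0 < C" and R: "4 \<le> R" and x: "dist x1 x \<le> R / 8"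
  shows "ennreal (cmod (u (\<lambda>y. \<psi> y * complex_of_real (cutoff x1 R y)))) \<le> ennreal (cutoff_const * C) * h x"
proof -
  let ?\<phi> = "\<lambda>y. \<psi> y * complex_of_real (cutoff x1 R y)"
  have cc: "0 < cutoff_const * C" using cutoff_const_pos C by simp
  have "test_bound \<mu> x1 1 1 2 (cutoff_const * C) ?\<phi>" using R C by (intro cutoff_test_bound[OF b]) auto
  then have "?\<phi> \<in> test_space \<mu> x1 1 1 2" using cc by (intro test_spaceI) auto
  moreover have "test_bound \<mu> x 1 1 2 (cutoff_const * C) ?\<phi>" using C by (intro cutoff_test_bound[OF b _ R x]) auto
  ultimately show ?thesis using u_le[of ?\<phi> 0 x "cutoff_const * C"] cc by simp
qed

text \<open>The tail of \<open>\<psi>\<close> beyond radius \<open>R\<close> is, up to a constant, a grand test function at every point of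
  the ball of radius \<open>R / 8\<close>. If \<open>u\<close> did not vanish on the tails in the limit, \<open>h\<close> would be bounded
  below on balls of arbitrarily large measure.\<close>
lemma u_eq_integral:
  assumes q: "0 < q" "q \<le> 1" "q \<le> p" "n * (1 / q - 1) < s"
    and unb: "(\<exists>R0. \<forall>y. dist x1 y \<le> R0) \<or> (\<forall>B. \<exists>R. B \<le> V x1 R)"
    and \<psi>: "\<psi> \<in> test_space \<mu> x1 1 1 2"
  shows "u \<psi> = (\<integral>y. F y * \<psi> y \<partial>\<mu>)"
proof (rule ccontr)
  assume neq: "u \<psi> \<noteq> (\<integral>y. F y * \<psi> y \<partial>\<mu>)"
  define e where "e = cmod (u \<psi> - (\<integral>y. F y * \<psi> y \<partial>\<mu>))"
  have e: "0 < e" using neq by (simp add: e_def)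
  obtain C0 where "0 \<le> C0" "test_bound \<mu> x1 1 1 2 C0 \<psi>" using \<psi> by (auto simp: test_space_def)
  then obtain C where C: "0 < C" and b: "test_bound \<mu> x1 1 1 2 C \<psi>"
    using test_bound_le_const[of \<mu> x1 1 1 2 C0 \<psi> "C0 + 1"] by (metis add_nonneg_pos less_add_one less_imp_le zero_less_one)
  define a where "a = C / V x1 1"
  have a: "0 < a" using C by (simp add: a_def)
  let ?R = "\<lambda>m. 4 + real m"
  let ?\<eta> = "\<lambda>m. cutoff x1 (?R m)"
  let ?\<phi> = "\<lambda>m y. \<psi> y * complex_of_real (?\<eta> m y)"
  have \<phi>_test: "?\<phi> m \<in> test_space \<mu> x1 1 1 2" for m
    using cutoff_test_bound[OF b, of "?R m" x1] C cutoff_const_pos by (intro test_spaceI) auto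
  have int: "integrable \<mu> (\<lambda>y. F y * \<omega> y)" if "\<omega> \<in> test_space \<mu> x1 1 1 2" for \<omega>
    using q s by (intro F_test_integrable[OF _ _ _ _ that]) auto
  \<comment> \<open>Removing the tail leaves a Lipschitz function of bounded support, on which
    \<open>u\<close> and integration against \<open>F\<close> agree. The whole discrepancy is
    therefore carried by the tail, for every \<open>m\<close>.\<close>
  have dif: "u \<psi> - (\<integral>y. F y * \<psi> y \<partial>\<mu>) = u (?\<phi> m) - (\<integral>y. F y * ?\<phi> m y \<partial>\<mu>)" for m
  proof -
    let ?\<omega> = "\<lambda>y. \<psi> y - ?\<phi> m y"
    have \<omega>t: "?\<omega> \<in> test_space \<mu> x1 1 1 2" by (rule test_space_diff[OF \<psi> \<phi>_test])
    have "u ?\<omega> = (\<integral>y. F y * ?\<omega> y \<partial>\<mu>)"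
    proof (rule u_eq_bounded_support[OF q, of "2 * ?R m" "5 * a"])
      fix y assume "?\<omega> y \<noteq> 0"
      then have "?\<eta> m y \<noteq> 1" by auto
      then show "dist x1 y \<le> 2 * ?R m" using cutoff_one[of "?R m" x1 y] by linarith
    next
      fix y
      have "?\<omega> y = \<psi> y * complex_of_real (1 - ?\<eta> m y)" by (simp add: algebra_simps)
      then have "cmod (?\<omega> y) = cmod (\<psi> y) * (1 - ?\<eta> m y)"
        using cutoff_bounds[of x1 "?R m" y] by (simp only: norm_mult norm_of_real)
      also have "\<dots> \<le> a * 1" using test_bound_lipschitz(1)[OF b, of y] C cutoff_bounds[of x1 "?R m" y] a
        by (intro mult_mono) (auto simp: a_def)
      finally show "cmod (?\<omega> y) \<le> 5 * a" using a by simp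
    next
      fix y y'
      have "?\<omega> y - ?\<omega> y' = (\<psi> y - \<psi> y') * complex_of_real (1 - ?\<eta> m y) + \<psi> y' * complex_of_real (?\<eta> m y' - ?\<eta> m y)"
        by (simp add: algebra_simps)
      then have "cmod (?\<omega> y - ?\<omega> y') \<le> cmod ((\<psi> y - \<psi> y') * complex_of_real (1 - ?\<eta> m y)) + cmod (\<psi> y' * complex_of_real (?\<eta> m y' - ?\<eta> m y))"
        by (metis norm_triangle_ineq)
      also have "\<dots> = cmod (\<psi> y - \<psi> y') * (1 - ?\<eta> m y) + cmod (\<psi> y') * \<bar>?\<eta> m y' - ?\<eta> m y\<bar>"
        using cutoff_bounds[of x1 "?R m" y] by (simp only: norm_mult norm_of_real)
      also have "\<dots> \<le> (4 * a * dist y y') * 1 + a * dist y y'"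
      proof (intro add_mono mult_mono)
        have "\<bar>?\<eta> m y' - ?\<eta> m y\<bar> \<le> dist y' y / ?R m" by (rule cutoff_lipschitz) simp
        also have "\<dots> \<le> dist y y'"
          using mult_left_mono[of 1 "?R m" "dist y y'"] by (simp add: divide_le_eq dist_commute)
        finally show "\<bar>?\<eta> m y' - ?\<eta> m y\<bar> \<le> dist y y'" .
      qed (use test_bound_lipschitz[OF b] C cutoff_bounds[of x1 "?R m" y] a in \<open>auto simp: a_def\<close>)
      finally show "cmod (?\<omega> y - ?\<omega> y') \<le> 5 * a * dist y y'" by simp
    qed (use a in auto)
    moreover have "u ?\<omega> = u \<psi> - u (?\<phi> m)" by (rule dual_diff[OF u \<psi> \<phi>_test])
    moreover have "(\<integral>y. F y * ?\<omega> y \<partial>\<mu>) = (\<integral>y. F y * \<psi> y \<partial>\<mu>) - (\<integral>y. F y * ?\<phi> m y \<partial>\<mu>)"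
    proof -
      have "(\<integral>y. F y * ?\<omega> y \<partial>\<mu>) = (\<integral>y. (F y * \<psi> y - F y * ?\<phi> m y) \<partial>\<mu>)" by (simp add: algebra_simps)
      also have "\<dots> = (\<integral>y. F y * \<psi> y \<partial>\<mu>) - (\<integral>y. F y * ?\<phi> m y \<partial>\<mu>)"
        by (rule Bochner_Integration.integral_diff[OF int[OF \<psi>] int[OF \<phi>_test]])
      finally show ?thesis .
    qed
    ultimately have eq: "u \<psi> - u (?\<phi> m) = (\<integral>y. F y * \<psi> y \<partial>\<mu>) - (\<integral>y. F y * ?\<phi> m y \<partial>\<mu>)" by (simp only:)
    have swap: "a - c = b - d" if "a - b = c - d" for a b c d :: complex
      using that by (simp add: algebra_simps)
    show ?thesis by (rule swap[OF eq])
  qed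
  \<comment> \<open>The integral part of the discrepancy vanishes in the limit, so for large
    \<open>m\<close> the functional must be at least \<open>e / 2\<close> on the tails.\<close>
  have lim: "(\<lambda>m. \<integral>y. F y * ?\<phi> m y \<partial>\<mu>) \<longlonglongrightarrow> (\<integral>y. 0 \<partial>\<mu>)"
  proof (rule integral_dominated_convergence)
    show "integrable \<mu> (\<lambda>y. cmod (F y * \<psi> y))" using int[OF \<psi>] by simp
    show "(\<lambda>y. F y * ?\<phi> m y) \<in> borel_measurable \<mu>" for m using int[OF \<phi>_test] by (rule borel_measurable_integrable)
    show "AE y in \<mu>. (\<lambda>m. F y * ?\<phi> m y) \<longlonglongrightarrow> 0"
    proof (rule AE_I2)
      fix y
      obtain M where "dist x1 y < real M" using reals_Archimedean2 by blast
      then have "\<forall>m\<ge>M. F y * ?\<phi> m y = 0"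
        using cutoff_zero[of "4 + real _" x1 y] by (auto simp: cutoff_zero)
      then show "(\<lambda>m. F y * ?\<phi> m y) \<longlonglongrightarrow> 0"
        by (intro tendsto_eventually) (auto simp: eventually_sequentially)
    qed
    show "AE y in \<mu>. norm (F y * ?\<phi> m y) \<le> cmod (F y * \<psi> y)" for m
    proof (rule AE_I2)
      fix y
      have "cmod (F y * ?\<phi> m y) = cmod (F y * \<psi> y) * ?\<eta> m y"
        using cutoff_bounds(1)[of x1 "?R m" y] by (simp add: norm_mult)
      also have "\<dots> \<le> cmod (F y * \<psi> y) * 1" using cutoff_bounds(2)[of x1 "?R m" y] by (intro mult_left_mono) auto
      finally show "norm (F y * ?\<phi> m y) \<le> cmod (F y * \<psi> y)" by simp
    qed
  qed simp
  then have "(\<lambda>m. cmod (\<integral>y. F y * ?\<phi> m y \<partial>\<mu>)) \<longlonglongrightarrow> 0" by (simp add: tendsto_norm_zero)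
  then have "eventually (\<lambda>m. cmod (\<integral>y. F y * ?\<phi> m y \<partial>\<mu>) < e / 2) sequentially"
    using e by (intro order_tendstoD) auto
  then obtain M where M: "\<And>m. M \<le> m \<Longrightarrow> cmod (\<integral>y. F y * ?\<phi> m y \<partial>\<mu>) < e / 2"
    by (auto simp: eventually_sequentially)
  have ge: "e / 2 \<le> cmod (u (?\<phi> m))" if "M \<le> m" for m
  proof -
    have "e \<le> cmod (u (?\<phi> m)) + cmod (\<integral>y. F y * ?\<phi> m y \<partial>\<mu>)"
      unfolding e_def dif[of m] by (rule norm_triangle_ineq4)
    then show ?thesis using M[OF that] by linarith
  qed
  from unb show False
  proof
    \<comment> \<open>In a bounded space the tails are eventually zero.\<close>
    assume "\<exists>R0. \<forall>y. dist x1 y \<le> R0"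
    then obtain R0 where R0: "\<And>y. dist x1 y \<le> R0" by blast
    obtain m where m: "R0 < real m" "M \<le> m"
      using reals_Archimedean2[of "max R0 (real M)"] by (metis max_less_iff_conj less_imp_le of_nat_less_iff)
    have "?\<phi> m = (\<lambda>y. 0 * \<psi> y)"
    proof
      fix y
      have "dist x1 y \<le> 4 + real m" using R0[of y] m by linarith
      then show "?\<phi> m y = 0 * \<psi> y" by (simp add: cutoff_zero)
    qed
    then have "u (?\<phi> m) = 0 * u \<psi>" using dual_scale[OF u \<psi>, of 0] by simp
    then show False using ge[OF m(2)] e by simp
  next
    assume unb: "\<forall>B. \<exists>R. B \<le> V x1 R"
    define T where "T = (\<integral>\<^sup>+x. epowr (ennreal (cutoff_const * C) * h x) p \<partial>\<mu>)"
    have "T = ennreal ((cutoff_const * C) powr p) * (\<integral>\<^sup>+x. epowr (h x) p \<partial>\<mu>)"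
      unfolding T_def using p cutoff_const_pos C by (simp add: epowr_mult nn_integral_cmult)
    then have "T < top" using h_Lp by (simp add: ennreal_mult_less_top)
    then obtain t where t: "T = ennreal t" "0 \<le> t" by (cases T) auto
    obtain R where R: "t / (e / 2) powr p + 1 \<le> V x1 R" using unb by blast
    obtain m where m: "8 * R < real m" "M \<le> m"
      using reals_Archimedean2[of "max (8 * R) (real M)"] by (metis max_less_iff_conj less_imp_le of_nat_less_iff)
    have "V x1 R \<le> V x1 (?R m / 8)" using m by (intro V_mono) auto
    then have V: "t / (e / 2) powr p + 1 \<le> V x1 (?R m / 8)" using R by linarith
    have "ennreal ((e / 2) powr p) * ennreal (V x1 (?R m / 8)) = (\<integral>\<^sup>+x. ennreal ((e / 2) powr p) * indicator (ball x1 (?R m / 8)) x \<partial>\<mu>)"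
      by (subst nn_integral_cmult_indicator) (auto simp: emeasure_ball)
    also have "\<dots> \<le> T"
      unfolding T_def
    proof (rule nn_integral_mono)
      fix x
      show "ennreal ((e / 2) powr p) * indicator (ball x1 (?R m / 8)) x \<le> epowr (ennreal (cutoff_const * C) * h x) p"
      proof (cases "x \<in> ball x1 (?R m / 8)")
        case True
        have "ennreal (e / 2) \<le> ennreal (cmod (u (?\<phi> m)))" by (intro ennreal_leI ge m)
        also have "\<dots> \<le> ennreal (cutoff_const * C) * h x" using True C by (intro u_cutoff_le[OF b]) auto
        finally have "epowr (ennreal (e / 2)) p \<le> epowr (ennreal (cutoff_const * C) * h x) p" using p by (intro epowr_mono) auto
        then show ?thesis using True e by simp
      qed simp
    qed
    finally have "(e / 2) powr p * V x1 (?R m / 8) \<le> t"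
      using t by (simp add: ennreal_mult[symmetric] ennreal_le_iff)
    moreover have "0 < (e / 2) powr p" using e by simp
    ultimately have "V x1 (?R m / 8) \<le> t / (e / 2) powr p" by (simp add: le_divide_eq mult.commute)
    then show False using V by linarith
  qed
qed

end

section \<open>Kernels and the square function\<close>

lemma infsum_ennreal_le:
  fixes f :: "'i \<Rightarrow> ennreal"
  assumes "\<And>F. finite F \<Longrightarrow> F \<subseteq> A \<Longrightarrow> sum f F \<le> b"
  shows "infsum f A \<le> b"
  using assms by (intro infsum_le_finite_sums nonneg_summable_on_complete) auto

lemma sum_set_nn_integral_le:
  assumes "finite G" "disjoint_family_on A G" "\<And>i. i \<in> G \<Longrightarrow> A i \<in> sets M" "\<And>i. i \<in> G \<Longrightarrow> A i \<subseteq> B"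
    and [measurable]: "W \<in> borel_measurable M"
  shows "(\<Sum>i\<in>G. \<integral>\<^sup>+x\<in>A i. W x \<partial>M) \<le> (\<integral>\<^sup>+x\<in>B. W x \<partial>M)"
proof -
  have "(\<Sum>i\<in>G. \<integral>\<^sup>+x\<in>A i. W x \<partial>M) = (\<integral>\<^sup>+x. (\<Sum>i\<in>G. W x * indicator (A i) x) \<partial>M)"
    using assms by (subst nn_integral_sum) auto
  also have "\<dots> \<le> (\<integral>\<^sup>+x\<in>B. W x \<partial>M)"
  proof (rule nn_integral_mono)
    fix x
    have "(\<Sum>i\<in>G. W x * indicator (A i) x) = W x * indicator (\<Union>i\<in>G. A i) x"
      using assms by (simp add: sum_distrib_left[symmetric] indicator_UN_disjoint)
    also have "\<dots> \<le> W x * indicator B x"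
      using assms(4) by (intro mult_left_mono) (auto split: split_indicator)
    finally show "(\<Sum>i\<in>G. W x * indicator (A i) x) \<le> W x * indicator B x" .
  qed
  finally show ?thesis .
qed

lemma dist_le_ediam: "x \<in> A \<Longrightarrow> y \<in> A \<Longrightarrow> ennreal (dist x y) \<le> ediam A"
  unfolding ediam_def by (rule SUP_upper2, assumption, rule SUP_upper)

lemma test_closure_memberI:
  assumes \<phi>: "\<phi> \<in> test_space \<mu> x1 1 \<epsilon> \<epsilon>" and "\<beta> \<le> \<epsilon>" "\<gamma> \<le> \<epsilon>"
  shows "\<phi> \<in> test_closure \<mu> x1 \<epsilon> \<beta> \<gamma>"
proof -
  obtain C where "0 \<le> C" "test_bound \<mu> x1 1 \<epsilon> \<epsilon> C \<phi>" using \<phi> by (auto simp: test_space_def)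
  then have "\<phi> \<in> test_space \<mu> x1 1 \<beta> \<gamma>"
    using test_bound_mono[of \<mu> x1 1 \<epsilon> \<epsilon> C \<phi> \<beta> \<gamma>] assms by (auto intro: test_spaceI)
  moreover have "test_norm \<mu> x1 1 \<beta> \<gamma> (\<lambda>x. \<phi> x - \<phi> x) < ennreal \<delta>" if "0 < \<delta>" for \<delta>
  proof -
    have "test_norm \<mu> x1 1 \<beta> \<gamma> (\<lambda>x. \<phi> x - \<phi> x) \<le> ennreal 0"
      using test_bound_zero[of \<mu> x1 1 \<beta> \<gamma>] by (intro test_bound_norm) auto
    then show ?thesis using that by (simp add: le_less_trans)
  qed
  ultimately show ?thesis unfolding test_closure_def using \<phi> by blast
qed

lemma test_closure_subset: "test_closure \<mu> x1 \<epsilon> \<beta> \<gamma> \<subseteq> test_space \<mu> x1 1 \<beta> \<gamma>"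
  by (auto simp: test_closure_def)

lemma test_closure_add:
  assumes "\<phi> \<in> test_closure \<mu> x1 \<epsilon> \<beta> \<gamma>" "\<psi> \<in> test_closure \<mu> x1 \<epsilon> \<beta> \<gamma>"
  shows "(\<lambda>x. \<phi> x + \<psi> x) \<in> test_closure \<mu> x1 \<epsilon> \<beta> \<gamma>"
proof -
  have "\<exists>\<omega>\<in>test_space \<mu> x1 1 \<epsilon> \<epsilon>. test_norm \<mu> x1 1 \<beta> \<gamma> (\<lambda>x. \<phi> x + \<psi> x - \<omega> x) < ennreal \<delta>" if \<delta>: "0 < \<delta>" for \<delta>
  proof -
    have "0 < \<delta> / 2" using \<delta> by simp
    then obtain \<phi>' \<psi>' where a: "\<phi>' \<in> test_space \<mu> x1 1 \<epsilon> \<epsilon>" "test_norm \<mu> x1 1 \<beta> \<gamma> (\<lambda>x. \<phi> x - \<phi>' x) < ennreal (\<delta> / 2)"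
      "\<psi>' \<in> test_space \<mu> x1 1 \<epsilon> \<epsilon>" "test_norm \<mu> x1 1 \<beta> \<gamma> (\<lambda>x. \<psi> x - \<psi>' x) < ennreal (\<delta> / 2)"
      using assms unfolding test_closure_def by blast
    obtain C where C: "0 \<le> C" "C < \<delta> / 2" "test_bound \<mu> x1 1 \<beta> \<gamma> C (\<lambda>x. \<phi> x - \<phi>' x)" using test_norm_less[OF a(2)] .
    obtain C' where C': "0 \<le> C'" "C' < \<delta> / 2" "test_bound \<mu> x1 1 \<beta> \<gamma> C' (\<lambda>x. \<psi> x - \<psi>' x)" using test_norm_less[OF a(4)] .
    have eq: "(\<lambda>x. (\<phi> x - \<phi>' x) + (\<psi> x - \<psi>' x)) = (\<lambda>x. \<phi> x + \<psi> x - (\<phi>' x + \<psi>' x))" by (auto simp: algebra_simps)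
    have "test_norm \<mu> x1 1 \<beta> \<gamma> (\<lambda>x. \<phi> x + \<psi> x - (\<phi>' x + \<psi>' x)) \<le> ennreal (C + C')"
      using test_bound_add[OF C(3) C'(3)] C(1) C'(1) unfolding eq by (intro test_bound_norm) auto
    also have "\<dots> < ennreal \<delta>" using C C' \<delta> by (intro ennreal_lessI) auto
    finally have "test_norm \<mu> x1 1 \<beta> \<gamma> (\<lambda>x. \<phi> x + \<psi> x - (\<phi>' x + \<psi>' x)) < ennreal \<delta>" .
    then show ?thesis by (rule bexI[where x = "\<lambda>x. \<phi>' x + \<psi>' x", OF _ test_space_add[OF a(1,3)]])
  qed
  then show ?thesis using assms test_space_add unfolding test_closure_def by blast
qed

lemma test_closure_scale:
  assumes "\<phi> \<in> test_closure \<mu> x1 \<epsilon> \<beta> \<gamma>"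
  shows "(\<lambda>x. c * \<phi> x) \<in> test_closure \<mu> x1 \<epsilon> \<beta> \<gamma>"
proof -
  have "\<exists>\<omega>\<in>test_space \<mu> x1 1 \<epsilon> \<epsilon>. test_norm \<mu> x1 1 \<beta> \<gamma> (\<lambda>x. c * \<phi> x - \<omega> x) < ennreal \<delta>" if \<delta>: "0 < \<delta>" for \<delta>
  proof -
    have c1: "0 < cmod c + 1" by (simp add: add_nonneg_pos)
    then have "0 < \<delta> / (cmod c + 1)" using \<delta> by simp
    then obtain \<phi>' where a: "\<phi>' \<in> test_space \<mu> x1 1 \<epsilon> \<epsilon>" "test_norm \<mu> x1 1 \<beta> \<gamma> (\<lambda>x. \<phi> x - \<phi>' x) < ennreal (\<delta> / (cmod c + 1))"
      using assms unfolding test_closure_def by blast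
    obtain C where C: "0 \<le> C" "C < \<delta> / (cmod c + 1)" "test_bound \<mu> x1 1 \<beta> \<gamma> C (\<lambda>x. \<phi> x - \<phi>' x)" using test_norm_less[OF a(2)] .
    have eq: "(\<lambda>x. c * (\<phi> x - \<phi>' x)) = (\<lambda>x. c * \<phi> x - c * \<phi>' x)" by (auto simp: algebra_simps)
    have "test_norm \<mu> x1 1 \<beta> \<gamma> (\<lambda>x. c * \<phi> x - c * \<phi>' x) \<le> ennreal (cmod c * C)"
      using test_bound_scale[OF C(3), of c] C(1) unfolding eq by (intro test_bound_norm) auto
    also have "\<dots> < ennreal \<delta>"
    proof (rule ennreal_lessI[OF \<delta>])
      have "C * (cmod c + 1) < \<delta>" using C(2) c1 by (simp add: pos_less_divide_eq)
      then show "cmod c * C < \<delta>" using C(1) by (simp add: algebra_simps)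
    qed
    finally have "test_norm \<mu> x1 1 \<beta> \<gamma> (\<lambda>x. c * \<phi> x - c * \<phi>' x) < ennreal \<delta>" .
    then show ?thesis by (rule bexI[where x = "\<lambda>x. c * \<phi>' x", OF _ test_space_scale[OF a(1)]])
  qed
  then show ?thesis using assms test_space_scale unfolding test_closure_def by blast
qed

context doubling_measure
begin

text \<open>Kernels are paired with functions of their second variable, so regularity is recorded in
  that variable, and the volume is taken at the first. The constant \<open>2 * C3\<close> allows a
  Holder bound without restriction on the distance.\<close>

definition kernel_bounds :: "real \<Rightarrow> real \<Rightarrow> real \<Rightarrow> (nat \<Rightarrow> 'a \<Rightarrow> 'a \<Rightarrow> complex) \<Rightarrow> bool" where
  "kernel_bounds C3 C4 \<epsilon> S \<longleftrightarrow> 0 < C3 \<and> 0 < C4 \<and> 0 < \<epsilon> \<and>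
     (\<forall>k x y. C4 * 2 powr (- real k) < dist x y \<longrightarrow> S k x y = 0) \<and>
     (\<forall>k x y. cmod (S k x y) \<le> C3 / V x (2 powr (- real k))) \<and>
     (\<forall>k x y y'. cmod (S k x y - S k x y') \<le> 2 * C3 / V x (2 powr (- real k)) * (dist y y' / 2 powr (- real k)) powr \<epsilon>) \<and>
     (\<forall>k x. integrable \<mu> (S k x) \<and> (\<integral>y. S k x y \<partial>\<mu>) = 1)"

text \<open>Outside the range of the regularity condition the distance is at least
  \<open>2 powr (- k)\<close>, and twice the size bound suffices.\<close>

lemma approx_identity_kernel_bounds:
  assumes S: "approx_identity \<mu> \<epsilon> S" and \<epsilon>: "0 < \<epsilon>"
  shows "\<exists>C3 C4. kernel_bounds C3 C4 \<epsilon> S"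
proof -
  obtain C3 C4 where C: "0 < C3" "0 < C4" and
    supp: "\<And>k x y. dist x y > C4 * 2 powr (- real k) \<Longrightarrow> S k x y = 0" and
    bd: "\<And>k x y. cmod (S k x y) \<le> C3 * (1 / (V x (2 powr (- real k)) + V y (2 powr (- real k))))" and
    hol: "\<And>k x y y'. dist y y' \<le> max C4 1 * 2 powr (1 - real k) \<Longrightarrow>
       cmod (S k x y - S k x y') \<le> C3 * 2 powr (real k * \<epsilon>) * dist y y' powr \<epsilon> * (1 / (V x (2 powr (- real k)) + V y (2 powr (- real k))))" and
    int: "\<And>k x. integrable \<mu> (\<lambda>y. S k x y) \<and> (\<integral>y. S k x y \<partial>\<mu>) = 1"
    using S unfolding approx_identity_def Let_def by auto
  have w: "1 / (V x r + V y r) \<le> 1 / V x r" if "0 < r" for x y r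
    using that by (intro divide_left_mono) (auto intro!: mult_pos_pos add_pos_nonneg)
  have bd': "cmod (S k x y) \<le> C3 / V x (2 powr (- real k))" for k x y
  proof -
    have "cmod (S k x y) \<le> C3 * (1 / (V x (2 powr (- real k)) + V y (2 powr (- real k))))" by (rule bd)
    also have "\<dots> \<le> C3 * (1 / V x (2 powr (- real k)))" using C by (intro mult_left_mono w) auto
    finally show ?thesis by simp
  qed
  have "cmod (S k x y - S k x y') \<le> 2 * C3 / V x (2 powr (- real k)) * (dist y y' / 2 powr (- real k)) powr \<epsilon>" for k x y y'
  proof -
    let ?r = "2 powr (- real k)"
    have v: "0 < V x ?r" by simp
    have cv: "0 \<le> C3 / V x ?r" using C by simp
    show ?thesis
    proof (cases "dist y y' \<le> max C4 1 * 2 powr (1 - real k)")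
      case True
      have "cmod (S k x y - S k x y') \<le> C3 * 2 powr (real k * \<epsilon>) * dist y y' powr \<epsilon> * (1 / (V x ?r + V y ?r))"
        by (rule hol[OF True])
      also have "\<dots> \<le> C3 * 2 powr (real k * \<epsilon>) * dist y y' powr \<epsilon> * (1 / V x ?r)"
        using C by (intro mult_left_mono w) auto
      also have "\<dots> = C3 / V x ?r * (dist y y' / ?r) powr \<epsilon>"
      proof -
        have "dist y y' / ?r = 2 powr real k * dist y y'" by (simp add: powr_minus divide_inverse)
        then have "(dist y y' / ?r) powr \<epsilon> = 2 powr (real k * \<epsilon>) * dist y y' powr \<epsilon>" by (simp add: powr_mult powr_powr)
        then show ?thesis by simp
      qed
      also have "\<dots> \<le> 2 * (C3 / V x ?r * (dist y y' / ?r) powr \<epsilon>)"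
        using mult_nonneg_nonneg[OF cv powr_ge_zero[of "dist y y' / ?r" \<epsilon>]] by linarith
      finally show ?thesis by simp
    next
      case False
      have "?r \<le> max C4 1 * 2 powr (1 - real k)"
      proof -
        have "?r \<le> 2 powr (1 - real k)" by simp
        also have "\<dots> \<le> max C4 1 * 2 powr (1 - real k)" by simp
        finally show ?thesis .
      qed
      then have "1 \<le> dist y y' / ?r" using False by simp
      then have one: "1 \<le> (dist y y' / ?r) powr \<epsilon>" using \<epsilon> by (intro ge_one_powr_ge_zero) auto
      have "cmod (S k x y - S k x y') \<le> C3 / V x ?r + C3 / V x ?r"
        using norm_triangle_ineq4[of "S k x y" "S k x y'"] bd'[of k x y] bd'[of k x y'] by linarith
      also have "\<dots> = 2 * C3 / V x ?r * 1" by simp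
      also have "\<dots> \<le> 2 * C3 / V x ?r * (dist y y' / ?r) powr \<epsilon>"
        using one C by (intro mult_left_mono) auto
      finally show ?thesis .
    qed
  qed
  then have "kernel_bounds C3 C4 \<epsilon> S"
    unfolding kernel_bounds_def using C \<epsilon> supp bd' int by auto
  then show ?thesis by blast
qed

definition kernel_const :: "real \<Rightarrow> real \<Rightarrow> real \<Rightarrow> real" where
  "kernel_const C3 C4 \<epsilon> = bump_const (max 1 C4) \<epsilon> 2 * (2 * C3)"

lemma kernel_const_pos: "0 < C3 \<Longrightarrow> 0 < kernel_const C3 C4 \<epsilon>"
  unfolding kernel_const_def using bump_const_pos[of "max 1 C4" \<epsilon> 2] by (intro mult_pos_pos) auto

context
  fixes C3 C4 \<epsilon> :: real and S :: "nat \<Rightarrow> 'a \<Rightarrow> 'a \<Rightarrow> complex"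
  assumes kb: "kernel_bounds C3 C4 \<epsilon> S"
begin

lemma kernel_supp: "S k x y \<noteq> 0 \<Longrightarrow> dist x y \<le> C4 * 2 powr (- real k)"
  using kb unfolding kernel_bounds_def by (meson not_le)

lemma kernel_facts:
  shows "0 < C3" "0 < C4" "0 < \<epsilon>" "cmod (S k x y) \<le> C3 / V x (2 powr (- real k))"
    "cmod (S k x y - S k x y') \<le> 2 * C3 / V x (2 powr (- real k)) * (dist y y' / 2 powr (- real k)) powr \<epsilon>"
    "integrable \<mu> (S k x)" "(\<integral>y. S k x y \<partial>\<mu>) = 1"
  using kb unfolding kernel_bounds_def by auto

lemma kernel_test_space: "S k x \<in> test_space \<mu> x1 1 \<epsilon> \<epsilon>"
proof (rule bump_in_test_space)
  fix y y'
  show "cmod (S k x y - S k x y') \<le> 2 * C3 / V x (2 powr (- real k)) / (2 powr (- real k)) powr \<epsilon> * dist y y' powr \<epsilon>"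
    using kernel_facts(5)[of k x y y'] by (simp add: powr_divide)
  show "cmod (S k x y) \<le> C3 / V x (2 powr (- real k))" by (rule kernel_facts)
  show "S k x y \<noteq> 0 \<Longrightarrow> dist x y \<le> C4 * 2 powr (- real k)" by (rule kernel_supp)
qed (use kernel_facts in auto)

lemma kernel_diff_test_space: "(\<lambda>y. S (Suc k) x y - S k x y) \<in> test_space \<mu> x1 1 \<epsilon> \<epsilon>"
  by (intro test_space_diff kernel_test_space)

lemma kernel_size: "cmod (S k x y) \<le> kernel_const C3 C4 \<epsilon> * test_weight \<mu> x (2 powr (- real k)) 2 y"
proof -
  let ?r = "2 powr (- real k)" and ?K = "max 1 C4"
  have v: "0 < V x ?r" by simp
  have "test_bound \<mu> x ?r \<epsilon> 2 (bump_const ?K \<epsilon> 2 * (2 * C3 / V x ?r) * V x ?r) (S k x)"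
  proof (rule bump_test_bound)
    show "0 < \<epsilon>" by (rule kernel_facts)
    fix y assume "S k x y \<noteq> 0"
    then have "dist x y \<le> C4 * ?r" by (rule kernel_supp)
    also have "\<dots> \<le> ?K * ?r" by (intro mult_right_mono) auto
    finally show "dist x y \<le> ?K * ?r" .
  next
    fix y
    have "0 \<le> C3 / V x ?r" using kernel_facts(1) by simp
    then show "cmod (S k x y) \<le> 2 * C3 / V x ?r" using kernel_facts(4)[of k x y] by simp
  next
    fix y y' show "cmod (S k x y - S k x y') \<le> 2 * C3 / V x ?r * (dist y y' / ?r) powr \<epsilon>" by (rule kernel_facts)
  qed (use kernel_facts(1) in auto)
  moreover have "bump_const ?K \<epsilon> 2 * (2 * C3 / V x ?r) * V x ?r = kernel_const C3 C4 \<epsilon>"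
    using less_imp_neq[OF v] by (simp add: kernel_const_def)
  ultimately show ?thesis unfolding test_bound_def by simp
qed

text \<open>Both kernels are measured by the weight of the coarser scale; halving the radius of the
  weight costs one doubling factor.\<close>

lemma kernel_diff_size:
  "cmod (S (Suc k) x y - S k x y) \<le> kernel_const C3 C4 \<epsilon> * (1 + D * 2 powr n) * test_weight \<mu> x (2 powr (- real k)) 2 y"
proof -
  let ?r = "2 powr (- real k)" and ?r' = "2 powr (- real (Suc k))" and ?M = "D * 2 powr n"
  have r: "?r = 2 * ?r'" by (simp add: powr_diff powr_minus_divide powr_add)
  have M: "1 \<le> ?M" using D_ge n_pos mult_mono[of 1 D 1 "2 powr n"] by (simp add: ge_one_powr_ge_zero)
  have w: "test_weight \<mu> x ?r' 2 y \<le> ?M * test_weight \<mu> x ?r 2 y"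
  proof -
    have v0: "0 < V x ?r + V x (dist x y)" "0 < V x ?r' + V x (dist x y)" by (auto intro!: add_pos_nonneg)
    have pos: "0 < ?r + dist x y" "0 < ?r' + dist x y" by (auto intro: add_pos_nonneg)
    have "V x ?r \<le> ?M * V x ?r'" by (intro V_le) (auto simp: r)
    moreover have "V x (dist x y) \<le> ?M * V x (dist x y)" using mult_right_mono[OF M V_nonneg, of x "dist x y"] by simp
    ultimately have "V x ?r + V x (dist x y) \<le> ?M * (V x ?r' + V x (dist x y))" by (simp only: distrib_left add_mono)
    then have 1: "1 / (V x ?r' + V x (dist x y)) \<le> ?M * (1 / (V x ?r + V x (dist x y)))"
      using v0 by (simp add: divide_simps mult_ac)
    have "?r' * (?r + dist x y) \<le> ?r * (?r' + dist x y)"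
      unfolding r by (simp add: algebra_simps)
    then have "?r' / (?r' + dist x y) \<le> ?r / (?r + dist x y)" using pos by (simp add: divide_le_eq le_divide_eq mult_ac)
    then have 2: "(?r' / (?r' + dist x y)) powr 2 \<le> (?r / (?r + dist x y)) powr 2" using pos by (intro powr_mono2) auto
    have "test_weight \<mu> x ?r' 2 y \<le> (?M * (1 / (V x ?r + V x (dist x y)))) * (?r / (?r + dist x y)) powr 2"
      unfolding test_weight_def using 1 2 v0 D_ge by (intro mult_mono) auto
    then show ?thesis unfolding test_weight_def by (simp only: mult.assoc)
  qed
  have kc: "0 < kernel_const C3 C4 \<epsilon>" using kernel_facts(1) by (rule kernel_const_pos)
  have "cmod (S (Suc k) x y - S k x y) \<le> kernel_const C3 C4 \<epsilon> * test_weight \<mu> x ?r' 2 y + kernel_const C3 C4 \<epsilon> * test_weight \<mu> x ?r 2 y"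
    using norm_triangle_ineq4[of "S (Suc k) x y" "S k x y"] kernel_size[of "Suc k" x y] kernel_size[of k x y] by linarith
  also have "\<dots> \<le> kernel_const C3 C4 \<epsilon> * (?M * test_weight \<mu> x ?r 2 y) + kernel_const C3 C4 \<epsilon> * test_weight \<mu> x ?r 2 y"
    using kc by (intro add_mono mult_left_mono w) auto
  finally show ?thesis by (simp add: algebra_simps)
qed

end

end

text \<open>The pointwise bound by \<open>g\<close> is a feature of functions built from a
  functional. A general Sobolev function lacks it, and \<open>cell_function\<close> replaces it by
  cell means.\<close>

locale hajlasz_function = doubling_measure +
  fixes f :: "'a \<Rightarrow> complex" and g :: "'a \<Rightarrow> real" and E :: "'a set" and s p q :: real
  assumes hj: "hajlasz_on s f g E" and fg: "\<And>x. x \<notin> E \<Longrightarrow> cmod (f x) \<le> g x"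
    and s: "0 < s" "s \<le> 1" and q: "0 < q" "q \<le> 1" "q < p" "n * (1 / q - 1) < s"
    and f_meas [measurable]: "f \<in> borel_measurable \<mu>" and g_meas [measurable]: "g \<in> borel_measurable \<mu>"
    and E: "E \<in> null_sets \<mu>" and g_Lp: "(\<integral>\<^sup>+x. epowr (ennreal (g x)) p \<partial>\<mu>) < top"
begin

abbreviation H :: "'a \<Rightarrow> ennreal" where
  "H x \<equiv> epowr (hl (\<lambda>y. epowr (ennreal (g y)) q) x) (1 / q)"

abbreviation g_norm :: ennreal where
  "g_norm \<equiv> epowr (\<integral>\<^sup>+x. epowr (ennreal (g x)) p \<partial>\<mu>) (1 / p)"

lemma weight_bounded:
  assumes "0 < \<gamma>" "n * (1 / q - 1) < \<gamma>"
  shows "\<exists>W\<ge>0. (\<integral>\<^sup>+y. ennreal (cmod (f y)) * ennreal (test_weight \<mu> x 1 \<gamma> y) \<partial>\<mu>) \<le> ennreal W"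
proof -
  obtain B where B: "0 \<le> B" "\<And>R. 1 \<le> R \<Longrightarrow> pavg q x R (\<lambda>x. ennreal (g x)) \<le> ennreal B"
    using pavg_bounded[of q p "\<lambda>x. ennreal (g x)" x] q g_Lp by auto
  have c: "0 \<le> size_const q 2 \<gamma> * loc_const s q"
    using size_const_pos[of 2 q \<gamma>] loc_const_pos[of q s] assms q by simp
  have "(\<integral>\<^sup>+y. ennreal (cmod (f y)) * ennreal (test_weight \<mu> x 1 \<gamma> y) \<partial>\<mu>) \<le> ennreal (size_const q 2 \<gamma> * loc_const s q) * ennreal B"
    using q assms s by (intro weighted_size_hajlasz[OF hj fg] B E) auto
  also have "\<dots> = ennreal (size_const q 2 \<gamma> * loc_const s q * B)" using c B by (intro ennreal_mult[symmetric]) auto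
  finally show ?thesis using c B by (intro exI[of _ "size_const q 2 \<gamma> * loc_const s q * B"]) auto
qed

lemma test_integrable:
  assumes "\<phi> \<in> test_space \<mu> x 1 \<beta> \<gamma>" "0 < \<beta>" "0 < \<gamma>" "n * (1 / q - 1) < \<gamma>"
  shows "integrable \<mu> (\<lambda>y. f y * \<phi> y)"
  using weight_bounded[OF assms(3,4), of x] test_product_integrable[OF assms(1,2), of f] by auto

text \<open>The pairing with a weight of decay \<open>\<gamma>\<close> is finite because
  \<open>n * (1 / q - 1) < \<gamma>\<close>. Adding 1 to the bound \<open>W\<close> only makes it
  positive, so that it can be divided by.\<close>

lemma functional_dual:
  assumes "0 < \<beta>" "0 < \<gamma>" "n * (1 / q - 1) < \<gamma>"
  shows "functional_of \<mu> (test_closure \<mu> x1 \<epsilon> \<beta> \<gamma>) f \<in> dual_space (test_closure \<mu> x1 \<epsilon> \<beta> \<gamma>) (test_norm \<mu> x1 1 \<beta> \<gamma>)"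
proof -
  let ?E = "test_closure \<mu> x1 \<epsilon> \<beta> \<gamma>"
  have int: "integrable \<mu> (\<lambda>y. f y * \<phi> y)" if "\<phi> \<in> ?E" for \<phi>
    using subsetD[OF test_closure_subset that] assms by (intro test_integrable[of \<phi> x1 \<beta> \<gamma>]) auto
  obtain W where W: "0 \<le> W" "(\<integral>\<^sup>+y. ennreal (cmod (f y)) * ennreal (test_weight \<mu> x1 1 \<gamma> y) \<partial>\<mu>) \<le> ennreal W"
    using weight_bounded[OF assms(2,3), of x1] by blast
  define W1 where "W1 = W + 1"
  have W1: "0 < W1" "W \<le> W1" using W by (auto simp: W1_def)
  have bound: "ennreal (cmod (\<integral>y. f y * \<phi> y \<partial>\<mu>)) \<le> ennreal W1 * test_norm \<mu> x1 1 \<beta> \<gamma> \<phi>" for \<phi>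
  proof -
    have "ennreal (cmod (\<integral>y. f y * \<phi> y \<partial>\<mu>)) / ennreal W1 \<le> test_norm \<mu> x1 1 \<beta> \<gamma> \<phi>"
      unfolding test_norm_def
    proof (rule INF_greatest)
      fix C assume "C \<in> {C. 0 \<le> C \<and> test_bound \<mu> x1 1 \<beta> \<gamma> C \<phi>}"
      then have C: "0 \<le> C" "test_bound \<mu> x1 1 \<beta> \<gamma> C \<phi>" by auto
      have "cmod (\<integral>y. f y * \<phi> y \<partial>\<mu>) \<le> C * W" by (rule test_product(2)[OF C(2,1) assms(1) f_meas W(2,1)])
      also have "\<dots> \<le> W1 * C" using mult_left_mono[OF W1(2) C(1)] by (simp add: mult.commute)
      finally have "ennreal (cmod (\<integral>y. f y * \<phi> y \<partial>\<mu>)) \<le> ennreal W1 * ennreal C"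
        using C W1 by (subst ennreal_mult[symmetric]) (auto intro: ennreal_leI)
      then show "ennreal (cmod (\<integral>y. f y * \<phi> y \<partial>\<mu>)) / ennreal W1 \<le> ennreal C"
        using W1 by (intro divide_le_posI_ennreal) (auto simp: mult.commute)
    qed
    then have "ennreal W1 * (ennreal (cmod (\<integral>y. f y * \<phi> y \<partial>\<mu>)) / ennreal W1) \<le> ennreal W1 * test_norm \<mu> x1 1 \<beta> \<gamma> \<phi>"
      by (rule mult_left_mono) simp
    moreover have "ennreal W1 * (ennreal (cmod (\<integral>y. f y * \<phi> y \<partial>\<mu>)) / ennreal W1) = ennreal (cmod (\<integral>y. f y * \<phi> y \<partial>\<mu>))"
      using W1 by (simp add: divide_ennreal ennreal_mult[symmetric])
    ultimately show ?thesis by simp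
  qed
  show ?thesis
    unfolding dual_space_def
  proof (intro CollectI conjI ballI allI)
    show "functional_of \<mu> ?E f \<in> extensional ?E" by (simp add: functional_of_def)
  next
    fix \<phi> \<psi> assume a: "\<phi> \<in> ?E" "\<psi> \<in> ?E"
    then show "functional_of \<mu> ?E f (\<lambda>x. \<phi> x + \<psi> x) = functional_of \<mu> ?E f \<phi> + functional_of \<mu> ?E f \<psi>"
      using int[OF a(1)] int[OF a(2)] by (simp add: functional_of_def test_closure_add distrib_left)
  next
    fix c \<phi> assume a: "\<phi> \<in> ?E"
    then show "functional_of \<mu> ?E f (\<lambda>x. c * \<phi> x) = c * functional_of \<mu> ?E f \<phi>"
      by (simp add: functional_of_def test_closure_scale mult.left_commute)
  next
    show "\<exists>C\<ge>0. \<forall>\<phi>\<in>?E. ennreal (cmod (functional_of \<mu> ?E f \<phi>)) \<le> ennreal C * test_norm \<mu> x1 1 \<beta> \<gamma> \<phi>"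
      using W1 bound by (intro exI[of _ W1]) (auto simp: functional_of_def)
  qed
qed

context
  fixes C3 C4 \<epsilon> :: real and S :: "nat \<Rightarrow> 'a \<Rightarrow> 'a \<Rightarrow> complex"
  assumes kb: "kernel_bounds C3 C4 \<epsilon> S" and q\<epsilon>: "n * (1 / q - 1) < \<epsilon>"
begin

lemma kernel_integrable: "integrable \<mu> (\<lambda>y. f y * S k x y)"
  using kernel_test_space[OF kb, of k x x] kernel_facts(3)[OF kb] q\<epsilon> by (intro test_integrable) auto

definition diff_const :: real where
  "diff_const = kernel_const C3 C4 \<epsilon> * (1 + D * 2 powr n) * osc_const s q 2"

text \<open>The kernel difference has integral zero, so \<open>f\<close> may be replaced by
  \<open>f - f z\<close>, and \<open>weighted_oscillation\<close> at scale
  \<open>2 powr (- k)\<close> provides the decay. Size and cancellation of the kernel suffice, which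
  admits \<open>s\<close> larger than the order \<open>\<epsilon>\<close> of the kernels.\<close>

lemma kernel_diff_le:
  "ennreal (cmod (\<integral>y. f y * (S (Suc k) x y - S k x y) \<partial>\<mu>)) \<le> ennreal (diff_const * (2 powr (- s)) ^ k) * H x"
proof -
  let ?r = "2 powr (- real k)" and ?c = "kernel_const C3 C4 \<epsilon> * (1 + D * 2 powr n)"
  let ?K = "\<lambda>y. S (Suc k) x y - S k x y"
  have c: "0 < ?c" using kernel_const_pos[OF kernel_facts(1)[OF kb], of C4 \<epsilon>] D_ge by (intro mult_pos_pos add_pos_pos) auto
  obtain z where z: "(\<integral>\<^sup>+y. ennreal (cmod (f y - f z)) * ennreal (test_weight \<mu> x ?r 2 y) \<partial>\<mu>) \<le> ennreal (osc_const s q 2 * ?r powr s) * H x"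
    using weighted_oscillation[OF hj s q(1,2,4) g_meas f_meas E, of ?r 2 x] s by auto
  have i1: "integrable \<mu> ?K" using kernel_facts(6)[OF kb] by auto
  have K0: "(\<integral>y. ?K y \<partial>\<mu>) = 0" using kernel_facts(6,7)[OF kb] by simp
  have i2: "integrable \<mu> (\<lambda>y. f y * ?K y)"
    using kernel_integrable[of "Suc k" x] kernel_integrable[of k x] by (simp add: right_diff_distrib)
  have i3: "integrable \<mu> (\<lambda>y. (f y - f z) * ?K y)"
  proof -
    have "integrable \<mu> (\<lambda>y. f y * ?K y - f z * ?K y)" using i1 i2 by (intro Bochner_Integration.integrable_diff) auto
    then show ?thesis by (simp add: left_diff_distrib)
  qed
  have "(\<integral>y. (f y - f z) * ?K y \<partial>\<mu>) = (\<integral>y. (f y * ?K y - f z * ?K y) \<partial>\<mu>)" by (simp only: left_diff_distrib)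
  also have "\<dots> = (\<integral>y. f y * ?K y \<partial>\<mu>) - (\<integral>y. f z * ?K y \<partial>\<mu>)"
    using i1 i2 by (intro Bochner_Integration.integral_diff) auto
  also have "(\<integral>y. f z * ?K y \<partial>\<mu>) = 0" using K0 by (simp only: integral_mult_right_zero) simp
  finally have "(\<integral>y. f y * ?K y \<partial>\<mu>) = (\<integral>y. (f y - f z) * ?K y \<partial>\<mu>)" by simp
  then have "ennreal (cmod (\<integral>y. f y * ?K y \<partial>\<mu>)) \<le> (\<integral>\<^sup>+y. ennreal (cmod ((f y - f z) * ?K y)) \<partial>\<mu>)"
    using integral_norm_bound_ennreal[OF i3] by simp
  also have "\<dots> \<le> (\<integral>\<^sup>+y. ennreal ?c * (ennreal (cmod (f y - f z)) * ennreal (test_weight \<mu> x ?r 2 y)) \<partial>\<mu>)"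
  proof (rule nn_integral_mono)
    fix y
    have "cmod ((f y - f z) * ?K y) \<le> cmod (f y - f z) * (?c * test_weight \<mu> x ?r 2 y)"
      unfolding norm_mult by (intro mult_left_mono kernel_diff_size[OF kb]) auto
    then have "ennreal (cmod ((f y - f z) * ?K y)) \<le> ennreal (?c * (cmod (f y - f z) * test_weight \<mu> x ?r 2 y))"
      by (intro ennreal_leI) (simp only: mult_ac)
    also have "\<dots> = ennreal ?c * (ennreal (cmod (f y - f z)) * ennreal (test_weight \<mu> x ?r 2 y))"
      using c by (simp only: ennreal_mult less_imp_le mult_nonneg_nonneg norm_ge_zero test_weight_nonneg)
    finally show "ennreal (cmod ((f y - f z) * ?K y)) \<le> ennreal ?c * (ennreal (cmod (f y - f z)) * ennreal (test_weight \<mu> x ?r 2 y))" .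
  qed
  also have "\<dots> = ennreal ?c * (\<integral>\<^sup>+y. ennreal (cmod (f y - f z)) * ennreal (test_weight \<mu> x ?r 2 y) \<partial>\<mu>)"
    by (rule nn_integral_cmult) measurable
  also have "\<dots> \<le> ennreal ?c * (ennreal (osc_const s q 2 * ?r powr s) * H x)" by (intro mult_left_mono z) simp
  also have "\<dots> = ennreal (?c * (osc_const s q 2 * ?r powr s)) * H x"
    using c osc_const_pos[of q s 2] q s by (subst ennreal_mult) (auto simp: mult.assoc)
  also have "?r powr s = (2 powr (- s)) ^ k" by (simp add: powr_realpow[symmetric] powr_powr mult.commute)
  finally show ?thesis unfolding diff_const_def by (simp only: mult.assoc)
qed

text \<open>Each term is a geometric factor times the same function \<open>H x\<close>, so the
  square sum is a geometric series of ratio \<open>(2 powr (- s))\<^sup>2\<close>.\<close>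

lemma square_function_le:
  "epowr (\<Sum>k. ennreal ((cmod (\<integral>y. f y * (S (Suc k) x y - S k x y) \<partial>\<mu>))\<^sup>2)) (1 / 2)
     \<le> ennreal (sqrt (diff_const\<^sup>2 / (1 - (2 powr (- s))\<^sup>2))) * H x"
proof -
  let ?d = "\<lambda>k. cmod (\<integral>y. f y * (S (Suc k) x y - S k x y) \<partial>\<mu>)" and ?a = "2 powr (- s)"
  have a: "0 \<le> ?a" "?a < 1" using s by (auto intro: powr_less_one)
  have a2: "0 \<le> ?a\<^sup>2" "?a\<^sup>2 < 1" using a by (auto simp: power_less_one_iff abs_less_iff)
  have dc: "0 < diff_const"
    using kernel_const_pos[OF kernel_facts(1)[OF kb], of C4 \<epsilon>] D_ge osc_const_pos[of q s 2] q s
    unfolding diff_const_def by (intro mult_pos_pos add_pos_pos) auto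
  have "(\<Sum>k. ennreal ((?d k)\<^sup>2)) \<le> (\<Sum>k. (ennreal (diff_const\<^sup>2) * (H x)\<^sup>2) * ennreal ((?a\<^sup>2) ^ k))"
  proof (intro suminf_le summableI)
    fix k
    have "ennreal ((?d k)\<^sup>2) = (ennreal (?d k))\<^sup>2" by (simp add: ennreal_power)
    also have "\<dots> \<le> (ennreal (diff_const * ?a ^ k) * H x)\<^sup>2" by (intro power_mono kernel_diff_le) simp
    also have "\<dots> = ennreal ((diff_const * ?a ^ k)\<^sup>2) * (H x)\<^sup>2"
      using dc a by (simp add: power_mult_distrib ennreal_power)
    also have "(diff_const * ?a ^ k)\<^sup>2 = diff_const\<^sup>2 * (?a\<^sup>2) ^ k"
      by (simp add: power_mult_distrib power_mult[symmetric] mult.commute)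
    also have "ennreal (diff_const\<^sup>2 * (?a\<^sup>2) ^ k) * (H x)\<^sup>2 = (ennreal (diff_const\<^sup>2) * (H x)\<^sup>2) * ennreal ((?a\<^sup>2) ^ k)"
      using a2 by (subst ennreal_mult) (auto simp: mult_ac)
    finally show "ennreal ((?d k)\<^sup>2) \<le> (ennreal (diff_const\<^sup>2) * (H x)\<^sup>2) * ennreal ((?a\<^sup>2) ^ k)" .
  qed
  also have "\<dots> = (ennreal (diff_const\<^sup>2) * (H x)\<^sup>2) * ennreal (1 / (1 - ?a\<^sup>2))"
    using a2 by (subst ennreal_suminf_cmult, subst suminf_ennreal_geometric) auto
  also have "\<dots> = ennreal (diff_const\<^sup>2 / (1 - ?a\<^sup>2)) * (H x)\<^sup>2"
  proof -
    have "ennreal (diff_const\<^sup>2 / (1 - ?a\<^sup>2)) = ennreal (diff_const\<^sup>2) * ennreal (1 / (1 - ?a\<^sup>2))"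
      using a2 by (subst ennreal_mult[symmetric]) auto
    then show ?thesis by (simp only: mult_ac)
  qed
  finally have "epowr (\<Sum>k. ennreal ((?d k)\<^sup>2)) (1 / 2) \<le> epowr (ennreal (diff_const\<^sup>2 / (1 - ?a\<^sup>2)) * (H x)\<^sup>2) (1 / 2)"
    by (rule epowr_mono) simp
  also have "\<dots> = ennreal (sqrt (diff_const\<^sup>2 / (1 - ?a\<^sup>2))) * epowr ((H x)\<^sup>2) (1 / 2)"
    using a2 by (simp add: epowr_mult powr_half_sqrt)
  also have "epowr ((H x)\<^sup>2) (1 / 2) = H x"
    using epowr_add[of "H x" 1 1] by (simp add: power2_eq_square epowr_mult epowr_add[symmetric, of _ "1 / 2" "1 / 2"] del: epowr_epowr)
  finally show ?thesis .
qed

definition S0_const :: real where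
  "S0_const = kernel_const C3 C4 \<epsilon> * (size_const q 2 2 * loc_const s q * (D * 5 powr n) powr (1 / q))"

lemma S0_const_pos: "0 < S0_const"
proof -
  have "0 < size_const q 2 2" using q s by (intro size_const_pos) auto
  moreover have "0 < loc_const s q" using q by (intro loc_const_pos) auto
  ultimately show ?thesis
    unfolding S0_const_def using kernel_const_pos[OF kernel_facts(1)[OF kb], of C4 \<epsilon>] D_ge
    by (intro mult_pos_pos) auto
qed

text \<open>The maximal function is evaluated at any \<open>y\<close> within distance 1 of
  \<open>x\<close>, because a cell mean has to be bounded by its value at every point of the cell.
  The relevant balls around \<open>x\<close> have radius at least 1 and so contain
  \<open>y\<close>.\<close>

lemma S0_le:
  assumes xy: "dist x y < 1"
  shows "ennreal (cmod (\<integral>z. f z * S 0 x z \<partial>\<mu>)) \<le> ennreal S0_const * H y"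
proof -
  let ?k = "kernel_const C3 C4 \<epsilon>" and ?c5 = "(D * 5 powr n) powr (1 / q)"
  have k: "0 < ?k" by (rule kernel_const_pos[OF kernel_facts(1)[OF kb]])
  have sc: "0 < size_const q 2 2 * loc_const s q"
    using q s by (intro mult_pos_pos size_const_pos loc_const_pos) auto
  have "ennreal (cmod (\<integral>z. f z * S 0 x z \<partial>\<mu>)) \<le> (\<integral>\<^sup>+z. ennreal (cmod (f z * S 0 x z)) \<partial>\<mu>)"
    by (rule integral_norm_bound_ennreal[OF kernel_integrable])
  also have "\<dots> \<le> (\<integral>\<^sup>+z. ennreal ?k * (ennreal (cmod (f z)) * ennreal (test_weight \<mu> x 1 2 z)) \<partial>\<mu>)"
  proof (rule nn_integral_mono)
    fix z
    have "cmod (f z * S 0 x z) \<le> cmod (f z) * (?k * test_weight \<mu> x 1 2 z)"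
      unfolding norm_mult using kernel_size[OF kb, of 0 x z] by (intro mult_left_mono) auto
    then have "ennreal (cmod (f z * S 0 x z)) \<le> ennreal (?k * (cmod (f z) * test_weight \<mu> x 1 2 z))"
      by (intro ennreal_leI) (simp only: mult_ac)
    also have "\<dots> = ennreal ?k * (ennreal (cmod (f z)) * ennreal (test_weight \<mu> x 1 2 z))"
      using k by (simp only: ennreal_mult less_imp_le mult_nonneg_nonneg norm_ge_zero test_weight_nonneg)
    finally show "ennreal (cmod (f z * S 0 x z)) \<le> ennreal ?k * (ennreal (cmod (f z)) * ennreal (test_weight \<mu> x 1 2 z))" .
  qed
  also have "\<dots> = ennreal ?k * (\<integral>\<^sup>+z. ennreal (cmod (f z)) * ennreal (test_weight \<mu> x 1 2 z) \<partial>\<mu>)"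
    by (rule nn_integral_cmult) measurable
  also have "\<dots> \<le> ennreal ?k * (ennreal (size_const q 2 2 * loc_const s q) * (ennreal ?c5 * H y))"
    using q s xy by (intro mult_left_mono weighted_size_hajlasz[OF hj fg] E pavg_le_hl) auto
  also have "\<dots> = ennreal (?k * (size_const q 2 2 * loc_const s q * ?c5)) * H y"
  proof -
    have "ennreal a * (ennreal b * (ennreal c * t)) = ennreal (a * (b * c)) * t" if "0 < a" "0 < b" "0 \<le> c" for a b c t
      using that by (simp add: ennreal_mult mult.assoc)
    from this[OF k sc, of ?c5 "H y"] show ?thesis by simp
  qed
  finally show ?thesis by (simp only: S0_const_def)
qed

definition mem_const :: real where
  "mem_const = (S0_const + sqrt (diff_const\<^sup>2 / (1 - (2 powr (- s))\<^sup>2))) *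
     (2 powr (p / q) * (p / q) / (p / q - 1) * (D * 3 powr n)) powr (1 / p)"

text \<open>Cells of level \<open>j\<close> have diameter below 1, so by \<open>S0_le\<close> a cell
  mean is at most a multiple of \<open>H\<close> everywhere on the cell, and its term in the
  discrete sum is at most an integral over the cell. Disjointness adds these up; the square function
  is bounded pointwise by \<open>H\<close>, and the maximal theorem finishes both parts.\<close>

lemma F_norm_le:
  assumes cubes: "dyadic_cubes \<mu> C5 I Q" and j: "2 powr (- real j) * C5 < 1 / 3"
    and u0: "\<And>x. u (S 0 x) = (\<integral>y. f y * S 0 x y \<partial>\<mu>)"
    and uk: "\<And>k x. u (\<lambda>y. S (Suc k) x y - S k x y) = (\<integral>y. f y * (S (Suc k) x y - S k x y) \<partial>\<mu>)"
  shows "F_norm \<mu> p S I Q j u \<le> ennreal mem_const * g_norm"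
proof -
  let ?c = S0_const and ?sq = "sqrt (diff_const\<^sup>2 / (1 - (2 powr (- s))\<^sup>2))"
  let ?hc = "(2 powr (p / q) * (p / q) / (p / q - 1) * (D * 3 powr n)) powr (1 / p)"
  have p0: "0 < p" using q by simp
  have sq0: "0 \<le> ?sq"
  proof -
    have "(2 powr (- s))\<^sup>2 < 1" using s powr_less_one[of 2 "- s"] by (simp add: power_less_one_iff)
    then show ?thesis by simp
  qed
  have HL: "epowr (\<integral>\<^sup>+x. epowr (H x) p \<partial>\<mu>) (1 / p) \<le> ennreal ?hc * g_norm"
    using q by (intro hl_Lp) auto
  have scaled: "epowr (\<integral>\<^sup>+x. epowr (ennreal b * H x) p \<partial>\<mu>) (1 / p) \<le> ennreal (b * ?hc) * g_norm" if "0 \<le> b" for b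
  proof -
    have "epowr (\<integral>\<^sup>+x. epowr (ennreal b * H x) p \<partial>\<mu>) (1 / p) = ennreal b * epowr (\<integral>\<^sup>+x. epowr (H x) p \<partial>\<mu>) (1 / p)"
      using p0 by (intro Lp_integral_cmult) auto
    also have "\<dots> \<le> ennreal b * (ennreal ?hc * g_norm)" by (intro mult_left_mono HL) simp
    also have "\<dots> = ennreal (b * ?hc) * g_norm" using that by (subst ennreal_mult) (auto simp: mult.assoc)
    finally show ?thesis .
  qed
  let ?W = "\<lambda>x. epowr (ennreal ?c * H x) p"
  have Qopen: "open (Q k \<alpha>)" if "\<alpha> \<in> I k" for k \<alpha> using cubes that by (auto simp: dyadic_cubes_def)
  have Qsets [simp]: "Q k \<alpha> \<in> sets \<mu>" if "\<alpha> \<in> I k" for k \<alpha> using Qopen[OF that] by (intro ball_borel borel_open)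
  have disj: "disjoint_family_on (Q k) (I k)" for k using cubes by (auto simp: dyadic_cubes_def)
  have cell: "emeasure \<mu> (Q (int j) \<alpha>) * epowr (mean_on \<mu> (Q (int j) \<alpha>) (\<lambda>x. ennreal (cmod (u (S 0 x))))) p \<le> (\<integral>\<^sup>+x\<in>Q (int j) \<alpha>. ?W x \<partial>\<mu>)"
    if \<alpha>: "\<alpha> \<in> I (int j)" for \<alpha>
  proof -
    let ?Q = "Q (int j) \<alpha>"
    have close: "dist x y < 1" if "x \<in> ?Q" "y \<in> ?Q" for x y
    proof -
      have "ennreal (dist x y) \<le> ennreal (C5 * 2 powr (- real_of_int (int j)))"
        using dist_le_ediam[OF that] cubes \<alpha> unfolding dyadic_cubes_def by (meson order_trans)
      moreover have "0 < C5" using cubes by (auto simp: dyadic_cubes_def)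
      ultimately have "dist x y \<le> C5 * 2 powr (- real j)" by (simp add: ennreal_le_iff)
      then show ?thesis using j by (simp add: mult.commute)
    qed
    let ?m = "mean_on \<mu> ?Q (\<lambda>x. ennreal (cmod (u (S 0 x))))"
    have m: "?m \<le> ennreal ?c * H y" if y: "y \<in> ?Q" for y
    proof -
      have "?Q \<subseteq> ball y 1" using close[OF y] by auto
      then have "emeasure \<mu> ?Q \<le> emeasure \<mu> (ball y 1)" by (intro emeasure_mono) auto
      then have fin: "emeasure \<mu> ?Q < top" using ball_finite[of 1 y] by (simp add: le_less_trans)
      obtain e where e: "0 < e" "ball y e \<subseteq> ?Q" using Qopen[OF \<alpha>] y by (meson open_contains_ball)
      then have "emeasure \<mu> (ball y e) \<le> emeasure \<mu> ?Q" using \<alpha> by (intro emeasure_mono) auto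
      then have pos: "0 < emeasure \<mu> ?Q" using ball_pos[OF e(1), of y] by (simp add: less_le_trans)
      have "(\<integral>\<^sup>+x\<in>?Q. ennreal (cmod (u (S 0 x))) \<partial>\<mu>) \<le> (\<integral>\<^sup>+x. (ennreal ?c * H y) * indicator ?Q x \<partial>\<mu>)"
      proof (rule nn_integral_mono)
        fix x
        show "ennreal (cmod (u (S 0 x))) * indicator ?Q x \<le> (ennreal ?c * H y) * indicator ?Q x"
          using S0_le[OF close[OF _ y], of x] u0[of x] by (cases "x \<in> ?Q") auto
      qed
      also have "\<dots> = (ennreal ?c * H y) * emeasure \<mu> ?Q" using \<alpha> by (intro nn_integral_cmult_indicator) simp
      finally show ?thesis
        unfolding mean_on_def using pos fin by (intro divide_le_posI_ennreal) (auto simp: mult.commute)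
    qed
    have "emeasure \<mu> ?Q * epowr ?m p = (\<integral>\<^sup>+x. epowr ?m p * indicator ?Q x \<partial>\<mu>)"
      using \<alpha> by (subst nn_integral_cmult_indicator) (auto simp: mult.commute)
    also have "\<dots> \<le> (\<integral>\<^sup>+x\<in>?Q. ?W x \<partial>\<mu>)"
    proof (rule nn_integral_mono)
      fix x show "epowr ?m p * indicator ?Q x \<le> ?W x * indicator ?Q x"
        using m[of x] p0 by (cases "x \<in> ?Q") (auto intro: epowr_mono)
    qed
    finally show ?thesis .
  qed
  have inner: "(\<Sum>\<^sub>\<infinity>\<tau>'\<in>{\<tau>'\<in>I (int j). Q (int j) \<tau>' \<subseteq> Q 0 \<tau>}. emeasure \<mu> (Q (int j) \<tau>') * epowr (mean_on \<mu> (Q (int j) \<tau>') (\<lambda>x. ennreal (cmod (u (S 0 x))))) p)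
      \<le> (\<integral>\<^sup>+x\<in>Q 0 \<tau>. ?W x \<partial>\<mu>)" for \<tau>
  proof (rule infsum_ennreal_le)
    fix G assume G: "finite G" "G \<subseteq> {\<tau>'\<in>I (int j). Q (int j) \<tau>' \<subseteq> Q 0 \<tau>}"
    have "(\<Sum>\<tau>'\<in>G. emeasure \<mu> (Q (int j) \<tau>') * epowr (mean_on \<mu> (Q (int j) \<tau>') (\<lambda>x. ennreal (cmod (u (S 0 x))))) p)
      \<le> (\<Sum>\<tau>'\<in>G. \<integral>\<^sup>+x\<in>Q (int j) \<tau>'. ?W x \<partial>\<mu>)" using G by (intro sum_mono cell) auto
    also have "\<dots> \<le> (\<integral>\<^sup>+x\<in>Q 0 \<tau>. ?W x \<partial>\<mu>)"
      using G disjoint_family_on_mono[OF _ disj[of "int j"], of G] by (intro sum_set_nn_integral_le) auto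
    finally show "(\<Sum>\<tau>'\<in>G. emeasure \<mu> (Q (int j) \<tau>') * epowr (mean_on \<mu> (Q (int j) \<tau>') (\<lambda>x. ennreal (cmod (u (S 0 x))))) p)
      \<le> (\<integral>\<^sup>+x\<in>Q 0 \<tau>. ?W x \<partial>\<mu>)" .
  qed
  have outer: "(\<Sum>\<^sub>\<infinity>\<tau>\<in>I 0. \<Sum>\<^sub>\<infinity>\<tau>'\<in>{\<tau>'\<in>I (int j). Q (int j) \<tau>' \<subseteq> Q 0 \<tau>}. emeasure \<mu> (Q (int j) \<tau>') * epowr (mean_on \<mu> (Q (int j) \<tau>') (\<lambda>x. ennreal (cmod (u (S 0 x))))) p)
      \<le> (\<integral>\<^sup>+x. ?W x \<partial>\<mu>)"
  proof (rule infsum_ennreal_le)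
    fix G assume G: "finite G" "G \<subseteq> I 0"
    have "(\<Sum>\<tau>\<in>G. \<Sum>\<^sub>\<infinity>\<tau>'\<in>{\<tau>'\<in>I (int j). Q (int j) \<tau>' \<subseteq> Q 0 \<tau>}. emeasure \<mu> (Q (int j) \<tau>') * epowr (mean_on \<mu> (Q (int j) \<tau>') (\<lambda>x. ennreal (cmod (u (S 0 x))))) p)
      \<le> (\<Sum>\<tau>\<in>G. \<integral>\<^sup>+x\<in>Q 0 \<tau>. ?W x \<partial>\<mu>)" by (intro sum_mono inner)
    also have "\<dots> \<le> (\<integral>\<^sup>+x\<in>UNIV. ?W x \<partial>\<mu>)"
      using G disjoint_family_on_mono[OF _ disj[of 0], of G] by (intro sum_set_nn_integral_le) auto
    finally show "(\<Sum>\<tau>\<in>G. \<Sum>\<^sub>\<infinity>\<tau>'\<in>{\<tau>'\<in>I (int j). Q (int j) \<tau>' \<subseteq> Q 0 \<tau>}. emeasure \<mu> (Q (int j) \<tau>') * epowr (mean_on \<mu> (Q (int j) \<tau>') (\<lambda>x. ennreal (cmod (u (S 0 x))))) p)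
      \<le> (\<integral>\<^sup>+x. ?W x \<partial>\<mu>)" by simp
  qed
  have first: "epowr (\<Sum>\<^sub>\<infinity>\<tau>\<in>I 0. \<Sum>\<^sub>\<infinity>\<tau>'\<in>{\<tau>'\<in>I (int j). Q (int j) \<tau>' \<subseteq> Q 0 \<tau>}. emeasure \<mu> (Q (int j) \<tau>') * epowr (mean_on \<mu> (Q (int j) \<tau>') (\<lambda>x. ennreal (cmod (u (S 0 x))))) p) (1 / p)
      \<le> ennreal (?c * ?hc) * g_norm"
    using p0 S0_const_pos by (intro order_trans[OF epowr_mono[OF outer] scaled]) auto
  have second: "Lp_norm \<mu> p (\<lambda>x. epowr (\<Sum>k. ennreal ((cmod (u (\<lambda>y. S (Suc k) x y - S k x y)))\<^sup>2)) (1 / 2)) \<le> ennreal (?sq * ?hc) * g_norm"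
  proof -
    have "Lp_norm \<mu> p (\<lambda>x. epowr (\<Sum>k. ennreal ((cmod (u (\<lambda>y. S (Suc k) x y - S k x y)))\<^sup>2)) (1 / 2))
       \<le> epowr (\<integral>\<^sup>+x. epowr (ennreal ?sq * H x) p \<partial>\<mu>) (1 / p)"
      unfolding uk using p0 square_function_le by (intro Lp_norm_le) auto
    also have "\<dots> \<le> ennreal (?sq * ?hc) * g_norm" by (rule scaled[OF sq0])
    finally show ?thesis .
  qed
  have "F_norm \<mu> p S I Q j u \<le> ennreal (?c * ?hc) * g_norm + ennreal (?sq * ?hc) * g_norm"
    unfolding F_norm_def by (rule add_mono[OF first second])
  also have "\<dots> = ennreal mem_const * g_norm"
    unfolding mem_const_def distrib_right using S0_const_pos sq0
    by (subst ennreal_plus) (auto simp: distrib_right)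
  finally show ?thesis .
qed

end

end

section \<open>Bounding the grand maximal function\<close>

lemma sum_le_infsum_ennreal:
  fixes f :: "'i \<Rightarrow> ennreal"
  assumes "finite B" "B \<subseteq> A" shows "sum f B \<le> infsum f A"
proof -
  have "infsum f B \<le> infsum f A"
    using assms(2) by (intro infsum_mono_neutral nonneg_summable_on_complete) auto
  then show ?thesis using assms(1) by simp
qed

text \<open>An enumeration of \<open>J\<close> provides increasing finite subsets; monotone
  convergence applies along them, and each finite sum is below the unordered one.\<close>

lemma nn_integral_disjoint_le_infsum:
  assumes J: "countable J" and A: "\<And>i. i \<in> J \<Longrightarrow> A i \<in> sets M" "disjoint_family_on A J"
    and [measurable]: "W \<in> borel_measurable M"
  shows "(\<integral>\<^sup>+x\<in>(\<Union>i\<in>J. A i). W x \<partial>M) \<le> (\<Sum>\<^sub>\<infinity>i\<in>J. \<integral>\<^sup>+x\<in>A i. W x \<partial>M)"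
proof (cases "J = {}")
  case False
  define Jm where "Jm m = from_nat_into J ` {..m}" for m :: nat
  have Jm: "finite (Jm m)" "Jm m \<subseteq> J" for m using from_nat_into[OF False] by (auto simp: Jm_def)
  have UJ: "(\<Union>m. Jm m) = J"
    using from_nat_into_surj[OF J] Jm(2) by (fastforce simp: Jm_def)
  have inc: "Jm m \<subseteq> Jm m'" if "m \<le> m'" for m m' using that by (auto simp: Jm_def)
  define B where "B m = (\<Union>i\<in>Jm m. A i)" for m
  define BJ where "BJ = (\<Union>i\<in>J. A i)"
  have [measurable]: "B m \<in> sets M" for m unfolding B_def using Jm A by (intro sets.finite_UN) auto
  have sub: "B m \<subseteq> B m'" if "m \<le> m'" for m m' unfolding B_def using inc[OF that] by blast
  have BB: "B m \<subseteq> BJ" for m unfolding B_def BJ_def using Jm(2) by blast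
  have ex: "\<exists>m. x \<in> B m" if "x \<in> BJ" for x using that UJ unfolding B_def BJ_def by blast
  define h where "h m x = W x * indicator (B m) x" for m x
  have h_inc: "incseq h"
  proof (rule incseq_SucI, rule le_funI)
    fix m x
    have "indicator (B m) x \<le> (indicator (B (Suc m)) x :: ennreal)"
      using sub[of m "Suc m"] by (auto split: split_indicator)
    then show "h m x \<le> h (Suc m) x" unfolding h_def by (rule mult_left_mono) simp
  qed
  have h_meas: "h m \<in> borel_measurable M" for m unfolding h_def by measurable
  have h_sup: "W x * indicator BJ x \<le> (SUP m. h m x)" for x
  proof (cases "x \<in> BJ")
    case True
    then obtain m where "x \<in> B m" using ex by blast
    then have "W x * indicator BJ x = h m x" using True by (simp add: h_def)
    then show ?thesis using SUP_upper[of m UNIV "\<lambda>m. h m x"] by simp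
  qed simp
  have "(\<integral>\<^sup>+x. W x * indicator BJ x \<partial>M) \<le> (\<integral>\<^sup>+x. (SUP m. h m x) \<partial>M)"
    by (rule nn_integral_mono) (rule h_sup)
  also have "\<dots> = (SUP m. integral\<^sup>N M (h m))"
    by (rule nn_integral_monotone_convergence_SUP[OF h_inc h_meas])
  also have "\<dots> \<le> (\<Sum>\<^sub>\<infinity>i\<in>J. \<integral>\<^sup>+x\<in>A i. W x \<partial>M)"
  proof (rule SUP_least)
    fix m
    have "integral\<^sup>N M (h m) = (\<integral>\<^sup>+x. (\<Sum>i\<in>Jm m. W x * indicator (A i) x) \<partial>M)"
      using Jm(1) disjoint_family_on_mono[OF Jm(2) A(2)]
      by (intro nn_integral_cong) (simp add: h_def B_def sum_distrib_left[symmetric] indicator_UN_disjoint)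
    also have "\<dots> = (\<Sum>i\<in>Jm m. \<integral>\<^sup>+x\<in>A i. W x \<partial>M)"
    proof (rule nn_integral_sum)
      fix i assume "i \<in> Jm m"
      then have [measurable]: "A i \<in> sets M" using Jm A by auto
      show "(\<lambda>x. W x * indicator (A i) x) \<in> borel_measurable M" by measurable
    qed
    also have "\<dots> \<le> (\<Sum>\<^sub>\<infinity>i\<in>J. \<integral>\<^sup>+x\<in>A i. W x \<partial>M)"
      using Jm by (intro sum_le_infsum_ennreal) auto
    finally show "integral\<^sup>N M (h m) \<le> (\<Sum>\<^sub>\<infinity>i\<in>J. \<integral>\<^sup>+x\<in>A i. W x \<partial>M)" .
  qed
  finally show ?thesis by (simp only: BJ_def)
qed simp

context doubling_measure
begin

text \<open>Every member contains a point of the dense sequence, and by disjointness its index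
  determines the member.\<close>

lemma countable_disjoint_open:
  fixes A :: "'i \<Rightarrow> 'a set"
  assumes "disjoint_family_on A J" "\<And>i. i \<in> J \<Longrightarrow> open (A i)" "\<And>i. i \<in> J \<Longrightarrow> A i \<noteq> {}"
  shows "countable J"
proof -
  have ex: "\<exists>m. dn m \<in> A i" if i: "i \<in> J" for i
  proof -
    obtain x where "x \<in> A i" using assms(3)[OF i] by blast
    then obtain e where "0 < e" "ball x e \<subseteq> A i" using assms(2)[OF i] by (meson open_contains_ball)
    then show ?thesis using dn_dense[of e x] by auto
  qed
  have "inj_on (\<lambda>i. SOME m. dn m \<in> A i) J"
  proof (rule inj_onI)
    fix i i' assume i: "i \<in> J" "i' \<in> J" and eq: "(SOME m. dn m \<in> A i) = (SOME m. dn m \<in> A i')"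
    have "dn (SOME m. dn m \<in> A i) \<in> A i" "dn (SOME m. dn m \<in> A i') \<in> A i'"
      using someI_ex[OF ex[OF i(1)]] someI_ex[OF ex[OF i(2)]] by auto
    then have "dn (SOME m. dn m \<in> A i) \<in> A i \<inter> A i'" using eq by auto
    then show "i = i'" using assms(1) i unfolding disjoint_family_on_def by blast
  qed
  then show ?thesis by (rule countableI)
qed

lemma hl_mono: "(\<And>y. w y \<le> w' y) \<Longrightarrow> hl w x \<le> hl w' x"
  unfolding hl_def by (intro SUP_mono' mult_right_mono mean_on_mono) auto

end

text \<open>No pointwise bound of \<open>f\<close> by \<open>g\<close> is available here. The size
  of \<open>f\<close> at scale 1 has to be recovered from the cell means of \<open>S 0\<close>
  applied to \<open>f\<close>.\<close>

locale cell_function = doubling_measure +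
  fixes f :: "'a \<Rightarrow> complex" and g :: "'a \<Rightarrow> real" and E :: "'a set" and s p q :: real
    and C3 C4 \<epsilon> :: real and S :: "nat \<Rightarrow> 'a \<Rightarrow> 'a \<Rightarrow> complex"
    and I :: "int \<Rightarrow> 'i set" and Q :: "int \<Rightarrow> 'i \<Rightarrow> 'a set" and j :: nat and C5 C6 :: real
  assumes hj: "hajlasz_on s f g E" and s: "0 < s" "s \<le> 1"
    and q: "0 < q" "q \<le> 1" "q < p" "n * (1 / q - 1) < s"
    and f_meas [measurable]: "f \<in> borel_measurable \<mu>" and g_meas [measurable]: "g \<in> borel_measurable \<mu>"
    and E: "E \<in> null_sets \<mu>"
    and kb: "kernel_bounds C3 C4 \<epsilon> S" and int_S: "\<And>x. integrable \<mu> (\<lambda>y. f y * S 0 x y)"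
    and cubes: "dyadic_cubes \<mu> C5 I Q" and j: "2 powr (- real j) * C5 < 1 / 3"
    and C6: "0 < C6" "\<And>k \<alpha>. \<alpha> \<in> I k \<Longrightarrow> \<exists>z. ball z (C6 * 2 powr (- real_of_int k)) \<subseteq> Q k \<alpha>"
begin

abbreviation G :: "'a \<Rightarrow> ennreal" where "G y \<equiv> ennreal (g y)"

abbreviation cell :: "'i \<Rightarrow> 'a set" where "cell \<equiv> Q (int j)"

abbreviation cells :: "'i set" where "cells \<equiv> I (int j)"

definition S0m :: "'i \<Rightarrow> ennreal" where
  "S0m \<alpha> = mean_on \<mu> (cell \<alpha>) (\<lambda>x. ennreal (cmod (\<integral>y. f y * S 0 x y \<partial>\<mu>)))"

text \<open>The cells are disjoint, so the choice is unique.\<close>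
definition Fc :: "'a \<Rightarrow> ennreal" where
  "Fc y = (if \<exists>\<alpha>\<in>cells. y \<in> cell \<alpha> then S0m (SOME \<alpha>. \<alpha> \<in> cells \<and> y \<in> cell \<alpha>) else 0)"

lemma Q_open: "\<alpha> \<in> I k \<Longrightarrow> open (Q k \<alpha>)"
  using cubes by (auto simp: dyadic_cubes_def)

lemma Q_sets [simp]: "\<alpha> \<in> I k \<Longrightarrow> Q k \<alpha> \<in> sets \<mu>"
  using Q_open by (intro ball_borel borel_open)

lemma Q_disj: "disjoint_family_on (Q k) (I k)"
  using cubes by (auto simp: dyadic_cubes_def)

lemma Q_null: "UNIV - (\<Union>\<alpha>\<in>I k. Q k \<alpha>) \<in> null_sets \<mu>"
  using cubes by (auto simp: dyadic_cubes_def)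

lemma Q_nonempty: "\<alpha> \<in> I k \<Longrightarrow> Q k \<alpha> \<noteq> {}"
proof -
  assume "\<alpha> \<in> I k"
  then obtain z where z: "ball z (C6 * 2 powr (- real_of_int k)) \<subseteq> Q k \<alpha>" using C6(2) by blast
  have "z \<in> ball z (C6 * 2 powr (- real_of_int k))" using C6(1) by simp
  then show ?thesis using z by blast
qed

lemma I_countable: "countable (I k)"
  using Q_disj Q_open Q_nonempty by (rule countable_disjoint_open)

lemma Fc_cell:
  assumes "\<alpha> \<in> cells" "y \<in> cell \<alpha>" shows "Fc y = S0m \<alpha>"
proof -
  have "\<exists>\<alpha>. \<alpha> \<in> cells \<and> y \<in> cell \<alpha>" using assms by blast
  from someI_ex[OF this] have "(SOME \<alpha>. \<alpha> \<in> cells \<and> y \<in> cell \<alpha>) = \<alpha>"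
    using Q_disj[of "int j"] assms unfolding disjoint_family_on_def by blast
  then show ?thesis using assms by (auto simp: Fc_def)
qed

text \<open>Superlevel sets are unions of open cells, hence open.\<close>

lemma Fc_measurable [measurable]: "Fc \<in> borel_measurable \<mu>"
proof (rule borel_measurableI_greater)
  fix t
  have "{y \<in> space \<mu>. t < Fc y} = (\<Union>\<alpha>\<in>{\<alpha> \<in> cells. t < S0m \<alpha>}. cell \<alpha>)"
  proof (intro set_eqI iffI)
    fix y assume "y \<in> {y \<in> space \<mu>. t < Fc y}"
    then have t: "t < Fc y" by simp
    then have "\<exists>\<alpha>\<in>cells. y \<in> cell \<alpha>" by (auto simp: Fc_def split: if_splits)
    then obtain \<alpha> where "\<alpha> \<in> cells" "y \<in> cell \<alpha>" by blast
    then show "y \<in> (\<Union>\<alpha>\<in>{\<alpha> \<in> cells. t < S0m \<alpha>}. cell \<alpha>)" using t Fc_cell by auto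
  qed (auto simp: Fc_cell)
  also have "open \<dots>" using Q_open by auto
  finally show "{y \<in> space \<mu>. t < Fc y} \<in> sets \<mu>" by (intro ball_borel borel_open)
qed

lemma cell_close: "\<alpha> \<in> cells \<Longrightarrow> x \<in> cell \<alpha> \<Longrightarrow> y \<in> cell \<alpha> \<Longrightarrow> dist x y < 1"
proof -
  assume a: "\<alpha> \<in> cells" "x \<in> cell \<alpha>" "y \<in> cell \<alpha>"
  have "ennreal (dist x y) \<le> ennreal (C5 * 2 powr (- real_of_int (int j)))"
    using dist_le_ediam[OF a(2,3)] cubes a(1) unfolding dyadic_cubes_def by (meson order_trans)
  moreover have "0 < C5" using cubes by (auto simp: dyadic_cubes_def)
  ultimately have "dist x y \<le> C5 * 2 powr (- real j)" by (simp add: ennreal_le_iff)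
  then show ?thesis using j by (simp add: mult.commute)
qed

lemma cell_measure:
  assumes "\<alpha> \<in> cells" "y \<in> cell \<alpha>"
  shows "0 < emeasure \<mu> (cell \<alpha>)" "emeasure \<mu> (cell \<alpha>) < top" "cell \<alpha> \<subseteq> ball y 1"
proof -
  show sub: "cell \<alpha> \<subseteq> ball y 1" using cell_close[OF assms] by auto
  then have "emeasure \<mu> (cell \<alpha>) \<le> emeasure \<mu> (ball y 1)" by (intro emeasure_mono) auto
  then show "emeasure \<mu> (cell \<alpha>) < top" using ball_finite[of 1 y] by (simp add: le_less_trans)
  obtain e where e: "0 < e" "ball y e \<subseteq> cell \<alpha>" using Q_open[OF assms(1)] assms(2) by (meson open_contains_ball)
  then have "emeasure \<mu> (ball y e) \<le> emeasure \<mu> (cell \<alpha>)" using assms by (intro emeasure_mono) auto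
  then show "0 < emeasure \<mu> (cell \<alpha>)" using ball_pos[OF e(1), of y] by (simp add: less_le_trans)
qed

text \<open>The cubes of level 0 cover almost everything, and a cell of level \<open>j\<close> that
  meets such a cube lies inside it. Points outside all cells contribute nothing because
  \<open>Fc\<close> is 0 there.\<close>

lemma Fc_Lp_le:
  "(\<integral>\<^sup>+y. epowr (Fc y) p \<partial>\<mu>) \<le> (\<Sum>\<^sub>\<infinity>\<tau>\<in>I 0. \<Sum>\<^sub>\<infinity>\<tau>'\<in>{\<tau>'\<in>cells. cell \<tau>' \<subseteq> Q 0 \<tau>}. emeasure \<mu> (cell \<tau>') * epowr (S0m \<tau>') p)"
proof -
  let ?W = "\<lambda>y. epowr (Fc y) p"
  have "(\<integral>\<^sup>+y. ?W y \<partial>\<mu>) = (\<integral>\<^sup>+y\<in>(\<Union>\<tau>\<in>I 0. Q 0 \<tau>). ?W y \<partial>\<mu>)"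
  proof (rule nn_integral_cong_AE)
    show "AE y in \<mu>. ?W y = ?W y * indicator (\<Union>\<tau>\<in>I 0. Q 0 \<tau>) y"
      using AE_not_in[OF Q_null[of 0]] by eventually_elim (simp add: indicator_def)
  qed
  also have "\<dots> \<le> (\<Sum>\<^sub>\<infinity>\<tau>\<in>I 0. \<integral>\<^sup>+y\<in>Q 0 \<tau>. ?W y \<partial>\<mu>)"
    using Q_disj[of 0] by (intro nn_integral_disjoint_le_infsum I_countable) auto
  also have "\<dots> \<le> (\<Sum>\<^sub>\<infinity>\<tau>\<in>I 0. \<Sum>\<^sub>\<infinity>\<tau>'\<in>{\<tau>'\<in>cells. cell \<tau>' \<subseteq> Q 0 \<tau>}. emeasure \<mu> (cell \<tau>') * epowr (S0m \<tau>') p)"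
  proof (rule infsum_mono)
    fix \<tau> assume \<tau>: "\<tau> \<in> I 0"
    let ?J = "{\<tau>'\<in>cells. cell \<tau>' \<subseteq> Q 0 \<tau>}"
    have "(\<integral>\<^sup>+y\<in>Q 0 \<tau>. ?W y \<partial>\<mu>) \<le> (\<integral>\<^sup>+y\<in>(\<Union>\<tau>'\<in>?J. cell \<tau>'). ?W y \<partial>\<mu>)"
    proof (rule nn_integral_mono)
      fix y
      show "?W y * indicator (Q 0 \<tau>) y \<le> ?W y * indicator (\<Union>\<tau>'\<in>?J. cell \<tau>') y"
      proof (cases "y \<in> Q 0 \<tau> \<and> (\<exists>\<alpha>\<in>cells. y \<in> cell \<alpha>)")
        case True
        then obtain \<alpha> where \<alpha>: "\<alpha> \<in> cells" "y \<in> cell \<alpha>" by blast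
        have "cell \<alpha> \<subseteq> Q 0 \<tau> \<or> cell \<alpha> \<inter> Q 0 \<tau> = {}"
          using cubes \<tau> \<alpha>(1) unfolding dyadic_cubes_def by (metis of_nat_0_le_iff)
        then have "cell \<alpha> \<subseteq> Q 0 \<tau>" using True \<alpha> by blast
        then have "y \<in> (\<Union>\<tau>'\<in>?J. cell \<tau>')" using \<alpha> by blast
        then show ?thesis by (simp add: indicator_def)
      next
        case False
        then show ?thesis by (auto simp: Fc_def)
      qed
    qed
    also have "\<dots> \<le> (\<Sum>\<^sub>\<infinity>\<tau>'\<in>?J. \<integral>\<^sup>+y\<in>cell \<tau>'. ?W y \<partial>\<mu>)"
    proof (rule nn_integral_disjoint_le_infsum)
      show "countable ?J" by (rule countable_subset[OF _ I_countable[of "int j"]]) auto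
      show "disjoint_family_on cell ?J" by (rule disjoint_family_on_mono[OF _ Q_disj[of "int j"]]) auto
    qed auto
    also have "\<dots> = (\<Sum>\<^sub>\<infinity>\<tau>'\<in>?J. emeasure \<mu> (cell \<tau>') * epowr (S0m \<tau>') p)"
    proof (rule infsum_cong)
      fix \<tau>' assume \<tau>': "\<tau>' \<in> ?J"
      have "(\<integral>\<^sup>+y\<in>cell \<tau>'. ?W y \<partial>\<mu>) = (\<integral>\<^sup>+y. epowr (S0m \<tau>') p * indicator (cell \<tau>') y \<partial>\<mu>)"
        using \<tau>' Fc_cell by (intro nn_integral_cong) (auto split: split_indicator)
      also have "\<dots> = epowr (S0m \<tau>') p * emeasure \<mu> (cell \<tau>')"
        using \<tau>' by (intro nn_integral_cmult_indicator) auto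
      finally show "(\<integral>\<^sup>+y\<in>cell \<tau>'. ?W y \<partial>\<mu>) = emeasure \<mu> (cell \<tau>') * epowr (S0m \<tau>') p" by (simp add: mult.commute)
    qed
    finally show "(\<integral>\<^sup>+y\<in>Q 0 \<tau>. ?W y \<partial>\<mu>) \<le> (\<Sum>\<^sub>\<infinity>\<tau>'\<in>?J. emeasure \<mu> (cell \<tau>') * epowr (S0m \<tau>') p)" .
  qed (auto intro: nonneg_summable_on_complete)
  finally show ?thesis .
qed

text \<open>Large enough that the ball of this radius around \<open>y\<close> contains
  \<open>ball y 2\<close> and the support of \<open>S 0 x\<close> for every \<open>x\<close> within
  distance 1 of \<open>y\<close>.\<close>

definition rad :: real where "rad = C4 + 2"

text \<open>The ratio between the scale of the \<open>q\<close>-means and the inner radius of a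
  cell; it measures how small a part of the ball a cell may be.\<close>

definition cell_K :: real where "cell_K = max 1 ((1 + 2 * rad) / (C6 * 2 powr (- real j)))"

lemma rad: "2 \<le> rad" "C4 + 1 < rad"
  using kernel_facts(2)[OF kb] by (auto simp: rad_def)

text \<open>On the cell \<open>Fc\<close> is constant with value \<open>S0m \<alpha>\<close>, and
  the cell, which contains a ball of comparable radius, fills a fixed proportion of the ball of
  radius \<open>2 * rad\<close>.\<close>

lemma S0m_le_pavg:
  assumes \<alpha>: "\<alpha> \<in> cells" "y \<in> cell \<alpha>"
  shows "S0m \<alpha> \<le> ennreal ((D * cell_K powr n) powr (1 / q)) * pavg q y (2 * rad) Fc"
proof -
  have r: "0 < 2 * rad" using rad by simp
  have c0: "0 \<le> D * cell_K powr n" using D_ge by simp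
  obtain z where z: "ball z (C6 * 2 powr (- real_of_int (int j))) \<subseteq> cell \<alpha>" using C6(2)[OF \<alpha>(1)] by blast
  let ?t = "C6 * 2 powr (- real j)"
  have t: "0 < ?t" using C6 by simp
  have "z \<in> cell \<alpha>" using z t by auto
  then have yz: "dist y z < 1" using cell_close[OF \<alpha>] by simp
  have "V y (2 * rad) \<le> D * cell_K powr n * V z ?t"
  proof (rule V_le)
    have "(1 + 2 * rad) / ?t \<le> cell_K" by (simp add: cell_K_def)
    then have "1 + 2 * rad \<le> cell_K * ?t" using t by (simp add: pos_divide_le_eq)
    then show "dist y z + 2 * rad \<le> cell_K * ?t" using yz by linarith
  qed (use t in \<open>auto simp: cell_K_def\<close>)
  then have "ennreal (V y (2 * rad)) \<le> ennreal (D * cell_K powr n) * ennreal (V z ?t)"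
    using c0 by (subst ennreal_mult[symmetric]) (auto intro: ennreal_leI)
  also have "\<dots> \<le> ennreal (D * cell_K powr n) * emeasure \<mu> (cell \<alpha>)"
    using z \<alpha> emeasure_mono[of "ball z ?t" "cell \<alpha>" \<mu>] by (intro mult_left_mono) (auto simp: emeasure_ball)
  finally have V: "ennreal (V y (2 * rad)) \<le> ennreal (D * cell_K powr n) * emeasure \<mu> (cell \<alpha>)" .
  let ?m = "epowr (S0m \<alpha>) q"
  have "?m * emeasure \<mu> (cell \<alpha>) = (\<integral>\<^sup>+x. ?m * indicator (cell \<alpha>) x \<partial>\<mu>)"
    using \<alpha> by (subst nn_integral_cmult_indicator) auto
  also have "\<dots> \<le> (\<integral>\<^sup>+x\<in>ball y (2 * rad). epowr (Fc x) q \<partial>\<mu>)"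
  proof (rule nn_integral_mono)
    fix x
    show "?m * indicator (cell \<alpha>) x \<le> epowr (Fc x) q * indicator (ball y (2 * rad)) x"
    proof (cases "x \<in> cell \<alpha>")
      case True
      then have "x \<in> ball y (2 * rad)" using cell_measure(3)[OF \<alpha>] rad by (auto simp: subset_iff)
      then show ?thesis using True Fc_cell[OF \<alpha>(1) True] by simp
    qed simp
  qed
  also have "\<dots> = ennreal (V y (2 * rad)) * avg y (2 * rad) (\<lambda>x. epowr (Fc x) q)" using r by (simp add: V_times_mean)
  also have "\<dots> \<le> ennreal (D * cell_K powr n) * emeasure \<mu> (cell \<alpha>) * avg y (2 * rad) (\<lambda>x. epowr (Fc x) q)"
    by (intro mult_right_mono V) simp
  finally have "?m * emeasure \<mu> (cell \<alpha>) \<le> (ennreal (D * cell_K powr n) * avg y (2 * rad) (\<lambda>x. epowr (Fc x) q)) * emeasure \<mu> (cell \<alpha>)"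
    by (simp only: mult_ac)
  then have "?m * emeasure \<mu> (cell \<alpha>) / emeasure \<mu> (cell \<alpha>) \<le>
      (ennreal (D * cell_K powr n) * avg y (2 * rad) (\<lambda>x. epowr (Fc x) q)) * emeasure \<mu> (cell \<alpha>) / emeasure \<mu> (cell \<alpha>)"
    by (rule divide_right_mono_ennreal)
  then have "?m \<le> ennreal (D * cell_K powr n) * avg y (2 * rad) (\<lambda>x. epowr (Fc x) q)"
    using cell_measure(1,2)[OF \<alpha>] by (simp add: ennreal_mult_divide_eq)
  then have "S0m \<alpha> \<le> epowr (ennreal (D * cell_K powr n) * avg y (2 * rad) (\<lambda>x. epowr (Fc x) q)) (1 / q)"
    using q by (simp add: epowr_le_iff)
  then show ?thesis using q c0 by (simp add: epowr_mult pavg_def)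
qed

definition cell_A :: real where
  "cell_A = poincare_const s q * rad powr s * (D * (rad + 1) powr n) * ((D * 2 powr n) powr (1 / q) + 1)"

lemma cell_A_pos: "0 < cell_A"
  using poincare_const_pos[OF q(4)] rad D_ge unfolding cell_A_def by (intro mult_pos_pos add_nonneg_pos) auto

text \<open>Since \<open>S\<^sub>0\<close> preserves constants, \<open>f x\<close> differs from \<open>S\<^sub>0 f x\<close> by means of differences of \<open>f\<close>,
  which the Poincare inequality controls.\<close>
lemma local_bound_cell:
  assumes \<alpha>: "\<alpha> \<in> cells" "y \<in> cell \<alpha>"
  shows "(\<integral>\<^sup>+x\<in>ball y 2. ennreal (cmod (f x)) \<partial>\<mu>) \<le>
    ennreal ((cell_A + D * 2 powr n * (1 + C3 * cell_A)) * V y 1) * (S0m \<alpha> + pavg q y (2 * rad) G)"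
proof (cases "pavg q y (2 * rad) G")
  case top
  have "0 < (cell_A + D * 2 powr n * (1 + C3 * cell_A)) * V y 1"
    using cell_A_pos kernel_facts(1)[OF kb] D_ge by (intro mult_pos_pos add_pos_pos) auto
  then have "ennreal ((cell_A + D * 2 powr n * (1 + C3 * cell_A)) * V y 1) * top = top"
    by (auto simp: ennreal_mult_top)
  moreover have "S0m \<alpha> + pavg q y (2 * rad) G = top" using top by simp
  ultimately show ?thesis by (simp only: top_greatest)
next
  case (real P)
  have C3: "0 < C3" by (rule kernel_facts(1)[OF kb])
  have r: "0 < rad" using rad by simp
  let ?c = "(D * 2 powr n) powr (1 / q)" and ?k = "poincare_const s q"
  have k: "0 < ?k" using q by (intro poincare_const_pos)
  obtain z where z: "dist y z < rad" "z \<notin> E" "G z \<le> pavg q y rad G"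
    using exists_le_pavg[of G rad E q y] E q r by auto
  have "pavg q y rad G \<le> ennreal ?c * pavg q y (2 * rad) G" using q r by (intro pavg_ball_le) auto
  then have "G z \<le> ennreal (?c * P)" using z(3) real by (simp add: ennreal_mult)
  then have gz: "g z \<le> ?c * P" using real by (simp add: ennreal_le_iff)
  have V1: "V y rad \<le> D * (rad + 1) powr n * V x 1" if "dist y x < 1" for x
    using that rad by (intro V_le) auto
  \<comment> \<open>The volume is taken at \<open>x\<close> rather than at \<open>y\<close> because
    the kernel \<open>S 0 x\<close> is bounded by \<open>C3 / V x 1\<close>, so that the two volumes
    cancel.\<close>
  have osc: "(\<integral>\<^sup>+x\<in>ball y rad. ennreal (cmod (f x - f z)) \<partial>\<mu>) \<le> ennreal (cell_A * V x 1 * P)" if x: "dist y x < 1" for x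
  proof -
    have "(\<integral>\<^sup>+x\<in>ball y rad. ennreal (cmod (f x - f z)) \<partial>\<mu>) \<le> ennreal (?k * rad powr s * V y rad) * (G z + pavg q y (2 * rad) G)"
      by (rule poincare[OF hj s q(1,2,4) g_meas E r z(2,1)])
    also have "\<dots> \<le> ennreal (?k * rad powr s * (D * (rad + 1) powr n * V x 1)) * ennreal (?c * P + P)"
    proof (rule mult_mono)
      show "ennreal (?k * rad powr s * V y rad) \<le> ennreal (?k * rad powr s * (D * (rad + 1) powr n * V x 1))"
        using V1[OF x] k by (intro ennreal_leI mult_left_mono) auto
      have "G z + pavg q y (2 * rad) G = ennreal (g z + P)" using real hajlasz_on_nonneg[OF hj, of z] by simp
      also have "\<dots> \<le> ennreal (?c * P + P)" using gz by (intro ennreal_leI) auto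
      finally show "G z + pavg q y (2 * rad) G \<le> ennreal (?c * P + P)" .
    qed auto
    also have "\<dots> = ennreal (?k * rad powr s * (D * (rad + 1) powr n * V x 1) * (?c * P + P))"
      using k D_ge real by (intro ennreal_mult[symmetric]) auto
    also have "?k * rad powr s * (D * (rad + 1) powr n * V x 1) * (?c * P + P) = cell_A * V x 1 * P"
      by (simp add: cell_A_def algebra_simps)
    finally show ?thesis .
  qed
  let ?e = "C3 * cell_A * P"
  have e0: "0 \<le> ?e" using C3 cell_A_pos real by simp
  have fz: "cmod (f z) \<le> cmod (\<integral>y. f y * S 0 x y \<partial>\<mu>) + ?e" if x: "x \<in> cell \<alpha>" for x
  proof -
    have yx: "dist y x < 1" using cell_close[OF \<alpha> x] .
    have SI: "integrable \<mu> (S 0 x)" "(\<integral>y. S 0 x y \<partial>\<mu>) = 1" using kernel_facts(6,7)[OF kb] by auto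
    have i3: "integrable \<mu> (\<lambda>y. (f y - f z) * S 0 x y)"
      using Bochner_Integration.integrable_diff[OF int_S[of x] integrable_mult_right[OF SI(1), of "f z"]]
      by (simp add: left_diff_distrib)
    have "(\<integral>y. (f y - f z) * S 0 x y \<partial>\<mu>) = (\<integral>y. (f y * S 0 x y - f z * S 0 x y) \<partial>\<mu>)" by (simp only: left_diff_distrib)
    also have "\<dots> = (\<integral>y. f y * S 0 x y \<partial>\<mu>) - f z * 1"
      using Bochner_Integration.integral_diff[OF int_S[of x] integrable_mult_right[OF SI(1), of "f z"]] SI(2) by simp
    finally have d: "(\<integral>y. (f y - f z) * S 0 x y \<partial>\<mu>) = (\<integral>y. f y * S 0 x y \<partial>\<mu>) - f z" by simp
    have "ennreal (cmod (\<integral>y. (f y - f z) * S 0 x y \<partial>\<mu>)) \<le> (\<integral>\<^sup>+y. ennreal (cmod ((f y - f z) * S 0 x y)) \<partial>\<mu>)"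
      by (rule integral_norm_bound_ennreal[OF i3])
    also have "\<dots> \<le> (\<integral>\<^sup>+w. ennreal (C3 / V x 1) * (ennreal (cmod (f w - f z)) * indicator (ball y rad) w) \<partial>\<mu>)"
    proof (rule nn_integral_mono)
      fix w
      show "ennreal (cmod ((f w - f z) * S 0 x w)) \<le> ennreal (C3 / V x 1) * (ennreal (cmod (f w - f z)) * indicator (ball y rad) w)"
      proof (cases "S 0 x w = 0")
        case False
        then have "dist x w \<le> C4 * 2 powr (- real 0)" by (rule kernel_supp[OF kb])
        then have "dist y w < rad" using yx rad dist_triangle[of y w x] by simp
        moreover have "cmod ((f w - f z) * S 0 x w) \<le> C3 / V x 1 * cmod (f w - f z)"
          unfolding norm_mult using kernel_facts(4)[OF kb, of 0 x w] mult_left_mono[of "cmod (S 0 x w)" "C3 / V x 1" "cmod (f w - f z)"]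
          by (simp add: mult.commute)
        then have "ennreal (cmod ((f w - f z) * S 0 x w)) \<le> ennreal (C3 / V x 1) * ennreal (cmod (f w - f z))"
          using C3 by (subst ennreal_mult[symmetric]) (auto intro: ennreal_leI)
        ultimately show ?thesis by simp
      qed simp
    qed
    also have "\<dots> = ennreal (C3 / V x 1) * (\<integral>\<^sup>+w\<in>ball y rad. ennreal (cmod (f w - f z)) \<partial>\<mu>)"
      by (rule nn_integral_cmult) measurable
    also have "\<dots> \<le> ennreal (C3 / V x 1) * ennreal (cell_A * V x 1 * P)" by (intro mult_left_mono osc yx) simp
    also have "\<dots> = ennreal (C3 / V x 1 * (cell_A * V x 1 * P))"
      using C3 cell_A_pos real by (intro ennreal_mult[symmetric]) auto
    also have "C3 / V x 1 * (cell_A * V x 1 * P) = ?e" using V_pos[of 1 x] by (simp del: V_pos)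
    finally have "cmod ((\<integral>y. f y * S 0 x y \<partial>\<mu>) - f z) \<le> ?e" unfolding d using e0 by (simp add: ennreal_le_iff)
    then show ?thesis using norm_triangle_ineq2[of "f z" "\<integral>y. f y * S 0 x y \<partial>\<mu>"] by (simp add: norm_minus_commute)
  qed
  \<comment> \<open>The bound just found holds for every \<open>x\<close> of the cell and is
    averaged over it. A negative difference is harmless since \<open>ennreal\<close> sends it to
    0.\<close>
  have m: "ennreal (cmod (f z)) \<le> S0m \<alpha> + ennreal ?e"
  proof -
    have "ennreal (cmod (f z) - ?e) * emeasure \<mu> (cell \<alpha>) = (\<integral>\<^sup>+x. ennreal (cmod (f z) - ?e) * indicator (cell \<alpha>) x \<partial>\<mu>)"
      using \<alpha> by (subst nn_integral_cmult_indicator) auto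
    also have "\<dots> \<le> (\<integral>\<^sup>+x\<in>cell \<alpha>. ennreal (cmod (\<integral>y. f y * S 0 x y \<partial>\<mu>)) \<partial>\<mu>)"
    proof (rule nn_integral_mono)
      fix x show "ennreal (cmod (f z) - ?e) * indicator (cell \<alpha>) x \<le> ennreal (cmod (\<integral>y. f y * S 0 x y \<partial>\<mu>)) * indicator (cell \<alpha>) x"
        using fz[of x] by (cases "x \<in> cell \<alpha>") (auto intro!: ennreal_leI)
    qed
    finally have "ennreal (cmod (f z) - ?e) * emeasure \<mu> (cell \<alpha>) / emeasure \<mu> (cell \<alpha>) \<le> S0m \<alpha>"
      unfolding S0m_def mean_on_def by (rule divide_right_mono_ennreal)
    then have "ennreal (cmod (f z) - ?e) \<le> S0m \<alpha>"
      using cell_measure(1,2)[OF \<alpha>] by (simp add: ennreal_mult_divide_eq)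
    then have "ennreal (cmod (f z) - ?e) + ennreal ?e \<le> S0m \<alpha> + ennreal ?e" by (rule add_right_mono)
    moreover have "ennreal (cmod (f z)) \<le> ennreal (cmod (f z) - ?e) + ennreal ?e"
    proof (cases "cmod (f z) \<le> ?e")
      case True
      then show ?thesis by (simp add: add_increasing ennreal_leI)
    next
      case False
      then show ?thesis using e0 by (subst ennreal_plus[symmetric]) auto
    qed
    ultimately show ?thesis by (rule order_trans[rotated])
  qed
  have "(\<integral>\<^sup>+x\<in>ball y 2. ennreal (cmod (f x)) \<partial>\<mu>) \<le> (\<integral>\<^sup>+x. (ennreal (cmod (f x - f z)) * indicator (ball y rad) x + ennreal (cmod (f z)) * indicator (ball y 2) x) \<partial>\<mu>)"
  proof (rule nn_integral_mono)
    fix x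
    show "ennreal (cmod (f x)) * indicator (ball y 2) x \<le> ennreal (cmod (f x - f z)) * indicator (ball y rad) x + ennreal (cmod (f z)) * indicator (ball y 2) x"
    proof (cases "x \<in> ball y 2")
      case True
      then have "x \<in> ball y rad" using rad by simp
      moreover have "ennreal (cmod (f x)) \<le> ennreal (cmod (f x - f z)) + ennreal (cmod (f z))"
        using ennreal_leI[of "cmod (f x)" "cmod (f x - f z) + cmod (f z)"] norm_triangle_ineq[of "f x - f z" "f z"] by simp
      ultimately show ?thesis using True by simp
    qed simp
  qed
  also have "\<dots> = (\<integral>\<^sup>+x\<in>ball y rad. ennreal (cmod (f x - f z)) \<partial>\<mu>) + ennreal (cmod (f z)) * ennreal (V y 2)"
    by (subst nn_integral_add) (auto simp: nn_integral_cmult_indicator emeasure_ball)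
  also have "\<dots> \<le> ennreal (cell_A * V y 1 * P) + (S0m \<alpha> + ennreal ?e) * ennreal (D * 2 powr n * V y 1)"
  proof (intro add_mono mult_mono)
    show "(\<integral>\<^sup>+x\<in>ball y rad. ennreal (cmod (f x - f z)) \<partial>\<mu>) \<le> ennreal (cell_A * V y 1 * P)" by (rule osc) simp
    show "ennreal (V y 2) \<le> ennreal (D * 2 powr n * V y 1)" by (intro ennreal_leI V_le) auto
  qed (use m in auto)
  also have "\<dots> = ennreal ((cell_A + D * 2 powr n * (C3 * cell_A)) * V y 1) * ennreal P + S0m \<alpha> * ennreal (D * 2 powr n * V y 1)"
  proof -
    have "ennreal (cell_A * V y 1 * P) + ennreal ?e * ennreal (D * 2 powr n * V y 1) = ennreal (cell_A * V y 1 * P + ?e * (D * 2 powr n * V y 1))"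
      using e0 D_ge cell_A_pos real by (subst ennreal_mult[symmetric]) (auto simp del: ennreal_plus simp flip: ennreal_plus)
    also have "cell_A * V y 1 * P + ?e * (D * 2 powr n * V y 1) = ((cell_A + D * 2 powr n * (C3 * cell_A)) * V y 1) * P"
      by (simp add: algebra_simps)
    also have "ennreal \<dots> = ennreal ((cell_A + D * 2 powr n * (C3 * cell_A)) * V y 1) * ennreal P"
      using real by (intro ennreal_mult'') auto
    finally show ?thesis by (simp add: distrib_right add_ac)
  qed
  also have "\<dots> \<le> ennreal ((cell_A + D * 2 powr n * (1 + C3 * cell_A)) * V y 1) * ennreal P + S0m \<alpha> * ennreal ((cell_A + D * 2 powr n * (1 + C3 * cell_A)) * V y 1)"
    using cell_A_pos C3 D_ge by (intro add_mono mult_right_mono mult_left_mono ennreal_leI) (auto simp: algebra_simps)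
  also have "\<dots> = ennreal ((cell_A + D * 2 powr n * (1 + C3 * cell_A)) * V y 1) * (S0m \<alpha> + pavg q y (2 * rad) G)"
    unfolding real(2) distrib_left by (simp only: mult.commute add.commute)
  finally show ?thesis .
qed

definition cell_B :: real where
  "cell_B = (cell_A + D * 2 powr n * (1 + C3 * cell_A)) * (D * 2 powr n) *
     (((D * cell_K powr n) powr (1 / q) + 1) * (D * 2 powr n) powr (1 / q))"

lemma cell_B_pos: "0 < cell_B"
  using cell_A_pos kernel_facts(1)[OF kb] D_ge unfolding cell_B_def
  by (intro mult_pos_pos add_pos_pos add_nonneg_pos) auto

text \<open>The point \<open>y\<close> may lie in no cell. Some \<open>y'\<close> within distance 1
  does, and passing to it explains the radius 2 in \<open>local_bound_cell\<close> and the radius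
  \<open>2 * rad + 1\<close> here.\<close>

lemma local_bound:
  "(\<integral>\<^sup>+x\<in>ball y 1. ennreal (cmod (f x)) \<partial>\<mu>) \<le> ennreal (cell_B * V y 1) * pavg q y (2 * rad + 1) (\<lambda>x. Fc x + G x)"
proof -
  let ?H = "\<lambda>x. Fc x + G x"
  let ?a = "cell_A + D * 2 powr n * (1 + C3 * cell_A)" and ?b = "(D * cell_K powr n) powr (1 / q)" and ?c = "(D * 2 powr n) powr (1 / q)"
  have a: "0 < ?a" using cell_A_pos kernel_facts(1)[OF kb] D_ge by (intro add_pos_pos mult_pos_pos) auto
  have "\<not> ball y 1 \<subseteq> UNIV - (\<Union>\<alpha>\<in>cells. cell \<alpha>)"
    using Q_null[of "int j"] ball_pos[of 1 y] by (metis emeasure_mono leD null_setsD1 null_setsD2 zero_less_one)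
  then obtain y' \<alpha> where y': "dist y y' < 1" "\<alpha> \<in> cells" "y' \<in> cell \<alpha>" by (auto simp: subset_iff)
  have "(\<integral>\<^sup>+x\<in>ball y 1. ennreal (cmod (f x)) \<partial>\<mu>) \<le> (\<integral>\<^sup>+x\<in>ball y' 2. ennreal (cmod (f x)) \<partial>\<mu>)"
    using y'(1) by (intro set_nn_integral_ball_mono) auto
  also have "\<dots> \<le> ennreal (?a * V y' 1) * (S0m \<alpha> + pavg q y' (2 * rad) G)"
    by (rule local_bound_cell[OF y'(2,3)])
  also have "\<dots> \<le> ennreal (?a * V y' 1) * (ennreal ?b * pavg q y' (2 * rad) ?H + pavg q y' (2 * rad) ?H)"
  proof (intro mult_left_mono add_mono)
    show "S0m \<alpha> \<le> ennreal ?b * pavg q y' (2 * rad) ?H"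
      using q by (intro order_trans[OF S0m_le_pavg[OF y'(2,3)]] mult_left_mono pavg_mono) auto
    show "pavg q y' (2 * rad) G \<le> pavg q y' (2 * rad) ?H" using q by (intro pavg_mono) auto
  qed auto
  also have "ennreal ?b * pavg q y' (2 * rad) ?H + pavg q y' (2 * rad) ?H = ennreal (?b + 1) * pavg q y' (2 * rad) ?H"
    by (simp add: distrib_right)
  also have "ennreal (?a * V y' 1) * (ennreal (?b + 1) * pavg q y' (2 * rad) ?H) \<le>
     ennreal (?a * (D * 2 powr n * V y 1)) * (ennreal (?b + 1) * (ennreal ?c * pavg q y (2 * rad + 1) ?H))"
  proof (intro mult_mono mult_left_mono)
    have "V y' 1 \<le> D * 2 powr n * V y 1" using y'(1) by (intro V_le) (auto simp: dist_commute)
    then show "ennreal (?a * V y' 1) \<le> ennreal (?a * (D * 2 powr n * V y 1))"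
      using a by (intro ennreal_leI mult_left_mono) auto
    show "pavg q y' (2 * rad) ?H \<le> ennreal ?c * pavg q y (2 * rad + 1) ?H"
      using q rad y'(1) by (intro pavg_ball_le) (auto simp: dist_commute)
  qed auto
  also have "\<dots> = ennreal (?a * (D * 2 powr n * V y 1) * ((?b + 1) * ?c)) * pavg q y (2 * rad + 1) ?H"
  proof -
    have "ennreal A * (ennreal B * (ennreal C * t)) = ennreal (A * (B * C)) * t" if "0 \<le> A" "0 \<le> B" "0 \<le> C" for A B C t
      using that by (simp add: ennreal_mult mult.assoc)
    from this[of "?a * (D * 2 powr n * V y 1)" "?b + 1" ?c] show ?thesis using a D_ge by simp
  qed
  also have "?a * (D * 2 powr n * V y 1) * ((?b + 1) * ?c) = cell_B * V y 1"
    unfolding cell_B_def by (simp only: mult_ac)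
  finally show ?thesis .
qed

abbreviation HF :: "'a \<Rightarrow> ennreal" where
  "HF x \<equiv> epowr (hl (\<lambda>y. epowr (Fc y + G y) q) x) (1 / q)"

text \<open>The first summand serves level 0, the second the positive levels. Each 2 bounds the
  constant of a function of test norm at most 1.\<close>

definition grand_const :: real where
  "grand_const = 2 * (size_const q (2 * rad + 1) 2 * cell_B * (D * 5 powr n) powr (1 / q)) + 2 * osc_const s q 2"

lemma grand_const_parts:
  "0 \<le> size_const q (2 * rad + 1) 2 * cell_B * (D * 5 powr n) powr (1 / q)" "0 \<le> osc_const s q 2"
  using size_const_pos[of "2 * rad + 1" q 2] osc_const_pos[of q s 2] cell_B_pos rad q s by (auto intro!: mult_nonneg_nonneg)

text \<open>At level 0 there is no cancellation, and the size of \<open>f\<close> is controlled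
  through \<open>local_bound\<close>. At positive levels the mean of \<open>\<phi>\<close> is zero,
  so only the oscillation of \<open>f\<close> counts, and it provides the factor
  \<open>2 powr (- k * s)\<close>.\<close>

lemma grand_pointwise:
  assumes \<phi>: "\<phi> \<in> grand_tests \<mu> x1 k x" and int: "integrable \<mu> (\<lambda>y. f y * \<phi> y)"
  shows "ennreal (2 powr (real k * s)) * ennreal (cmod (\<integral>y. f y * \<phi> y \<partial>\<mu>)) \<le> ennreal grand_const * HF x"
proof -
  let ?r = "2 powr (- real k)"
  have r: "0 < ?r" by simp
  have "test_norm \<mu> x ?r 1 2 \<phi> \<le> 1" using \<phi> by (simp add: grand_tests_def)
  also have "(1::ennreal) < ennreal 2" by simp
  \<comment> \<open>The norm is an infimum, so norm at most 1 yields directly only constants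
    arbitrarily close to 1; 2 leaves room.\<close>
  finally obtain C where C: "0 \<le> C" "C < 2" "test_bound \<mu> x ?r 1 2 C \<phi>" using test_norm_less by blast
  have \<phi>w: "cmod (\<phi> y) \<le> 2 * test_weight \<mu> x ?r 2 y" for y
    using test_bound_le_const[OF C(3), of 2] C(2) by (simp add: test_bound_def)
  have prod: "(\<integral>\<^sup>+y. ennreal (cmod (c y * \<phi> y)) \<partial>\<mu>) \<le> ennreal 2 * (\<integral>\<^sup>+y. ennreal (cmod (c y)) * ennreal (test_weight \<mu> x ?r 2 y) \<partial>\<mu>)"
    if [measurable]: "c \<in> borel_measurable \<mu>" for c :: "'a \<Rightarrow> complex"
  proof -
    have "(\<integral>\<^sup>+y. ennreal (cmod (c y * \<phi> y)) \<partial>\<mu>) \<le> (\<integral>\<^sup>+y. ennreal 2 * (ennreal (cmod (c y)) * ennreal (test_weight \<mu> x ?r 2 y)) \<partial>\<mu>)"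
    proof (rule nn_integral_mono)
      fix y
      have "cmod (c y * \<phi> y) \<le> cmod (c y) * (2 * test_weight \<mu> x ?r 2 y)"
        unfolding norm_mult by (intro mult_left_mono \<phi>w) auto
      then have "ennreal (cmod (c y * \<phi> y)) \<le> ennreal (2 * (cmod (c y) * test_weight \<mu> x ?r 2 y))"
        by (intro ennreal_leI) (simp only: mult_ac)
      also have "\<dots> = ennreal 2 * (ennreal (cmod (c y)) * ennreal (test_weight \<mu> x ?r 2 y))"
        by (simp only: ennreal_mult zero_le_numeral mult_nonneg_nonneg norm_ge_zero test_weight_nonneg)
      finally show "ennreal (cmod (c y * \<phi> y)) \<le> ennreal 2 * (ennreal (cmod (c y)) * ennreal (test_weight \<mu> x ?r 2 y))" .
    qed
    also have "\<dots> = ennreal 2 * (\<integral>\<^sup>+y. ennreal (cmod (c y)) * ennreal (test_weight \<mu> x ?r 2 y) \<partial>\<mu>)"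
      by (rule nn_integral_cmult) measurable
    finally show ?thesis .
  qed
  show ?thesis
  proof (cases "k = 0")
    case True
    have "ennreal (cmod (\<integral>y. f y * \<phi> y \<partial>\<mu>)) \<le> (\<integral>\<^sup>+y. ennreal (cmod (f y * \<phi> y)) \<partial>\<mu>)"
      by (rule integral_norm_bound_ennreal[OF int])
    also have "\<dots> \<le> ennreal 2 * (\<integral>\<^sup>+y. ennreal (cmod (f y)) * ennreal (test_weight \<mu> x 1 2 y) \<partial>\<mu>)"
      using prod[of f] True by simp
    also have "\<dots> \<le> ennreal 2 * (ennreal (size_const q (2 * rad + 1) 2 * cell_B) * (ennreal ((D * 5 powr n) powr (1 / q)) * HF x))"
    proof (intro mult_left_mono weighted_size[where H = "\<lambda>x. Fc x + G x"])
      show "pavg q x R (\<lambda>x. Fc x + G x) \<le> ennreal ((D * 5 powr n) powr (1 / q)) * HF x" if "1 \<le> R" for R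
        using that q by (intro pavg_le_hl) auto
    qed (use q s rad cell_B_pos local_bound in auto)
    also have "\<dots> = ennreal (2 * (size_const q (2 * rad + 1) 2 * cell_B * (D * 5 powr n) powr (1 / q))) * HF x"
    proof -
      have "ennreal A * (ennreal B * (ennreal C * t)) = ennreal (A * (B * C)) * t" if "0 \<le> A" "0 \<le> B" "0 \<le> C" for A B C t
        using that by (simp add: ennreal_mult mult.assoc)
      from this[of 2 "size_const q (2 * rad + 1) 2 * cell_B" "(D * 5 powr n) powr (1 / q)"]
      show ?thesis using size_const_pos[of "2 * rad + 1" q 2] cell_B_pos rad q s by (simp add: less_imp_le mult_pos_pos)
    qed
    finally have "ennreal (cmod (\<integral>y. f y * \<phi> y \<partial>\<mu>)) \<le> ennreal grand_const * HF x"
      by (rule ennreal_mult_mono_const) (use grand_const_parts in \<open>simp add: grand_const_def\<close>)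
    then show ?thesis using True by simp
  next
    case False
    then have \<phi>0: "\<phi> \<in> test_space \<mu> x1 1 1 2" "(\<integral>y. \<phi> y \<partial>\<mu>) = 0"
      using \<phi> by (auto simp: grand_tests_def test_space_mean_zero_def)
    have i\<phi>: "integrable \<mu> \<phi>" by (rule test_bound_integrable[OF C(3)]) auto
    obtain z where z: "(\<integral>\<^sup>+y. ennreal (cmod (f y - f z)) * ennreal (test_weight \<mu> x ?r 2 y) \<partial>\<mu>) \<le>
        ennreal (osc_const s q 2 * ?r powr s) * epowr (hl (\<lambda>y. epowr (G y) q) x) (1 / q)"
      using weighted_oscillation[OF hj s q(1,2,4) g_meas f_meas E r, of 2 x] s by auto
    have mono: "epowr (hl (\<lambda>y. epowr (G y) q) x) (1 / q) \<le> HF x"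
      using q by (intro epowr_mono hl_mono) auto
    have i3: "integrable \<mu> (\<lambda>y. (f y - f z) * \<phi> y)"
      using Bochner_Integration.integrable_diff[OF int integrable_mult_right[OF i\<phi>, of "f z"]] by (simp add: left_diff_distrib)
    have "(\<integral>y. (f y - f z) * \<phi> y \<partial>\<mu>) = (\<integral>y. (f y * \<phi> y - f z * \<phi> y) \<partial>\<mu>)" by (simp only: left_diff_distrib)
    also have "\<dots> = (\<integral>y. f y * \<phi> y \<partial>\<mu>)"
      using Bochner_Integration.integral_diff[OF int integrable_mult_right[OF i\<phi>, of "f z"]] \<phi>0(2) by simp
    finally have eq: "(\<integral>y. f y * \<phi> y \<partial>\<mu>) = (\<integral>y. (f y - f z) * \<phi> y \<partial>\<mu>)" by simp
    have "ennreal (cmod (\<integral>y. f y * \<phi> y \<partial>\<mu>)) \<le> (\<integral>\<^sup>+y. ennreal (cmod ((f y - f z) * \<phi> y)) \<partial>\<mu>)"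
      unfolding eq by (rule integral_norm_bound_ennreal[OF i3])
    also have "\<dots> \<le> ennreal 2 * (\<integral>\<^sup>+y. ennreal (cmod (f y - f z)) * ennreal (test_weight \<mu> x ?r 2 y) \<partial>\<mu>)"
      by (rule prod) measurable
    also have "\<dots> \<le> ennreal 2 * (ennreal (osc_const s q 2 * ?r powr s) * HF x)"
      by (intro mult_left_mono order_trans[OF z] mono) auto
    finally have "ennreal (2 powr (real k * s)) * ennreal (cmod (\<integral>y. f y * \<phi> y \<partial>\<mu>)) \<le>
        ennreal (2 powr (real k * s)) * (ennreal 2 * (ennreal (osc_const s q 2 * ?r powr s) * HF x))"
      by (intro mult_left_mono) auto
    also have "\<dots> = ennreal (2 powr (real k * s) * (2 * (osc_const s q 2 * ?r powr s))) * HF x"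
    proof -
      have "ennreal A * (ennreal B * (ennreal C * t)) = ennreal (A * (B * C)) * t" if "0 \<le> A" "0 \<le> B" "0 \<le> C" for A B C t
        using that by (simp add: ennreal_mult mult.assoc)
      from this[of "2 powr (real k * s)" 2 "osc_const s q 2 * ?r powr s"] show ?thesis using grand_const_parts(2) by simp
    qed
    also have "2 powr (real k * s) * (2 * (osc_const s q 2 * ?r powr s)) = 2 * osc_const s q 2 * (2 powr (real k * s) * ?r powr s)"
      by (simp only: mult_ac)
    also have "2 powr (real k * s) * ?r powr s = 1" by (simp add: powr_powr powr_add[symmetric])
    finally have "ennreal (2 powr (real k * s)) * ennreal (cmod (\<integral>y. f y * \<phi> y \<partial>\<mu>)) \<le> ennreal (2 * osc_const s q 2 * 1) * HF x" .
    then show ?thesis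
      by (rule ennreal_mult_mono_const) (use grand_const_parts in \<open>simp add: grand_const_def\<close>)
  qed
qed

definition AF_const :: real where
  "AF_const = grand_const * (2 powr (p / q) * (p / q) / (p / q - 1) * (D * 3 powr n)) powr (1 / p) * (2 * 2 powr (1 / p))"

text \<open>Here \<open>u\<close> and \<open>v\<close> are the functionals induced by
  \<open>f\<close> on two different test spaces: \<open>u\<close> acts on grand test functions,
  \<open>v\<close> on the kernels, and \<open>f\<close> is the link between them.\<close>

lemma AF_norm_le:
  assumes int: "\<And>\<phi>. \<phi> \<in> test_space \<mu> x1 1 1 2 \<Longrightarrow> integrable \<mu> (\<lambda>y. f y * \<phi> y)"
    and u: "\<And>\<phi>. \<phi> \<in> test_space \<mu> x1 1 1 2 \<Longrightarrow> u \<phi> = (\<integral>y. f y * \<phi> y \<partial>\<mu>)"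
    and v: "\<And>x. v (S 0 x) = (\<integral>y. f y * S 0 x y \<partial>\<mu>)"
  shows "AF_norm \<mu> x1 s p u \<le> ennreal AF_const * (F_norm \<mu> p S I Q j v + Lp_norm \<mu> p G)"
proof -
  let ?hc = "(2 powr (p / q) * (p / q) / (p / q - 1) * (D * 3 powr n)) powr (1 / p)"
  have p: "0 < p" using q by simp
  have gt: "\<phi> \<in> test_space \<mu> x1 1 1 2" if "\<phi> \<in> grand_tests \<mu> x1 k x" for \<phi> k x
    using that by (auto simp: grand_tests_def test_space_mean_zero_def split: if_splits)
  have gc: "0 \<le> grand_const" using grand_const_parts by (simp add: grand_const_def)
  have "AF_norm \<mu> x1 s p u \<le> epowr (\<integral>\<^sup>+x. epowr (ennreal grand_const * HF x) p \<partial>\<mu>) (1 / p)"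
    unfolding AF_norm_def
  proof (rule Lp_norm_le)
    fix x
    show "(SUP k. ennreal (2 powr (real k * s)) * (SUP \<phi>\<in>grand_tests \<mu> x1 k x. ennreal (cmod (u \<phi>)))) \<le> ennreal grand_const * HF x"
    proof (rule SUP_least)
      fix k
      show "ennreal (2 powr (real k * s)) * (SUP \<phi>\<in>grand_tests \<mu> x1 k x. ennreal (cmod (u \<phi>))) \<le> ennreal grand_const * HF x"
      proof (cases "grand_tests \<mu> x1 k x = {}")
        case False
        have "ennreal (2 powr (real k * s)) * (SUP \<phi>\<in>grand_tests \<mu> x1 k x. ennreal (cmod (u \<phi>))) =
          (SUP \<phi>\<in>grand_tests \<mu> x1 k x. ennreal (2 powr (real k * s)) * ennreal (cmod (u \<phi>)))"
          by (simp add: SUP_mult_left_ennreal)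
        also have "\<dots> \<le> ennreal grand_const * HF x"
        proof (rule SUP_least)
          fix \<phi> assume \<phi>: "\<phi> \<in> grand_tests \<mu> x1 k x"
          show "ennreal (2 powr (real k * s)) * ennreal (cmod (u \<phi>)) \<le> ennreal grand_const * HF x"
            unfolding u[OF gt[OF \<phi>]] by (rule grand_pointwise[OF \<phi> int[OF gt[OF \<phi>]]])
        qed
        finally show ?thesis .
      qed (simp add: bot_ennreal)
    qed
  qed (use p in auto)
  also have "\<dots> = ennreal grand_const * epowr (\<integral>\<^sup>+x. epowr (HF x) p \<partial>\<mu>) (1 / p)"
    using p by (intro Lp_integral_cmult) auto
  also have "\<dots> \<le> ennreal grand_const * (ennreal ?hc * epowr (\<integral>\<^sup>+x. epowr (Fc x + G x) p \<partial>\<mu>) (1 / p))"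
    using q by (intro mult_left_mono hl_Lp) auto
  also have "\<dots> \<le> ennreal grand_const * (ennreal ?hc * (ennreal (2 * 2 powr (1 / p)) * (F_norm \<mu> p S I Q j v + Lp_norm \<mu> p G)))"
  proof (intro mult_left_mono)
    let ?a = "\<integral>\<^sup>+x. epowr (Fc x) p \<partial>\<mu>" and ?b = "\<integral>\<^sup>+x. epowr (G x) p \<partial>\<mu>"
    have "(\<integral>\<^sup>+x. epowr (Fc x + G x) p \<partial>\<mu>) \<le> (\<integral>\<^sup>+x. ennreal (2 powr p) * (epowr (Fc x) p + epowr (G x) p) \<partial>\<mu>)"
      using p by (intro nn_integral_mono epowr_add_le)
    also have "\<dots> = ennreal (2 powr p) * (?a + ?b)"
      by (simp add: nn_integral_cmult nn_integral_add)
    finally have "epowr (\<integral>\<^sup>+x. epowr (Fc x + G x) p \<partial>\<mu>) (1 / p) \<le> epowr (ennreal (2 powr p) * (?a + ?b)) (1 / p)"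
      using p by (intro epowr_mono) auto
    also have "\<dots> = ennreal 2 * epowr (?a + ?b) (1 / p)"
      using p by (simp add: epowr_mult powr_powr)
    also have "\<dots> \<le> ennreal 2 * (ennreal (2 powr (1 / p)) * (epowr ?a (1 / p) + epowr ?b (1 / p)))"
      using p by (intro mult_left_mono epowr_add_le) auto
    also have "\<dots> = ennreal (2 * 2 powr (1 / p)) * (epowr ?a (1 / p) + epowr ?b (1 / p))"
      by (simp add: ennreal_mult mult.assoc)
    also have "\<dots> \<le> ennreal (2 * 2 powr (1 / p)) * (F_norm \<mu> p S I Q j v + Lp_norm \<mu> p G)"
    proof (intro mult_left_mono add_mono)
      have "epowr ?a (1 / p) \<le> epowr (\<Sum>\<^sub>\<infinity>\<tau>\<in>I 0. \<Sum>\<^sub>\<infinity>\<tau>'\<in>{\<tau>'\<in>cells. cell \<tau>' \<subseteq> Q 0 \<tau>}. emeasure \<mu> (cell \<tau>') * epowr (S0m \<tau>') p) (1 / p)"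
        using p by (intro epowr_mono Fc_Lp_le) auto
      also have "\<dots> \<le> F_norm \<mu> p S I Q j v"
        unfolding F_norm_def S0m_def v by (simp add: add_increasing2)
      finally show "epowr ?a (1 / p) \<le> F_norm \<mu> p S I Q j v" .
      show "epowr ?b (1 / p) \<le> Lp_norm \<mu> p G" using p by (subst Lp_norm_measurable) auto
    qed auto
    finally show "epowr (\<integral>\<^sup>+x. epowr (Fc x + G x) p \<partial>\<mu>) (1 / p) \<le> ennreal (2 * 2 powr (1 / p)) * (F_norm \<mu> p S I Q j v + Lp_norm \<mu> p G)" .
  qed auto
  also have "\<dots> = ennreal AF_const * (F_norm \<mu> p S I Q j v + Lp_norm \<mu> p G)"
  proof -
    have "ennreal A * (ennreal B * (ennreal C * t)) = ennreal (A * B * C) * t" if "0 \<le> A" "0 \<le> B" "0 \<le> C" for A B C t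
      using that by (simp add: ennreal_mult mult.assoc)
    from this[of grand_const ?hc "2 * 2 powr (1 / p)"] show ?thesis using gc by (simp add: AF_const_def)
  qed
  finally show ?thesis .
qed

end

section \<open>Equality of the spaces\<close>

text \<open>The RD condition is confined to radii and dilations below twice the diameter. In a space
  of finite diameter, balls of larger radius are the whole space, so doubling extends to all
  dilations. In an unbounded space the lower RD estimate makes volumes grow without bound.\<close>

lemma rd_space_doubling:
  fixes \<mu> :: "'a::metric_space measure"
  assumes rd: "rd_space \<mu> \<kappa> n"
  shows "\<exists>D. doubling_measure \<mu> n D"
    and "(\<exists>R0. \<forall>y. dist x1 y \<le> R0) \<or> (\<forall>B. \<exists>R. B \<le> vol \<mu> x1 R)"
proof -
  let ?d = "ediam (UNIV :: 'a set)"
  obtain C1 C2 where C: "0 < C1" "C1 \<le> 1" "1 \<le> C2" and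
    dbl': "\<forall>x r l. 0 < r \<and> ennreal r < 2 * ?d \<and> 1 \<le> l \<and> ennreal l < 2 * ?d / ennreal r \<longrightarrow>
      C1 * l powr \<kappa> * vol \<mu> x r \<le> vol \<mu> x (l * r) \<and> vol \<mu> x (l * r) \<le> C2 * l powr n * vol \<mu> x r"
    using rd unfolding rd_space_def by (elim conjE exE) rule
  have dbl: "C1 * l powr \<kappa> * vol \<mu> x r \<le> vol \<mu> x (l * r)" "vol \<mu> x (l * r) \<le> C2 * l powr n * vol \<mu> x r"
    if "0 < r" "ennreal r < 2 * ?d" "1 \<le> l" "ennreal l < 2 * ?d / ennreal r" for x r l
    using dbl'[rule_format, OF conjI[OF that(1) conjI[OF that(2) conjI[OF that(3,4)]]], of x] by (rule conjunct1, rule conjunct2)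
  note rd' = rd[unfolded rd_space_def, THEN conjunct2, THEN conjunct2]
  have sets: "sets \<mu> = sets borel" by (rule rd[unfolded rd_space_def, THEN conjunct1])
  have ball': "\<forall>x r. 0 < r \<longrightarrow> 0 < emeasure \<mu> (ball x r) \<and> emeasure \<mu> (ball x r) < \<infinity>" by (rule rd'[THEN conjunct1])
  have \<kappa>: "0 < \<kappa>" "\<kappa> \<le> n"
    by (rule rd'[THEN conjunct2, THEN conjunct1], rule rd'[THEN conjunct2, THEN conjunct2, THEN conjunct1])
  have ball: "0 < emeasure \<mu> (ball x r)" "emeasure \<mu> (ball x r) < \<infinity>" if "0 < r" for x r
    using ball' that by blast+
  have vnn: "0 \<le> vol \<mu> x r" for x r by (simp add: vol_def)
  have le_d: "ennreal (dist x y) \<le> ?d" for x y :: 'a by (rule dist_le_ediam) auto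
  have D_pow: "vol \<mu> x r \<le> C2 * l powr n * vol \<mu> x r" if "1 \<le> l" for x r l
  proof -
    have "1 \<le> l powr n" using that \<kappa> by (intro ge_one_powr_ge_zero) auto
    then have "1 * 1 \<le> C2 * l powr n" using C by (intro mult_mono) auto
    then show ?thesis using mult_right_mono[OF _ vnn, of 1 "C2 * l powr n" x r] by simp
  qed
  have doubling: "vol \<mu> x (l * r) \<le> C2 * l powr n * vol \<mu> x r" if r: "0 < r" and l: "1 \<le> l" for x r l
  proof (cases ?d)
    case top
    then have "ennreal l < 2 * ?d / ennreal r" using r
      by (simp add: ennreal_mult_top ennreal_top_divide)
    moreover have "ennreal r < 2 * ?d" using top by (simp add: ennreal_mult_top)
    ultimately show ?thesis using r l by (intro dbl(2))
  next
    case (real d)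
    have dd: "dist x y \<le> d" for x y :: 'a using le_d[of x y] real by (simp add: ennreal_le_iff)
    have UN: "ball x t = UNIV" if "d < t" for x :: 'a and t
      using le_less_trans[OF dd that] by (intro set_eqI) (simp only: mem_ball UNIV_I)
    have d2: "2 * ?d = ennreal (2 * d)" using real by (simp add: ennreal_mult)
    have dr: "2 * ?d = ennreal (2 * d)" "2 * ?d / ennreal t = ennreal (2 * d / t)" if "0 < t" for t
      unfolding d2 using real that by (simp_all only: divide_ennreal mult_nonneg_nonneg zero_le_numeral)
    show ?thesis
    proof (cases "l * r < 2 * d")
      case True
      have "r \<le> l * r" using r l by simp
      then have "r < 2 * d" using True by linarith
      moreover have "l < 2 * d / r" using True r by (simp add: pos_less_divide_eq)
      ultimately show ?thesis using dr[OF r] r l by (intro dbl(2)) (simp_all only: ennreal_lessI mult_pos_pos divide_pos_pos | simp add: ennreal_lessI)+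
    next
      case False
      show ?thesis
      proof (cases "d < r")
        case True
        have "r \<le> l * r" using r l by simp
        then have "vol \<mu> x (l * r) = vol \<mu> x r" using UN[OF True] UN[of "l * r"] True by (simp add: vol_def)
        then show ?thesis using D_pow[OF l] by simp
      next
        case rd': False
        then have d: "0 < d" using r by linarith
        \<comment> \<open>A dilation with \<open>d < t * r < 2 * d\<close>: the dilated ball is
          already the whole space, while \<open>t\<close> is still admissible in the RD
          condition.\<close>
        define t where "t = 3 / 2 * d / r"
        have t: "1 \<le> t" "t * r = 3 / 2 * d" "t < 2 * d / r" using rd' r d by (auto simp: t_def field_simps)
        have "t * r \<le> l * r" using t(2) False d by linarith
        then have tl: "t \<le> l" using r by simp
        have "ball x (l * r) = UNIV" "ball x (t * r) = UNIV" using t(2) False d by (intro UN, linarith)+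
        then have "vol \<mu> x (l * r) = vol \<mu> x (t * r)" by (simp only: vol_def)
        also have "\<dots> \<le> C2 * t powr n * vol \<mu> x r"
          using dr[OF r] r t rd' d by (intro dbl(2)) (simp_all add: ennreal_lessI)
        also have "\<dots> \<le> C2 * l powr n * vol \<mu> x r"
          using C t tl \<kappa> vnn by (intro mult_right_mono mult_left_mono powr_mono2) auto
        finally show ?thesis .
      qed
    qed
  qed
  show "\<exists>D. doubling_measure \<mu> n D"
  proof (intro exI[of _ C2], unfold_locales)
    show "0 < n" using \<kappa> by linarith
  qed (use sets ball C doubling in blast)+
  show "(\<exists>R0. \<forall>y. dist x1 y \<le> R0) \<or> (\<forall>B. \<exists>R. B \<le> vol \<mu> x1 R)"
  proof (cases ?d)
    case (real d)
    then have "dist x1 y \<le> d" for y using le_d[of x1 y] by (simp add: ennreal_le_iff)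
    then show ?thesis by blast
  next
    case top
    have v: "0 < vol \<mu> x1 1" using ball[of 1 x1] unfolding vol_def measure_def by (simp only: enn2real_positive_iff infinity_ennreal_def)
    have "\<exists>R. B \<le> vol \<mu> x1 R" for B
    proof -
      \<comment> \<open>Chosen by solving
        \<open>C1 * l powr \<kappa> * vol \<mu> x1 1 = \<bar>B\<bar>\<close> for \<open>l\<close>;
        the maximum with 1 keeps the dilation admissible.\<close>
      define l where "l = max 1 ((\<bar>B\<bar> / (C1 * vol \<mu> x1 1)) powr (1 / \<kappa>))"
      have l: "1 \<le> l" by (simp add: l_def)
      have "(\<bar>B\<bar> / (C1 * vol \<mu> x1 1)) = ((\<bar>B\<bar> / (C1 * vol \<mu> x1 1)) powr (1 / \<kappa>)) powr \<kappa>"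
        using C v \<kappa> by (simp add: powr_powr)
      also have "\<dots> \<le> l powr \<kappa>" using \<kappa> by (intro powr_mono2) (auto simp: l_def)
      finally have "\<bar>B\<bar> \<le> C1 * l powr \<kappa> * vol \<mu> x1 1" using C v by (simp add: divide_le_eq mult_ac)
      also have "\<dots> \<le> vol \<mu> x1 (l * 1)"
        using l top by (intro dbl(1)) (simp_all add: ennreal_mult_top ennreal_top_divide)
      finally show ?thesis by (intro exI[of _ "l * 1"]) linarith
    qed
    then show ?thesis by blast
  qed
qed

text \<open>With \<open>m = min s \<gamma>\<close> the last two conditions amount to
  \<open>n / (n + m) < q\<close>, and the hypotheses place this quotient below both \<open>p\<close>
  and 1.\<close>

lemma exists_exponent:
  fixes n s p \<gamma> :: real
  assumes "0 < n" "0 < s" "n / (n + s) < p" "n * max (1 / p - 1) 0 < \<gamma>"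
  shows "\<exists>q. 0 < q \<and> q \<le> 1 \<and> q < p \<and> n * (1 / q - 1) < s \<and> n * (1 / q - 1) < \<gamma>"
proof -
  define m where "m = min s \<gamma>"
  have "0 \<le> n * max (1 / p - 1) 0" using assms by (intro mult_nonneg_nonneg) auto
  then have \<gamma>: "0 < \<gamma>" using assms(4) by linarith
  have p: "0 < p" using assms by (smt (verit) divide_pos_pos)
  have m: "0 < m" "m \<le> s" "m \<le> \<gamma>" using assms \<gamma> by (auto simp: m_def)
  have "n * (1 / p - 1) < m"
  proof -
    have "n * (1 / p - 1) \<le> n * max (1 / p - 1) 0" using assms by (intro mult_left_mono) auto
    then have "n * (1 / p - 1) < \<gamma>" using assms(4) by linarith
    moreover have "n * (1 / p - 1) < s" using assms p by (simp add: field_simps)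
    ultimately show ?thesis by (simp add: m_def)
  qed
  then have "n / (n + m) < p" using assms p m by (simp add: field_simps)
  moreover have "n / (n + m) < 1" using assms m by simp
  ultimately obtain q where q: "n / (n + m) < q" "q < min p 1" using dense[of "n / (n + m)" "min p 1"] by auto
  have q0: "0 < q" using q assms m by (smt (verit) divide_pos_pos)
  have "n * (1 / q - 1) < m" using q q0 assms m by (simp add: field_simps)
  then show ?thesis using q q0 m by (intro exI[of _ q]) auto
qed

lemma Lp_add_finite:
  assumes [measurable]: "a \<in> borel_measurable M" "b \<in> borel_measurable M" and p: "0 < p"
    and "(\<integral>\<^sup>+x. epowr (a x) p \<partial>M) < top" "(\<integral>\<^sup>+x. epowr (b x) p \<partial>M) < top"
  shows "(\<integral>\<^sup>+x. epowr (a x + b x) p \<partial>M) < top"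
proof -
  have "(\<integral>\<^sup>+x. epowr (a x + b x) p \<partial>M) \<le> (\<integral>\<^sup>+x. ennreal (2 powr p) * (epowr (a x) p + epowr (b x) p) \<partial>M)"
    using p by (intro nn_integral_mono epowr_add_le)
  also have "\<dots> = ennreal (2 powr p) * ((\<integral>\<^sup>+x. epowr (a x) p \<partial>M) + (\<integral>\<^sup>+x. epowr (b x) p \<partial>M))"
    by (simp add: nn_integral_cmult nn_integral_add)
  also have "\<dots> < top" using assms by (simp add: ennreal_mult_less_top)
  finally show ?thesis .
qed

lemma hajlasz_gradientsD:
  assumes g: "g \<in> hajlasz_gradients \<mu> s p f" and p: "0 < p"
  shows "g \<in> borel_measurable \<mu>" "(\<integral>\<^sup>+x. epowr (ennreal (g x)) p \<partial>\<mu>) < top" "\<exists>E\<in>null_sets \<mu>. hajlasz_on s f g E"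
proof -
  show m: "g \<in> borel_measurable \<mu>" using g by (simp add: hajlasz_gradients_def)
  have "Lp_norm \<mu> p (\<lambda>x. ennreal (g x)) < top" using g by (simp add: hajlasz_gradients_def)
  then have "epowr (\<integral>\<^sup>+x. epowr (ennreal (g x)) p \<partial>\<mu>) (1 / p) < top"
    using m p by (subst (asm) Lp_norm_measurable) auto
  then show "(\<integral>\<^sup>+x. epowr (ennreal (g x)) p \<partial>\<mu>) < top" by (simp add: less_top[symmetric])
  show "\<exists>E\<in>null_sets \<mu>. hajlasz_on s f g E" using g unfolding hajlasz_gradients_def hajlasz_on_def by blast
qed

lemma hajlasz_gradientsI:
  assumes "hajlasz_on s f g E" "E \<in> null_sets \<mu>" "g \<in> borel_measurable \<mu>" "0 < p"
    "(\<integral>\<^sup>+x. epowr (ennreal (g x)) p \<partial>\<mu>) < top"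
  shows "g \<in> hajlasz_gradients \<mu> s p f"
proof -
  have "Lp_norm \<mu> p (\<lambda>x. ennreal (g x)) < top"
    using assms by (subst Lp_norm_measurable) (auto simp: less_top[symmetric])
  then show ?thesis using assms unfolding hajlasz_gradients_def hajlasz_on_def by auto
qed

lemma hajlasz_gradients_AE_subset:
  assumes eq: "AE x in \<mu>. f x = f' x" and sp: "space \<mu> = UNIV"
  shows "hajlasz_gradients \<mu> s p f \<subseteq> hajlasz_gradients \<mu> s p f'"
proof
  fix g assume g: "g \<in> hajlasz_gradients \<mu> s p f"
  obtain N where N: "N \<in> null_sets \<mu>" "{x \<in> space \<mu>. f x \<noteq> f' x} \<subseteq> N" proof -
    obtain N where "\<And>x. x \<in> space \<mu> - N \<Longrightarrow> f x = f' x" "N \<in> null_sets \<mu>" using AE_E3[OF eq] by blast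
    then show ?thesis by (intro that[of N]) auto
  qed
  obtain E where E: "E \<in> null_sets \<mu>" "\<forall>x y. x \<notin> E \<and> y \<notin> E \<longrightarrow> cmod (f x - f y) \<le> dist x y powr s * (g x + g y)"
    using g by (auto simp: hajlasz_gradients_def)
  have eqN: "f x = f' x" if "x \<notin> N" for x using N(2) sp that by auto
  have "\<forall>x y. x \<notin> E \<union> N \<and> y \<notin> E \<union> N \<longrightarrow> cmod (f' x - f' y) \<le> dist x y powr s * (g x + g y)"
    using E(2) eqN by (metis UnCI)
  then show "g \<in> hajlasz_gradients \<mu> s p f'"
    using g null_sets.Un[OF E(1) N(1)] unfolding hajlasz_gradients_def by blast
qed

context doubling_measure
begin

text \<open>Where the maximal function is finite, \<open>w x\<close> is a mean of \<open>w x - w y\<close> over a ball of radius \<open>r\<close>,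
  which is \<open>O(r powr s)\<close>.\<close>
lemma hajlasz_ae_zero:
  assumes hj: "hajlasz_on s w g E" and s: "0 < s" "s \<le> 1" and q: "0 < q" "q \<le> 1" "q < p" "n * (1 / q - 1) < s"
    and [measurable]: "g \<in> borel_measurable \<mu>" "w \<in> borel_measurable \<mu>" and E: "E \<in> null_sets \<mu>"
    and gp: "(\<integral>\<^sup>+x. epowr (ennreal (g x)) p \<partial>\<mu>) < top"
    and int: "\<And>r z. 0 < r \<Longrightarrow> integrable \<mu> (\<lambda>y. w y * rho r z y)"
    and zero: "\<And>r z. 0 < r \<Longrightarrow> (\<integral>y. w y * rho r z y \<partial>\<mu>) = 0"
  shows "AE x in \<mu>. w x = 0"
proof -
  let ?G = "\<lambda>y. ennreal (g y)" and ?H = "\<lambda>x. epowr (hl (\<lambda>y. epowr (ennreal (g y)) q) x) (1 / q)"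
  have "epowr (\<integral>\<^sup>+x. epowr (?H x) p \<partial>\<mu>) (1 / p) \<le>
    ennreal ((2 powr (p / q) * (p / q) / (p / q - 1) * (D * 3 powr n)) powr (1 / p)) * epowr (\<integral>\<^sup>+x. epowr (?G x) p \<partial>\<mu>) (1 / p)"
    using q by (intro hl_Lp) auto
  also have "\<dots> < top"
  proof -
    have "epowr (\<integral>\<^sup>+x. epowr (?G x) p \<partial>\<mu>) (1 / p) < top" using gp by (simp add: less_top[symmetric])
    then show ?thesis by (simp only: ennreal_mult_less_top) simp
  qed
  finally have "(\<integral>\<^sup>+x. epowr (?H x) p \<partial>\<mu>) < top" by (simp add: less_top[symmetric])
  then have "AE x in \<mu>. epowr (?H x) p \<noteq> \<infinity>" by (intro nn_integral_PInf_AE) auto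
  then show ?thesis using AE_not_in[OF E]
  proof eventually_elim
    case (elim x)
    then have "?H x < top" by (simp add: less_top[symmetric])
    then obtain b where b: "?H x = ennreal b" "0 \<le> b" by (cases "?H x") auto
    let ?c = "(D * 5 powr n) powr (1 / q)" and ?k = "poincare_const s q" and ?M = "2 * (D * 2 powr n)"
    have k: "0 < ?k" using q by (intro poincare_const_pos)
    have g0: "0 \<le> g x" using hj by (rule hajlasz_on_nonneg)
    have bound: "cmod (w x) \<le> ?M * ?k * (g x + ?c * b) * r powr s" if r: "0 < r" for r
    proof -
      have v: "0 < V x r" using r by simp
      have "(\<integral>\<^sup>+y\<in>ball x r. ennreal (cmod (w y - w x)) \<partial>\<mu>) \<le> ennreal (?k * r powr s * V x r) * (?G x + pavg q x (2 * r) ?G)"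
        using r elim by (intro poincare[OF hj s q(1,2,4) _ E]) auto
      also have "\<dots> \<le> ennreal (?k * r powr s * V x r) * (?G x + ennreal ?c * ennreal b)"
      proof (intro mult_left_mono add_left_mono)
        show "pavg q x (2 * r) ?G \<le> ennreal ?c * ennreal b"
          unfolding b(1)[symmetric] using q r by (intro pavg_le_hl) auto
      qed auto
      also have "\<dots> = ennreal (?k * r powr s * V x r * (g x + ?c * b))"
        using k g0 b by (simp add: ennreal_mult)
      finally have P: "(\<integral>\<^sup>+y\<in>ball x r. ennreal (cmod (w y - w x)) \<partial>\<mu>) \<le> ennreal (?k * r powr s * V x r * (g x + ?c * b))" .
      have i3: "integrable \<mu> (\<lambda>y. (w y - w x) * rho r x y)"
        using Bochner_Integration.integrable_diff[OF int[OF r, of x] integrable_mult_right[OF rho_integrable[OF r, of x], of "w x"]]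
        by (simp add: left_diff_distrib)
      have "(\<integral>y. (w y - w x) * rho r x y \<partial>\<mu>) = (\<integral>y. (w y * rho r x y - w x * rho r x y) \<partial>\<mu>)" by (simp only: left_diff_distrib)
      also have "\<dots> = - w x"
        using Bochner_Integration.integral_diff[OF int[OF r, of x] integrable_mult_right[OF rho_integrable[OF r, of x], of "w x"]]
          zero[OF r, of x] rho_integral[OF r, of x] by simp
      finally have eq: "(\<integral>y. (w y - w x) * rho r x y \<partial>\<mu>) = - w x" .
      have "ennreal (cmod (w x)) \<le> (\<integral>\<^sup>+y. ennreal (cmod ((w y - w x) * rho r x y)) \<partial>\<mu>)"
        using integral_norm_bound_ennreal[OF i3] unfolding eq by simp
      also have "\<dots> \<le> (\<integral>\<^sup>+y. ennreal (?M / V x r) * (ennreal (cmod (w y - w x)) * indicator (ball x r) y) \<partial>\<mu>)"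
      proof (rule nn_integral_mono)
        fix y
        show "ennreal (cmod ((w y - w x) * rho r x y)) \<le> ennreal (?M / V x r) * (ennreal (cmod (w y - w x)) * indicator (ball x r) y)"
        proof (cases "rho r x y = 0")
          case False
          have "cmod ((w y - w x) * rho r x y) \<le> ?M / V x r * cmod (w y - w x)"
            unfolding norm_mult using rho_bounds(2)[OF r, of x y] mult_left_mono[of "cmod (rho r x y)" "?M / V x r" "cmod (w y - w x)"]
            by (simp add: mult.commute)
          then have "ennreal (cmod ((w y - w x) * rho r x y)) \<le> ennreal (?M / V x r) * ennreal (cmod (w y - w x))"
            using D_ge by (subst ennreal_mult[symmetric]) (auto intro: ennreal_leI)
          then show ?thesis using rho_bounds(1)[OF r False] by simp
        qed simp
      qed
      also have "\<dots> = ennreal (?M / V x r) * (\<integral>\<^sup>+y\<in>ball x r. ennreal (cmod (w y - w x)) \<partial>\<mu>)"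
        by (rule nn_integral_cmult) measurable
      also have "\<dots> \<le> ennreal (?M / V x r) * ennreal (?k * r powr s * V x r * (g x + ?c * b))"
        by (intro mult_left_mono P) simp
      also have "\<dots> = ennreal (?M / V x r * (?k * r powr s * V x r * (g x + ?c * b)))"
        using D_ge k g0 b by (intro ennreal_mult[symmetric]) auto
      also have "?M / V x r * (?k * r powr s * V x r * (g x + ?c * b)) = ?M * ?k * (g x + ?c * b) * r powr s"
        using v by (simp del: V_pos)
      finally show ?thesis using D_ge k g0 b by (subst (asm) ennreal_le_iff) auto
    qed
    let ?Z = "?M * ?k * (g x + ?c * b)"
    have "(\<lambda>i. ?Z * (2 powr (- s)) ^ i) \<longlonglongrightarrow> 0"
      using s powr_less_one[of 2 "- s"] by (intro tendsto_mult_right_zero LIMSEQ_power_zero) auto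
    moreover have "cmod (w x) \<le> ?Z * (2 powr (- s)) ^ i" for i
    proof -
      have "(2 powr (- real i)) powr s = (2 powr (- s)) ^ i"
        by (simp add: powr_realpow[symmetric] powr_powr mult.commute)
      then show ?thesis using bound[of "2 powr (- real i)"] by simp
    qed
    ultimately have "cmod (w x) \<le> 0" by (intro LIMSEQ_le_const[of _ 0]) auto
    then show ?case by simp
  qed
qed

lemma hajlasz_on_diff:
  assumes "hajlasz_on s f g E" "hajlasz_on s f' g' E'"
  shows "hajlasz_on s (\<lambda>x. f x - f' x) (\<lambda>x. g x + g' x) (E \<union> E')"
  unfolding hajlasz_on_def
proof (intro conjI allI impI)
  fix x show "0 \<le> g x + g' x" using assms by (simp add: hajlasz_on_def)
next
  fix x y assume "x \<notin> E \<union> E'" "y \<notin> E \<union> E'"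
  then have "cmod (f x - f y) \<le> dist x y powr s * (g x + g y)" "cmod (f' x - f' y) \<le> dist x y powr s * (g' x + g' y)"
    using assms by (auto simp: hajlasz_on_def)
  then have "cmod (f x - f y) + cmod (f' x - f' y) \<le> dist x y powr s * (g x + g' x + (g y + g' y))"
    by (simp add: algebra_simps)
  moreover have "f x - f' x - (f y - f' y) = (f x - f y) - (f' x - f' y)" by simp
  ultimately show "cmod (f x - f' x - (f y - f' y)) \<le> dist x y powr s * (g x + g' x + (g y + g' y))"
    by (metis norm_triangle_ineq4 order_trans)
qed

text \<open>Lowering the exponents 1 and 2 to \<open>\<epsilon>\<close> places the function in the
  space whose closure is taken, so no approximation is involved.\<close>

lemma test_space_in_closure:
  assumes \<phi>: "\<phi> \<in> test_space \<mu> x1 1 1 2" and "\<epsilon> \<le> 1" "\<beta> \<le> \<epsilon>" "\<gamma> \<le> \<epsilon>"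
  shows "\<phi> \<in> test_closure \<mu> x1 \<epsilon> \<beta> \<gamma>"
proof -
  obtain C where "0 \<le> C" "test_bound \<mu> x1 1 1 2 C \<phi>" using \<phi> by (auto simp: test_space_def)
  then have "\<phi> \<in> test_space \<mu> x1 1 \<epsilon> \<epsilon>"
    using test_bound_mono[of \<mu> x1 1 1 2 C \<phi> \<epsilon> \<epsilon>] assms by (auto intro: test_spaceI)
  then show ?thesis using assms by (intro test_closure_memberI)
qed

text \<open>The test space of exponents 1 and 2 is contained in the closure and carries the larger
  norm, so boundedness is inherited.\<close>

lemma functional_dual_restrict:
  assumes d: "functional_of \<mu> (test_closure \<mu> x1 \<epsilon> \<beta> \<gamma>) f \<in> dual_space (test_closure \<mu> x1 \<epsilon> \<beta> \<gamma>) (test_norm \<mu> x1 1 \<beta> \<gamma>)"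
    and int: "\<And>\<phi>. \<phi> \<in> test_closure \<mu> x1 \<epsilon> \<beta> \<gamma> \<Longrightarrow> integrable \<mu> (\<lambda>y. f y * \<phi> y)"
    and e: "\<epsilon> \<le> 1" "\<beta> \<le> \<epsilon>" "\<gamma> \<le> \<epsilon>"
  shows "functional_of \<mu> (test_space \<mu> x1 1 1 2) f \<in> dual_space (test_space \<mu> x1 1 1 2) (test_norm \<mu> x1 1 1 2)"
proof -
  let ?E = "test_space \<mu> x1 1 1 2"
  note sub = test_space_in_closure[OF _ e]
  obtain C where C: "0 \<le> C" "\<And>\<phi>. \<phi> \<in> test_closure \<mu> x1 \<epsilon> \<beta> \<gamma> \<Longrightarrow>
      ennreal (cmod (functional_of \<mu> (test_closure \<mu> x1 \<epsilon> \<beta> \<gamma>) f \<phi>)) \<le> ennreal C * test_norm \<mu> x1 1 \<beta> \<gamma> \<phi>"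
    using d unfolding dual_space_def by blast
  have tn: "test_norm \<mu> x1 1 \<beta> \<gamma> \<phi> \<le> test_norm \<mu> x1 1 1 2 \<phi>" for \<phi>
    unfolding test_norm_def
  proof (rule INF_superset_mono)
    show "{C. 0 \<le> C \<and> test_bound \<mu> x1 1 1 2 C \<phi>} \<subseteq> {C. 0 \<le> C \<and> test_bound \<mu> x1 1 \<beta> \<gamma> C \<phi>}"
      using e test_bound_mono[of \<mu> x1 1 1 2 _ \<phi> \<beta> \<gamma>] by auto
  qed simp
  show ?thesis
    unfolding dual_space_def
  proof (intro CollectI conjI ballI allI)
    show "functional_of \<mu> ?E f \<in> extensional ?E" by (simp add: functional_of_def)
  next
    fix \<phi> \<psi> assume a: "\<phi> \<in> ?E" "\<psi> \<in> ?E"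
    then show "functional_of \<mu> ?E f (\<lambda>x. \<phi> x + \<psi> x) = functional_of \<mu> ?E f \<phi> + functional_of \<mu> ?E f \<psi>"
      using int[OF sub[OF a(1)]] int[OF sub[OF a(2)]] by (simp add: functional_of_def test_space_add distrib_left)
  next
    fix c \<phi> assume a: "\<phi> \<in> ?E"
    then show "functional_of \<mu> ?E f (\<lambda>x. c * \<phi> x) = c * functional_of \<mu> ?E f \<phi>"
      by (simp add: functional_of_def test_space_scale mult.left_commute)
  next
    show "\<exists>C\<ge>0. \<forall>\<phi>\<in>?E. ennreal (cmod (functional_of \<mu> ?E f \<phi>)) \<le> ennreal C * test_norm \<mu> x1 1 1 2 \<phi>"
    proof (intro exI[of _ C] conjI ballI C(1))
      fix \<phi> assume a: "\<phi> \<in> ?E"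
      then have "ennreal (cmod (functional_of \<mu> ?E f \<phi>)) \<le> ennreal C * test_norm \<mu> x1 1 \<beta> \<gamma> \<phi>"
        using C(2)[OF sub[OF a]] sub[OF a] by (simp add: functional_of_def)
      also have "\<dots> \<le> ennreal C * test_norm \<mu> x1 1 1 2 \<phi>" by (intro mult_left_mono tn) simp
      finally show "ennreal (cmod (functional_of \<mu> ?E f \<phi>)) \<le> ennreal C * test_norm \<mu> x1 1 1 2 \<phi>" .
    qed
  qed
qed

end

text \<open>Lets a function be exchanged for the representative that is reconstructed from its
  functional.\<close>

lemma sobolev_norm_AE_cong:
  fixes \<mu> :: "'a::metric_space measure"
  assumes eq: "AE x in \<mu>. f x = f' x" and sp: "space \<mu> = UNIV"
    and m: "f \<in> borel_measurable \<mu>" "f' \<in> borel_measurable \<mu>"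
    and cl: "\<And>\<phi>. \<phi> \<in> test_closure \<mu> x1 \<epsilon> \<beta> \<gamma> \<Longrightarrow> \<phi> \<in> borel_measurable \<mu>"
  shows "sobolev_norm \<mu> x1 s p \<epsilon> \<beta> \<gamma> S I Q j f = sobolev_norm \<mu> x1 s p \<epsilon> \<beta> \<gamma> S I Q j f'"
proof -
  have "functional_of \<mu> (test_closure \<mu> x1 \<epsilon> \<beta> \<gamma>) f = functional_of \<mu> (test_closure \<mu> x1 \<epsilon> \<beta> \<gamma>) f'"
    unfolding functional_of_def
  proof (rule restrict_ext)
    fix \<phi> assume "\<phi> \<in> test_closure \<mu> x1 \<epsilon> \<beta> \<gamma>"
    then have [measurable]: "\<phi> \<in> borel_measurable \<mu>" by (rule cl)
    note m[measurable]
    show "(\<integral>x. f x * \<phi> x \<partial>\<mu>) = (\<integral>x. f' x * \<phi> x \<partial>\<mu>)"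
    proof (rule integral_cong_AE)
      show "AE x in \<mu>. f x * \<phi> x = f' x * \<phi> x" using eq by eventually_elim simp
    qed measurable
  qed
  moreover have "hajlasz_gradients \<mu> s p f = hajlasz_gradients \<mu> s p f'"
  proof
    have eq': "AE x in \<mu>. f' x = f x" using eq by eventually_elim simp
    show "hajlasz_gradients \<mu> s p f \<subseteq> hajlasz_gradients \<mu> s p f'" by (rule hajlasz_gradients_AE_subset[OF eq sp])
    show "hajlasz_gradients \<mu> s p f' \<subseteq> hajlasz_gradients \<mu> s p f" by (rule hajlasz_gradients_AE_subset[OF eq' sp])
  qed
  ultimately show ?thesis by (simp add: sobolev_norm_def hom_sobolev_norm_def)
qed

text \<open>Members of \<open>M\<close> are functions rather than classes, so the identification
  through \<open>J\<close> can be injective only up to null sets.\<close>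

theorem theorem5p2:
  fixes \<mu> :: "'a::metric_space measure"
    and x1 :: 'a
    and \<kappa> n s p \<epsilon> \<beta> \<gamma> :: real
    and S :: "nat \<Rightarrow> 'a \<Rightarrow> 'a \<Rightarrow> complex"
    and I :: "int \<Rightarrow> 'i set"
    and Q :: "int \<Rightarrow> 'i \<Rightarrow> 'a set"
    and j :: nat
  assumes "rd_space \<mu> \<kappa> n"
    and "0 < s" and "s \<le> 1"
    and "n / (n + s) < p"
    and "hardy_data \<mu> n p \<epsilon> \<beta> \<gamma> S I Q j"
  defines "M \<equiv> sobolev_space \<mu> x1 s p \<epsilon> \<beta> \<gamma> S I Q j"
    and "J \<equiv> functional_of \<mu> (test_space \<mu> x1 1 1 2)"
  shows "J ` M = AF_space \<mu> x1 s p \<and>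
         (\<forall>f\<in>M. \<forall>g\<in>M. J f = J g \<longrightarrow> (AE x in \<mu>. f x = g x)) \<and>
         (\<exists>C::real. 0 < C \<and> (\<forall>f\<in>M.
            AF_norm \<mu> x1 s p (J f) \<le> ennreal C * sobolev_norm \<mu> x1 s p \<epsilon> \<beta> \<gamma> S I Q j f \<and>
            sobolev_norm \<mu> x1 s p \<epsilon> \<beta> \<gamma> S I Q j f \<le> ennreal C * AF_norm \<mu> x1 s p (J f)))"
proof -

  \<comment> \<open>Doubling constant, exponent and auxiliary data\<close>
  obtain D where D: "doubling_measure \<mu> n D" using rd_space_doubling(1)[OF assms(1)] by blast
  interpret doubling_measure \<mu> n D by (rule D)
  have unb: "(\<exists>R0. \<forall>y. dist x1 y \<le> R0) \<or> (\<forall>B. \<exists>R. B \<le> vol \<mu> x1 R)"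
    by (rule rd_space_doubling(2)[OF assms(1)])
  have hd: "0 < \<epsilon>" "\<epsilon> < 1" "n * max (1 / p - 1) 0 < \<beta>" "\<beta> < \<epsilon>" "n * max (1 / p - 1) 0 < \<gamma>" "\<gamma> < \<epsilon>"
    "approx_identity \<mu> \<epsilon> S" "\<exists>C5. dyadic_cubes \<mu> C5 I Q \<and> 2 powr (- real j) * C5 < 1 / 3"
    using assms(5) by (auto simp: hardy_data_def)
  have nm: "0 \<le> n * max (1 / p - 1) 0" using n_pos by (intro mult_nonneg_nonneg) auto
  have \<beta>: "0 < \<beta>" and \<gamma>: "0 < \<gamma>" using nm hd by linarith+
  note s = assms(2,3)
  have p: "0 < p" using assms(4) n_pos s by (smt (verit) divide_pos_pos)
  \<comment> \<open>The condition involving \<open>\<gamma>\<close> ensures that pairings with the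
    test space underlying the Hardy space are finite.\<close>
  obtain q where q: "0 < q" "q \<le> 1" "q < p" "n * (1 / q - 1) < s" and q\<gamma>: "n * (1 / q - 1) < \<gamma>"
    using exists_exponent[OF n_pos s(1) assms(4) hd(5)] by blast
  have q\<epsilon>: "n * (1 / q - 1) < \<epsilon>" using q\<gamma> hd by linarith
  obtain C3 C4 where kb: "kernel_bounds C3 C4 \<epsilon> S"
    using approx_identity_kernel_bounds[OF hd(7,1)] by blast
  obtain C5 where cubes: "dyadic_cubes \<mu> C5 I Q" and jC: "2 powr (- real j) * C5 < 1 / 3" using hd(8) by blast
  obtain C6 where C6: "0 < C6" "\<And>k \<alpha>. \<alpha> \<in> I k \<Longrightarrow> \<exists>z. ball z (C6 * 2 powr (- real_of_int k)) \<subseteq> Q k \<alpha>"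
  proof -
    have "\<exists>C6>0. \<forall>k. \<forall>\<alpha>\<in>I k. \<exists>z. ball z (C6 * 2 powr (- real_of_int k)) \<subseteq> Q k \<alpha>"
      using cubes unfolding dyadic_cubes_def by (elim conjE) assumption
    then show ?thesis using that by auto
  qed
  let ?cl = "test_closure \<mu> x1 \<epsilon> \<beta> \<gamma>" and ?ts = "test_space \<mu> x1 1 1 2"
  let ?fc = "functional_of \<mu> ?cl"
  have ts_cl: "\<phi> \<in> ?cl" if "\<phi> \<in> ?ts" for \<phi> using that hd by (intro test_space_in_closure) auto
  have S_cl: "S k x \<in> ?cl" for k x
    using kernel_test_space[OF kb] hd by (intro test_closure_memberI) auto
  have Sd_cl: "(\<lambda>y. S (Suc k) x y - S k x y) \<in> ?cl" for k x
    using kernel_diff_test_space[OF kb] hd by (intro test_closure_memberI) auto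
  have cl_meas: "\<phi> \<in> borel_measurable \<mu>" if mem: "\<phi> \<in> ?cl" for \<phi>
  proof -
    obtain C where "test_bound \<mu> x1 1 \<beta> \<gamma> C \<phi>"
      using subsetD[OF test_closure_subset mem] by (auto simp: test_space_def)
    then show ?thesis using zero_less_one \<beta> by (rule test_bound_measurable)
  qed

  \<comment> \<open>The grand norm is controlled by the Sobolev norm\<close>
  have M_D: "f \<in> borel_measurable \<mu>" "hajlasz_gradients \<mu> s p f \<noteq> {}" "\<And>\<phi>. \<phi> \<in> ?cl \<Longrightarrow> integrable \<mu> (\<lambda>x. f x * \<phi> x)"
    "?fc f \<in> dual_space ?cl (test_norm \<mu> x1 1 \<beta> \<gamma>)" "F_norm \<mu> p S I Q j (?fc f) < top" if "f \<in> M" for f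
    using that by (auto simp: M_def sobolev_space_def hom_sobolev_space_def Lp_loc_def F_space_def)
  \<comment> \<open>The exported constant displays its parameters, and neither \<open>f\<close> nor
    its gradient or exceptional set is among them. The maximum with 1 makes it positive.\<close>
  define cB where "cB = max 1 (cell_function.AF_const n D s p q C3 C4 j C6)"
  have upper: "AF_norm \<mu> x1 s p (J f) \<le> ennreal cB * (F_norm \<mu> p S I Q j (?fc f) + Lp_norm \<mu> p (\<lambda>x. ennreal (g x)))"
    if f: "f \<in> M" and g: "g \<in> hajlasz_gradients \<mu> s p f" for f g
  proof -
    note fD = M_D[OF f] and gD = hajlasz_gradientsD[OF g p]
    obtain E where E: "E \<in> null_sets \<mu>" "hajlasz_on s f g E" using gD(3) by blast
    interpret B: cell_function \<mu> n D f g E s p q C3 C4 \<epsilon> S I Q j C5 C6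
      using E s q fD(1,3) S_cl gD(1) kb cubes jC C6 by unfold_locales auto
    have "AF_norm \<mu> x1 s p (J f) \<le> ennreal (cell_function.AF_const n D s p q C3 C4 j C6) * (F_norm \<mu> p S I Q j (?fc f) + Lp_norm \<mu> p (\<lambda>x. ennreal (g x)))"
      using fD(3) ts_cl S_cl by (intro B.AF_norm_le) (auto simp: J_def functional_of_def)
    then show ?thesis by (rule ennreal_mult_mono_const) (simp add: cB_def)
  qed
  have upper': "AF_norm \<mu> x1 s p (J f) \<le> ennreal cB * sobolev_norm \<mu> x1 s p \<epsilon> \<beta> \<gamma> S I Q j f" if f: "f \<in> M" for f
  proof -
    let ?F = "F_norm \<mu> p S I Q j (?fc f)" and ?A = "AF_norm \<mu> x1 s p (J f)"
    have cB: "0 < cB" by (simp add: cB_def)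
    \<comment> \<open>The finite Hardy norm is subtracted first, so that the infimum over gradients
      acts on a single term.\<close>
    have "?A / ennreal cB - ?F \<le> hom_sobolev_norm \<mu> s p f"
      unfolding hom_sobolev_norm_def
    proof (rule INF_greatest)
      fix g assume "g \<in> hajlasz_gradients \<mu> s p f"
      then have "?A / ennreal cB \<le> ?F + Lp_norm \<mu> p (\<lambda>x. ennreal (g x))"
        using upper[OF f] cB by (intro divide_le_posI_ennreal) (auto simp: mult.commute)
      then show "?A / ennreal cB - ?F \<le> Lp_norm \<mu> p (\<lambda>x. ennreal (g x))"
        using M_D(5)[OF f] by (auto simp: ennreal_minus_le_iff)
    qed
    then have "?A / ennreal cB \<le> sobolev_norm \<mu> x1 s p \<epsilon> \<beta> \<gamma> S I Q j f"
      using M_D(5)[OF f] by (auto simp: ennreal_minus_le_iff sobolev_norm_def)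
    then have "ennreal cB * (?A / ennreal cB) \<le> ennreal cB * sobolev_norm \<mu> x1 s p \<epsilon> \<beta> \<gamma> S I Q j f"
      by (rule mult_left_mono) simp
    moreover have "ennreal cB * (?A / ennreal cB) = ?A"
      using cB unfolding ennreal_times_divide by (subst mult.commute) (simp add: ennreal_mult_divide_eq)
    ultimately show ?thesis by simp
  qed

  \<comment> \<open>From functionals to functions\<close>
  define mc where "mc = max 0 (hajlasz_function.mem_const n D s p q C3 C4 \<epsilon>) + 1"
  \<comment> \<open>In \<open>mc\<close> the 1 accounts for the homogeneous norm and the rest for
    the Hardy norm, both measured by \<open>g\<close>; the factor \<open>maj_const s\<close> passes
    from \<open>g\<close> to \<open>h\<close>.\<close>
  define cA where "cA = mc * maj_const s"
  have maj1: "1 \<le> maj_const s"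
  proof -
    have "0 < 1 - 2 powr (- s)" using s powr_less_one[of 2 "- s"] by simp
    then have "0 \<le> 4 * rho_const 1 / (1 - 2 powr (- s))" using rho_const_pos[of 1] by (intro divide_nonneg_pos) auto
    then show ?thesis using rho_const_pos[of 1] by (simp add: maj_const_def)
  qed
  have cA: "0 < cA" using maj1 by (simp add: cA_def mc_def add_nonneg_pos)
  \<comment> \<open>Stated for an arbitrary functional and an arbitrary majorant, so that it yields
    both surjectivity and, through the infimum over \<open>h\<close>, the norm estimate.\<close>
  have lower: "\<exists>F\<in>M. J F = u \<and> sobolev_norm \<mu> x1 s p \<epsilon> \<beta> \<gamma> S I Q j F \<le> ennreal cA * epowr (\<integral>\<^sup>+x. epowr (h x) p \<partial>\<mu>) (1 / p)"
    if u: "u \<in> dual_space ?ts (test_norm \<mu> x1 1 1 2)" and h: "h \<in> borel_measurable \<mu>"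
      and maj: "\<And>x. (SUP k. ennreal (2 powr (real k * s)) * (SUP \<phi>\<in>grand_tests \<mu> x1 k x. ennreal (cmod (u \<phi>)))) \<le> h x"
      and hp: "(\<integral>\<^sup>+x. epowr (h x) p \<partial>\<mu>) < top" for u h
  proof -
    interpret A: grand_majorant \<mu> n D x1 s p u h
      using s p u h maj hp by unfold_locales auto
    interpret H: hajlasz_function \<mu> n D A.F A.g A.E s p q
      using A.F_hajlasz A.F_le_g s q A.E_null A.g_Lp_finite by unfold_locales auto
    let ?h = "epowr (\<integral>\<^sup>+x. epowr (h x) p \<partial>\<mu>) (1 / p)" and ?g = "epowr (\<integral>\<^sup>+x. epowr (ennreal (A.g x)) p \<partial>\<mu>) (1 / p)"
    have gh: "?g \<le> ennreal (maj_const s) * ?h"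
    proof -
      have "?g \<le> epowr (ennreal (maj_const s powr p) * (\<integral>\<^sup>+x. epowr (h x) p \<partial>\<mu>)) (1 / p)"
        using p A.g_Lp by (intro epowr_mono) auto
      also have "\<dots> = ennreal (maj_const s) * ?h" using p maj1 by (simp add: epowr_mult powr_powr)
      finally show ?thesis .
    qed
    have int: "integrable \<mu> (\<lambda>x. A.F x * \<phi> x)" if "\<phi> \<in> ?cl" for \<phi>
      using subsetD[OF test_closure_subset that] \<beta> \<gamma> q\<gamma> by (intro H.test_integrable[of \<phi> x1 \<beta> \<gamma>]) auto
    have JF: "J A.F = u"
    proof
      fix \<phi>
      show "J A.F \<phi> = u \<phi>"
      \<comment> \<open>Off the test space both functionals are undefined in the same way, by
        extensionality.\<close>
      proof (cases "\<phi> \<in> ?ts")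
        case True
        then show ?thesis using A.u_eq_integral[OF q(1,2) _ q(4) unb True] q by (simp add: J_def functional_of_def)
      next
        case False
        then show ?thesis using u by (simp add: J_def functional_of_def dual_space_def extensional_def)
      qed
    qed
    have Fn: "F_norm \<mu> p S I Q j (?fc A.F) \<le> ennreal (hajlasz_function.mem_const n D s p q C3 C4 \<epsilon>) * ?g"
      using S_cl Sd_cl by (intro H.F_norm_le[OF kb q\<epsilon> cubes jC]) (auto simp: functional_of_def)
    have g_top: "?g < top" using A.g_Lp_finite by (simp add: less_top[symmetric])
    have grad: "A.g \<in> hajlasz_gradients \<mu> s p A.F"
      using p A.g_Lp_finite by (intro hajlasz_gradientsI[OF A.F_hajlasz A.E_null]) auto
    have hom: "hom_sobolev_norm \<mu> s p A.F \<le> ?g"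
    proof -
      have "hom_sobolev_norm \<mu> s p A.F \<le> Lp_norm \<mu> p (\<lambda>x. ennreal (A.g x))"
        unfolding hom_sobolev_norm_def by (rule INF_lower[OF grad])
      then show ?thesis using p by (simp add: Lp_norm_measurable)
    qed
    have loc: "(\<integral>\<^sup>+y\<in>ball x r. ennreal (cmod (A.F y) powr p) \<partial>\<mu>) < \<infinity>" for x r
    proof -
      have "(\<integral>\<^sup>+y\<in>ball x r. ennreal (cmod (A.F y) powr p) \<partial>\<mu>) \<le> (\<integral>\<^sup>+x. epowr (ennreal (A.g x)) p \<partial>\<mu>)"
      proof (rule nn_integral_mono_AE)
        show "AE y in \<mu>. ennreal (cmod (A.F y) powr p) * indicator (ball x r) y \<le> epowr (ennreal (A.g y)) p"
          using AE_not_in[OF A.E_null]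
        proof eventually_elim
          case (elim y)
          have "ennreal (cmod (A.F y) powr p) \<le> epowr (ennreal (A.g y)) p"
            using A.F_le_g[OF elim] p A.g_nonneg[of y] by (auto intro!: ennreal_leI powr_mono2)
          then show ?case by (simp add: indicator_def)
        qed
      qed
      then show ?thesis using A.g_Lp_finite by (simp add: le_less_trans)
    qed
    have FM: "A.F \<in> M"
      unfolding M_def sobolev_space_def hom_sobolev_space_def Lp_loc_def F_space_def
    proof (intro CollectI conjI ballI allI)
      show "A.F \<in> borel_measurable \<mu>" by simp
      show "hajlasz_gradients \<mu> s p A.F \<noteq> {}" using grad by blast
      show "?fc A.F \<in> dual_space ?cl (test_norm \<mu> x1 1 \<beta> \<gamma>)"
        using \<beta> \<gamma> q\<gamma> by (intro H.functional_dual) auto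
      show "F_norm \<mu> p S I Q j (?fc A.F) < \<infinity>" using Fn g_top by (simp add: ennreal_mult_less_top le_less_trans)
    qed (use loc int in auto)
    have "sobolev_norm \<mu> x1 s p \<epsilon> \<beta> \<gamma> S I Q j A.F \<le> ennreal (max 0 (hajlasz_function.mem_const n D s p q C3 C4 \<epsilon>)) * ?g + 1 * ?g"
      unfolding sobolev_norm_def using Fn hom by (intro add_mono ennreal_mult_mono_const[OF Fn]) auto
    also have "\<dots> = ennreal mc * ?g" unfolding mc_def by (subst ennreal_plus) (auto simp: distrib_right)
    also have "\<dots> \<le> ennreal mc * (ennreal (maj_const s) * ?h)" by (intro mult_left_mono gh) simp
    also have "\<dots> = ennreal cA * ?h" using maj1 by (simp add: cA_def mc_def ennreal_mult mult.assoc)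
    finally show ?thesis using FM JF by blast
  qed

  \<comment> \<open>Injectivity up to null sets\<close>
  have inj: "AE x in \<mu>. f x = g x" if f: "f \<in> M" and g: "g \<in> M" and eq: "J f = J g" for f g
  proof -
    obtain a where a: "a \<in> hajlasz_gradients \<mu> s p f" using M_D(2)[OF f] by blast
    obtain b where b: "b \<in> hajlasz_gradients \<mu> s p g" using M_D(2)[OF g] by blast
    note aD = hajlasz_gradientsD[OF a p] and bD = hajlasz_gradientsD[OF b p]
    obtain Ea Eb where E: "Ea \<in> null_sets \<mu>" "hajlasz_on s f a Ea" "Eb \<in> null_sets \<mu>" "hajlasz_on s g b Eb"
      using aD(3) bD(3) by blast
    note [measurable] = M_D(1)[OF f] M_D(1)[OF g] aD(1) bD(1)
    have nn: "0 \<le> a x" "0 \<le> b x" for x using E(2,4) by (auto simp: hajlasz_on_def)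
    have ints: "integrable \<mu> (\<lambda>y. f y * rho r z y)" "integrable \<mu> (\<lambda>y. g y * rho r z y)" if "0 < r" for r z
      using M_D(3)[OF f] M_D(3)[OF g] ts_cl[OF rho_test_space[OF that, of z x1]] by auto
    \<comment> \<open>The difference has the sum of the two gradients as a gradient and is
      annihilated by every bump \<open>rho\<close>, since these are test functions.\<close>
    have "AE x in \<mu>. f x - g x = 0"
    proof (rule hajlasz_ae_zero[OF hajlasz_on_diff[OF E(2,4)] s q])
      show "Ea \<union> Eb \<in> null_sets \<mu>" using E by auto
      have "(\<integral>\<^sup>+x. epowr (ennreal (a x) + ennreal (b x)) p \<partial>\<mu>) < top"
        using p aD(2) bD(2) by (intro Lp_add_finite) auto
      then show "(\<integral>\<^sup>+x. epowr (ennreal (a x + b x)) p \<partial>\<mu>) < top" using nn by simp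
      fix r :: real and z assume r: "0 < r"
      show "integrable \<mu> (\<lambda>y. (f y - g y) * rho r z y)"
        using Bochner_Integration.integrable_diff[OF ints[OF r, of z]] by (simp add: left_diff_distrib)
      have "(\<integral>y. f y * rho r z y \<partial>\<mu>) = (\<integral>y. g y * rho r z y \<partial>\<mu>)"
        using fun_cong[OF eq, of "rho r z"] rho_test_space[OF r, of z x1] by (simp add: J_def functional_of_def)
      then show "(\<integral>y. (f y - g y) * rho r z y \<partial>\<mu>) = 0"
        using Bochner_Integration.integral_diff[OF ints[OF r, of z]] by (simp add: left_diff_distrib)
    qed measurable
    then show ?thesis by eventually_elim simp
  qed

  \<comment> \<open>The two inclusions and equivalence of the norms\<close>
  have J_AF: "J f \<in> AF_space \<mu> x1 s p" if f: "f \<in> M" for f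
  proof -
    obtain g where g: "g \<in> hajlasz_gradients \<mu> s p f" using M_D(2)[OF f] by blast
    have "Lp_norm \<mu> p (\<lambda>x. ennreal (g x)) < top" using g by (simp add: hajlasz_gradients_def)
    then have "ennreal cB * (F_norm \<mu> p S I Q j (?fc f) + Lp_norm \<mu> p (\<lambda>x. ennreal (g x))) < top"
      using M_D(5)[OF f] by (simp add: ennreal_mult_less_top)
    then have "AF_norm \<mu> x1 s p (J f) < top" using upper[OF f g] by (rule le_less_trans[rotated])
    moreover have "J f \<in> dual_space ?ts (test_norm \<mu> x1 1 1 2)"
      unfolding J_def using hd by (intro functional_dual_restrict[OF M_D(4,3)[OF f]]) auto
    ultimately show ?thesis by (simp add: AF_space_def)
  qed
  have "J ` M = AF_space \<mu> x1 s p"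
  proof
    show "J ` M \<subseteq> AF_space \<mu> x1 s p" using J_AF by blast
    show "AF_space \<mu> x1 s p \<subseteq> J ` M"
    proof
      fix u assume "u \<in> AF_space \<mu> x1 s p"
      then have u: "u \<in> dual_space ?ts (test_norm \<mu> x1 1 1 2)" and AF: "AF_norm \<mu> x1 s p u < top"
        by (auto simp: AF_space_def)
      let ?G = "\<lambda>x. SUP k. ennreal (2 powr (real k * s)) * (SUP \<phi>\<in>grand_tests \<mu> x1 k x. ennreal (cmod (u \<phi>)))"
      \<comment> \<open>Finiteness of the upper integral provides one measurable majorant with
        finite integral.\<close>
      have "(INF h\<in>{h \<in> borel_measurable \<mu>. \<forall>x. ?G x \<le> h x}. \<integral>\<^sup>+x. epowr (h x) p \<partial>\<mu>) < top"
        using AF unfolding AF_norm_def Lp_norm_def by (simp add: less_top[symmetric])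
      then obtain h where "h \<in> borel_measurable \<mu>" "\<forall>x. ?G x \<le> h x" "(\<integral>\<^sup>+x. epowr (h x) p \<partial>\<mu>) < top"
        unfolding INF_less_iff by blast
      then obtain F where "F \<in> M" "J F = u" using lower[OF u, of h] by blast
      then show "u \<in> J ` M" by blast
    qed
  qed
  moreover have lower': "sobolev_norm \<mu> x1 s p \<epsilon> \<beta> \<gamma> S I Q j f \<le> ennreal cA * AF_norm \<mu> x1 s p (J f)" if f: "f \<in> M" for f
    unfolding AF_norm_def
  proof (rule le_Lp_norm[OF p cA])
    fix h assume h: "h \<in> borel_measurable \<mu>"
      "\<forall>x. (SUP k. ennreal (2 powr (real k * s)) * (SUP \<phi>\<in>grand_tests \<mu> x1 k x. ennreal (cmod (J f \<phi>)))) \<le> h x"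
    show "sobolev_norm \<mu> x1 s p \<epsilon> \<beta> \<gamma> S I Q j f \<le> ennreal cA * epowr (\<integral>\<^sup>+x. epowr (h x) p \<partial>\<mu>) (1 / p)"
    proof (cases "(\<integral>\<^sup>+x. epowr (h x) p \<partial>\<mu>) < top")
      case True
      have "J f \<in> dual_space ?ts (test_norm \<mu> x1 1 1 2)" using J_AF[OF f] by (simp add: AF_space_def)
      then obtain F where F: "F \<in> M" "J F = J f" "sobolev_norm \<mu> x1 s p \<epsilon> \<beta> \<gamma> S I Q j F \<le> ennreal cA * epowr (\<integral>\<^sup>+x. epowr (h x) p \<partial>\<mu>) (1 / p)"
        using lower[of "J f" h] h True by blast
      \<comment> \<open>\<open>F\<close> is reconstructed from the functional of \<open>f\<close>
        and need not be \<open>f\<close> itself; by injectivity the two agree almost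
        everywhere.\<close>
      have "sobolev_norm \<mu> x1 s p \<epsilon> \<beta> \<gamma> S I Q j F = sobolev_norm \<mu> x1 s p \<epsilon> \<beta> \<gamma> S I Q j f"
        using F f by (intro sobolev_norm_AE_cong inj M_D cl_meas) auto
      then show ?thesis using F(3) by simp
    next
      case False
      then have "(\<integral>\<^sup>+x. epowr (h x) p \<partial>\<mu>) = top" by (simp add: less_top[symmetric])
      then have "ennreal cA * epowr (\<integral>\<^sup>+x. epowr (h x) p \<partial>\<mu>) (1 / p) = top" using cA by (auto simp: ennreal_mult_top)
      then show ?thesis by simp
    qed
  qed
  moreover have "\<exists>C::real. 0 < C \<and> (\<forall>f\<in>M.
            AF_norm \<mu> x1 s p (J f) \<le> ennreal C * sobolev_norm \<mu> x1 s p \<epsilon> \<beta> \<gamma> S I Q j f \<and>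
            sobolev_norm \<mu> x1 s p \<epsilon> \<beta> \<gamma> S I Q j f \<le> ennreal C * AF_norm \<mu> x1 s p (J f))"
  proof (intro exI[of _ "max cA cB"] conjI ballI)
    show "0 < max cA cB" using cA by simp
    fix f assume f: "f \<in> M"
    show "AF_norm \<mu> x1 s p (J f) \<le> ennreal (max cA cB) * sobolev_norm \<mu> x1 s p \<epsilon> \<beta> \<gamma> S I Q j f"
      by (rule ennreal_mult_mono_const[OF upper'[OF f]]) simp
    show "sobolev_norm \<mu> x1 s p \<epsilon> \<beta> \<gamma> S I Q j f \<le> ennreal (max cA cB) * AF_norm \<mu> x1 s p (J f)"
      by (rule ennreal_mult_mono_const[OF lower'[OF f]]) simp
  qed
  ultimately show ?thesis using inj by blast
qed

end
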